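(* For every $\gamma\in H$ there exists a real function $h\in S^-$ such that the Riemann–Hilbert problem \[ \operatorname{Re}[Af^+]=\gamma+h \quad\text{on } \Gamma \] is solvable, i.e. there exists $f$ with: - $f$ analytic in $G$ and $f(\infty)=0$; - $f$ continuous on $G\cup\Gamma$; - $f$ satisfying this boundary condition.
   Context: $G$ is an unbounded multiply connected region of connectivity $m$ with $\infty\in G$ and $0\in G$. Its boundary is $\Gamma=\Gamma_1\cup\dots\cup\Gamma_m$, consisting of simple, non-intersecting, smooth, clockwise oriented closed curves. $G^-:=(\mathbb C\cup\{\infty\})\setminus(G\cup\Gamma)$ is the union of the bounded simply connected regions $G_k$ enclosed by $\Gamma_k$. Each $\Gamma_k$ is parametrized by a $2\pi$-periodic, twice continuously differentiable function $\eta_k$ with $\dot\eta_k\ne0$. $J$ is the disjoint union of $J_k=[0,2\pi]$, and $\eta=\eta_k$ on $J_k$. $H$ is the space of real functions on $J$ that are Hölder continuous and $2\pi$-periodic on each $J_k$. Functions on $\Gamma$ are identified with functions on $J$ via $\eta$. $A$ is a nonvanishing complex function on $\Gamma$ with continuously differentiable parametric form on $J$. $f^+$ is the boundary value from $G$ and $g^-$ the boundary value from $G^-$. $S^-:=\{\gamma\in H:\gamma=Ag^- \text{ for some } g \text{ analytic in } G^-\}$, i.e. the real functions of the form $Ag^-$. *)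

theory Defs
  imports "HOL-Complex_Analysis.Complex_Analysis"
begin

text \<open>Boundary curves: \<eta> k :: real \<Rightarrow> complex is the 2pi-periodic parametrization
  of Gamma_k (k < m).  loop_k rescales it to the unit interval.\<close>

definition bloop :: "(nat \<Rightarrow> real \<Rightarrow> complex) \<Rightarrow> nat \<Rightarrow> real \<Rightarrow> complex" where
  "bloop \<eta> k = (\<lambda>s. \<eta> k (2 * pi * s))"

definition Gam_k :: "(nat \<Rightarrow> real \<Rightarrow> complex) \<Rightarrow> nat \<Rightarrow> complex set" where
  "Gam_k \<eta> k = \<eta> k ` {0..2*pi}"

definition Gam :: "nat \<Rightarrow> (nat \<Rightarrow> real \<Rightarrow> complex) \<Rightarrow> complex set" where
  "Gam m \<eta> = (\<Union>k<m. Gam_k \<eta> k)"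

definition Gminus :: "nat \<Rightarrow> (nat \<Rightarrow> real \<Rightarrow> complex) \<Rightarrow> complex set" where
  "Gminus m \<eta> = (\<Union>k<m. inside (Gam_k \<eta> k))"

text \<open>G (finite part): complement of Gamma union G^-.\<close>
definition Gdom :: "nat \<Rightarrow> (nat \<Rightarrow> real \<Rightarrow> complex) \<Rightarrow> complex set" where
  "Gdom m \<eta> = - (Gam m \<eta> \<union> Gminus m \<eta>)"

text \<open>The space H: real functions on J = disjoint union of J_k = [0,2pi], k<m,
  Hoelder continuous and 2pi-periodic on each J_k.\<close>
definition spaceH :: "nat \<Rightarrow> (nat \<Rightarrow> real \<Rightarrow> real) set" where
  "spaceH m = {\<gamma>. \<forall>k<m. (\<forall>t. \<gamma> k (t + 2*pi) = \<gamma> k t) \<and>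
      (\<exists>C \<alpha>. 0 < \<alpha> \<and> \<alpha> \<le> 1 \<and>
         (\<forall>s\<in>{0..2*pi}. \<forall>t\<in>{0..2*pi}. \<bar>\<gamma> k s - \<gamma> k t\<bar> \<le> C * \<bar>s - t\<bar> powr \<alpha>))}"

definition Sminus :: "nat \<Rightarrow> (nat \<Rightarrow> real \<Rightarrow> complex) \<Rightarrow> (complex \<Rightarrow> complex)
    \<Rightarrow> (nat \<Rightarrow> real \<Rightarrow> real) set" where
  "Sminus m \<eta> A = {\<gamma> \<in> spaceH m. \<exists>g gm.
      g holomorphic_on Gminus m \<eta> \<and>
      (\<forall>z\<in>Gam m \<eta>. (g \<longlongrightarrow> gm z) (at z within Gminus m \<eta>)) \<and>
      (\<forall>k<m. \<forall>t. complex_of_real (\<gamma> k t) = A (\<eta> k t) * gm (\<eta> k t))}"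

end

theory Submission
  imports Defs
begin

text \<open>
  Let \<open>f\<close> and \<open>g\<close> be the restrictions to \<open>G\<close> and \<open>G\<^sup>-\<close> of the Cauchy integral of a density
  \<open>\<rho> = (\<gamma> + \<i> \<mu>) / A\<close>. The Plemelj formula \<open>f\<^sup>+ - g\<^sup>- = \<rho>\<close> gives \<open>Re (A f\<^sup>+) = \<gamma> + Re (A g\<^sup>-)\<close>, so it
  remains to choose the real function \<open>\<mu>\<close> such that \<open>A g\<^sup>-\<close> is real. This is an integral equation of the
  second kind with the generalised Neumann kernel of \<open>A\<close>, to which the Fredholm alternative applies.

  A solution \<open>\<psi>\<close> of the adjoint equation yields a density \<open>\<sigma> = A \<psi> / \<eta>'\<close> whose Cauchy integral \<open>F\<close> satisfies
  \<open>Re (F\<^sup>- cnj F\<^sup>+) = |F\<^sup>+|\<^sup>2\<close>, i.e. \<open>F\<^sup>+ = w F\<^sup>-\<close> with \<open>w\<close> in the disc of radius 1/2 about 1/2. Dividing by the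
  exponential of the Cauchy integral of (a regularisation of) \<open>log w\<close> turns \<open>F\<close> into an entire function
  vanishing at infinity, whence \<open>F = 0\<close> in \<open>G\<close>. The growth of the divisor is controlled by Zygmund's
  exponential estimate for conjugates of functions bounded by \<open>pi/2\<close>, which is proved on the circle and
  transferred by comparing Cauchy kernels. So \<open>\<sigma> = - F\<^sup>-\<close>, and the orthogonality of \<open>\<psi>\<close> to the right-hand
  side is Cauchy's theorem in \<open>G\<^sup>-\<close>.
\<close>

section \<open>Hoelder continuous functions\<close>

text \<open>The obstacle is the vanishing of \<open>F\<close> on the boundary: there
  \<open>log w\<close> is unbounded and only its argument, at most pi/2, is under control.
  Regularising with \<epsilon> leaves a defect of order sqrt \<epsilon>, which competes with the
  exponential of a constant times the integral of log (1 / (|F|^2 + \<epsilon>)). If the boundary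
  zeros form a null set, that exponential is at most of order \<epsilon>^(-1/4) and the defect wins;
  a zero set of positive measure is treated separately by a two constants argument. Zygmund's bound
  therefore has to be uniform over all densities bounded by pi/2, since their Hoelder norms are not
  controlled as \<epsilon> tends to 0.

  Nothing about the argument of \<open>A\<close> along the curves enters: the transposed kernel is
  minus the generalised Neumann kernel of \<eta>'/A, and the uniqueness argument is the same for
  every coefficient.

  All estimates of the geometry go back to one expansion: displaced along the normal, the Cauchy
  kernel of a curve is the half-plane kernel plus a bounded error. Cauchy's theorem for merely
  continuous boundary values is obtained by gluing the two sides, because \<Gamma> is removable for
  continuous functions.\<close>

definition hoelder_on :: "'a::metric_space set \<Rightarrow> ('a \<Rightarrow> 'b::real_normed_vector) \<Rightarrow> bool" where
  "hoelder_on S f \<longleftrightarrow> (\<exists>\<alpha> C. 0 < \<alpha> \<and> \<alpha> \<le> 1 \<and> 0 \<le> C \<and>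
     (\<forall>x\<in>S. \<forall>y\<in>S. norm (f x - f y) \<le> C * dist x y powr \<alpha>))"

lemma hoelder_onI:
  assumes "0 < \<alpha>" "\<alpha> \<le> 1" "\<And>x y. x \<in> S \<Longrightarrow> y \<in> S \<Longrightarrow> norm (f x - f y) \<le> C * dist x y powr \<alpha>"
  shows "hoelder_on S f"
proof -
  have "norm (f x - f y) \<le> \<bar>C\<bar> * dist x y powr \<alpha>" if "x \<in> S" "y \<in> S" for x y
    using assms(3)[OF that] by (smt (verit) mult_right_mono powr_ge_zero abs_ge_self)
  then show ?thesis
    unfolding hoelder_on_def using assms(1,2) by (intro exI[of _ \<alpha>] exI[of _ "\<bar>C\<bar>"]) auto
qed

lemma hoelder_on_lipschitz:
  assumes "\<And>x y. x \<in> S \<Longrightarrow> y \<in> S \<Longrightarrow> norm (f x - f y) \<le> C * dist x y"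
  shows "hoelder_on S f"
  by (rule hoelder_onI[of 1 _ _ C]) (use assms in auto)

lemma powr_exponent_le:
  fixes d R :: real
  assumes "0 \<le> d" "d \<le> R" "1 \<le> R" "\<beta> \<le> \<alpha>" "\<alpha> \<le> \<beta> + 1"
  shows "d powr \<alpha> \<le> R * d powr \<beta>"
proof -
  have "d powr \<alpha> = d powr (\<alpha> - \<beta>) * d powr \<beta>"
    by (simp flip: powr_add)
  also have "d powr (\<alpha> - \<beta>) \<le> R powr (\<alpha> - \<beta>)"
    using assms by (intro powr_mono2) auto
  also have "R powr (\<alpha> - \<beta>) \<le> R powr 1"
    using assms by (intro powr_mono) auto
  finally show ?thesis using assms by (simp add: mult_right_mono)
qed

text \<open>The surplus power of the distance is at most a constant depending on the diameter. This
  lets functions with different exponents be treated with a common one; the summand 1 in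
  \<open>R\<close> provides \<open>1 \<le> R\<close> for \<open>powr_exponent_le\<close>.\<close>

lemma hoelder_on_exponent_le:
  assumes "bounded S" "0 < \<beta>" "\<beta> \<le> \<alpha>" "\<alpha> \<le> 1" "0 \<le> C"
    and "\<And>x y. x \<in> S \<Longrightarrow> y \<in> S \<Longrightarrow> norm (f x - f y) \<le> C * dist x y powr \<alpha>"
  obtains C' where "0 \<le> C'" "\<And>x y. x \<in> S \<Longrightarrow> y \<in> S \<Longrightarrow> norm (f x - f y) \<le> C' * dist x y powr \<beta>"
proof -
  define R where "R = 1 + diameter S"
  have R: "1 \<le> R" using diameter_ge_0[OF assms(1)] by (simp add: R_def)
  have d: "dist x y \<le> R" if "x \<in> S" "y \<in> S" for x y
    using diameter_bounded_bound[OF assms(1) that] by (simp add: R_def)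
  have "norm (f x - f y) \<le> (C * R) * dist x y powr \<beta>" if "x \<in> S" "y \<in> S" for x y
  proof -
    have "norm (f x - f y) \<le> C * dist x y powr \<alpha>" using assms(6) that by blast
    also have "\<dots> \<le> C * (R * dist x y powr \<beta>)"
      using d[OF that] R assms by (intro mult_left_mono powr_exponent_le) auto
    finally show ?thesis by (simp add: mult.assoc)
  qed
  then show ?thesis using that[of "C*R"] R assms by auto
qed

lemma hoelder_on_common_exponent:
  assumes "bounded S" "hoelder_on S f" "hoelder_on S g"
  obtains \<alpha> C where "0 < \<alpha>" "\<alpha> \<le> 1" "0 \<le> C"
    "\<And>x y. x \<in> S \<Longrightarrow> y \<in> S \<Longrightarrow> norm (f x - f y) \<le> C * dist x y powr \<alpha>"
    "\<And>x y. x \<in> S \<Longrightarrow> y \<in> S \<Longrightarrow> norm (g x - g y) \<le> C * dist x y powr \<alpha>"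
proof -
  obtain a1 C1 where 1: "0 < a1" "a1 \<le> 1" "0 \<le> C1"
    "\<And>x y. x \<in> S \<Longrightarrow> y \<in> S \<Longrightarrow> norm (f x - f y) \<le> C1 * dist x y powr a1"
    using assms(2) unfolding hoelder_on_def by blast
  obtain a2 C2 where 2: "0 < a2" "a2 \<le> 1" "0 \<le> C2"
    "\<And>x y. x \<in> S \<Longrightarrow> y \<in> S \<Longrightarrow> norm (g x - g y) \<le> C2 * dist x y powr a2"
    using assms(3) unfolding hoelder_on_def by blast
  define a where "a = min a1 a2"
  obtain D1 where D1: "0 \<le> D1" "\<And>x y. x \<in> S \<Longrightarrow> y \<in> S \<Longrightarrow> norm (f x - f y) \<le> D1 * dist x y powr a"
    using hoelder_on_exponent_le[OF assms(1), of a a1 C1 f] 1 2 by (auto simp: a_def)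
  obtain D2 where D2: "0 \<le> D2" "\<And>x y. x \<in> S \<Longrightarrow> y \<in> S \<Longrightarrow> norm (g x - g y) \<le> D2 * dist x y powr a"
    using hoelder_on_exponent_le[OF assms(1), of a a2 C2 g] 1 2 by (auto simp: a_def)
  have "norm (f x - f y) \<le> (D1 + D2) * dist x y powr a" "norm (g x - g y) \<le> (D1 + D2) * dist x y powr a"
    if "x \<in> S" "y \<in> S" for x y
    using D1 D2 that by (smt (verit) mult_right_mono powr_ge_zero)+
  then show ?thesis using that[of a "D1+D2"] 1 2 D1 D2 by (auto simp: a_def)
qed

text \<open>Common source of the closure rules: increments of \<open>h\<close> that are controlled
  by those of \<open>f\<close> and \<open>g\<close> inherit an exponent valid for both.\<close>

lemma hoelder_on_dominated:
  assumes "bounded S" "hoelder_on S f" "hoelder_on S g"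
    and "\<And>x y. x \<in> S \<Longrightarrow> y \<in> S \<Longrightarrow> norm (h x - h y) \<le> K * (norm (f x - f y) + norm (g x - g y))"
  shows "hoelder_on S h"
proof -
  obtain \<alpha> C where a: "0 < \<alpha>" "\<alpha> \<le> 1" "0 \<le> C"
    "\<And>x y. x \<in> S \<Longrightarrow> y \<in> S \<Longrightarrow> norm (f x - f y) \<le> C * dist x y powr \<alpha>"
    "\<And>x y. x \<in> S \<Longrightarrow> y \<in> S \<Longrightarrow> norm (g x - g y) \<le> C * dist x y powr \<alpha>"
    using hoelder_on_common_exponent[OF assms(1-3)] by metis
  show ?thesis
  proof (rule hoelder_onI[of \<alpha> _ _ "\<bar>K\<bar> * (2*C)"])
    fix x y assume xy: "x \<in> S" "y \<in> S"
    have "norm (h x - h y) \<le> K * (norm (f x - f y) + norm (g x - g y))" using assms(4) xy by blast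
    also have "\<dots> \<le> \<bar>K\<bar> * (norm (f x - f y) + norm (g x - g y))"
      by (intro mult_right_mono) auto
    also have "\<dots> \<le> \<bar>K\<bar> * (C * dist x y powr \<alpha> + C * dist x y powr \<alpha>)"
      using a(4,5)[OF xy] by (intro mult_left_mono add_mono) auto
    finally show "norm (h x - h y) \<le> \<bar>K\<bar> * (2*C) * dist x y powr \<alpha>" by (simp add: algebra_simps)
  qed (use a in auto)
qed

lemma hoelder_on_const: "hoelder_on S (\<lambda>x. c)"
  by (rule hoelder_on_lipschitz[of _ _ 0]) auto

lemma hoelder_on_imp_continuous_on:
  assumes "hoelder_on S f"
  shows "continuous_on S f"
proof -
  obtain \<alpha> C where a: "0 < \<alpha>" "\<alpha> \<le> 1" "0 \<le> C"
    "\<And>x y. x \<in> S \<Longrightarrow> y \<in> S \<Longrightarrow> norm (f x - f y) \<le> C * dist x y powr \<alpha>"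
    using assms unfolding hoelder_on_def by blast
  show ?thesis
    unfolding continuous_on_def
  proof
    fix x assume x: "x \<in> S"
    have "((\<lambda>y. C * dist x y powr \<alpha>) \<longlongrightarrow> C * dist x x powr \<alpha>) (at x within S)"
      using a(1) by (intro tendsto_intros) auto
    then have "((\<lambda>y. C * dist x y powr \<alpha>) \<longlongrightarrow> 0) (at x within S)" by simp
    moreover have "\<forall>\<^sub>F y in at x within S. norm (f y - f x) \<le> C * dist x y powr \<alpha>"
      unfolding eventually_at_filter using a(4) x by (auto simp: dist_commute intro!: always_eventually)
    ultimately have "((\<lambda>y. f y - f x) \<longlongrightarrow> 0) (at x within S)"
      by (rule Lim_null_comparison[rotated])
    then show "(f \<longlongrightarrow> f x) (at x within S)" by (simp add: LIM_zero_iff)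
  qed
qed

lemma hoelder_on_bounded:
  assumes "compact S" "hoelder_on S f"
  obtains B where "0 < B" "\<And>x. x \<in> S \<Longrightarrow> norm (f x) \<le> B"
  using compact_imp_bounded[OF compact_continuous_image[OF hoelder_on_imp_continuous_on[OF assms(2)] assms(1)]]
  unfolding bounded_pos by (metis imageI)

lemma hoelder_on_add:
  assumes "bounded S" "hoelder_on S f" "hoelder_on S g"
  shows "hoelder_on S (\<lambda>x. f x + g x)"
proof (rule hoelder_on_dominated[OF assms, where K = 1])
  fix x y
  have "f x + g x - (f y + g y) = (f x - f y) + (g x - g y)" by (simp add: algebra_simps)
  then show "norm (f x + g x - (f y + g y)) \<le> 1 * (norm (f x - f y) + norm (g x - g y))"
    by (metis mult_1 norm_triangle_ineq)
qed

lemma hoelder_on_diff: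
  assumes "bounded S" "hoelder_on S f" "hoelder_on S g"
  shows "hoelder_on S (\<lambda>x. f x - g x)"
proof (rule hoelder_on_dominated[OF assms, where K = 1])
  fix x y
  have "f x - g x - (f y - g y) = (f x - f y) - (g x - g y)" by (simp add: algebra_simps)
  then show "norm (f x - g x - (f y - g y)) \<le> 1 * (norm (f x - f y) + norm (g x - g y))"
    by (metis mult_1 norm_triangle_ineq4)
qed

lemma hoelder_on_lipschitz_compose:
  assumes "bounded S" "hoelder_on S f"
    and "\<And>x y. x \<in> S \<Longrightarrow> y \<in> S \<Longrightarrow> norm (h x - h y) \<le> K * norm (f x - f y)"
  shows "hoelder_on S h"
proof (rule hoelder_on_dominated[OF assms(1,2,2), where K = "\<bar>K\<bar>"])
  fix x y assume "x \<in> S" "y \<in> S"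
  then have "norm (h x - h y) \<le> K * norm (f x - f y)" by (rule assms(3))
  also have "\<dots> \<le> \<bar>K\<bar> * (norm (f x - f y) + norm (f x - f y))"
    by (intro mult_mono) auto
  finally show "norm (h x - h y) \<le> \<bar>K\<bar> * (norm (f x - f y) + norm (f x - f y))" .
qed

lemma hoelder_on_mult:
  fixes f g :: "'a::metric_space \<Rightarrow> 'b::real_normed_algebra"
  assumes "compact S" "hoelder_on S f" "hoelder_on S g"
  shows "hoelder_on S (\<lambda>x. f x * g x)"
proof -
  obtain B1 where B1: "0 < B1" "\<And>x. x \<in> S \<Longrightarrow> norm (f x) \<le> B1" using hoelder_on_bounded[OF assms(1,2)] by blast
  obtain B2 where B2: "0 < B2" "\<And>x. x \<in> S \<Longrightarrow> norm (g x) \<le> B2" using hoelder_on_bounded[OF assms(1,3)] by blast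
  show ?thesis
  proof (rule hoelder_on_dominated[OF compact_imp_bounded[OF assms(1)] assms(2,3), where K = "B1 + B2"])
    fix x y assume xy: "x \<in> S" "y \<in> S"
    have "f x * g x - f y * g y = (f x - f y) * g x + f y * (g x - g y)" by (simp add: algebra_simps)
    then have "norm (f x * g x - f y * g y) \<le> norm (f x - f y) * norm (g x) + norm (f y) * norm (g x - g y)"
      by (simp del: norm_mult) (rule order_trans[OF norm_triangle_ineq add_mono[OF norm_mult_ineq norm_mult_ineq]])
    also have "\<dots> \<le> norm (f x - f y) * (B1 + B2) + (B1 + B2) * norm (g x - g y)"
      using B1 B2 xy by (intro add_mono mult_left_mono mult_right_mono) (auto intro: add_increasing add_increasing2 less_imp_le)
    finally show "norm (f x * g x - f y * g y) \<le> (B1 + B2) * (norm (f x - f y) + norm (g x - g y))"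
      by (simp add: algebra_simps)
  qed
qed

lemma hoelder_on_of_real_iff:
  "hoelder_on S (\<lambda>x. complex_of_real (f x)) \<longleftrightarrow> hoelder_on S f"
  unfolding hoelder_on_def by (simp flip: of_real_diff)

lemma hoelder_on_Re: "bounded S \<Longrightarrow> hoelder_on S f \<Longrightarrow> hoelder_on S (\<lambda>x. Re (f x))"
  by (rule hoelder_on_lipschitz_compose[where K = 1]) (auto simp flip: minus_complex.sel intro: abs_Re_le_cmod)

lemma hoelder_on_Im: "bounded S \<Longrightarrow> hoelder_on S f \<Longrightarrow> hoelder_on S (\<lambda>x. Im (f x))"
  by (rule hoelder_on_lipschitz_compose[where K = 1]) (auto simp flip: minus_complex.sel intro: abs_Im_le_cmod)

lemma hoelder_on_cnj: "bounded S \<Longrightarrow> hoelder_on S f \<Longrightarrow> hoelder_on S (\<lambda>x. cnj (f x))"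
  by (rule hoelder_on_lipschitz_compose[where K = 1]) (auto simp flip: complex_cnj_diff)

lemma hoelder_on_inverse:
  fixes f :: "'a::metric_space \<Rightarrow> 'b::real_normed_field"
  assumes "bounded S" "hoelder_on S f" "0 < c" "\<And>x. x \<in> S \<Longrightarrow> c \<le> norm (f x)"
  shows "hoelder_on S (\<lambda>x. inverse (f x))"
proof (rule hoelder_on_lipschitz_compose[OF assms(1,2), where K = "1 / c^2"])
  fix x y assume xy: "x \<in> S" "y \<in> S"
  have nz: "f x \<noteq> 0" "f y \<noteq> 0" using assms(3,4) xy by fastforce+
  have "norm (inverse (f x) - inverse (f y)) = norm (f x - f y) / (norm (f x) * norm (f y))"
    using nz unfolding inverse_diff_inverse[OF nz] by (simp add: norm_mult norm_inverse norm_minus_commute divide_inverse ac_simps)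
  also have "\<dots> \<le> norm (f x - f y) / (c * c)"
    using assms(3,4) xy nz by (intro divide_left_mono mult_mono) (auto intro!: mult_pos_pos)
  finally show "norm (inverse (f x) - inverse (f y)) \<le> 1 / c^2 * norm (f x - f y)"
    by (simp add: power2_eq_square)
qed

lemma hoelder_on_exp:
  fixes f :: "'a::metric_space \<Rightarrow> complex"
  assumes "compact S" "hoelder_on S f"
  shows "hoelder_on S (\<lambda>x. exp (f x))"
proof -
  obtain B where B: "0 < B" "\<And>x. x \<in> S \<Longrightarrow> norm (f x) \<le> B" using hoelder_on_bounded[OF assms] by blast
  show ?thesis
  proof (rule hoelder_on_lipschitz_compose[OF compact_imp_bounded[OF assms(1)] assms(2), where K = "exp B"])
    fix x y assume xy: "x \<in> S" "y \<in> S"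
    show "norm (exp (f x) - exp (f y)) \<le> exp B * norm (f x - f y)"
    proof (rule field_differentiable_bound[where S = "cball 0 B" and f' = exp])
      fix z :: complex assume "z \<in> cball 0 B"
      then show "norm (exp z) \<le> exp B" using complex_Re_le_cmod[of z] by (simp)
    qed (use B xy in \<open>auto intro!: derivative_eq_intros\<close>)
  qed
qed

text \<open>The half-plane Re \<ge> c is convex, avoids the branch cut and satisfies |1/z| \<le>
  1/c, so \<open>Ln\<close> is Lipschitz on it. The positive lower bound \<open>c\<close> is what
  the regularisation of the transmission quotient supplies.\<close>

lemma hoelder_on_Ln:
  assumes "bounded S" "hoelder_on S f" "0 < c" "\<And>x. x \<in> S \<Longrightarrow> c \<le> Re (f x)"
  shows "hoelder_on S (\<lambda>x. Ln (f x))"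
proof (rule hoelder_on_lipschitz_compose[OF assms(1,2), where K = "1 / c"])
  fix x y assume xy: "x \<in> S" "y \<in> S"
  show "norm (Ln (f x) - Ln (f y)) \<le> 1 / c * norm (f x - f y)"
  proof (rule field_differentiable_bound[where S = "{z. c \<le> Re z}" and f' = inverse])
    show "convex {z. c \<le> Re z}" by (rule convex_halfspace_Re_ge)
    fix z assume "z \<in> {z. c \<le> Re z}"
    then have z: "c \<le> Re z" by simp
    then have "z \<notin> \<real>\<^sub>\<le>\<^sub>0" using assms(3) by (auto simp: complex_nonpos_Reals_iff)
    then show "(Ln has_field_derivative inverse z) (at z within {z. c \<le> Re z})"
      using has_field_derivative_Ln has_field_derivative_at_within by blast
    have "c \<le> cmod z" using z complex_Re_le_cmod[of z] by linarith
    then show "norm (inverse z) \<le> 1 / c" using assms(3) by (simp add: norm_inverse divide_inverse le_imp_inverse_le del: norm_divide)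
  qed (use assms(4) xy in auto)
qed

section \<open>Cauchy integrals over a contour\<close>

text \<open>\<open>M\<close> is the image of Lebesgue measure on the parameter intervals and \<open>\<tau>\<close> the derivative of the
  parametrisation, as a function of the boundary point; \<open>\<tau> x \<partial>M\<close> is then the complex line element.\<close>
locale contour = finite_measure M for M :: "complex measure" +
  fixes \<Gamma> G D :: "complex set" and \<tau> :: "complex \<Rightarrow> complex"
  assumes compact_\<Gamma>: "compact \<Gamma>"
    and \<Gamma>_nonempty: "\<Gamma> \<noteq> {}"
    and sets_M: "sets M = sets (restrict_space borel \<Gamma>)"
    and \<tau>_lipschitz: "\<exists>L. \<forall>x\<in>\<Gamma>. \<forall>y\<in>\<Gamma>. cmod (\<tau> x - \<tau> y) \<le> L * cmod (x - y)"
    and \<tau>_nz: "\<And>x. x \<in> \<Gamma> \<Longrightarrow> \<tau> x \<noteq> 0"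
    and growth: "\<And>\<beta>. 0 < \<beta> \<Longrightarrow> \<beta> \<le> 1 \<Longrightarrow> \<exists>C. \<forall>y\<in>\<Gamma>.
        integrable M (\<lambda>x. cmod (x - y) powr (\<beta> - 1)) \<and> (LINT x|M. cmod (x - y) powr (\<beta> - 1)) \<le> C"
    and kappa_bounded: "\<exists>C. \<forall>x\<in>\<Gamma>. \<forall>y\<in>\<Gamma>. \<bar>Im (\<tau> x / (x - y))\<bar> \<le> C"
    and kappa_integral: "\<And>y. y \<in> \<Gamma> \<Longrightarrow> (LINT x|M. Im (\<tau> x / (x - y))) = - pi"
    and open_G: "open G" and open_D: "open D" and G_D_disjoint: "G \<inter> D = {}"
    and G_Un_D: "G \<union> D = - \<Gamma>" and bounded_D: "bounded D"
    and wind_G: "\<And>z. z \<in> G \<Longrightarrow> (LINT x|M. \<tau> x / (x - z)) = 0"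
    and wind_D: "\<And>z. z \<in> D \<Longrightarrow> (LINT x|M. \<tau> x / (x - z)) = - (2 * of_real pi * \<i>)"
    and removable: "\<And>F. continuous_on UNIV F \<Longrightarrow> F holomorphic_on (- \<Gamma>) \<Longrightarrow> F holomorphic_on UNIV"
begin

lemma space_M: "space M = \<Gamma>"
  using sets_eq_imp_space_eq[OF sets_M] by (simp add: space_restrict_space)

lemma bounded_\<Gamma>: "bounded \<Gamma>"
  using compact_\<Gamma> by (rule compact_imp_bounded)

lemma closed_\<Gamma>: "closed \<Gamma>"
  using compact_\<Gamma> by (rule compact_imp_closed)

lemma borel_measurable_M [measurable (raw)]:
  "continuous_on \<Gamma> f \<Longrightarrow> f \<in> borel_measurable M"
  using borel_measurable_continuous_on_restrict measurable_cong_sets[OF sets_M refl] by blast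

lemma measurable_id_M [measurable]: "(\<lambda>x. x) \<in> borel_measurable M"
  by (intro borel_measurable_M continuous_intros)

lemma hoelder_\<tau>: "hoelder_on \<Gamma> \<tau>"
  using \<tau>_lipschitz hoelder_on_lipschitz[of \<Gamma> \<tau>] unfolding dist_norm by blast

lemma measurable_\<tau> [measurable]: "\<tau> \<in> borel_measurable M"
  by (intro borel_measurable_M hoelder_on_imp_continuous_on hoelder_\<tau>)

lemma \<tau>_bound: obtains T where "0 < T" "\<And>x. x \<in> \<Gamma> \<Longrightarrow> cmod (\<tau> x) \<le> T"
  using hoelder_on_bounded[OF compact_\<Gamma> hoelder_\<tau>] by blast

lemma dist_pos:
  assumes "z \<notin> \<Gamma>"
  obtains r where "0 < r" "\<And>x. x \<in> \<Gamma> \<Longrightarrow> r \<le> cmod (x - z)"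
  using separate_point_closed[OF closed_\<Gamma> assms] by (metis dist_norm norm_minus_commute)

lemma integrable_bounded:
  fixes f :: "complex \<Rightarrow> 'b::{banach, second_countable_topology}"
  assumes "f \<in> borel_measurable M" "\<And>x. x \<in> \<Gamma> \<Longrightarrow> norm (f x) \<le> B"
  shows "integrable M f"
  by (rule integrable_const_bound[OF _ assms(1), of B]) (use assms(2) space_M in auto)

lemma norm_integral_bounded:
  fixes f :: "complex \<Rightarrow> 'b::{banach, second_countable_topology}"
  assumes "f \<in> borel_measurable M" "\<And>x. x \<in> \<Gamma> \<Longrightarrow> norm (f x) \<le> B"
  shows "norm (LINT x|M. f x) \<le> B * measure M \<Gamma>"
proof -
  have "norm (LINT x|M. f x) \<le> (LINT x|M. norm (f x))" by (rule integral_norm_bound)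
  also have "\<dots> \<le> (LINT x|M. B)"
    using assms integrable_bounded[OF assms] by (intro integral_mono) (auto simp: space_M)
  finally show ?thesis by (simp add: space_M mult.commute)
qed

lemma in_G_or_D: "z \<notin> \<Gamma> \<Longrightarrow> z \<in> G \<or> z \<in> D"
  using G_Un_D by auto

text \<open>The curves run clockwise, so by \<open>wind_G\<close> and \<open>wind_D\<close> a
  constant density c yields 0 in \<open>G\<close> and -c in \<open>D\<close>; this is the source of
  the minus signs on the side of \<open>D\<close> below.\<close>

definition Cint :: "(complex \<Rightarrow> complex) \<Rightarrow> complex \<Rightarrow> complex" where
  "Cint \<rho> z = (LINT x|M. \<rho> x * \<tau> x / (x - z)) / (2 * of_real pi * \<i>)"

text \<open>The boundary value from \<open>G\<close>: there the contour has winding number 0, so subtracting \<open>\<rho> y\<close> is free.\<close>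
definition Cbd :: "(complex \<Rightarrow> complex) \<Rightarrow> complex \<Rightarrow> complex" where
  "Cbd \<rho> y = (LINT x|M. (\<rho> x - \<rho> y) * \<tau> x / (x - y)) / (2 * of_real pi * \<i>)"

text \<open>Large enough to contain the indicator of a closed part of \<Gamma>, whose Cauchy
  integral is later used off the contour.\<close>

definition bdd_meas :: "(complex \<Rightarrow> 'b::real_normed_vector) \<Rightarrow> bool" where
  "bdd_meas \<rho> \<longleftrightarrow> \<rho> \<in> borel_measurable M \<and> (\<exists>B. \<forall>x\<in>\<Gamma>. norm (\<rho> x) \<le> B)"

lemma bdd_meas_bound:
  assumes "bdd_meas \<rho>"
  obtains B where "0 < B" "\<And>x. x \<in> \<Gamma> \<Longrightarrow> norm (\<rho> x) \<le> B"
proof -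
  obtain B where "\<forall>x\<in>\<Gamma>. norm (\<rho> x) \<le> B" using assms unfolding bdd_meas_def by blast
  then show ?thesis using that[of "\<bar>B\<bar> + 1"] by fastforce
qed

lemma bdd_meas_continuous_on: "continuous_on \<Gamma> \<rho> \<Longrightarrow> bdd_meas \<rho>"
  unfolding bdd_meas_def using compact_imp_bounded[OF compact_continuous_image[OF _ compact_\<Gamma>], of \<rho>]
  by (auto simp: bounded_iff borel_measurable_M)

lemma bdd_meas_hoelder: "hoelder_on \<Gamma> \<rho> \<Longrightarrow> bdd_meas \<rho>"
  by (intro bdd_meas_continuous_on hoelder_on_imp_continuous_on)

section \<open>The Cauchy integral off the contour: analyticity and behaviour at infinity\<close>

lemma integrable_Cauchy_kernel:
  assumes "bdd_meas \<rho>" "z \<notin> \<Gamma>"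
  shows "integrable M (\<lambda>x. \<rho> x * \<tau> x / (x - z))"
proof -
  obtain B where B: "0 < B" "\<And>x. x \<in> \<Gamma> \<Longrightarrow> norm (\<rho> x) \<le> B" using bdd_meas_bound[OF assms(1)] by blast
  obtain T where T: "0 < T" "\<And>x. x \<in> \<Gamma> \<Longrightarrow> cmod (\<tau> x) \<le> T" using \<tau>_bound by blast
  obtain r where r: "0 < r" "\<And>x. x \<in> \<Gamma> \<Longrightarrow> r \<le> cmod (x - z)" using dist_pos[OF assms(2)] by blast
  have [measurable]: "\<rho> \<in> borel_measurable M" using assms unfolding bdd_meas_def by blast
  show ?thesis
  proof (rule integrable_bounded[of _ "B * T / r"])
    fix x assume "x \<in> \<Gamma>"
    then show "norm (\<rho> x * \<tau> x / (x - z)) \<le> B * T / r"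
      unfolding norm_mult norm_divide using B T r by (intro frac_le mult_mono) auto
  qed measurable
qed

text \<open>The bound is by the mean, not the maximum, of the density: in the uniqueness proof the
  jump is controlled only in the mean, by Zygmund's estimate. The factor 1/(2 pi) is
  discarded.\<close>

lemma norm_Cint_le:
  assumes "0 < r" "\<And>x. x \<in> \<Gamma> \<Longrightarrow> r \<le> cmod (x - z)" "\<And>x. x \<in> \<Gamma> \<Longrightarrow> cmod (\<tau> x) \<le> T"
    and "bdd_meas \<rho>"
  shows "cmod (Cint \<rho> z) \<le> T / r * (LINT x|M. cmod (\<rho> x))"
proof -
  obtain B where B: "0 < B" "\<And>x. x \<in> \<Gamma> \<Longrightarrow> norm (\<rho> x) \<le> B" using bdd_meas_bound[OF assms(4)] by blast
  have [measurable]: "\<rho> \<in> borel_measurable M" using assms(4) unfolding bdd_meas_def by blast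
  have zn: "z \<notin> \<Gamma>" using assms(1,2) by force
  have Tp: "0 \<le> T" using assms(3) \<Gamma>_nonempty norm_ge_zero order_trans by blast
  have "cmod (LINT x|M. \<rho> x * \<tau> x / (x - z)) \<le> (LINT x|M. cmod (\<rho> x * \<tau> x / (x - z)))"
    by (rule integral_norm_bound)
  also have "\<dots> \<le> (LINT x|M. T / r * cmod (\<rho> x))"
  proof (rule integral_mono)
    show "integrable M (\<lambda>x. cmod (\<rho> x * \<tau> x / (x - z)))"
      using integrable_Cauchy_kernel[OF assms(4) zn] by (rule integrable_norm)
    show "integrable M (\<lambda>x. T / r * cmod (\<rho> x))"
      using B(2) by (intro integrable_mult_right integrable_norm integrable_bounded[of \<rho> B]) auto
    fix x assume "x \<in> space M"
    then have x: "x \<in> \<Gamma>" by (simp add: space_M)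
    have "cmod (\<tau> x) / cmod (x - z) \<le> T / r" using assms x Tp by (intro frac_le) auto
    then have "cmod (\<rho> x) * (cmod (\<tau> x) / cmod (x - z)) \<le> cmod (\<rho> x) * (T / r)"
      by (intro mult_left_mono) auto
    then show "cmod (\<rho> x * \<tau> x / (x - z)) \<le> T / r * cmod (\<rho> x)"
      by (simp add: norm_mult norm_divide ac_simps)
  qed
  finally have *: "cmod (LINT x|M. \<rho> x * \<tau> x / (x - z)) \<le> T / r * (LINT x|M. cmod (\<rho> x))" by simp
  have "cmod (Cint \<rho> z) = cmod (LINT x|M. \<rho> x * \<tau> x / (x - z)) / (2 * pi)"
    by (simp add: Cint_def norm_divide norm_mult)
  also have "\<dots> \<le> cmod (LINT x|M. \<rho> x * \<tau> x / (x - z)) / 1"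
    using pi_ge_two by (intro divide_left_mono) auto
  finally show ?thesis using * by simp
qed

text \<open>Differentiation under the integral sign, carried out on difference quotients:
  subtracting the candidate derivative leaves \<open>h\<close> times an integral with kernel
  1/((x-z)^2 (x-z-h)), which is bounded once |h| < r/2.\<close>

lemma holomorphic_Cint:
  assumes "bdd_meas \<rho>"
  shows "Cint \<rho> holomorphic_on (- \<Gamma>)"
proof (rule holomorphic_onI)
  fix z assume "z \<in> - \<Gamma>"
  then have z: "z \<notin> \<Gamma>" by simp
  obtain B where B: "0 < B" "\<And>x. x \<in> \<Gamma> \<Longrightarrow> norm (\<rho> x) \<le> B" using bdd_meas_bound[OF assms(1)] by blast
  obtain T where T: "0 < T" "\<And>x. x \<in> \<Gamma> \<Longrightarrow> cmod (\<tau> x) \<le> T" using \<tau>_bound by blast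
  obtain r where r: "0 < r" "\<And>x. x \<in> \<Gamma> \<Longrightarrow> r \<le> cmod (x - z)" using dist_pos[OF z] by blast
  have [measurable]: "\<rho> \<in> borel_measurable M" using assms unfolding bdd_meas_def by blast
  define d where "d = (LINT x|M. \<rho> x * \<tau> x / (x - z)^2) / (2 * of_real pi * \<i>)"
  define K where "K = B * T / (r^2 * (r/2)) * measure M \<Gamma> / (2 * pi)"
  have key: "cmod ((Cint \<rho> (z + h) - Cint \<rho> z) / h - d) \<le> K * cmod h" if h: "h \<noteq> 0" "cmod h < r / 2" for h
  proof -
    have r2: "r / 2 \<le> cmod (x - (z + h))" if "x \<in> \<Gamma>" for x
    proof -
      have "cmod (x - z) \<le> cmod (x - (z + h)) + cmod h"
        using norm_triangle_ineq[of "x - (z + h)" h] by (simp add: algebra_simps)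
      then show ?thesis using r(2)[OF that] h by linarith
    qed
    have zh: "z + h \<notin> \<Gamma>" using r2 r(1) by force
    have i1: "integrable M (\<lambda>x. \<rho> x * \<tau> x / (x - (z + h)))" by (rule integrable_Cauchy_kernel[OF assms zh])
    have i2: "integrable M (\<lambda>x. \<rho> x * \<tau> x / (x - z))" by (rule integrable_Cauchy_kernel[OF assms z])
    have i3: "integrable M (\<lambda>x. \<rho> x * \<tau> x / (x - z)^2)"
    proof (rule integrable_bounded[of _ "B * T / r^2"])
      fix x assume "x \<in> \<Gamma>"
      then show "norm (\<rho> x * \<tau> x / (x - z)\<^sup>2) \<le> B * T / r\<^sup>2"
        unfolding norm_mult norm_divide norm_power using B T r by (intro frac_le mult_mono power_mono) auto
    qed measurable
    have "(Cint \<rho> (z + h) - Cint \<rho> z) / h - d =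
      (LINT x|M. ((\<rho> x * \<tau> x / (x - (z + h)) - \<rho> x * \<tau> x / (x - z)) / h - \<rho> x * \<tau> x / (x - z)^2)) / (2 * of_real pi * \<i>)"
    proof -
      have "(LINT x|M. ((\<rho> x * \<tau> x / (x - (z + h)) - \<rho> x * \<tau> x / (x - z)) / h - \<rho> x * \<tau> x / (x - z)^2))
         = ((LINT x|M. \<rho> x * \<tau> x / (x - (z + h))) - (LINT x|M. \<rho> x * \<tau> x / (x - z))) / h
           - (LINT x|M. \<rho> x * \<tau> x / (x - z)^2)"
        using i1 i2 i3 by simp
      then show ?thesis unfolding Cint_def d_def by (simp only:) (simp add: diff_divide_distrib mult.commute)
    qed
    also have "(LINT x|M. ((\<rho> x * \<tau> x / (x - (z + h)) - \<rho> x * \<tau> x / (x - z)) / h - \<rho> x * \<tau> x / (x - z)^2))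
       = (LINT x|M. h * (\<rho> x * \<tau> x / ((x - z)^2 * (x - (z + h)))))"
    proof (rule Bochner_Integration.integral_cong[OF refl])
      fix x assume "x \<in> space M"
      then have "x \<in> \<Gamma>" by (simp add: space_M)
      then have "x - z \<noteq> 0" "x - (z + h) \<noteq> 0" using z zh by auto
      then show "(\<rho> x * \<tau> x / (x - (z + h)) - \<rho> x * \<tau> x / (x - z)) / h - \<rho> x * \<tau> x / (x - z)\<^sup>2 =
         h * (\<rho> x * \<tau> x / ((x - z)\<^sup>2 * (x - (z + h))))"
        using h(1) by (simp add: divide_simps) (simp add: power2_eq_square algebra_simps)
    qed
    finally have "cmod ((Cint \<rho> (z + h) - Cint \<rho> z) / h - d) =
       cmod (LINT x|M. h * (\<rho> x * \<tau> x / ((x - z)^2 * (x - (z + h))))) / (2 * pi)"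
      by (simp add: norm_divide norm_mult)
    also have "\<dots> \<le> (cmod h * (B * T / (r^2 * (r/2))) * measure M \<Gamma>) / (2 * pi)"
    proof (intro divide_right_mono norm_integral_bounded)
      fix x assume x: "x \<in> \<Gamma>"
      show "cmod (h * (\<rho> x * \<tau> x / ((x - z)^2 * (x - (z + h))))) \<le> cmod h * (B * T / (r^2 * (r/2)))"
        unfolding norm_mult norm_divide norm_power using B T r x r2[OF x]
        by (intro mult_left_mono frac_le mult_mono power_mono) (auto intro: less_imp_le)
    qed auto
    finally show ?thesis by (simp add: K_def ac_simps)
  qed
  have "((\<lambda>h. (Cint \<rho> (z + h) - Cint \<rho> z) / h - d) \<longlongrightarrow> 0) (at 0)"
  proof (rule Lim_null_comparison)
    show "\<forall>\<^sub>F h in at 0. cmod ((Cint \<rho> (z + h) - Cint \<rho> z) / h - d) \<le> K * cmod h"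
      unfolding eventually_at using key r(1) by (intro exI[of _ "r/2"]) auto
    show "((\<lambda>h. K * cmod h) \<longlongrightarrow> 0) (at 0)"
      by (auto intro!: tendsto_eq_intros)
  qed
  then have "(Cint \<rho> has_field_derivative d) (at z)"
    unfolding DERIV_def by (simp add: LIM_zero_iff)
  then show "Cint \<rho> field_differentiable at z within - \<Gamma>"
    using field_differentiable_def field_differentiable_at_within by blast
qed

lemma Cint_at_infinity:
  assumes "bdd_meas \<rho>"
  shows "(Cint \<rho> \<longlongrightarrow> 0) at_infinity"
proof -
  obtain T where T: "0 < T" "\<And>x. x \<in> \<Gamma> \<Longrightarrow> cmod (\<tau> x) \<le> T" using \<tau>_bound by blast
  obtain R where R: "0 < R" "\<And>x. x \<in> \<Gamma> \<Longrightarrow> cmod x \<le> R" using bounded_\<Gamma> unfolding bounded_pos by blast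
  show ?thesis
  proof (rule Lim_null_comparison)
    show "\<forall>\<^sub>F z in at_infinity. cmod (Cint \<rho> z) \<le> T / (cmod z / 2) * (LINT x|M. cmod (\<rho> x))"
      unfolding eventually_at_infinity
    proof (intro exI[of _ "2 * R"] allI impI)
      fix z :: complex assume z: "2 * R \<le> cmod z"
      show "cmod (Cint \<rho> z) \<le> T / (cmod z / 2) * (LINT x|M. cmod (\<rho> x))"
      proof (rule norm_Cint_le[OF _ _ T(2) assms])
        show "0 < cmod z / 2" using z R by auto
        fix x assume "x \<in> \<Gamma>"
        then have "cmod x \<le> R" by (rule R)
        moreover have "cmod z \<le> cmod x + cmod (x - z)"
          by (metis norm_triangle_sub norm_minus_commute)
        ultimately show "cmod z / 2 \<le> cmod (x - z)" using z by linarith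
      qed
    qed
    have "((\<lambda>z::complex. T / (cmod z / 2)) \<longlongrightarrow> 0) at_infinity"
    proof (rule tendsto_divide_0[OF tendsto_const], rule filterlim_at_top_imp_at_infinity)
      have "filterlim (\<lambda>z::complex. cmod z * (1/2)) at_top at_infinity"
        by (rule filterlim_at_top_mult_tendsto_pos[OF tendsto_const _ filterlim_norm_at_top]) auto
      then show "filterlim (\<lambda>z::complex. cmod z / 2) at_top at_infinity" by simp
    qed
    then show "((\<lambda>z. T / (cmod z / 2) * (LINT x|M. cmod (\<rho> x))) \<longlongrightarrow> 0) at_infinity"
      by (rule tendsto_mult_left_zero)
  qed
qed

text \<open>From z/(x-z) = x/(x-z) - 1. The coefficient of 1/z at infinity recovers the integral of
  \<open>\<rho>\<close> against the line element; \<open>Cauchy_minus\<close> reads Cauchy's theorem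
  off it.\<close>

lemma Cint_at_infinity_coeff:
  assumes "bdd_meas \<rho>"
  shows "((\<lambda>z. z * Cint \<rho> z) \<longlongrightarrow> - (LINT x|M. \<rho> x * \<tau> x) / (2 * of_real pi * \<i>)) at_infinity"
proof -
  obtain B where B: "0 < B" "\<And>x. x \<in> \<Gamma> \<Longrightarrow> norm (\<rho> x) \<le> B" using bdd_meas_bound[OF assms(1)] by blast
  obtain T where T: "0 < T" "\<And>x. x \<in> \<Gamma> \<Longrightarrow> cmod (\<tau> x) \<le> T" using \<tau>_bound by blast
  obtain R where R: "0 < R" "\<And>x. x \<in> \<Gamma> \<Longrightarrow> cmod x \<le> R" using bounded_\<Gamma> unfolding bounded_pos by blast
  have [measurable]: "\<rho> \<in> borel_measurable M" using assms unfolding bdd_meas_def by blast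
  have bm: "bdd_meas (\<lambda>x. x * \<rho> x)"
    unfolding bdd_meas_def
  proof (intro conjI exI[of _ "R * B"] ballI)
    fix x assume "x \<in> \<Gamma>"
    then show "norm (x * \<rho> x) \<le> R * B" using R B by (auto simp: norm_mult intro!: mult_mono)
  qed measurable
  have "integrable M (\<lambda>x. \<rho> x * \<tau> x)"
  proof (rule integrable_bounded[of _ "B * T"])
    fix x assume "x \<in> \<Gamma>"
    then show "norm (\<rho> x * \<tau> x) \<le> B * T" using T B by (auto simp: norm_mult intro!: mult_mono)
  qed measurable
  then have eq: "z * Cint \<rho> z = Cint (\<lambda>x. x * \<rho> x) z - (LINT x|M. \<rho> x * \<tau> x) / (2 * of_real pi * \<i>)" if "z \<notin> \<Gamma>" for z
  proof -
    have "z * (LINT x|M. \<rho> x * \<tau> x / (x - z)) = (LINT x|M. z * (\<rho> x * \<tau> x / (x - z)))"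
      by (rule integral_mult_right_zero[symmetric])
    also have "\<dots> = (LINT x|M. x * \<rho> x * \<tau> x / (x - z) - \<rho> x * \<tau> x)"
    proof (rule Bochner_Integration.integral_cong[OF refl])
      fix x assume "x \<in> space M"
      then have "x - z \<noteq> 0" using that space_M by auto
      then show "z * (\<rho> x * \<tau> x / (x - z)) = x * \<rho> x * \<tau> x / (x - z) - \<rho> x * \<tau> x"
        by (simp add: divide_simps) (simp add: algebra_simps)
    qed
    also have "\<dots> = (LINT x|M. x * \<rho> x * \<tau> x / (x - z)) - (LINT x|M. \<rho> x * \<tau> x)"
      using \<open>integrable M (\<lambda>x. \<rho> x * \<tau> x)\<close> integrable_Cauchy_kernel[OF bm that] by simp
    finally show ?thesis by (simp only: Cint_def times_divide_eq_right diff_divide_distrib)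
  qed
  have "((\<lambda>z. Cint (\<lambda>x. x * \<rho> x) z - (LINT x|M. \<rho> x * \<tau> x) / (2 * of_real pi * \<i>))
      \<longlongrightarrow> 0 - (LINT x|M. \<rho> x * \<tau> x) / (2 * of_real pi * \<i>)) at_infinity"
    by (intro tendsto_diff tendsto_const Cint_at_infinity bm)
  moreover have "\<forall>\<^sub>F z in at_infinity. Cint (\<lambda>x. x * \<rho> x) z - (LINT x|M. \<rho> x * \<tau> x) / (2 * of_real pi * \<i>) = z * Cint \<rho> z"
    unfolding eventually_at_infinity
  proof (intro exI[of _ "R + 1"] allI impI)
    fix z :: complex assume "R + 1 \<le> cmod z"
    then have "z \<notin> \<Gamma>" using R(2)[of z] by linarith
    then show "Cint (\<lambda>x. x * \<rho> x) z - (LINT x|M. \<rho> x * \<tau> x) / (2 * of_real pi * \<i>) = z * Cint \<rho> z"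
      by (rule eq[symmetric])
  qed
  ultimately have "((\<lambda>z. z * Cint \<rho> z) \<longlongrightarrow> 0 - (LINT x|M. \<rho> x * \<tau> x) / (2 * of_real pi * \<i>)) at_infinity"
    by (rule Lim_transform_eventually)
  then show ?thesis by simp
qed

section \<open>Hoelder continuity of the boundary values\<close>

lemma growth_integrable:
  assumes "0 < \<beta>" "\<beta> \<le> 1" "y \<in> \<Gamma>"
  shows "integrable M (\<lambda>x. cmod (x - y) powr (\<beta> - 1))"
  using growth[OF assms(1,2)] assms(3) by blast

lemma norm_singular_integral_le:
  fixes F :: "complex \<Rightarrow> 'b::{banach, second_countable_topology}"
  assumes "F \<in> borel_measurable M" "integrable M g" "\<And>x. x \<in> \<Gamma> \<Longrightarrow> norm (F x) \<le> g x"
  shows "integrable M F" "norm (LINT x|M. F x) \<le> (LINT x|M. g x)"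
proof -
  show i: "integrable M F"
    by (rule Bochner_Integration.integrable_bound[OF assms(2,1)])
       (use assms(3) in \<open>auto simp: space_M intro!: AE_I2 order_trans[OF assms(3)]\<close>)
  have "norm (LINT x|M. F x) \<le> (LINT x|M. norm (F x))" by (rule integral_norm_bound)
  also have "\<dots> \<le> (LINT x|M. g x)"
    using i assms by (intro integral_mono) (auto simp: space_M)
  finally show "norm (LINT x|M. F x) \<le> (LINT x|M. g x)" .
qed

lemma hoelder_quotient_bound:
  assumes "0 < \<alpha>" "0 \<le> C" "\<And>x y. x \<in> \<Gamma> \<Longrightarrow> y \<in> \<Gamma> \<Longrightarrow> cmod (\<rho> x - \<rho> y) \<le> C * dist x y powr \<alpha>"
    and "0 < T" "\<And>x. x \<in> \<Gamma> \<Longrightarrow> cmod (\<tau> x) \<le> T" "x \<in> \<Gamma>" "y \<in> \<Gamma>"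
  shows "cmod ((\<rho> x - \<rho> y) * \<tau> x / (x - y)) \<le> C * T * cmod (x - y) powr (\<alpha> - 1)"
\<comment> \<open>For x = y both sides are 0, since division by zero and \<open>0 powr _\<close> are
  0; the singular integrands below rely on the same convention.\<close>
proof (cases "x = y")
  case False
  have "cmod ((\<rho> x - \<rho> y) * \<tau> x / (x - y)) \<le> (C * cmod (x - y) powr \<alpha>) * T / cmod (x - y)"
    unfolding norm_mult norm_divide using assms
    by (intro divide_right_mono mult_mono) (auto simp: dist_norm)
  also have "\<dots> = C * T * cmod (x - y) powr (\<alpha> - 1)"
    using False by (simp add: powr_diff)
  finally show ?thesis .
qed auto

lemma singular_integrable:
  assumes "hoelder_on \<Gamma> \<rho>" "y \<in> \<Gamma>"
  shows "integrable M (\<lambda>x. (\<rho> x - \<rho> y) * \<tau> x / (x - y))"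
proof -
  obtain \<alpha> C where a: "0 < \<alpha>" "\<alpha> \<le> 1" "0 \<le> C"
    "\<And>x y. x \<in> \<Gamma> \<Longrightarrow> y \<in> \<Gamma> \<Longrightarrow> norm (\<rho> x - \<rho> y) \<le> C * dist x y powr \<alpha>"
    using assms unfolding hoelder_on_def by blast
  obtain T where T: "0 < T" "\<And>x. x \<in> \<Gamma> \<Longrightarrow> cmod (\<tau> x) \<le> T" using \<tau>_bound by blast
  have [measurable]: "\<rho> \<in> borel_measurable M"
    using assms by (intro borel_measurable_M hoelder_on_imp_continuous_on)
  show ?thesis
  proof (rule norm_singular_integral_le)
    show "integrable M (\<lambda>x. C * T * cmod (x - y) powr (\<alpha> - 1))"
      using growth_integrable[OF a(1,2) assms(2)] by simp
    show "norm ((\<rho> x - \<rho> y) * \<tau> x / (x - y)) \<le> C * T * cmod (x - y) powr (\<alpha> - 1)" if "x \<in> \<Gamma>" for x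
      by (rule hoelder_quotient_bound[OF a(1,3,4) T that assms(2)])
  qed measurable
qed

text \<open>Trades half of the Hoelder exponent: a factor d^(\<alpha>/2) is split off as the future
  modulus of continuity, and the remaining exponent \<alpha>/2 - 1 is still above -1, hence
  integrable by \<open>growth\<close>.\<close>

lemma powr_split_le:
  fixes a d :: real
  assumes "0 \<le> a" "a \<le> k * d" "0 \<le> d" "1 \<le> k" "0 < \<alpha>" "\<alpha> \<le> 1"
  shows "a powr (\<alpha> - 1) \<le> k * d powr (\<alpha>/2) * a powr (\<alpha>/2 - 1)"
proof -
  have "a powr (\<alpha> - 1) = a powr (\<alpha>/2) * a powr (\<alpha>/2 - 1)"
    by (simp flip: powr_add)
  also have "a powr (\<alpha>/2) \<le> (k * d) powr (\<alpha>/2)"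
    using assms by (intro powr_mono2) auto
  also have "(k * d) powr (\<alpha>/2) = k powr (\<alpha>/2) * d powr (\<alpha>/2)"
    using assms by (simp add: powr_mult)
  also have "k powr (\<alpha>/2) \<le> k powr 1"
    using assms by (intro powr_mono) auto
  finally show ?thesis using assms by (simp add: mult_right_mono)
qed

text \<open>Two scales are distinguished. If x is within 2|y1 - y2| of y1, each term is small on its
  own; otherwise the kernels are subtracted. Aiming at the exponent \<alpha>/2 instead of \<alpha>
  keeps a weight whose integral is bounded uniformly in the points.\<close>

lemma Cbd_integrand_diff:
  assumes a: "0 < \<alpha>" "\<alpha> \<le> 1" "0 \<le> C"
    "\<And>x y. x \<in> \<Gamma> \<Longrightarrow> y \<in> \<Gamma> \<Longrightarrow> cmod (\<rho> x - \<rho> y) \<le> C * dist x y powr \<alpha>"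
    and T: "0 < T" "\<And>x. x \<in> \<Gamma> \<Longrightarrow> cmod (\<tau> x) \<le> T"
    and x: "x \<in> \<Gamma>" and y: "y1 \<in> \<Gamma>" "y2 \<in> \<Gamma>"
  shows "cmod ((\<rho> x - \<rho> y1) * \<tau> x / (x - y1) - (\<rho> x - \<rho> y2) * \<tau> x / (x - y2))
     \<le> 3 * C * T * cmod (y1 - y2) powr (\<alpha>/2) * (cmod (x - y1) powr (\<alpha>/2 - 1) + cmod (x - y2) powr (\<alpha>/2 - 1))"
proof -
  define A B d where "A = cmod (x - y1)" and "B = cmod (x - y2)" and "d = cmod (y1 - y2)"
  have tri: "B \<le> A + d" "A \<le> B + d" "0 \<le> A" "0 \<le> B" "0 \<le> d"
    unfolding A_def B_def d_def using norm_triangle_ineq[of "x - y1" "y1 - y2"] norm_triangle_ineq[of "x - y2" "y2 - y1"]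
    by (auto simp: norm_minus_commute)
  show ?thesis
  \<comment> \<open>\<open>0 < A\<close> is included because \<open>2 * d \<le> A\<close> also holds
    when x, y1 and y2 all coincide.\<close>
  proof (cases "2 * d \<le> A \<and> 0 < A")
    case False
    then have A2: "A \<le> 2 * d" using tri by auto
    have B3: "B \<le> 3 * d" using A2 tri by linarith
    have "cmod ((\<rho> x - \<rho> y1) * \<tau> x / (x - y1) - (\<rho> x - \<rho> y2) * \<tau> x / (x - y2))
       \<le> C * T * A powr (\<alpha> - 1) + C * T * B powr (\<alpha> - 1)"
      unfolding A_def B_def
      by (intro order_trans[OF norm_triangle_ineq4] add_mono hoelder_quotient_bound a T x y)
    also have "\<dots> \<le> C * T * (3 * d powr (\<alpha>/2) * A powr (\<alpha>/2 - 1)) + C * T * (3 * d powr (\<alpha>/2) * B powr (\<alpha>/2 - 1))"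
      using a T tri A2 B3 by (intro add_mono mult_left_mono powr_split_le) auto
    finally show ?thesis by (simp add: A_def B_def d_def algebra_simps)
  next
    case True
    then have A0: "0 < A" and BA: "A / 2 \<le> B" using tri by auto
    have B0: "0 < B" using A0 BA by linarith
    have nz: "x - y1 \<noteq> 0" "x - y2 \<noteq> 0" using A0 B0 unfolding A_def B_def by auto
    \<comment> \<open>The first summand carries the change of the kernel, the second the change of
      the subtracted constant.\<close>
    have "(\<rho> x - \<rho> y1) * \<tau> x / (x - y1) - (\<rho> x - \<rho> y2) * \<tau> x / (x - y2)
       = ((\<rho> x - \<rho> y2) * \<tau> x / (x - y2)) * ((y1 - y2) / (x - y1)) + (\<rho> y2 - \<rho> y1) * \<tau> x / (x - y1)"
      using nz by (simp add: divide_simps) (simp add: algebra_simps)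
    then have "cmod ((\<rho> x - \<rho> y1) * \<tau> x / (x - y1) - (\<rho> x - \<rho> y2) * \<tau> x / (x - y2))
       \<le> cmod ((\<rho> x - \<rho> y2) * \<tau> x / (x - y2)) * cmod ((y1 - y2) / (x - y1)) + cmod ((\<rho> y2 - \<rho> y1) * \<tau> x / (x - y1))"
      by (metis norm_mult norm_triangle_ineq)
    also have "\<dots> \<le> (C * T * B powr (\<alpha> - 1)) * (d / A) + (C * d powr \<alpha>) * T / A"
    proof (intro add_mono mult_mono)
      show "cmod ((\<rho> x - \<rho> y2) * \<tau> x / (x - y2)) \<le> C * T * B powr (\<alpha> - 1)"
        unfolding B_def by (intro hoelder_quotient_bound a T x y)
      show "cmod ((y1 - y2) / (x - y1)) \<le> d / A" by (simp add: norm_divide A_def d_def)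
      show "cmod ((\<rho> y2 - \<rho> y1) * \<tau> x / (x - y1)) \<le> C * d powr \<alpha> * T / A"
        unfolding norm_mult norm_divide A_def d_def using a T x y A0
        by (intro divide_right_mono mult_mono) (auto simp: dist_norm norm_minus_commute[of y1])
    qed (use a T in auto)
    also have "\<dots> \<le> C * T * (2 * (d powr (\<alpha>/2) * A powr (\<alpha>/2 - 1))) + C * T * (d powr (\<alpha>/2) * A powr (\<alpha>/2 - 1))"
    proof (rule add_mono)
      have "B powr (\<alpha> - 1) \<le> (A / 2) powr (\<alpha> - 1)"
        using a A0 BA by (intro powr_mono2') auto
      also have "(A / 2) powr (\<alpha> - 1) = A powr (\<alpha> - 1) * 2 powr (1 - \<alpha>)"
        using A0 by (simp add: powr_divide powr_diff)
      also have "2 powr (1 - \<alpha>) \<le> 2 powr (1::real)" using a by (intro powr_mono) auto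
      finally have B1: "B powr (\<alpha> - 1) \<le> 2 * A powr (\<alpha> - 1)" using A0 by (simp add: mult_left_mono mult.commute)
      have "d powr 1 = d powr (\<alpha>/2) * d powr (1 - \<alpha>/2)" by (simp flip: powr_add)
      then have "d = d powr (\<alpha>/2) * d powr (1 - \<alpha>/2)" using tri by simp
      also have "\<dots> \<le> d powr (\<alpha>/2) * A powr (1 - \<alpha>/2)"
        using a tri True by (intro mult_left_mono powr_mono2) auto
      finally have d1: "d \<le> d powr (\<alpha>/2) * A powr (1 - \<alpha>/2)" .
      have "(B powr (\<alpha> - 1)) * (d / A) \<le> (2 * A powr (\<alpha> - 1)) * (d powr (\<alpha>/2) * A powr (1 - \<alpha>/2) / A)"
        using B1 d1 A0 tri by (intro mult_mono divide_right_mono) auto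
      also have "\<dots> = 2 * (d powr (\<alpha>/2) * (A powr (\<alpha> - 1) * A powr (1 - \<alpha>/2) * A powr (-1)))"
      proof -
        have "A powr (-1) = inverse A" using A0 by (simp add: powr_minus)
        then show ?thesis unfolding divide_inverse by (simp only: ac_simps)
      qed
      also have "A powr (\<alpha> - 1) * A powr (1 - \<alpha>/2) * A powr (-1) = A powr (\<alpha>/2 - 1)"
        unfolding powr_add[symmetric] by simp
      finally have "B powr (\<alpha> - 1) * (d / A) \<le> 2 * (d powr (\<alpha>/2) * A powr (\<alpha>/2 - 1))" .
      then have "(C * T) * (B powr (\<alpha> - 1) * (d / A)) \<le> (C * T) * (2 * (d powr (\<alpha>/2) * A powr (\<alpha>/2 - 1)))"
        by (rule mult_left_mono) (use a T in auto)
      then show "C * T * B powr (\<alpha> - 1) * (d / A) \<le> C * T * (2 * (d powr (\<alpha>/2) * A powr (\<alpha>/2 - 1)))"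
        by (simp only: mult.assoc)
      have "d powr \<alpha> = d powr (\<alpha>/2) * d powr (\<alpha>/2)" by (simp flip: powr_add)
      also have "\<dots> \<le> d powr (\<alpha>/2) * A powr (\<alpha>/2)"
        using a tri True by (intro mult_left_mono powr_mono2) auto
      finally have "d powr \<alpha> / A \<le> d powr (\<alpha>/2) * A powr (\<alpha>/2) / A"
        using A0 by (intro divide_right_mono) auto
      also have "\<dots> = d powr (\<alpha>/2) * A powr (\<alpha>/2 - 1)"
        using A0 by (simp add: powr_diff abs_of_pos[OF A0])
      finally have "(C * T) * (d powr \<alpha> / A) \<le> (C * T) * (d powr (\<alpha>/2) * A powr (\<alpha>/2 - 1))"
        using a T by (intro mult_left_mono) auto
      then show "C * d powr \<alpha> * T / A \<le> C * T * (d powr (\<alpha>/2) * A powr (\<alpha>/2 - 1))"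
        by (simp add: ac_simps)
    qed
    also have "\<dots> \<le> 3 * C * T * d powr (\<alpha>/2) * (A powr (\<alpha>/2 - 1) + B powr (\<alpha>/2 - 1))"
      using a T by (simp add: algebra_simps)
    finally show ?thesis by (simp add: A_def B_def d_def)
  qed
qed

lemma hoelder_Cbd:
  assumes "hoelder_on \<Gamma> \<rho>"
  shows "hoelder_on \<Gamma> (Cbd \<rho>)"
proof -
  obtain \<alpha> C where a: "0 < \<alpha>" "\<alpha> \<le> 1" "0 \<le> C"
    "\<And>x y. x \<in> \<Gamma> \<Longrightarrow> y \<in> \<Gamma> \<Longrightarrow> norm (\<rho> x - \<rho> y) \<le> C * dist x y powr \<alpha>"
    using assms unfolding hoelder_on_def by blast
  obtain T where T: "0 < T" "\<And>x. x \<in> \<Gamma> \<Longrightarrow> cmod (\<tau> x) \<le> T" using \<tau>_bound by blast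
  have [measurable]: "\<rho> \<in> borel_measurable M"
    using assms by (intro borel_measurable_M hoelder_on_imp_continuous_on)
  obtain K where K: "\<And>y. y \<in> \<Gamma> \<Longrightarrow> (LINT x|M. cmod (x - y) powr (\<alpha>/2 - 1)) \<le> K"
    using growth[of "\<alpha>/2"] a by auto
  show ?thesis
  proof (rule hoelder_onI[of "\<alpha>/2" _ _ "3 * C * T * (2 * K) / (2 * pi)"])
    fix y1 y2 assume y: "y1 \<in> \<Gamma>" "y2 \<in> \<Gamma>"
    let ?F = "\<lambda>y x. (\<rho> x - \<rho> y) * \<tau> x / (x - y)"
    let ?c = "3 * C * T * cmod (y1 - y2) powr (\<alpha>/2)"
    have gi: "integrable M (\<lambda>x. cmod (x - y) powr (\<alpha>/2 - 1))" if "y \<in> \<Gamma>" for y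
      using growth_integrable[of "\<alpha>/2" y] a that by auto
    have "cmod (LINT x|M. ?F y1 x - ?F y2 x) \<le> (LINT x|M. ?c * (cmod (x - y1) powr (\<alpha>/2 - 1) + cmod (x - y2) powr (\<alpha>/2 - 1)))"
    proof (rule norm_singular_integral_le)
      show "integrable M (\<lambda>x. ?c * (cmod (x - y1) powr (\<alpha>/2 - 1) + cmod (x - y2) powr (\<alpha>/2 - 1)))"
        using gi y by (intro integrable_mult_right Bochner_Integration.integrable_add) auto
      show "norm (?F y1 x - ?F y2 x) \<le> ?c * (cmod (x - y1) powr (\<alpha>/2 - 1) + cmod (x - y2) powr (\<alpha>/2 - 1))" if "x \<in> \<Gamma>" for x
        by (rule Cbd_integrand_diff[OF a T that y])
    qed measurable
    also have "\<dots> = ?c * ((LINT x|M. cmod (x - y1) powr (\<alpha>/2 - 1)) + (LINT x|M. cmod (x - y2) powr (\<alpha>/2 - 1)))"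
      using gi y by simp
    also have "\<dots> \<le> ?c * (K + K)"
      using K y a T by (intro mult_left_mono add_mono) auto
    finally have *: "cmod (LINT x|M. ?F y1 x - ?F y2 x) \<le> ?c * (K + K)" .
    have "Cbd \<rho> y1 - Cbd \<rho> y2 = (LINT x|M. ?F y1 x - ?F y2 x) / (2 * of_real pi * \<i>)"
      using singular_integrable[OF assms] y by (simp add: Cbd_def diff_divide_distrib)
    then have "cmod (Cbd \<rho> y1 - Cbd \<rho> y2) = cmod (LINT x|M. ?F y1 x - ?F y2 x) / (2 * pi)"
      by (simp add: norm_divide norm_mult)
    also have "\<dots> \<le> ?c * (K + K) / (2 * pi)" using * by (intro divide_right_mono) auto
    finally show "norm (Cbd \<rho> y1 - Cbd \<rho> y2) \<le> 3 * C * T * (2 * K) / (2 * pi) * dist y1 y2 powr (\<alpha>/2)"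
      by (simp add: dist_norm ac_simps)
  qed (use a in auto)
qed

section \<open>The Plemelj formulas\<close>

lemma Cint_subtract:
  assumes "bdd_meas \<rho>" "z \<notin> \<Gamma>"
  shows "Cint \<rho> z = (LINT x|M. (\<rho> x - c) * \<tau> x / (x - z)) / (2 * of_real pi * \<i>) + (if z \<in> G then 0 else - c)"
proof -
  have bc: "bdd_meas (\<lambda>x. c)" by (intro bdd_meas_continuous_on continuous_intros)
  have i1: "integrable M (\<lambda>x. \<rho> x * \<tau> x / (x - z))" by (rule integrable_Cauchy_kernel[OF assms])
  have i2: "integrable M (\<lambda>x. c * \<tau> x / (x - z))" by (rule integrable_Cauchy_kernel[OF bc assms(2)])
  have "(LINT x|M. (\<rho> x - c) * \<tau> x / (x - z)) = (LINT x|M. \<rho> x * \<tau> x / (x - z) - c * \<tau> x / (x - z))"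
    by (intro Bochner_Integration.integral_cong) (auto simp: algebra_simps diff_divide_distrib)
  also have "\<dots> = (LINT x|M. \<rho> x * \<tau> x / (x - z)) - (LINT x|M. c * \<tau> x / (x - z))"
    using i1 i2 by simp
  also have "(LINT x|M. c * \<tau> x / (x - z)) = (LINT x|M. c * (\<tau> x / (x - z)))" by simp
  also have "\<dots> = c * (LINT x|M. \<tau> x / (x - z))" by (rule integral_mult_right_zero)
  also have "(LINT x|M. \<tau> x / (x - z)) = (if z \<in> G then 0 else - (2 * of_real pi * \<i>))"
    using wind_G wind_D in_G_or_D[OF assms(2)] by auto
  finally have "(LINT x|M. (\<rho> x - c) * \<tau> x / (x - z)) =
     (LINT x|M. \<rho> x * \<tau> x / (x - z)) - c * (if z \<in> G then 0 else - (2 * of_real pi * \<i>))" .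
  then show ?thesis unfolding Cint_def by (cases "z \<in> G") (simp_all add: add_divide_distrib)
qed

text \<open>Comparison with a nearest boundary point y gives |x - y| \<le> 2|x - z| for all x on
  \<Gamma>; the kernels at z and at y then differ by |z - y|^(\<alpha>/2) times an integrable
  weight. The estimate is uniform and does not restrict the direction of approach.\<close>

lemma plemelj_estimate:
  assumes "hoelder_on \<Gamma> \<rho>"
  obtains \<beta> K where "0 < \<beta>" "0 \<le> K" "\<forall>z. z \<notin> \<Gamma> \<longrightarrow> (\<exists>y\<in>\<Gamma>. (\<forall>x\<in>\<Gamma>. dist z y \<le> dist z x) \<and>
     cmod (Cint \<rho> z - (Cbd \<rho> y + (if z \<in> G then 0 else - \<rho> y))) \<le> K * dist z y powr \<beta>)"
proof -
  obtain \<alpha> C where a: "0 < \<alpha>" "\<alpha> \<le> 1" "0 \<le> C"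
    "\<And>x y. x \<in> \<Gamma> \<Longrightarrow> y \<in> \<Gamma> \<Longrightarrow> norm (\<rho> x - \<rho> y) \<le> C * dist x y powr \<alpha>"
    using assms unfolding hoelder_on_def by blast
  obtain T where T: "0 < T" "\<And>x. x \<in> \<Gamma> \<Longrightarrow> cmod (\<tau> x) \<le> T" using \<tau>_bound by blast
  have [measurable]: "\<rho> \<in> borel_measurable M"
    using assms by (intro borel_measurable_M hoelder_on_imp_continuous_on)
  obtain K0 where K0: "\<And>y. y \<in> \<Gamma> \<Longrightarrow> (LINT x|M. cmod (x - y) powr (\<alpha>/2 - 1)) \<le> K0"
    using growth[of "\<alpha>/2"] a by auto
  define K where "K = 2 * C * T * \<bar>K0\<bar> / (2 * pi)"
  have "\<exists>y\<in>\<Gamma>. (\<forall>x\<in>\<Gamma>. dist z y \<le> dist z x) \<and>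
     cmod (Cint \<rho> z - (Cbd \<rho> y + (if z \<in> G then 0 else - \<rho> y))) \<le> K * dist z y powr (\<alpha>/2)"
    if z: "z \<notin> \<Gamma>" for z
  proof -
    obtain y where y: "y \<in> \<Gamma>" "\<forall>x\<in>\<Gamma>. dist z y \<le> dist z x"
      by (rule distance_attains_inf[OF closed_\<Gamma> \<Gamma>_nonempty, of z]) auto
    define \<delta> where "\<delta> = cmod (z - y)"
    have \<delta>: "0 < \<delta>" using z y(1) by (auto simp: \<delta>_def)
    let ?c = "2 * C * T * \<delta> powr (\<alpha>/2)"
    let ?F = "\<lambda>w x. (\<rho> x - \<rho> y) * \<tau> x / (x - w)"
    have gi: "integrable M (\<lambda>x. cmod (x - y) powr (\<alpha>/2 - 1))"
      using growth_integrable[of "\<alpha>/2" y] a y by auto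
    have bm: "bdd_meas (\<lambda>x. \<rho> x - \<rho> y)"
      by (intro bdd_meas_continuous_on continuous_intros hoelder_on_imp_continuous_on assms)
    have "cmod (LINT x|M. ?F z x - ?F y x) \<le> (LINT x|M. ?c * cmod (x - y) powr (\<alpha>/2 - 1))"
    proof (rule norm_singular_integral_le)
      show "integrable M (\<lambda>x. ?c * cmod (x - y) powr (\<alpha>/2 - 1))" using gi by simp
      fix x assume x: "x \<in> \<Gamma>"
      show "cmod (?F z x - ?F y x) \<le> ?c * cmod (x - y) powr (\<alpha>/2 - 1)"
      proof (cases "x = y")
        case False
        define A e where "A = cmod (x - y)" and "e = cmod (x - z)"
        have e: "\<delta> \<le> e" using y x by (auto simp: \<delta>_def e_def dist_norm norm_minus_commute)
        have A: "A \<le> 2 * e" "0 < A"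
          using False e norm_triangle_ineq[of "x - z" "z - y"] by (auto simp: A_def e_def \<delta>_def)
        have nz: "x - z \<noteq> 0" "x - y \<noteq> 0" using x z False by auto
        have "?F z x - ?F y x = ?F y x * ((z - y) / (x - z))"
          using nz by (simp add: divide_simps) (simp add: algebra_simps)
        then have "cmod (?F z x - ?F y x) = cmod (?F y x) * (\<delta> / e)"
          by (simp add: norm_mult norm_divide \<delta>_def e_def)
        also have "\<dots> \<le> (C * T * A powr (\<alpha> - 1)) * (2 * (\<delta> powr (\<alpha>/2) * A powr (-\<alpha>/2)))"
        proof (rule mult_mono)
          show "cmod (?F y x) \<le> C * T * A powr (\<alpha> - 1)"
            unfolding A_def by (intro hoelder_quotient_bound a T x y(1))
          \<comment> \<open>A ratio at most 1 grows when raised to the power \<alpha>/2; spending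
            only this power leaves the integrable weight A^(\<alpha>/2 - 1).\<close>
          have "(\<delta> / e) powr 1 \<le> (\<delta> / e) powr (\<alpha>/2)"
            using a \<delta> e by (intro powr_mono') auto
          then have "\<delta> / e \<le> (\<delta> / e) powr (\<alpha>/2)" using \<delta> e by simp
          also have "\<dots> \<le> (2 * \<delta> / A) powr (\<alpha>/2)"
          proof (intro powr_mono2)
            show "\<delta> / e \<le> 2 * \<delta> / A" using \<delta> e A by (simp add: frac_le divide_simps mult.commute)
          qed (use a \<delta> e in auto)
          also have "\<dots> = 2 powr (\<alpha>/2) * (\<delta> powr (\<alpha>/2) * A powr (-\<alpha>/2))"
            unfolding powr_divide powr_mult using \<delta> A by (simp add: powr_minus_divide)
          also have "\<dots> \<le> 2 powr 1 * (\<delta> powr (\<alpha>/2) * A powr (-\<alpha>/2))"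
            using a by (intro mult_right_mono powr_mono) auto
          finally show "\<delta> / e \<le> 2 * (\<delta> powr (\<alpha>/2) * A powr (-\<alpha>/2))" by simp
        qed (use a T \<delta> e in auto)
        also have "\<dots> = ?c * (A powr (\<alpha> - 1) * A powr (-\<alpha>/2))" by (simp add: ac_simps)
        also have "A powr (\<alpha> - 1) * A powr (-\<alpha>/2) = A powr (\<alpha>/2 - 1)" by (simp flip: powr_add)
        finally show ?thesis by (simp add: A_def)
      qed simp
    qed measurable
    also have "\<dots> = ?c * (LINT x|M. cmod (x - y) powr (\<alpha>/2 - 1))" by simp
    also have "\<dots> \<le> ?c * \<bar>K0\<bar>" using K0[OF y(1)] a T by (intro mult_left_mono) auto
    finally have *: "cmod (LINT x|M. ?F z x - ?F y x) \<le> ?c * \<bar>K0\<bar>" .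
    have "Cint \<rho> z - (Cbd \<rho> y + (if z \<in> G then 0 else - \<rho> y)) = (LINT x|M. ?F z x - ?F y x) / (2 * of_real pi * \<i>)"
      using integrable_Cauchy_kernel[OF bm z] singular_integrable[OF assms y(1)]
      unfolding Cint_subtract[OF bdd_meas_hoelder[OF assms] z, of "\<rho> y"] Cbd_def
      by (simp add: diff_divide_distrib)
    then have "cmod (Cint \<rho> z - (Cbd \<rho> y + (if z \<in> G then 0 else - \<rho> y))) = cmod (LINT x|M. ?F z x - ?F y x) / (2 * pi)"
      by (simp add: norm_divide norm_mult)
    also have "\<dots> \<le> ?c * \<bar>K0\<bar> / (2 * pi)" using * by (intro divide_right_mono) auto
    also have "\<dots> = K * dist z y powr (\<alpha>/2)" by (simp add: K_def \<delta>_def dist_norm)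
    finally show ?thesis using y by blast
  qed
  then show ?thesis using that[of "\<alpha>/2" K] a T by (auto simp: K_def)
qed

text \<open>If y is a boundary point nearest to z, then dist y p \<le> 2 * dist z p for every
  boundary point p; so \<open>F z\<close>, being close to \<open>v y\<close>, is close to
  \<open>v p\<close>.\<close>

lemma continuous_on_boundary_extension:
  fixes F v :: "complex \<Rightarrow> complex"
  assumes "open S" "S \<inter> \<Gamma> = {}" "continuous_on S F" "continuous_on \<Gamma> v" "0 < \<beta>" "0 \<le> K"
    and "\<And>z. z \<in> S \<Longrightarrow> \<exists>y\<in>\<Gamma>. (\<forall>x\<in>\<Gamma>. dist z y \<le> dist z x) \<and> cmod (F z - v y) \<le> K * dist z y powr \<beta>"
  shows "continuous_on (S \<union> \<Gamma>) (\<lambda>z. if z \<in> \<Gamma> then v z else F z)" (is "continuous_on _ ?f")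
  unfolding continuous_on_eq_continuous_within
proof
  fix p assume p: "p \<in> S \<union> \<Gamma>"
  show "continuous (at p within (S \<union> \<Gamma>)) ?f"
  proof (cases "p \<in> \<Gamma>")
    case False
    then have pS: "p \<in> S" using p by auto
    have "continuous_on S ?f"
      by (rule continuous_on_cong[THEN iffD1, OF refl _ assms(3)]) (use assms(2) in auto)
    then have "continuous (at p) ?f"
      using pS assms(1) by (simp add: continuous_on_eq_continuous_at)
    then show ?thesis by (rule continuous_at_imp_continuous_at_within)
  next
    case True
    show ?thesis
      unfolding continuous_within_eps_delta
    proof (intro allI impI)
      fix e :: real assume e: "0 < e"
      obtain d1 where d1: "0 < d1" "\<And>x. x \<in> \<Gamma> \<Longrightarrow> dist x p < d1 \<Longrightarrow> dist (v x) (v p) < e / 2"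
        using assms(4) True e unfolding continuous_on_iff by (metis half_gt_zero)
      have "((\<lambda>t::real. K * t powr \<beta>) \<longlongrightarrow> K * 0 powr \<beta>) (at_right 0)"
        using assms(5) by (intro tendsto_intros) (auto simp: eventually_at_filter)
      then have "\<forall>\<^sub>F t in at_right 0. K * t powr \<beta> < e / 2"
        using e by (intro order_tendstoD) auto
      then obtain d2 where d2: "0 < d2" "\<And>t. 0 < t \<Longrightarrow> t < d2 \<Longrightarrow> K * t powr \<beta> < e / 2"
        unfolding eventually_at_right_field by blast
      show "\<exists>d>0. \<forall>x\<in>S \<union> \<Gamma>. dist x p < d \<longrightarrow> dist (?f x) (?f p) < e"
      \<comment> \<open>\<open>d1\<close> is halved because the nearest point of z may lie twice as
        far from p as z does.\<close>
      proof (intro exI[of _ "min (d1/2) d2"] conjI ballI impI)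
        show "0 < min (d1/2) d2" using d1 d2 by auto
        fix z assume z: "z \<in> S \<union> \<Gamma>" and dz: "dist z p < min (d1/2) d2"
        show "dist (?f z) (?f p) < e"
        proof (cases "z \<in> \<Gamma>")
          case True
          have "dist (v z) (v p) < e / 2" by (rule d1(2)[OF True]) (use dz d1(1) in linarith)
          then show ?thesis using True \<open>p \<in> \<Gamma>\<close> e by auto
        next
          case False
          then have "z \<in> S" using z by auto
          then obtain y where y: "y \<in> \<Gamma>" "\<forall>x\<in>\<Gamma>. dist z y \<le> dist z x" "cmod (F z - v y) \<le> K * dist z y powr \<beta>"
            using assms(7) by blast
          have zy: "dist z y \<le> dist z p" using y(2) True by blast
          have "dist y p \<le> dist z y + dist z p" by (metis dist_commute dist_triangle)
          then have "dist (v y) (v p) < e / 2" using zy dz by (intro d1(2)[OF y(1)]) linarith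
          moreover have "z \<noteq> y" using False y(1) by auto
          then have "K * dist z y powr \<beta> < e / 2" using zy dz by (intro d2(2)) auto
          then have "dist (F z) (v y) < e / 2" using y(3) by (simp add: dist_norm)
          ultimately have "dist (F z) (v p) < e"
            using dist_triangle[of "F z" "v p" "v y"] by linarith
          then show ?thesis using False True by simp
        qed
      qed
    qed
  qed
qed

text \<open>The one-sided boundary value is built into the function, so that
  \<open>Cplus \<rho> x - Cminus \<rho> x = \<rho> x\<close> holds on \<Gamma> by definition; the
  content of the Plemelj formulas lies in \<open>continuous_on_Cplus\<close> and
  \<open>continuous_on_Cminus\<close>.\<close>

definition Cplus :: "(complex \<Rightarrow> complex) \<Rightarrow> complex \<Rightarrow> complex" where
  "Cplus \<rho> z = (if z \<in> \<Gamma> then Cbd \<rho> z else Cint \<rho> z)"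

definition Cminus :: "(complex \<Rightarrow> complex) \<Rightarrow> complex \<Rightarrow> complex" where
  "Cminus \<rho> z = (if z \<in> \<Gamma> then Cbd \<rho> z - \<rho> z else Cint \<rho> z)"

lemma G_\<Gamma>_disjoint: "G \<inter> \<Gamma> = {}" and D_\<Gamma>_disjoint: "D \<inter> \<Gamma> = {}"
  using G_Un_D by auto

lemma continuous_on_Cplus:
  assumes "hoelder_on \<Gamma> \<rho>"
  shows "continuous_on (G \<union> \<Gamma>) (Cplus \<rho>)"
proof -
  obtain K \<beta> where K: "0 < \<beta>" "0 \<le> K" "\<forall>z. z \<notin> \<Gamma> \<longrightarrow> (\<exists>y\<in>\<Gamma>. (\<forall>x\<in>\<Gamma>. dist z y \<le> dist z x) \<and>
     cmod (Cint \<rho> z - (Cbd \<rho> y + (if z \<in> G then 0 else - \<rho> y))) \<le> K * dist z y powr \<beta>)"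
    by (rule plemelj_estimate[OF assms])
  show ?thesis unfolding Cplus_def[abs_def]
  proof (rule continuous_on_boundary_extension[OF open_G G_\<Gamma>_disjoint _ _ K(1,2)])
    show "continuous_on G (Cint \<rho>)"
      using holomorphic_on_imp_continuous_on[OF holomorphic_Cint[OF bdd_meas_hoelder[OF assms]]]
      by (rule continuous_on_subset) (use G_\<Gamma>_disjoint in auto)
    show "continuous_on \<Gamma> (Cbd \<rho>)" by (intro hoelder_on_imp_continuous_on hoelder_Cbd assms)
    fix z assume "z \<in> G"
    then show "\<exists>y\<in>\<Gamma>. (\<forall>x\<in>\<Gamma>. dist z y \<le> dist z x) \<and> cmod (Cint \<rho> z - Cbd \<rho> y) \<le> K * dist z y powr \<beta>"
      using K(3)[rule_format, of z] G_\<Gamma>_disjoint by (metis add_0_right disjoint_iff)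
  qed
qed

lemma continuous_on_Cminus:
  assumes "hoelder_on \<Gamma> \<rho>"
  shows "continuous_on (D \<union> \<Gamma>) (Cminus \<rho>)"
proof -
  obtain K \<beta> where K: "0 < \<beta>" "0 \<le> K" "\<forall>z. z \<notin> \<Gamma> \<longrightarrow> (\<exists>y\<in>\<Gamma>. (\<forall>x\<in>\<Gamma>. dist z y \<le> dist z x) \<and>
     cmod (Cint \<rho> z - (Cbd \<rho> y + (if z \<in> G then 0 else - \<rho> y))) \<le> K * dist z y powr \<beta>)"
    by (rule plemelj_estimate[OF assms])
  show ?thesis unfolding Cminus_def[abs_def]
  proof (rule continuous_on_boundary_extension[OF open_D D_\<Gamma>_disjoint _ _ K(1,2)])
    show "continuous_on D (Cint \<rho>)"
      using holomorphic_on_imp_continuous_on[OF holomorphic_Cint[OF bdd_meas_hoelder[OF assms]]]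
      by (rule continuous_on_subset) (use D_\<Gamma>_disjoint in auto)
    show "continuous_on \<Gamma> (\<lambda>z. Cbd \<rho> z - \<rho> z)"
      by (intro continuous_intros hoelder_on_imp_continuous_on hoelder_Cbd assms)
    fix z assume "z \<in> D"
    then show "\<exists>y\<in>\<Gamma>. (\<forall>x\<in>\<Gamma>. dist z y \<le> dist z x) \<and> cmod (Cint \<rho> z - (Cbd \<rho> y - \<rho> y)) \<le> K * dist z y powr \<beta>"
      using K(3)[rule_format, of z] G_D_disjoint D_\<Gamma>_disjoint by (metis disjoint_iff add_uminus_conv_diff)
  qed
qed

lemma holomorphic_Cplus: "bdd_meas \<rho> \<Longrightarrow> Cplus \<rho> holomorphic_on G"
  by (rule holomorphic_transform[OF holomorphic_on_subset[OF holomorphic_Cint[of \<rho>]], of G])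
     (use G_\<Gamma>_disjoint in \<open>auto simp: Cplus_def\<close>)

lemma holomorphic_Cminus: "bdd_meas \<rho> \<Longrightarrow> Cminus \<rho> holomorphic_on D"
  by (rule holomorphic_transform[OF holomorphic_on_subset[OF holomorphic_Cint[of \<rho>]], of D])
     (use D_\<Gamma>_disjoint in \<open>auto simp: Cminus_def\<close>)

lemma eventually_not_\<Gamma>: "\<forall>\<^sub>F z in at_infinity. z \<in> G"
proof -
  obtain R where "\<And>x. x \<in> \<Gamma> \<union> D \<Longrightarrow> cmod x \<le> R"
    using bounded_Un[of \<Gamma> D] bounded_\<Gamma> bounded_D unfolding bounded_iff by blast
  then show ?thesis
    unfolding eventually_at_infinity using in_G_or_D
    by (intro exI[of _ "R+1"]) (metis UnCI add_le_same_cancel1 linorder_not_less order_trans zero_less_one)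
qed

lemma Cplus_at_infinity:
  assumes "bdd_meas \<rho>"
  shows "(Cplus \<rho> \<longlongrightarrow> 0) at_infinity"
  by (rule Lim_transform_eventually[OF Cint_at_infinity[OF assms]])
     (rule eventually_mono[OF eventually_not_\<Gamma>], use G_\<Gamma>_disjoint in \<open>auto simp: Cplus_def\<close>)

section \<open>Gluing across the contour and Cauchy's formulas\<close>

definition holo_plus :: "(complex \<Rightarrow> complex) \<Rightarrow> bool" where
  "holo_plus f \<longleftrightarrow> f holomorphic_on G \<and> continuous_on (G \<union> \<Gamma>) f \<and> (f \<longlongrightarrow> 0) at_infinity"

definition holo_minus :: "(complex \<Rightarrow> complex) \<Rightarrow> bool" where
  "holo_minus g \<longleftrightarrow> g holomorphic_on D \<and> continuous_on (D \<union> \<Gamma>) g"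

lemma holo_plus_Cplus: "hoelder_on \<Gamma> \<rho> \<Longrightarrow> holo_plus (Cplus \<rho>)"
  by (simp add: holo_plus_def holomorphic_Cplus continuous_on_Cplus Cplus_at_infinity bdd_meas_hoelder)

lemma holo_minus_Cminus: "hoelder_on \<Gamma> \<rho> \<Longrightarrow> holo_minus (Cminus \<rho>)"
  by (simp add: holo_minus_def holomorphic_Cminus continuous_on_Cminus bdd_meas_hoelder)

text \<open>Together the two functions are continuous on the plane and analytic off \<Gamma>, hence
  entire because \<Gamma> is removable; they vanish at infinity, and Liouville's theorem finishes.
  The Cauchy formulas up to the boundary are instances of this.\<close>

lemma glue:
  assumes "holo_plus f" "holo_minus g" "\<And>x. x \<in> \<Gamma> \<Longrightarrow> f x = g x"
  shows "\<And>z. z \<in> G \<union> \<Gamma> \<Longrightarrow> f z = 0" "\<And>z. z \<in> D \<union> \<Gamma> \<Longrightarrow> g z = 0"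
proof -
  define F where "F z = (if z \<in> G \<union> \<Gamma> then f z else g z)" for z
  have cG: "closed (G \<union> \<Gamma>)" and cD: "closed (D \<union> \<Gamma>)"
  proof -
    have "- (G \<union> \<Gamma>) = D" "- (D \<union> \<Gamma>) = G" using G_Un_D G_D_disjoint by blast+
    then show "closed (G \<union> \<Gamma>)" "closed (D \<union> \<Gamma>)" using open_G open_D by (simp_all add: closed_def)
  qed
  have Fg: "F z = g z" if "z \<in> D \<union> \<Gamma>" for z
    using that assms(3) G_D_disjoint by (auto simp: F_def)
  have "continuous_on ((G \<union> \<Gamma>) \<union> (D \<union> \<Gamma>)) F"
  proof (rule continuous_on_closed_Un[OF cG cD])
    show "continuous_on (G \<union> \<Gamma>) F"
      by (rule continuous_on_cong[THEN iffD1, OF refl, of _ f]) (use assms(1) in \<open>auto simp: F_def holo_plus_def\<close>)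
    show "continuous_on (D \<union> \<Gamma>) F"
      by (rule continuous_on_cong[THEN iffD1, OF refl, of _ g]) (use assms(2) Fg in \<open>auto simp: holo_minus_def\<close>)
  qed
  moreover have "(G \<union> \<Gamma>) \<union> (D \<union> \<Gamma>) = UNIV" using G_Un_D by auto
  ultimately have c: "continuous_on UNIV F" by simp
  have "F holomorphic_on (G \<union> D)"
  proof (rule holomorphic_on_Un[OF _ _ open_G open_D])
    show "F holomorphic_on G"
      by (rule holomorphic_transform[of f]) (use assms(1) in \<open>auto simp: F_def holo_plus_def\<close>)
    show "F holomorphic_on D"
      by (rule holomorphic_transform[of g]) (use assms(2) Fg in \<open>auto simp: holo_minus_def\<close>)
  qed
  then have h: "F holomorphic_on UNIV" using removable[OF c] G_Un_D by simp
  have "(F \<longlongrightarrow> 0) at_infinity"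
    by (rule Lim_transform_eventually[of f]) (use assms(1) eventually_mono[OF eventually_not_\<Gamma>] in \<open>auto simp: F_def holo_plus_def\<close>)
  then have "F z = 0" for z by (rule Liouville_weak_0[OF h])
  then show "\<And>z. z \<in> G \<union> \<Gamma> \<Longrightarrow> f z = 0" "\<And>z. z \<in> D \<union> \<Gamma> \<Longrightarrow> g z = 0"
    using Fg unfolding F_def by (metis)+
qed

text \<open>The functions \<open>f - Cplus f\<close> on \<open>G\<close> and
  \<open>- Cminus f\<close> on \<open>D\<close> agree on \<Gamma> by the jump relation, so gluing
  forces both to be 0.\<close>

lemma Cauchy_plus:
  assumes "holo_plus f" "hoelder_on \<Gamma> f" "z \<in> G"
  shows "Cint f z = f z"
proof -
  have hf: "holo_plus (\<lambda>z. f z - Cplus f z)"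
    using assms(1) holo_plus_Cplus[OF assms(2)] unfolding holo_plus_def
    by (auto intro!: holomorphic_intros continuous_intros tendsto_eq_intros)
  have hg: "holo_minus (\<lambda>z. - Cminus f z)"
    using holo_minus_Cminus[OF assms(2)] unfolding holo_minus_def
    by (auto intro!: holomorphic_intros continuous_intros)
  have "f z - Cplus f z = 0"
    by (rule glue(1)[OF hf hg]) (use assms(3) in \<open>auto simp: Cplus_def Cminus_def\<close>)
  then show ?thesis using assms(3) G_\<Gamma>_disjoint by (auto simp: Cplus_def)
qed

text \<open>Here \<open>Cplus g\<close> and \<open>g + Cminus g\<close> are glued. The second claim
  is Cauchy's theorem: \<open>Cint g\<close> vanishes near infinity, hence so does its leading
  coefficient there.\<close>

lemma Cauchy_minus:
  assumes "holo_minus g" "hoelder_on \<Gamma> g"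
  shows "z \<in> G \<Longrightarrow> Cint g z = 0" "(LINT x|M. g x * \<tau> x) = 0"
proof -
  have hg: "holo_minus (\<lambda>z. g z + Cminus g z)"
    using assms(1) holo_minus_Cminus[OF assms(2)] unfolding holo_minus_def
    by (auto intro!: holomorphic_intros continuous_intros)
  have 0: "Cplus g z = 0" if "z \<in> G" for z
    by (rule glue(1)[OF holo_plus_Cplus[OF assms(2)] hg]) (use that in \<open>auto simp: Cplus_def Cminus_def\<close>)
  then show *: "Cint g z = 0" if "z \<in> G" for z
    using that G_\<Gamma>_disjoint 0[OF that] unfolding Cplus_def by (metis disjoint_iff)
  have "((\<lambda>z. z * Cint g z) \<longlongrightarrow> 0) at_infinity"
    by (rule Lim_transform_eventually[OF tendsto_const])
       (rule eventually_mono[OF eventually_not_\<Gamma>], simp add: *)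
  from tendsto_unique[OF _ this Cint_at_infinity_coeff[OF bdd_meas_hoelder[OF assms(2)]]]
  show "(LINT x|M. g x * \<tau> x) = 0" by (simp add: trivial_limit_at_infinity)
qed

subsection \<open>The generalised Neumann kernel\<close>

text \<open>The Lipschitz condition keeps (a y - a x)/(x - y) bounded, and with it the generalised
  Neumann kernel.\<close>

definition coeff :: "(complex \<Rightarrow> complex) \<Rightarrow> bool" where
  "coeff a \<longleftrightarrow> (\<forall>x\<in>\<Gamma>. a x \<noteq> 0) \<and> (\<exists>L. \<forall>x\<in>\<Gamma>. \<forall>y\<in>\<Gamma>. cmod (a x - a y) \<le> L * cmod (x - y))"

text \<open>The generalised Neumann kernel, with the observation point y first and the integration
  variable x second; for constant \<open>a\<close> it is the classical double layer kernel Im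
  (\<tau> x / (x - y)) / pi.\<close>

definition kern :: "(complex \<Rightarrow> complex) \<Rightarrow> complex \<Rightarrow> complex \<Rightarrow> real" where
  "kern a y x = Im (a y * \<tau> x / (a x * (x - y))) / pi"

definition Nop :: "(complex \<Rightarrow> complex) \<Rightarrow> (complex \<Rightarrow> real) \<Rightarrow> complex \<Rightarrow> real" where
  "Nop a \<mu> y = (LINT x|M. kern a y x * \<mu> x)"

lemma coeff_hoelder: "coeff a \<Longrightarrow> hoelder_on \<Gamma> a"
  unfolding coeff_def using hoelder_on_lipschitz[of \<Gamma> a] unfolding dist_norm by blast

lemma coeff_lower:
  assumes "coeff a"
  obtains c where "0 < c" "\<And>x. x \<in> \<Gamma> \<Longrightarrow> c \<le> cmod (a x)"
proof -
  have "continuous_on \<Gamma> (\<lambda>x. cmod (a x))"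
    by (intro continuous_intros hoelder_on_imp_continuous_on coeff_hoelder assms)
  then obtain p where p: "p \<in> \<Gamma>" "\<forall>x\<in>\<Gamma>. cmod (a p) \<le> cmod (a x)"
    using continuous_attains_inf[OF compact_\<Gamma> \<Gamma>_nonempty] by blast
  show ?thesis using that[of "cmod (a p)"] p assms by (auto simp: coeff_def)
qed

lemma coeff_measurable: "coeff a \<Longrightarrow> a \<in> borel_measurable M"
  by (intro borel_measurable_M hoelder_on_imp_continuous_on coeff_hoelder)

lemma hoelder_on_divide_coeff:
  assumes "coeff a" "hoelder_on \<Gamma> f"
  shows "hoelder_on \<Gamma> (\<lambda>x. f x / a x)"
proof -
  obtain c where "0 < c" "\<And>x. x \<in> \<Gamma> \<Longrightarrow> c \<le> cmod (a x)" using coeff_lower[OF assms(1)] by blast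
  then show ?thesis unfolding divide_inverse
    by (intro hoelder_on_mult[OF compact_\<Gamma> assms(2)] hoelder_on_inverse[OF bounded_\<Gamma> coeff_hoelder[OF assms(1)]])
qed

lemma coeff_\<tau>: "coeff \<tau>"
  unfolding coeff_def using \<tau>_lipschitz \<tau>_nz by blast

text \<open>Makes \<open>\<lambda>x. \<tau> x / a x\<close> admissible, the coefficient of the
  adjoint equation.\<close>

lemma coeff_divide:
  assumes "coeff a" "coeff b"
  shows "coeff (\<lambda>x. b x / a x)"
proof -
  obtain c where c: "0 < c" "\<And>x. x \<in> \<Gamma> \<Longrightarrow> c \<le> cmod (a x)" using coeff_lower[OF assms(1)] by blast
  obtain L1 where L1: "\<And>x y. x \<in> \<Gamma> \<Longrightarrow> y \<in> \<Gamma> \<Longrightarrow> cmod (a x - a y) \<le> L1 * cmod (x - y)" using assms(1) unfolding coeff_def by blast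
  obtain L2 where L2: "\<And>x y. x \<in> \<Gamma> \<Longrightarrow> y \<in> \<Gamma> \<Longrightarrow> cmod (b x - b y) \<le> L2 * cmod (x - y)" using assms(2) unfolding coeff_def by blast
  obtain B where B: "0 < B" "\<And>x. x \<in> \<Gamma> \<Longrightarrow> cmod (b x) \<le> B" using hoelder_on_bounded[OF compact_\<Gamma> coeff_hoelder[OF assms(2)]] by blast
  have "cmod (b x / a x - b y / a y) \<le> (\<bar>L2\<bar> / c + B * \<bar>L1\<bar> / (c * c)) * cmod (x - y)" if "x \<in> \<Gamma>" "y \<in> \<Gamma>" for x y
  proof -
    have nz: "a x \<noteq> 0" "a y \<noteq> 0" using assms(1) that by (auto simp: coeff_def)
    have "b x / a x - b y / a y = (b x - b y) / a x + b y * (a y - a x) / (a x * a y)"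
      using nz by (simp add: divide_simps) (simp add: algebra_simps)
    then have "cmod (b x / a x - b y / a y) \<le> cmod (b x - b y) / cmod (a x) + cmod (b y) * cmod (a y - a x) / (cmod (a x) * cmod (a y))"
      by (metis norm_divide norm_mult norm_triangle_ineq)
    also have "\<dots> \<le> (\<bar>L2\<bar> * cmod (x - y)) / c + B * (\<bar>L1\<bar> * cmod (x - y)) / (c * c)"
    proof (intro add_mono frac_le mult_mono)
      show "cmod (b x - b y) \<le> \<bar>L2\<bar> * cmod (x - y)"
        using L2[OF that] by (smt (verit) mult_right_mono norm_ge_zero)
      show "cmod (a y - a x) \<le> \<bar>L1\<bar> * cmod (x - y)"
        using L1[OF that] by (smt (verit) mult_right_mono norm_ge_zero norm_minus_commute)
    qed (use c B that in auto)
    finally show ?thesis by (simp add: algebra_simps)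
  qed
  then show ?thesis using assms unfolding coeff_def by auto
qed

text \<open>Separates the geometric part, which \<open>kappa_bounded\<close> controls, from the
  difference quotient of \<open>a\<close>.\<close>

lemma kern_split:
  assumes "a x \<noteq> 0"
  shows "pi * kern a y x = Im (\<tau> x / (x - y)) + Im ((a y - a x) / (x - y) * (\<tau> x / a x))"
proof (cases "x = y")
  case False
  have "a y * \<tau> x / (a x * (x - y)) = \<tau> x / (x - y) + (a y - a x) / (x - y) * (\<tau> x / a x)"
    using assms False by (simp add: divide_simps) (simp add: algebra_simps)
  then have "Im (a y * \<tau> x / (a x * (x - y))) = Im (\<tau> x / (x - y)) + Im ((a y - a x) / (x - y) * (\<tau> x / a x))"
    by (metis plus_complex.sel(2))
  then show ?thesis by (simp add: kern_def)
qed (simp add: kern_def)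

lemma kern_bounded:
  assumes "coeff a"
  obtains C where "0 < C" "\<And>x y. x \<in> \<Gamma> \<Longrightarrow> y \<in> \<Gamma> \<Longrightarrow> \<bar>kern a y x\<bar> \<le> C"
proof -
  obtain c where c: "0 < c" "\<And>x. x \<in> \<Gamma> \<Longrightarrow> c \<le> cmod (a x)" using coeff_lower[OF assms(1)] by blast
  obtain L where L: "\<And>x y. x \<in> \<Gamma> \<Longrightarrow> y \<in> \<Gamma> \<Longrightarrow> cmod (a x - a y) \<le> L * cmod (x - y)" using assms(1) unfolding coeff_def by blast
  obtain T where T: "0 < T" "\<And>x. x \<in> \<Gamma> \<Longrightarrow> cmod (\<tau> x) \<le> T" using \<tau>_bound by blast
  obtain Ck where Ck: "\<And>x y. x \<in> \<Gamma> \<Longrightarrow> y \<in> \<Gamma> \<Longrightarrow> \<bar>Im (\<tau> x / (x - y))\<bar> \<le> Ck" using kappa_bounded by blast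
  have "\<bar>kern a y x\<bar> \<le> \<bar>Ck\<bar> + \<bar>L\<bar> * (T / c)" if xy: "x \<in> \<Gamma>" "y \<in> \<Gamma>" for x y
  proof -
    have q: "cmod ((a y - a x) / (x - y)) \<le> \<bar>L\<bar>"
    proof (cases "x = y")
      case False
      have "cmod (a y - a x) \<le> \<bar>L\<bar> * cmod (x - y)"
        using L[OF xy] by (smt (verit) mult_right_mono norm_ge_zero norm_minus_commute)
      then show ?thesis using False by (simp add: norm_divide divide_le_eq)
    qed simp
    have "\<bar>Im ((a y - a x) / (x - y) * (\<tau> x / a x))\<bar> \<le> cmod ((a y - a x) / (x - y)) * cmod (\<tau> x / a x)"
      by (metis abs_Im_le_cmod norm_mult)
    also have "\<dots> \<le> \<bar>L\<bar> * (T / c)"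
      using q T c xy by (intro mult_mono) (auto simp: norm_divide intro!: frac_le)
    finally have "\<bar>pi * kern a y x\<bar> \<le> \<bar>Ck\<bar> + \<bar>L\<bar> * (T / c)"
      using Ck[OF xy] assms xy kern_split[of a x y] by (auto simp: coeff_def)
    moreover have "\<bar>kern a y x\<bar> \<le> \<bar>pi * kern a y x\<bar>"
      using pi_ge_two by (auto simp: abs_mult intro!: mult_right_mono[of 1 pi "\<bar>kern a y x\<bar>", simplified])
    ultimately show ?thesis by linarith
  qed
  moreover have "0 \<le> \<bar>L\<bar> * (T / c)" using T c by auto
  ultimately show ?thesis using that[of "\<bar>Ck\<bar> + \<bar>L\<bar> * (T / c) + 1"] by force
qed

lemma kern_measurable2:
  assumes "coeff a"
  shows "(\<lambda>z. kern a (fst z) (snd z)) \<in> borel_measurable (M \<Otimes>\<^sub>M M)"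
proof -
  have [measurable]: "a \<in> borel_measurable M" by (rule coeff_measurable[OF assms])
  show ?thesis unfolding kern_def by measurable
qed

lemma kern_measurable [measurable (raw)]:
  assumes "coeff a"
  shows "(\<lambda>x. kern a y x) \<in> borel_measurable M" "(\<lambda>y. kern a y x) \<in> borel_measurable M"
proof -
  have [measurable]: "a \<in> borel_measurable M" by (rule coeff_measurable[OF assms])
  show "(\<lambda>x. kern a y x) \<in> borel_measurable M" "(\<lambda>y. kern a y x) \<in> borel_measurable M"
    unfolding kern_def by measurable
qed

text \<open>Together with \<open>one_le_ratio_root\<close> this lets near and far points be
  estimated by the same expression (d/A)^(1/2), whose weight A^(-1/2) is integrable.\<close>

lemma ratio_le_root:
  fixes d A :: real
  assumes "0 \<le> d" "d \<le> A" "0 < A"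
  shows "d / A \<le> d powr (1/2) * A powr (-1/2)"
proof (cases "d = 0")
  case False
  then have "(d / A) powr 1 \<le> (d / A) powr (1/2)" using assms by (intro powr_mono') auto
  also have "\<dots> = d powr (1/2) * A powr (-1/2)"
    unfolding powr_divide using assms by (simp add: powr_minus_divide)
  finally show ?thesis using assms by simp
qed simp

lemma one_le_ratio_root:
  fixes d A :: real
  assumes "A \<le> d" "0 < A"
  shows "1 \<le> d powr (1/2) * A powr (-1/2)"
proof -
  have "A powr (1/2) * A powr (-1/2) \<le> d powr (1/2) * A powr (-1/2)"
    using assms by (intro mult_right_mono powr_mono2) auto
  moreover have "A powr (1/2) * A powr (-1/2) = 1" unfolding powr_add[symmetric] using assms by simp
  ultimately show ?thesis by simp
qed

lemma abs_Im_mult_le: "\<bar>Im (p * q)\<bar> \<le> \<bar>Im p\<bar> * cmod q + cmod p * \<bar>Im q\<bar>"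
proof -
  have "\<bar>Im (p * q)\<bar> \<le> \<bar>Re p\<bar> * \<bar>Im q\<bar> + \<bar>Im p\<bar> * \<bar>Re q\<bar>"
    by (simp flip: abs_mult) 
  also have "\<dots> \<le> cmod p * \<bar>Im q\<bar> + \<bar>Im p\<bar> * cmod q"
    using abs_Re_le_cmod by (intro add_mono mult_left_mono mult_right_mono) auto
  finally show ?thesis by simp
qed

text \<open>The tangents at x and y1 and the chords through y1 are almost parallel, so the
  imaginary part of the second order pole cancels.\<close>
lemma kappa_diff:
  obtains K where "0 < K" "\<And>x y1 y2. \<lbrakk>x \<in> \<Gamma>; y1 \<in> \<Gamma>; y2 \<in> \<Gamma>; cmod (y1 - y2) < cmod (x - y1); cmod (y1 - y2) < cmod (x - y2)\<rbrakk>
     \<Longrightarrow> \<bar>Im (\<tau> x / (x - y1)) - Im (\<tau> x / (x - y2))\<bar>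
        \<le> K * (cmod (y1 - y2) / cmod (x - y1) + cmod (y1 - y2) / cmod (x - y2))"
proof -
  obtain T where T: "0 < T" "\<And>x. x \<in> \<Gamma> \<Longrightarrow> cmod (\<tau> x) \<le> T" using \<tau>_bound by blast
  obtain t where t: "0 < t" "\<And>x. x \<in> \<Gamma> \<Longrightarrow> t \<le> cmod (\<tau> x)" using coeff_lower[OF coeff_\<tau>] by blast
  obtain Ck0 where Ck0: "\<And>x y. x \<in> \<Gamma> \<Longrightarrow> y \<in> \<Gamma> \<Longrightarrow> \<bar>Im (\<tau> x / (x - y))\<bar> \<le> Ck0" using kappa_bounded by blast
  define Ck where "Ck = \<bar>Ck0\<bar>"
  have Ck: "0 \<le> Ck" "\<And>x y. x \<in> \<Gamma> \<Longrightarrow> y \<in> \<Gamma> \<Longrightarrow> \<bar>Im (\<tau> x / (x - y))\<bar> \<le> Ck"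
    using Ck0 by (auto simp: Ck_def intro: order_trans[OF _ abs_ge_self])
  define K1 where "K1 = Ck * T / t^2 + Ck / t"
  have K1: "0 \<le> K1" using Ck T t by (auto simp: K1_def)
  have "\<bar>Im (\<tau> x / (x - y1)) - Im (\<tau> x / (x - y2))\<bar>
        \<le> (Ck + T * K1 + 1) * (cmod (y1 - y2) / cmod (x - y1) + cmod (y1 - y2) / cmod (x - y2))"
    if x: "x \<in> \<Gamma>" and y: "y1 \<in> \<Gamma>" "y2 \<in> \<Gamma>" and d: "cmod (y1 - y2) < cmod (x - y1)" "cmod (y1 - y2) < cmod (x - y2)" for x y1 y2
  proof (cases "y1 = y2")
    case False
    define A B d where "A = cmod (x - y1)" and "B = cmod (x - y2)" and "d = cmod (y1 - y2)"
    have pos: "0 < d" "d < A" "d < B" using False that by (auto simp: A_def B_def d_def)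
    then have nz: "x - y1 \<noteq> 0" "x - y2 \<noteq> 0" "y1 - y2 \<noteq> 0" by (auto simp: A_def B_def d_def)
    \<comment> \<open>The difference of the kernels is P * Q with \<open>Im P\<close> bounded; it
      remains to see that \<open>Im Q\<close> is of order d, although Q itself is only of order
      d/A.\<close>
    define P Q where "P = \<tau> x / (x - y2)" and "Q = (y1 - y2) / (x - y1)"
    \<comment> \<open>Inserting the tangent at y1 writes Q as chord over tangent times tangent over
      chord, and \<open>kappa_bounded\<close> controls the imaginary part of each factor.\<close>
    define q1 q2 where "q1 = (y1 - y2) / \<tau> y1" and "q2 = \<tau> y1 / (x - y1)"
    have "\<tau> x / (x - y1) - \<tau> x / (x - y2) = P * Q"
      using nz by (simp add: P_def Q_def divide_simps) (simp add: algebra_simps)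
    then have eq: "Im (\<tau> x / (x - y1)) - Im (\<tau> x / (x - y2)) = Im (P * Q)" by (metis minus_complex.sel(2))
    have "Q = q1 * q2" using \<tau>_nz[OF y(1)] by (simp add: Q_def q1_def q2_def)
    then have "\<bar>Im Q\<bar> \<le> \<bar>Im q1\<bar> * cmod q2 + cmod q1 * \<bar>Im q2\<bar>" using abs_Im_mult_le by simp
    also have "\<dots> \<le> (Ck * d^2 / t^2) * (T / A) + (d / t) * Ck"
    proof (intro add_mono mult_mono)
      define w where "w = \<tau> y1 / (y1 - y2)"
      have w: "q1 = inverse w" by (simp add: q1_def w_def)
      have wl: "t / d \<le> cmod w" unfolding w_def norm_divide d_def[symmetric]
        using t y pos by (intro divide_right_mono) auto
      then have wp: "0 < cmod w" using t pos by (smt (verit) divide_pos_pos)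
      have "\<bar>Im q1\<bar> = \<bar>Im w\<bar> / (cmod w)^2" by (simp add: w cmod_power2)
      also have "\<dots> \<le> Ck / (t / d)^2"
        using Ck wl t pos y unfolding w_def[symmetric] by (intro frac_le power_mono) (auto simp: w_def)
      finally show "\<bar>Im q1\<bar> \<le> Ck * d^2 / t^2" by (simp add: power_divide)
      show "cmod q2 \<le> T / A" unfolding q2_def norm_divide A_def using T y by (intro divide_right_mono) auto
      show "cmod q1 \<le> d / t" unfolding q1_def norm_divide d_def using t y by (intro frac_le) auto
      have "\<tau> y1 / (y1 - x) = - q2" unfolding q2_def by (metis minus_diff_eq divide_minus_right)
      then have "\<bar>Im q2\<bar> = \<bar>Im (\<tau> y1 / (y1 - x))\<bar>" by simp
      then show "\<bar>Im q2\<bar> \<le> Ck" using Ck(2)[OF y(1) x] by simp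
    qed (use T Ck t pos in auto)
    also have "\<dots> = d * (Ck * T / t^2 * (d / A) + Ck / t)"
      by (simp add: algebra_simps power2_eq_square)
    also have "\<dots> \<le> d * (Ck * T / t^2 * 1 + Ck / t)"
      using pos Ck T t by (intro mult_left_mono add_right_mono) auto
    finally have ImQ: "\<bar>Im Q\<bar> \<le> d * K1" by (simp add: K1_def)
    have "\<bar>Im (P * Q)\<bar> \<le> \<bar>Im P\<bar> * cmod Q + cmod P * \<bar>Im Q\<bar>" by (rule abs_Im_mult_le)
    also have "\<dots> \<le> Ck * (d / A) + (T / B) * (d * K1)"
    proof (intro add_mono mult_mono)
      show "\<bar>Im P\<bar> \<le> Ck" using Ck(2)[OF x y(2)] by (simp add: P_def)
      show "cmod Q \<le> d / A" by (simp add: Q_def norm_divide d_def A_def)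
      show "cmod P \<le> T / B" unfolding P_def norm_divide B_def using T x by (intro divide_right_mono) auto
      show "\<bar>Im Q\<bar> \<le> d * K1" by (rule ImQ)
    qed (use Ck T pos in auto)
    also have "\<dots> = Ck * (d / A) + (T * K1) * (d / B)" by simp
    also have "\<dots> \<le> (Ck + T * K1 + 1) * (d / A) + (Ck + T * K1 + 1) * (d / B)"
      using Ck T K1 pos by (intro add_mono mult_right_mono) auto
    finally show ?thesis unfolding eq by (simp add: A_def B_def d_def distrib_left)
  qed simp
  moreover have "0 < Ck + T * K1 + 1" using Ck T K1 by (smt (verit) mult_nonneg_nonneg)
  ultimately show ?thesis using that by blast
qed

text \<open>Continuity of order 1/2 in y with an integrable weight in x, which is enough for
  \<open>Nop\<close> to smooth. Near points use only that the kernel is bounded, far points use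
  \<open>kappa_diff\<close> and the Lipschitz bound for \<open>a\<close>.\<close>

lemma kern_diff:
  assumes "coeff a"
  obtains C where "0 < C" "\<And>x y1 y2. \<lbrakk>x \<in> \<Gamma>; y1 \<in> \<Gamma>; y2 \<in> \<Gamma>\<rbrakk> \<Longrightarrow>
     \<bar>kern a y1 x - kern a y2 x\<bar> \<le> C * cmod (y1 - y2) powr (1/2) * (cmod (x - y1) powr (-1/2) + cmod (x - y2) powr (-1/2))"
proof -
  obtain C0 where C0: "0 < C0" "\<And>x y. x \<in> \<Gamma> \<Longrightarrow> y \<in> \<Gamma> \<Longrightarrow> \<bar>kern a y x\<bar> \<le> C0" using kern_bounded[OF assms] by blast
  obtain K where K: "0 < K" "\<And>x y1 y2. \<lbrakk>x \<in> \<Gamma>; y1 \<in> \<Gamma>; y2 \<in> \<Gamma>; cmod (y1 - y2) < cmod (x - y1); cmod (y1 - y2) < cmod (x - y2)\<rbrakk>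
     \<Longrightarrow> \<bar>Im (\<tau> x / (x - y1)) - Im (\<tau> x / (x - y2))\<bar>
        \<le> K * (cmod (y1 - y2) / cmod (x - y1) + cmod (y1 - y2) / cmod (x - y2))"
    using kappa_diff by metis
  obtain c where c: "0 < c" "\<And>x. x \<in> \<Gamma> \<Longrightarrow> c \<le> cmod (a x)" using coeff_lower[OF assms(1)] by blast
  obtain L0 where L0: "\<And>x y. x \<in> \<Gamma> \<Longrightarrow> y \<in> \<Gamma> \<Longrightarrow> cmod (a x - a y) \<le> L0 * cmod (x - y)" using assms(1) unfolding coeff_def by blast
  define L where "L = \<bar>L0\<bar>"
  have L: "0 \<le> L" "\<And>x y. x \<in> \<Gamma> \<Longrightarrow> y \<in> \<Gamma> \<Longrightarrow> cmod (a x - a y) \<le> L * cmod (x - y)"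
    using order_trans[OF L0 mult_right_mono[OF abs_ge_self norm_ge_zero]] by (auto simp: L_def)
  obtain T where T: "0 < T" "\<And>x. x \<in> \<Gamma> \<Longrightarrow> cmod (\<tau> x) \<le> T" using \<tau>_bound by blast
  define C where "C = 2 * C0 + K + 2 * L * (T / c)"
  have Cpos: "0 < C" using C0 K L T c by (auto simp: C_def intro!: add_pos_nonneg)
  have "\<bar>kern a y1 x - kern a y2 x\<bar> \<le> C * (cmod (y1 - y2) powr (1/2) * cmod (x - y1) powr (-1/2) + cmod (y1 - y2) powr (1/2) * cmod (x - y2) powr (-1/2))"
    if x: "x \<in> \<Gamma>" and y: "y1 \<in> \<Gamma>" "y2 \<in> \<Gamma>" for x y1 y2
  proof -
    define A B d where "A = cmod (x - y1)" and "B = cmod (x - y2)" and "d = cmod (y1 - y2)"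
    define s where "s = d powr (1/2) * A powr (-1/2) + d powr (1/2) * B powr (-1/2)"
    have s0: "0 \<le> s" by (simp add: s_def)
    have nn: "0 \<le> A" "0 \<le> B" "0 \<le> d" by (auto simp: A_def B_def d_def)
    have triv: "\<bar>kern a y1 x - kern a y2 x\<bar> \<le> 2 * C0" using C0(2)[OF x y(1)] C0(2)[OF x y(2)] by linarith
    have big: ?thesis if "1 \<le> s"
    proof -
      have "2 * C0 \<le> C * s"
      proof -
        have "2 * C0 * 1 \<le> C * s" using that C0 K L T c by (intro mult_mono) (auto simp: C_def)
        then show ?thesis by simp
      qed
      then show ?thesis using triv by (simp add: s_def A_def B_def d_def)
    qed
    consider "y1 = y2" | "d \<noteq> 0" "A \<le> d \<or> B \<le> d" | "d < A" "d < B" "d \<noteq> 0"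
      using not_less[of d A] not_less[of d B] by (auto simp: d_def)
    then show ?thesis
    proof cases
      case 1
      then show ?thesis by simp
    next
      case 2
      have "1 \<le> s"
      \<comment> \<open>Since \<open>0 powr _\<close> is 0, the bound 1 must come from the other
        summand if x coincides with y1 or y2; there the ratio is exactly 1.\<close>
      proof (cases "A = 0 \<or> B = 0")
        case True
        then have "B = d \<and> A = 0 \<or> A = d \<and> B = 0" by (auto simp: A_def B_def d_def norm_minus_commute)
        moreover have "d powr (1/2) * d powr (-1/2) = 1" unfolding powr_add[symmetric] using 2 by simp
        ultimately show ?thesis by (auto simp: s_def)
      next
        case False
        have "0 \<le> d powr (1/2) * A powr (-1/2)" "0 \<le> d powr (1/2) * B powr (-1/2)" by auto
        moreover have "1 \<le> d powr (1/2) * A powr (-1/2) \<or> 1 \<le> d powr (1/2) * B powr (-1/2)"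
          using 2 False nn one_le_ratio_root[of A d] one_le_ratio_root[of B d] by linarith
        ultimately show ?thesis unfolding s_def by linarith
      qed
      then show ?thesis by (rule big)
    next
      case 3
      have pos: "0 < A" "0 < B" using 3 nn by auto
      then have nz: "x - y1 \<noteq> 0" "x - y2 \<noteq> 0" by (auto simp: A_def B_def)
      have ratio: "d / A + d / B \<le> s" unfolding s_def using 3 nn pos by (intro add_mono ratio_le_root) auto
      have k1: "\<bar>Im (\<tau> x / (x - y1)) - Im (\<tau> x / (x - y2))\<bar> \<le> K * (d / A + d / B)"
        using K(2)[OF x y] 3 by (simp add: A_def B_def d_def)
      define E where "E y = (a y - a x) / (x - y)" for y
      have "E y1 - E y2 = (a y1 - a y2) / (x - y2) + (a y1 - a x) / (x - y1) * ((y1 - y2) / (x - y2))"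
        unfolding E_def using nz by (simp add: divide_simps) (simp add: algebra_simps)
      then have "cmod (E y1 - E y2) \<le> cmod (a y1 - a y2) / cmod (x - y2) + cmod (a y1 - a x) / cmod (x - y1) * (cmod (y1 - y2) / cmod (x - y2))"
        by (metis norm_divide norm_mult norm_triangle_ineq)
      also have "\<dots> \<le> (L * d) / B + L * (d / B)"
      proof (rule add_mono)
        show "cmod (a y1 - a y2) / cmod (x - y2) \<le> L * d / B"
          unfolding B_def d_def using L(2)[OF y] by (intro divide_right_mono) auto
        show "cmod (a y1 - a x) / cmod (x - y1) * (cmod (y1 - y2) / cmod (x - y2)) \<le> L * (d / B)"
          unfolding B_def d_def
          by (intro mult_right_mono) (use L(2)[OF y(1) x] pos in \<open>simp_all add: divide_le_eq A_def norm_minus_commute\<close>)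
      qed
      also have "\<dots> \<le> 2 * L * (d / A + d / B)" using L pos nn by (simp add: algebra_simps)
      finally have E: "cmod (E y1 - E y2) \<le> 2 * L * (d / A + d / B)" .
      have ax: "a x \<noteq> 0" using assms x by (auto simp: coeff_def)
      have "pi * kern a y1 x - pi * kern a y2 x =
         (Im (\<tau> x / (x - y1)) - Im (\<tau> x / (x - y2))) + Im ((E y1 - E y2) * (\<tau> x / a x))"
        unfolding kern_split[of a, OF ax] E_def by (simp only: left_diff_distrib minus_complex.sel)
      also have "\<bar>\<dots>\<bar> \<le> K * (d / A + d / B) + 2 * L * (d / A + d / B) * (T / c)"
      proof -
        have "\<bar>Im ((E y1 - E y2) * (\<tau> x / a x))\<bar> \<le> cmod (E y1 - E y2) * cmod (\<tau> x / a x)"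
          by (metis abs_Im_le_cmod norm_mult)
        also have "\<dots> \<le> 2 * L * (d / A + d / B) * (T / c)"
          using E T c x L pos nn by (intro mult_mono) (auto simp: norm_divide intro!: frac_le)
        finally show ?thesis using k1 by linarith
      qed
      also have "\<dots> = (K + 2 * L * (T / c)) * (d / A + d / B)"
        by (simp only: distrib_right distrib_left mult.assoc mult.left_commute mult.commute add.assoc)
      also have "\<dots> \<le> C * s"
        using ratio C0 K L T c nn pos by (intro mult_mono) (auto simp: C_def)
      finally have "\<bar>pi * kern a y1 x - pi * kern a y2 x\<bar> \<le> C * s" .
      moreover have "\<bar>kern a y1 x - kern a y2 x\<bar> \<le> \<bar>pi * kern a y1 x - pi * kern a y2 x\<bar>"
      proof -
        have "1 * \<bar>kern a y1 x - kern a y2 x\<bar> \<le> pi * \<bar>kern a y1 x - kern a y2 x\<bar>"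
          using pi_ge_two by (intro mult_right_mono) auto
        then show ?thesis by (simp add: abs_mult flip: right_diff_distrib)
      qed
      ultimately show ?thesis by (simp add: s_def A_def B_def d_def)
    qed
  qed
  then show ?thesis using that[OF Cpos] by (simp add: distrib_left mult.assoc)
qed

lemma kern_integrable:
  fixes \<mu> :: "complex \<Rightarrow> real"
  assumes "coeff a" "bdd_meas \<mu>" "y \<in> \<Gamma>"
  shows "integrable M (\<lambda>x. kern a y x * \<mu> x)"
proof -
  obtain C0 where C0: "0 < C0" "\<And>x y. x \<in> \<Gamma> \<Longrightarrow> y \<in> \<Gamma> \<Longrightarrow> \<bar>kern a y x\<bar> \<le> C0" using kern_bounded[OF assms(1)] by blast
  obtain B where B: "0 < B" "\<And>x. x \<in> \<Gamma> \<Longrightarrow> norm (\<mu> x) \<le> B" using bdd_meas_bound[OF assms(2)] by blast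
  have [measurable]: "\<mu> \<in> borel_measurable M" using assms(2) unfolding bdd_meas_def by blast
  have [measurable]: "(\<lambda>x. kern a y x) \<in> borel_measurable M" by (rule kern_measurable[OF assms(1)])
  show ?thesis
  proof (rule integrable_bounded[of _ "C0 * B"])
    fix x assume "x \<in> \<Gamma>"
    then show "norm (kern a y x * \<mu> x) \<le> C0 * B"
      unfolding norm_mult using C0 B assms(3) by (intro mult_mono) auto
  qed measurable
qed

text \<open>The smoothing property: continuous solutions of the integral equations become Hoelder
  continuous, as the Plemelj formulas require.\<close>

lemma hoelder_Nop:
  assumes "coeff a" "bdd_meas \<mu>"
  shows "hoelder_on \<Gamma> (Nop a \<mu>)"
proof -
  obtain C where C: "0 < C" "\<And>x y1 y2. \<lbrakk>x \<in> \<Gamma>; y1 \<in> \<Gamma>; y2 \<in> \<Gamma>\<rbrakk> \<Longrightarrow>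
     \<bar>kern a y1 x - kern a y2 x\<bar> \<le> C * cmod (y1 - y2) powr (1/2) * (cmod (x - y1) powr (-1/2) + cmod (x - y2) powr (-1/2))"
    using kern_diff[OF assms(1)] by metis
  obtain B where B: "0 < B" "\<And>x. x \<in> \<Gamma> \<Longrightarrow> norm (\<mu> x) \<le> B" using bdd_meas_bound[OF assms(2)] by blast
  have [measurable]: "\<mu> \<in> borel_measurable M" using assms(2) unfolding bdd_meas_def by blast
  have [measurable]: "(\<lambda>x. kern a y x) \<in> borel_measurable M" for y by (rule kern_measurable[OF assms(1)])
  obtain K where K: "\<And>y. y \<in> \<Gamma> \<Longrightarrow> integrable M (\<lambda>x. cmod (x - y) powr (-1/2))" "\<And>y. y \<in> \<Gamma> \<Longrightarrow> (LINT x|M. cmod (x - y) powr (-1/2)) \<le> K"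
    using growth[of "1/2"] by auto
  show ?thesis
  proof (rule hoelder_onI[of "1/2" _ _ "C * B * (2 * K)"])
    fix y1 y2 assume y: "y1 \<in> \<Gamma>" "y2 \<in> \<Gamma>"
    let ?c = "C * B * cmod (y1 - y2) powr (1/2)"
    have "norm (LINT x|M. kern a y1 x * \<mu> x - kern a y2 x * \<mu> x) \<le> (LINT x|M. ?c * (cmod (x - y1) powr (-1/2) + cmod (x - y2) powr (-1/2)))"
    proof (rule norm_singular_integral_le)
      show "integrable M (\<lambda>x. ?c * (cmod (x - y1) powr (-1/2) + cmod (x - y2) powr (-1/2)))"
        using K(1) y by (intro integrable_mult_right Bochner_Integration.integrable_add) auto
      fix x assume x: "x \<in> \<Gamma>"
      have "norm (kern a y1 x * \<mu> x - kern a y2 x * \<mu> x) = \<bar>kern a y1 x - kern a y2 x\<bar> * norm (\<mu> x)"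
        by (simp add: abs_mult flip: left_diff_distrib)
      also have "\<dots> \<le> (C * cmod (y1 - y2) powr (1/2) * (cmod (x - y1) powr (-1/2) + cmod (x - y2) powr (-1/2))) * B"
        using C B x y by (intro mult_mono) auto
      finally show "norm (kern a y1 x * \<mu> x - kern a y2 x * \<mu> x) \<le> ?c * (cmod (x - y1) powr (-1/2) + cmod (x - y2) powr (-1/2))"
        by (simp add: ac_simps)
    qed measurable
    also have "\<dots> = ?c * ((LINT x|M. cmod (x - y1) powr (-1/2)) + (LINT x|M. cmod (x - y2) powr (-1/2)))"
      using K(1)[OF y(1)] K(1)[OF y(2)] by (simp only: integral_mult_right_zero Bochner_Integration.integral_add)
    also have "\<dots> \<le> ?c * (K + K)" using K(2) y C B by (intro mult_left_mono add_mono) auto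
    finally show "norm (Nop a \<mu> y1 - Nop a \<mu> y2) \<le> C * B * (2 * K) * dist y1 y2 powr (1/2)"
      using kern_integrable[OF assms] y by (simp add: Nop_def dist_norm ac_simps)
  qed auto
qed

text \<open>Turns a condition on boundary values into an integral equation. The constant subtracted
  in \<open>Cbd\<close> contributes \<open>- \<mu> y\<close> times the integral of Im (\<tau> x / (x
  - y)), which is -pi by \<open>kappa_integral\<close>; hence the term
  \<open>\<mu> y / 2\<close>.\<close>

lemma Re_Cbd:
  fixes \<mu> :: "complex \<Rightarrow> real"
  assumes "coeff a" "hoelder_on \<Gamma> \<mu>" "y \<in> \<Gamma>"
  shows "Re (a y * Cbd (\<lambda>x. of_real (\<mu> x) / a x) y) = (Nop a \<mu> y + \<mu> y) / 2"
proof -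
  let ?\<rho> = "\<lambda>x. of_real (\<mu> x) / a x"
  have h: "hoelder_on \<Gamma> ?\<rho>" by (intro hoelder_on_divide_coeff assms) (simp add: hoelder_on_of_real_iff assms)
  have bm: "bdd_meas \<mu>" by (intro bdd_meas_hoelder assms)
  have ay: "a y \<noteq> 0" using assms by (auto simp: coeff_def)
  have i: "integrable M (\<lambda>x. a y * ((?\<rho> x - ?\<rho> y) * \<tau> x / (x - y)))"
    using singular_integrable[OF h assms(3)] by (rule integrable_mult_right)
  obtain Ck where Ck: "\<And>x y. x \<in> \<Gamma> \<Longrightarrow> y \<in> \<Gamma> \<Longrightarrow> \<bar>Im (\<tau> x / (x - y))\<bar> \<le> Ck" using kappa_bounded by blast
  have ik: "integrable M (\<lambda>x. Im (\<tau> x / (x - y)))"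
    using Ck assms(3) by (intro integrable_bounded[of _ Ck]) auto
  have "a y * Cbd ?\<rho> y = (LINT x|M. a y * ((?\<rho> x - ?\<rho> y) * \<tau> x / (x - y))) / (2 * of_real pi * \<i>)"
    unfolding Cbd_def integral_mult_right_zero by (rule times_divide_eq_right)
  then have "Re (a y * Cbd ?\<rho> y) = Im (LINT x|M. a y * ((?\<rho> x - ?\<rho> y) * \<tau> x / (x - y))) / (2 * pi)"
    by (simp add: Re_divide cmod_power2 power2_eq_square complex_eq_iff)
  also have "Im (LINT x|M. a y * ((?\<rho> x - ?\<rho> y) * \<tau> x / (x - y))) = (LINT x|M. Im (a y * ((?\<rho> x - ?\<rho> y) * \<tau> x / (x - y))))"
    using integral_Im[OF i] by simp
  also have "\<dots> = (LINT x|M. pi * (kern a y x * \<mu> x) - \<mu> y * Im (\<tau> x / (x - y)))"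
  proof (rule Bochner_Integration.integral_cong[OF refl])
    fix x assume "x \<in> space M"
    then have ax: "a x \<noteq> 0" using assms space_M by (auto simp: coeff_def)
    have "a y * ((?\<rho> x - ?\<rho> y) * \<tau> x / (x - y)) = of_real (\<mu> x) * (a y * \<tau> x / (a x * (x - y))) - of_real (\<mu> y) * (\<tau> x / (x - y))"
      using ax ay by (cases "x = y") (auto simp: divide_simps, simp add: algebra_simps)
    moreover have "Im (of_real r * w) = r * Im w" for r w by simp
    ultimately show "Im (a y * ((?\<rho> x - ?\<rho> y) * \<tau> x / (x - y))) = pi * (kern a y x * \<mu> x) - \<mu> y * Im (\<tau> x / (x - y))"
      by (simp only: minus_complex.sel) (simp add: kern_def)
  qed
  also have "\<dots> = pi * Nop a \<mu> y - \<mu> y * (- pi)"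
    using kern_integrable[OF assms(1) bm assms(3)] ik
    by (simp only: Bochner_Integration.integral_diff integrable_mult_right integral_mult_right_zero kappa_integral[OF assms(3)] Nop_def)
  also have "(pi * Nop a \<mu> y - \<mu> y * (- pi)) / (2 * pi) = (Nop a \<mu> y + \<mu> y) / 2"
    by (simp add: field_simps)
  finally show ?thesis .
qed

text \<open>The transposed kernel is again, up to sign, a generalised Neumann kernel, so the adjoint
  equation can be read as a boundary value problem of the same kind.\<close>

lemma kern_swap:
  assumes "coeff a" "x \<in> \<Gamma>" "y \<in> \<Gamma>"
  shows "kern a y x = - kern (\<lambda>x. \<tau> x / a x) x y"
proof (cases "x = y")
  case False
  have nz: "a x \<noteq> 0" "a y \<noteq> 0" "\<tau> x \<noteq> 0" "\<tau> y \<noteq> 0" "x - y \<noteq> 0" "y - x \<noteq> 0"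
    using assms \<tau>_nz False by (auto simp: coeff_def)
  have "\<tau> x / a x * \<tau> y / (\<tau> y / a y * (y - x)) = - (a y * \<tau> x / (a x * (x - y)))"
    using nz by (simp add: divide_simps) (simp add: algebra_simps)
  then show ?thesis unfolding kern_def by simp
qed (simp add: kern_def)

end

section \<open>The Fredholm alternative\<close>

text \<open>Vectors are functions on all natural numbers, so that the dimension can stay a variable;
  in the application only the coordinates below \<open>n\<close> occur.\<close>

definition lin_form :: "((nat \<Rightarrow> real) \<Rightarrow> real) \<Rightarrow> bool" where
  "lin_form F \<longleftrightarrow> (\<forall>x y c. F (\<lambda>l. x l + c * y l) = F x + c * F y)"

lemma lin_form_in_span:
  fixes n :: nat
  assumes "\<And>i. i < n \<Longrightarrow> lin_form (L i)" "lin_form F" "\<And>x. (\<And>i. i < n \<Longrightarrow> L i x = 0) \<Longrightarrow> F x = 0"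
  shows "\<exists>e. \<forall>x. F x = (\<Sum>i<n. e i * L i x)"
  using assms
proof (induction n arbitrary: F)
  case (Suc n)
  show ?case
  proof (cases "\<forall>x. (\<forall>i<n. L i x = 0) \<longrightarrow> L n x = 0")
    case True
    then have "\<exists>e. \<forall>x. F x = (\<Sum>i<n. e i * L i x)"
      using Suc.prems by (intro Suc.IH) (auto simp: less_Suc_eq)
    then obtain e where "\<forall>x. F x = (\<Sum>i<n. e i * L i x)" by blast
    then show ?thesis by (intro exI[of _ "e(n := 0)"]) simp
  next
    case False
    then obtain x0 where x0: "\<forall>i<n. L i x0 = 0" "L n x0 \<noteq> 0" by blast
    define q where "q = F x0 / L n x0"
    have "\<exists>e. \<forall>x. F x - q * L n x = (\<Sum>i<n. e i * L i x)"
    proof (rule Suc.IH)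
      show "lin_form (L i)" if "i < n" for i using Suc.prems(1) that by auto
      show "lin_form (\<lambda>x. F x - q * L n x)"
        using Suc.prems(1)[of n] Suc.prems(2) unfolding lin_form_def by (simp add: algebra_simps)
      fix x assume x: "\<And>i. i < n \<Longrightarrow> L i x = 0"
      define c where "c = - (L n x / L n x0)"
      have "F (\<lambda>l. x l + c * x0 l) = 0"
      proof (rule Suc.prems(3))
        fix i assume "i < Suc n"
        then have "L i (\<lambda>l. x l + c * x0 l) = L i x + c * L i x0" using Suc.prems(1)[of i] unfolding lin_form_def by blast
        then show "L i (\<lambda>l. x l + c * x0 l) = 0" using \<open>i < Suc n\<close> x x0 by (auto simp: less_Suc_eq c_def)
      qed
      then have "F x + c * F x0 = 0" using Suc.prems(2) unfolding lin_form_def by metis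
      then show "F x - q * L n x = 0" by (simp add: c_def q_def)
    qed
    then obtain e where e: "\<forall>x. F x - q * L n x = (\<Sum>i<n. e i * L i x)" by blast
    have "F x = (\<Sum>i<Suc n. (e(n := q)) i * L i x)" for x
      using e[rule_format, of x] by simp
    then show ?thesis by blast
  qed
qed auto

text \<open>The finite-dimensional Fredholm alternative without matrices: the obstructions are the
  linear relations \<open>d\<close> among the forms. If \<open>L n\<close> depends on the earlier
  forms, that relation makes \<open>\<beta> n\<close> compatible; otherwise the solution is
  corrected along a vector killed by the earlier forms.\<close>

lemma lin_system_solvable:
  fixes n :: nat
  assumes "\<And>i. i < n \<Longrightarrow> lin_form (L i)"
    "\<And>d. (\<And>x. (\<Sum>i<n. d i * L i x) = 0) \<Longrightarrow> (\<Sum>i<n. d i * \<beta> i) = 0"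
  shows "\<exists>x. \<forall>i<n. L i x = \<beta> i"
  using assms
proof (induction n)
  case (Suc n)
  have "\<exists>x. \<forall>i<n. L i x = \<beta> i"
  proof (rule Suc.IH)
    show "lin_form (L i)" if "i < n" for i using Suc.prems(1) that by auto
    fix d assume d: "\<And>x. (\<Sum>i<n. d i * L i x) = 0"
    have "(\<Sum>i<Suc n. (d(n := 0)) i * \<beta> i) = 0" by (rule Suc.prems(2)) (use d in simp)
    then show "(\<Sum>i<n. d i * \<beta> i) = 0" by simp
  qed
  then obtain x0 where x0: "\<forall>i<n. L i x0 = \<beta> i" by blast
  show ?case
  proof (cases "\<forall>x. (\<forall>i<n. L i x = 0) \<longrightarrow> L n x = 0")
    case True
    have "\<exists>e. \<forall>x. L n x = (\<Sum>i<n. e i * L i x)"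
      by (rule lin_form_in_span) (use Suc.prems(1) True in auto)
    then obtain e where e: "\<forall>x. L n x = (\<Sum>i<n. e i * L i x)" by blast
    have "(\<Sum>i<Suc n. (e(n := -1)) i * \<beta> i) = 0" by (rule Suc.prems(2)) (use e in simp)
    then have "\<beta> n = (\<Sum>i<n. e i * \<beta> i)" by simp
    also have "\<dots> = L n x0" using e x0 by simp
    finally show ?thesis using x0 by (intro exI[of _ x0]) (auto simp: less_Suc_eq)
  next
    case False
    then obtain x1 where x1: "\<forall>i<n. L i x1 = 0" "L n x1 \<noteq> 0" by blast
    define c where "c = (\<beta> n - L n x0) / L n x1"
    have "L i (\<lambda>l. x0 l + c * x1 l) = \<beta> i" if "i < Suc n" for i
    proof -
      have "L i (\<lambda>l. x0 l + c * x1 l) = L i x0 + c * L i x1" using Suc.prems(1)[OF that] unfolding lin_form_def by blast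
      then show ?thesis using that x0 x1 by (auto simp: less_Suc_eq c_def)
    qed
    then show ?thesis by blast
  qed
qed auto

section \<open>Polynomials in two variables as degenerate kernels\<close>

lemma real_polynomial_function_tensor:
  fixes p :: "'a::real_normed_vector \<times> 'b::real_normed_vector \<Rightarrow> real"
  assumes "real_polynomial_function p"
  shows "\<exists>ps. (\<forall>(f, g) \<in> set ps. continuous_on UNIV f \<and> continuous_on UNIV g) \<and>
     (\<forall>x y. p (x, y) = (\<Sum>(f, g)\<leftarrow>ps. f x * g y))"
  using assms
proof induction
  case (linear h)
  then have h: "h (x, y) = h (x, 0) + h (0, y)" for x y
    by (metis add.left_neutral add.right_neutral add_Pair bounded_linear.linear linear_add)
  have "continuous_on UNIV (\<lambda>x. h (x, 0))" "continuous_on UNIV (\<lambda>y. h (0, y))"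
    by (intro bounded_linear.continuous_on[OF linear] continuous_intros)+
  then show ?case
    by (intro exI[of _ "[(\<lambda>x. h (x, 0), \<lambda>y. 1), (\<lambda>x. 1, \<lambda>y. h (0, y))]"]) (auto simp: h[symmetric])
next
  case (const c)
  show ?case by (intro exI[of _ "[(\<lambda>x. c, \<lambda>y. 1)]"]) auto
next
  case (add f g)
  then obtain ps qs where "\<forall>(f, g) \<in> set ps. continuous_on UNIV f \<and> continuous_on UNIV g"
     "\<forall>x y. f (x, y) = (\<Sum>(f, g)\<leftarrow>ps. f x * g y)"
     "\<forall>(f, g) \<in> set qs. continuous_on UNIV f \<and> continuous_on UNIV g"
     "\<forall>x y. g (x, y) = (\<Sum>(f, g)\<leftarrow>qs. f x * g y)" by blast
  then show ?case by (intro exI[of _ "ps @ qs"]) auto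
next
  case (mult f g)
  then obtain ps qs where pq: "\<forall>(f, g) \<in> set ps. continuous_on UNIV f \<and> continuous_on UNIV g"
     "\<forall>x y. f (x, y) = (\<Sum>(f, g)\<leftarrow>ps. f x * g y)"
     "\<forall>(f, g) \<in> set qs. continuous_on UNIV f \<and> continuous_on UNIV g"
     "\<forall>x y. g (x, y) = (\<Sum>(f, g)\<leftarrow>qs. f x * g y)" by blast
  have 1: "(\<Sum>(f, g)\<leftarrow>map (\<lambda>(f2, g2). (\<lambda>x. f1 x * f2 x, \<lambda>y. g1 y * g2 y)) qs. f x * g y)
     = f1 x * g1 y * (\<Sum>(f, g)\<leftarrow>qs. f x * g y)" for f1 x g1 y and qs :: "(('a \<Rightarrow> real) \<times> ('b \<Rightarrow> real)) list"
    by (induction qs) (auto simp: algebra_simps)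
  have 2: "(\<Sum>(f, g)\<leftarrow>concat (map (\<lambda>(f1, g1). map (\<lambda>(f2, g2). (\<lambda>x. f1 x * f2 x, \<lambda>y. g1 y * g2 y)) qs) ps). f x * g y)
     = (\<Sum>(f, g)\<leftarrow>ps. f x * g y) * (\<Sum>(f, g)\<leftarrow>qs. f x * g y)" for x y and ps qs :: "(('a \<Rightarrow> real) \<times> ('b \<Rightarrow> real)) list"
    by (induction ps) (auto simp: 1 algebra_simps simp del: map_map)
  show ?case
    using pq(1,3) by (intro exI[of _ "concat (map (\<lambda>(f1, g1). map (\<lambda>(f2, g2). (\<lambda>x. f1 x * f2 x, \<lambda>y. g1 y * g2 y)) qs) ps)"])
      (auto simp: 2 pq(2,4) simp del: sum_list_mult_const intro!: continuous_intros)
qed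

text \<open>Polynomial kernels have finite rank; with the Stone-Weierstrass theorem this supplies
  finite-rank approximations of continuous kernels.\<close>

lemma real_polynomial_function_degenerate:
  fixes p :: "'a::real_normed_vector \<times> 'b::real_normed_vector \<Rightarrow> real"
  assumes "real_polynomial_function p"
  obtains n :: nat and f g where "\<And>i. i < n \<Longrightarrow> continuous_on UNIV (f i)" "\<And>i. i < n \<Longrightarrow> continuous_on UNIV (g i)"
    "\<And>x y. p (x, y) = (\<Sum>i<n. f i x * g i y)"
proof -
  obtain ps where ps: "\<forall>(f, g) \<in> set ps. continuous_on UNIV f \<and> continuous_on UNIV g"
     "\<forall>x y. p (x, y) = (\<Sum>(f, g)\<leftarrow>ps. f x * g y)"
    using real_polynomial_function_tensor[OF assms] by blast
  show ?thesis
  proof (rule that[of "length ps" "\<lambda>i. fst (ps ! i)" "\<lambda>i. snd (ps ! i)"])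
    show "continuous_on UNIV (fst (ps ! i))" "continuous_on UNIV (snd (ps ! i))" if "i < length ps" for i
      using ps(1) nth_mem[OF that] by (auto simp: case_prod_beta)
    show "p (x, y) = (\<Sum>i<length ps. fst (ps ! i) x * snd (ps ! i) y)" for x y
      using ps(2) by (simp add: sum_list_sum_nth case_prod_beta atLeast0LessThan)
  qed
qed

section \<open>Integral equations of the second kind on the contour\<close>

context contour
begin

lemma integrable_mult_bdd_meas:
  fixes e \<mu> :: "complex \<Rightarrow> real"
  assumes "integrable M e" "bdd_meas \<mu>"
  shows "integrable M (\<lambda>x. e x * \<mu> x)"
proof -
  obtain B where B: "0 < B" "\<And>x. x \<in> \<Gamma> \<Longrightarrow> norm (\<mu> x) \<le> B" using bdd_meas_bound[OF assms(2)] by blast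
  have [measurable]: "\<mu> \<in> borel_measurable M" using assms(2) unfolding bdd_meas_def by blast
  have [measurable]: "e \<in> borel_measurable M" using assms(1) by auto
  show ?thesis
  proof (rule norm_singular_integral_le(1))
    show "integrable M (\<lambda>x. \<bar>e x\<bar> * B)" using assms(1) by (intro integrable_mult_left integrable_abs)
    show "norm (e x * \<mu> x) \<le> \<bar>e x\<bar> * B" if "x \<in> \<Gamma>" for x
      unfolding norm_mult using B(2)[OF that] by (intro mult_mono) auto
  qed measurable
qed

text \<open>The operator has norm at most 1/2 on continuous functions, so its iterates
  \<open>d n\<close> applied to \<open>b\<close> decay like 2^(-n), and their sum solves the
  equation.\<close>

lemma neumann_series:
  fixes e :: "complex \<Rightarrow> complex \<Rightarrow> real" and b :: "complex \<Rightarrow> real"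
  assumes int: "\<And>y. y \<in> \<Gamma> \<Longrightarrow> integrable M (e y)"
    and half: "\<And>y. y \<in> \<Gamma> \<Longrightarrow> (LINT x|M. \<bar>e y x\<bar>) \<le> 1/2"
    and cont: "\<And>\<mu>. continuous_on \<Gamma> \<mu> \<Longrightarrow> continuous_on \<Gamma> (\<lambda>y. LINT x|M. e y x * \<mu> x)"
    and b: "continuous_on \<Gamma> b"
  shows "\<exists>\<mu>. continuous_on \<Gamma> \<mu> \<and> (\<forall>y\<in>\<Gamma>. \<mu> y = b y + (LINT x|M. e y x * \<mu> x))"
proof -
  define E where "E \<mu> y = (LINT x|M. e y x * \<mu> x)" for \<mu> y
  have E_bound: "\<bar>E \<mu> y\<bar> \<le> 1/2 * B" if "\<And>x. x \<in> \<Gamma> \<Longrightarrow> \<bar>\<mu> x\<bar> \<le> B" "continuous_on \<Gamma> \<mu>" "y \<in> \<Gamma>" for \<mu> B y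
  proof -
    have B0: "0 \<le> B" using that(1,3) by (meson abs_ge_zero order_trans)
    have [measurable]: "e y \<in> borel_measurable M" using int[OF that(3)] by auto
    have "norm (LINT x|M. e y x * \<mu> x) \<le> (LINT x|M. \<bar>e y x\<bar> * B)"
    proof (rule norm_singular_integral_le(2))
      show "(\<lambda>x. e y x * \<mu> x) \<in> borel_measurable M" using borel_measurable_M[OF that(2)] by measurable
      show "integrable M (\<lambda>x. \<bar>e y x\<bar> * B)" using int[OF that(3)] by (intro integrable_mult_left integrable_abs)
      show "norm (e y x * \<mu> x) \<le> \<bar>e y x\<bar> * B" if "x \<in> \<Gamma>" for x
        unfolding norm_mult using \<open>\<And>x. x \<in> \<Gamma> \<Longrightarrow> \<bar>\<mu> x\<bar> \<le> B\<close>[OF that] by (intro mult_mono) auto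
    qed
    also have "\<dots> = (LINT x|M. \<bar>e y x\<bar>) * B" by simp
    also have "\<dots> \<le> 1/2 * B" using half[OF that(3)] B0 by (intro mult_right_mono) auto
    finally show ?thesis by (simp add: E_def)
  qed
  define d where "d = rec_nat b (\<lambda>_. E)"
  have d0: "d 0 = b" and dS: "\<And>n. d (Suc n) = E (d n)" by (auto simp: d_def)
  have dc: "continuous_on \<Gamma> (d n)" for n
    by (induction n) (auto simp: d0 dS b E_def[abs_def] cont)
  obtain B where B: "0 < B" "\<And>x. x \<in> \<Gamma> \<Longrightarrow> norm (b x) \<le> B"
    using bdd_meas_bound[OF bdd_meas_continuous_on[OF b]] by blast
  have db: "\<bar>d n y\<bar> \<le> (1/2)^n * B" if "y \<in> \<Gamma>" for n y
    using that
  proof (induction n arbitrary: y)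
    case 0
    then show ?case using B by (simp add: d0)
  next
    case (Suc n)
    show ?case using E_bound[OF Suc.IH dc Suc.prems] by (simp add: dS)
  qed
  have ul: "uniform_limit \<Gamma> (\<lambda>n y. \<Sum>i<n. d i y) (\<lambda>y. suminf (\<lambda>i. d i y)) sequentially"
  proof (rule Weierstrass_m_test)
    show "norm (d n y) \<le> (1/2)^n * B" if "y \<in> \<Gamma>" for n y using db that by simp
    show "summable (\<lambda>n. (1/2::real)^n * B)" by (intro summable_mult2 summable_geometric) auto
  qed
  define \<mu> where "\<mu> = (\<lambda>y. suminf (\<lambda>i. d i y))"
  define S where "S n y = (\<Sum>i<n. d i y)" for n y
  have Sc: "continuous_on \<Gamma> (S n)" for n unfolding S_def[abs_def] by (intro continuous_intros dc)
  have ul: "uniform_limit \<Gamma> S \<mu> sequentially" using ul by (simp add: S_def[abs_def] \<mu>_def)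
  have mc: "continuous_on \<Gamma> \<mu>"
    by (rule uniform_limit_theorem[OF always_eventually ul]) (auto simp: Sc)
  have "\<mu> y = b y + E \<mu> y" if y: "y \<in> \<Gamma>" for y
  proof -
    have ES: "b y + E (S n) y = S (Suc n) y" for n
    proof -
      have "E (S n) y = (LINT x|M. (\<Sum>i<n. e y x * d i x))" by (simp add: E_def S_def sum_distrib_left)
      also have "\<dots> = (\<Sum>i<n. E (d i) y)" unfolding E_def
        by (rule Bochner_Integration.integral_sum) (intro integrable_mult_bdd_meas int y bdd_meas_continuous_on dc)
      finally show ?thesis unfolding S_def sum.lessThan_Suc_shift by (simp add: d0 dS)
    qed
    have "(\<lambda>n. E (S n) y) \<longlonglongrightarrow> E \<mu> y"
    proof (rule LIMSEQ_I)
      fix r :: real assume r: "0 < r"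
      from uniform_limitD[OF ul r] obtain N where N: "\<And>n. n \<ge> N \<Longrightarrow> \<forall>x\<in>\<Gamma>. dist (S n x) (\<mu> x) < r"
        unfolding eventually_sequentially by blast
      have "norm (E (S n) y - E \<mu> y) < r" if "n \<ge> N" for n
      proof -
        have "E (S n) y - E \<mu> y = E (\<lambda>x. S n x - \<mu> x) y"
          unfolding E_def right_diff_distrib
          by (rule Bochner_Integration.integral_diff[symmetric])
             (intro integrable_mult_bdd_meas bdd_meas_continuous_on int y Sc mc)+
        also have "\<bar>\<dots>\<bar> \<le> 1/2 * r"
          by (rule E_bound) (use N[OF that] y Sc mc in \<open>auto simp: dist_real_def less_imp_le intro!: continuous_intros\<close>)
        finally show ?thesis using r by simp
      qed
      then show "\<exists>no. \<forall>n\<ge>no. norm (E (S n) y - E \<mu> y) < r" by blast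
    qed
    then have "(\<lambda>n. b y + E (S n) y) \<longlonglongrightarrow> b y + E \<mu> y" by (intro tendsto_intros)
    moreover have "(\<lambda>n. S (Suc n) y) \<longlonglongrightarrow> \<mu> y"
      using tendsto_uniform_limitI[OF ul y] by (rule LIMSEQ_Suc)
    ultimately show ?thesis unfolding ES using LIMSEQ_unique by blast
  qed
  then show ?thesis using mc unfolding E_def by blast
qed

definition cutoff :: "real \<Rightarrow> real \<Rightarrow> real" where
  "cutoff \<epsilon> r = min 1 (max 0 (r / \<epsilon> - 1))"

text \<open>Smallness is required in both variables because the kernel and its transpose are both
  inverted by a Neumann series. Of the 1/2, one quarter pays for the cutoff near the diagonal and
  one quarter for the polynomial approximation.\<close>

lemma kern_degenerate_approx:
  assumes a: "coeff a"
  obtains n :: nat and f g :: "nat \<Rightarrow> complex \<Rightarrow> real" where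
    "\<forall>i<n. continuous_on UNIV (f i)" "\<forall>i<n. continuous_on UNIV (g i)"
    "\<forall>y\<in>\<Gamma>. (LINT x|M. \<bar>kern a y x - (\<Sum>i<n. f i y * g i x)\<bar>) \<le> 1/2"
    "\<forall>x\<in>\<Gamma>. (LINT y|M. \<bar>kern a y x - (\<Sum>i<n. f i y * g i x)\<bar>) \<le> 1/2"
proof -
  obtain C0 where C0: "0 < C0" "\<And>x y. x \<in> \<Gamma> \<Longrightarrow> y \<in> \<Gamma> \<Longrightarrow> \<bar>kern a y x\<bar> \<le> C0" using kern_bounded[OF a] by blast
  obtain K where K: "\<And>y. y \<in> \<Gamma> \<Longrightarrow> integrable M (\<lambda>x. cmod (x - y) powr (-1/2))" "\<And>y. y \<in> \<Gamma> \<Longrightarrow> (LINT x|M. cmod (x - y) powr (-1/2)) \<le> K"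
    using growth[of "1/2"] by auto
  \<comment> \<open>\<open>s\<close> is the square root of 2\<epsilon>. The cutoff error is at most
    C0 * s * |x - y|^(-1/2), and this choice makes its integral at most 1/4.\<close>
  define s where "s = 1 / (4 * (C0 * \<bar>K\<bar> + 1))"
  define \<epsilon> where "\<epsilon> = s^2 / 2"
  have s: "0 < s" "C0 * s * \<bar>K\<bar> \<le> 1/4"
  proof -
    have p: "0 < C0 * \<bar>K\<bar> + 1" using C0(1) by (simp add: add_nonneg_pos)
    show "0 < s" using p by (simp add: s_def)
    have "C0 * s * \<bar>K\<bar> = (C0 * \<bar>K\<bar>) / (C0 * \<bar>K\<bar> + 1) / 4" by (simp add: s_def)
    also have "\<dots> \<le> 1 / 4" using p by (intro divide_right_mono) auto
    finally show "C0 * s * \<bar>K\<bar> \<le> 1/4" .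
  qed
  have \<epsilon>: "0 < \<epsilon>" "(2 * \<epsilon>) powr (1/2) = s" using s by (simp_all add: \<epsilon>_def powr_half_sqrt)
  define \<delta> where "\<delta> = 1 / (4 * (measure M \<Gamma> + 1))"
  have \<delta>: "0 < \<delta>" "\<delta> * measure M \<Gamma> \<le> 1/4"
  proof -
    have p: "0 < measure M \<Gamma> + 1" using measure_nonneg[of M \<Gamma>] by linarith
    show "0 < \<delta>" using p by (simp add: \<delta>_def)
    have "\<delta> * measure M \<Gamma> = measure M \<Gamma> / (measure M \<Gamma> + 1) / 4" by (simp add: \<delta>_def)
    also have "\<dots> \<le> 1 / 4" using p by (intro divide_right_mono) auto
    finally show "\<delta> * measure M \<Gamma> \<le> 1/4" .
  qed
  \<comment> \<open>Extending by the conjugate of x - y makes the singular denominator |x - y|^2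
    real; \<open>max _ \<epsilon>\<close> keeps it away from 0 and changes nothing, as the cutoff
    vanishes up to \<epsilon>.\<close>
  define kc where "kc z = Im (a (fst z) * \<tau> (snd z) * cnj (snd z - fst z) / a (snd z)) *
      (cutoff \<epsilon> (cmod (snd z - fst z)) / (max (cmod (snd z - fst z)) \<epsilon>)^2) / pi" for z
  have "continuous_on (\<Gamma> \<times> \<Gamma>) kc"
  proof -
    have ca: "continuous_on \<Gamma> a" and ct: "continuous_on \<Gamma> \<tau>"
      by (intro hoelder_on_imp_continuous_on coeff_hoelder a hoelder_\<tau>)+
    have "continuous_on (\<Gamma> \<times> \<Gamma>) (\<lambda>z. a (fst z))" "continuous_on (\<Gamma> \<times> \<Gamma>) (\<lambda>z. a (snd z))" "continuous_on (\<Gamma> \<times> \<Gamma>) (\<lambda>z. \<tau> (snd z))"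
      by (auto intro!: continuous_on_compose2[OF ca] continuous_on_compose2[OF ct] continuous_intros)
    then show ?thesis unfolding kc_def cutoff_def using \<epsilon>(1) a
      by (intro continuous_intros) (auto simp: coeff_def max_def)
  qed
  then obtain p where p: "real_polynomial_function p" "\<And>z. z \<in> \<Gamma> \<times> \<Gamma> \<Longrightarrow> \<bar>kc z - p z\<bar> < \<delta>"
    using Stone_Weierstrass_real_polynomial_function[OF compact_Times[OF compact_\<Gamma> compact_\<Gamma>] _ \<delta>(1)] by metis
  obtain n :: nat and f g where fg: "\<And>i. i < n \<Longrightarrow> continuous_on UNIV (f i)" "\<And>i. i < n \<Longrightarrow> continuous_on UNIV (g i)"
    "\<And>x y. p (x, y) = (\<Sum>i<n. f i x * g i y)" using real_polynomial_function_degenerate[OF p(1)] by metis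
  have kc: "\<bar>kern a y x - kc (y, x)\<bar> \<le> C0 * s * cmod (x - y) powr (-1/2)" if xy: "x \<in> \<Gamma>" "y \<in> \<Gamma>" for x y
  proof (cases "x = y")
    case True
    then show ?thesis by (simp add: kern_def kc_def)
  next
    case False
    define r where "r = cmod (x - y)"
    have r: "0 < r" using False by (simp add: r_def)
    have k: "kern a y x = Im (a y * \<tau> x * cnj (x - y) / a x) * (1 / r^2) / pi"
    proof -
      have "a y * \<tau> x / (a x * (x - y)) = (a y * \<tau> x * cnj (x - y) / a x) / ((x - y) * cnj (x - y))"
        using False xy by (simp add: divide_simps)
      also have "(x - y) * cnj (x - y) = of_real (r^2)" unfolding r_def by (rule complex_norm_square[symmetric])
      finally have "Im (a y * \<tau> x / (a x * (x - y))) = Im (a y * \<tau> x * cnj (x - y) / a x) / r^2"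
        by (simp only: Im_divide_of_real)
      then show ?thesis by (simp add: kern_def)
    qed
    have kc: "kc (y, x) = kern a y x * cutoff \<epsilon> r"
    proof (cases "\<epsilon> \<le> r")
      case True
      then show ?thesis unfolding k kc_def by (simp add: r_def max_def)
    next
      case False
      then have "cutoff \<epsilon> r = 0" using \<epsilon>(1) by (simp add: cutoff_def)
      then show ?thesis by (simp add: kc_def r_def)
    qed
    have "\<bar>kern a y x - kc (y, x)\<bar> = \<bar>kern a y x\<bar> * (1 - cutoff \<epsilon> r)"
    proof -
      have "cutoff \<epsilon> r \<le> 1" by (simp add: cutoff_def)
      moreover have "kern a y x - kc (y, x) = kern a y x * (1 - cutoff \<epsilon> r)"
        unfolding kc by (simp add: right_diff_distrib)
      ultimately show ?thesis by (simp add: abs_mult)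
    qed
    also have "\<dots> \<le> C0 * (s * r powr (-1/2))"
    proof (cases "2 * \<epsilon> \<le> r")
      case True
      then have "cutoff \<epsilon> r = 1" using \<epsilon>(1) by (simp add: cutoff_def le_divide_eq)
      then show ?thesis using C0 s by simp
    next
      case False
      have "1 \<le> (2 * \<epsilon>) powr (1/2) * r powr (-1/2)" using False r by (intro one_le_ratio_root) auto
      then have "1 - cutoff \<epsilon> r \<le> s * r powr (-1/2)" unfolding \<epsilon>(2) by (simp add: cutoff_def)
      then show ?thesis using C0 xy by (intro mult_mono) (auto simp: cutoff_def)
    qed
    finally show ?thesis by (simp add: r_def mult.assoc)
  qed
  have pt: "\<bar>kern a y x - (\<Sum>i<n. f i y * g i x)\<bar> \<le> C0 * s * cmod (x - y) powr (-1/2) + \<delta>" if "x \<in> \<Gamma>" "y \<in> \<Gamma>" for x y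
    using kc[OF that] p(2)[of "(y, x)"] that unfolding fg(3)[symmetric] by fastforce
  have gm [measurable]: "(\<lambda>x. \<Sum>i<n. c i * g i x) \<in> borel_measurable M" "(\<lambda>y. \<Sum>i<n. f i y * c i) \<in> borel_measurable M" for c
    using fg(1,2) by (auto intro!: borel_measurable_M continuous_intros intro: continuous_on_subset)
  have [measurable]: "(\<lambda>x. kern a y x) \<in> borel_measurable M" "(\<lambda>y. kern a y x) \<in> borel_measurable M" for x y
    by (auto intro: kern_measurable[OF a])
  have fin: "(LINT x|M. \<bar>h x\<bar>) \<le> 1/2" if "h \<in> borel_measurable M" "y \<in> \<Gamma>"
    "\<And>x. x \<in> \<Gamma> \<Longrightarrow> \<bar>h x\<bar> \<le> C0 * s * cmod (x - y) powr (-1/2) + \<delta>" for h :: "complex \<Rightarrow> real" and y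
  proof -
    have "norm (LINT x|M. \<bar>h x\<bar>) \<le> (LINT x|M. C0 * s * cmod (x - y) powr (-1/2) + \<delta>)"
    proof (rule norm_singular_integral_le(2))
      show "integrable M (\<lambda>x. C0 * s * cmod (x - y) powr (-1/2) + \<delta>)"
        using K(1)[OF that(2)] by (intro Bochner_Integration.integrable_add integrable_mult_right) auto
    qed (use that in auto)
    also have "\<dots> = C0 * s * (LINT x|M. cmod (x - y) powr (-1/2)) + \<delta> * measure M \<Gamma>"
      using K(1)[OF that(2)]
      by (subst Bochner_Integration.integral_add) (auto simp: space_M simp del: integral_mult_right_zero intro!: integral_mult_right_zero)
    also have "\<dots> \<le> C0 * s * \<bar>K\<bar> + \<delta> * measure M \<Gamma>"
      using K(2)[OF that(2)] C0 s by (intro add_right_mono mult_left_mono) auto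
    also have "\<dots> \<le> 1/4 + 1/4" using s \<delta> by (intro add_mono)
    finally show ?thesis by simp
  qed
  have "(LINT x|M. \<bar>kern a y x - (\<Sum>i<n. f i y * g i x)\<bar>) \<le> 1/2" if "y \<in> \<Gamma>" for y
    using pt that by (intro fin[of _ y]) auto
  moreover have "(LINT y|M. \<bar>kern a y x - (\<Sum>i<n. f i y * g i x)\<bar>) \<le> 1/2" if "x \<in> \<Gamma>" for x
  proof (rule fin[of _ x])
    fix y assume "y \<in> \<Gamma>"
    then show "\<bar>kern a y x - (\<Sum>i<n. f i y * g i x)\<bar> \<le> C0 * s * cmod (y - x) powr (-1/2) + \<delta>"
      using pt[OF that] by (simp add: norm_minus_commute[of y x])
  qed (use that in auto)
  ultimately show ?thesis using fg(1,2) by (intro that[of n f g]) auto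
qed

text \<open>The kernel is a small part \<open>e\<close> plus a part of finite rank. Inverting the
  small part leaves a linear system for the moments of \<open>\<mu>\<close> against the
  \<open>g i\<close>. A relation among its rows assembles to a solution of the adjoint equation, so
  \<open>orth\<close> is exactly the compatibility of the system.\<close>

lemma fredholm_alternative:
  fixes b :: "complex \<Rightarrow> real"
  assumes a: "coeff a" and b: "continuous_on \<Gamma> b"
    and orth: "\<And>\<psi>. continuous_on \<Gamma> \<psi> \<Longrightarrow> (\<And>x. x \<in> \<Gamma> \<Longrightarrow> \<psi> x = (LINT y|M. kern a y x * \<psi> y)) \<Longrightarrow> (LINT x|M. \<psi> x * b x) = 0"
  shows "\<exists>\<mu>. continuous_on \<Gamma> \<mu> \<and> (\<forall>y\<in>\<Gamma>. \<mu> y = Nop a \<mu> y + b y)"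
proof -
  obtain n :: nat and f g :: "nat \<Rightarrow> complex \<Rightarrow> real" where
    fg: "\<forall>i<n. continuous_on UNIV (f i)" "\<forall>i<n. continuous_on UNIV (g i)"
    and half: "\<forall>y\<in>\<Gamma>. (LINT x|M. \<bar>kern a y x - (\<Sum>i<n. f i y * g i x)\<bar>) \<le> 1/2"
    "\<forall>x\<in>\<Gamma>. (LINT y|M. \<bar>kern a y x - (\<Sum>i<n. f i y * g i x)\<bar>) \<le> 1/2"
    by (rule kern_degenerate_approx[OF a])
  define e where "e y x = kern a y x - (\<Sum>i<n. f i y * g i x)" for y x
  have cf: "continuous_on \<Gamma> (f i)" and cg: "continuous_on \<Gamma> (g i)" if "i < n" for i
    using fg that continuous_on_subset by blast+
  define ip where "ip u v = (LINT x|M. u x * v x)" for u v :: "complex \<Rightarrow> real"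
  have ipi: "integrable M (\<lambda>x. u x * v x)" if "continuous_on \<Gamma> u" "continuous_on \<Gamma> v" for u v :: "complex \<Rightarrow> real"
  proof -
    have "bdd_meas (\<lambda>x. u x * v x)" using that by (intro bdd_meas_continuous_on continuous_intros)
    then show ?thesis unfolding bdd_meas_def using integrable_bounded by blast
  qed
  have ip_comm: "ip u v = ip v u" for u v by (simp add: ip_def mult.commute)
  have ip_sum: "ip u (\<lambda>x. v0 x + (\<Sum>j<n. c j * v j x)) = ip u v0 + (\<Sum>j<n. c j * ip u (v j))"
    if "continuous_on \<Gamma> u" "continuous_on \<Gamma> v0" "\<And>j. j < n \<Longrightarrow> continuous_on \<Gamma> (v j)" for u v0 v c
  proof -
    have "ip u (\<lambda>x. v0 x + (\<Sum>j<n. c j * v j x)) = (LINT x|M. u x * v0 x + (\<Sum>j<n. c j * (u x * v j x)))"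
      unfolding ip_def by (intro Bochner_Integration.integral_cong refl) (simp add: distrib_left sum_distrib_left ac_simps)
    also have "\<dots> = (LINT x|M. u x * v0 x) + (LINT x|M. (\<Sum>j<n. c j * (u x * v j x)))"
      by (intro Bochner_Integration.integral_add Bochner_Integration.integrable_sum integrable_mult_right ipi that) auto
    also have "(LINT x|M. (\<Sum>j<n. c j * (u x * v j x))) = (\<Sum>j<n. LINT x|M. c j * (u x * v j x))"
      by (intro Bochner_Integration.integral_sum integrable_mult_right ipi that) auto
    finally show ?thesis by (simp add: ip_def)
  qed
  have one: "bdd_meas (\<lambda>x. 1::real)" by (intro bdd_meas_continuous_on continuous_intros)
  have kern_int: "integrable M (\<lambda>x. kern a y x)" if "y \<in> \<Gamma>" for y
    using kern_integrable[OF a one that] by simp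
  have coeff': "coeff (\<lambda>x. \<tau> x / a x)" by (intro coeff_divide a coeff_\<tau>)
  have kern_int': "integrable M (\<lambda>y. kern a y x)" if "x \<in> \<Gamma>" for x
  proof -
    have "integrable M (\<lambda>y. - kern (\<lambda>x. \<tau> x / a x) x y)"
      using kern_integrable[OF coeff' one that] by simp
    then show ?thesis
      by (rule Bochner_Integration.integrable_cong[THEN iffD1, OF refl, rotated]) (simp add: space_M kern_swap[OF a that])
  qed
  have sum_int: "integrable M (\<lambda>x. \<Sum>i<n. c i * g i x)" "integrable M (\<lambda>y. \<Sum>i<n. f i y * c i)" for c
    by (intro Bochner_Integration.integrable_sum ipi continuous_on_const cf cg, simp)+
  have e_int: "integrable M (e y)" if "y \<in> \<Gamma>" for y
    unfolding e_def[abs_def] by (intro Bochner_Integration.integrable_diff kern_int that sum_int)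
  have e_int': "integrable M (\<lambda>y. e y x)" if "x \<in> \<Gamma>" for x
    unfolding e_def[abs_def] by (intro Bochner_Integration.integrable_diff kern_int' that sum_int)
  have Eeq: "(LINT x|M. e y x * \<mu> x) = Nop a \<mu> y - (\<Sum>i<n. f i y * ip (g i) \<mu>)"
    if "continuous_on \<Gamma> \<mu>" "y \<in> \<Gamma>" for \<mu> y
  proof -
    have "(LINT x|M. e y x * \<mu> x) = (LINT x|M. kern a y x * \<mu> x - (\<Sum>i<n. f i y * (g i x * \<mu> x)))"
      by (intro Bochner_Integration.integral_cong refl) (simp add: e_def left_diff_distrib right_diff_distrib sum_distrib_right sum_distrib_left ac_simps)
    also have "\<dots> = (LINT x|M. kern a y x * \<mu> x) - (LINT x|M. (\<Sum>i<n. f i y * (g i x * \<mu> x)))"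
      by (intro Bochner_Integration.integral_diff kern_integrable a bdd_meas_continuous_on that Bochner_Integration.integrable_sum integrable_mult_right ipi cg) auto
    also have "(LINT x|M. (\<Sum>i<n. f i y * (g i x * \<mu> x))) = (\<Sum>i<n. LINT x|M. f i y * (g i x * \<mu> x))"
      by (intro Bochner_Integration.integral_sum integrable_mult_right ipi that cg) auto
    finally show ?thesis by (simp add: ip_def Nop_def)
  qed
  have Eeq': "(LINT y|M. e y x * \<psi> y) = (LINT y|M. kern a y x * \<psi> y) - (\<Sum>i<n. g i x * ip (f i) \<psi>)"
    if "continuous_on \<Gamma> \<psi>" "x \<in> \<Gamma>" for \<psi> x
  proof -
    have "(LINT y|M. e y x * \<psi> y) = (LINT y|M. kern a y x * \<psi> y - (\<Sum>i<n. g i x * (f i y * \<psi> y)))"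
      by (intro Bochner_Integration.integral_cong refl) (simp add: e_def left_diff_distrib right_diff_distrib sum_distrib_right sum_distrib_left ac_simps)
    also have "\<dots> = (LINT y|M. kern a y x * \<psi> y) - (LINT y|M. (\<Sum>i<n. g i x * (f i y * \<psi> y)))"
      by (intro Bochner_Integration.integral_diff integrable_mult_bdd_meas kern_int' bdd_meas_continuous_on that Bochner_Integration.integrable_sum integrable_mult_right ipi cf) auto
    also have "(LINT y|M. (\<Sum>i<n. g i x * (f i y * \<psi> y))) = (\<Sum>i<n. LINT y|M. g i x * (f i y * \<psi> y))"
      by (intro Bochner_Integration.integral_sum integrable_mult_right ipi that cf) auto
    finally show ?thesis by (simp add: ip_def)
  qed
  have transp: "(LINT y|M. kern a y x * \<psi> y) = - Nop (\<lambda>x. \<tau> x / a x) \<psi> x" if "x \<in> \<Gamma>" for x \<psi>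
    unfolding Nop_def integral_minus[symmetric]
    by (intro Bochner_Integration.integral_cong refl) (simp add: space_M kern_swap[OF a that])
  have Ec: "continuous_on \<Gamma> (\<lambda>y. LINT x|M. e y x * \<mu> x)" if "continuous_on \<Gamma> \<mu>" for \<mu>
  proof -
    have "continuous_on \<Gamma> (\<lambda>y. Nop a \<mu> y - (\<Sum>i<n. f i y * ip (g i) \<mu>))"
      by (intro continuous_intros hoelder_on_imp_continuous_on hoelder_Nop a bdd_meas_continuous_on that cf) auto
    then show ?thesis by (rule continuous_on_cong[THEN iffD1, OF refl, rotated]) (simp add: Eeq[OF that])
  qed
  have Ec': "continuous_on \<Gamma> (\<lambda>x. LINT y|M. e y x * \<psi> y)" if "continuous_on \<Gamma> \<psi>" for \<psi>
  proof -
    have "continuous_on \<Gamma> (\<lambda>x. - Nop (\<lambda>x. \<tau> x / a x) \<psi> x - (\<Sum>i<n. g i x * ip (f i) \<psi>))"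
      by (intro continuous_intros hoelder_on_imp_continuous_on hoelder_Nop coeff' bdd_meas_continuous_on that cg) auto
    then show ?thesis by (rule continuous_on_cong[THEN iffD1, OF refl, rotated]) (simp add: Eeq'[OF that] transp)
  qed
  have sol: "\<exists>\<mu>. continuous_on \<Gamma> \<mu> \<and> (\<forall>y\<in>\<Gamma>. \<mu> y = c y + (LINT x|M. e y x * \<mu> x))" if "continuous_on \<Gamma> c" for c
    by (rule neumann_series[OF e_int _ Ec that]) (use half(1) in \<open>simp_all add: e_def\<close>)
  have sol': "\<exists>\<psi>. continuous_on \<Gamma> \<psi> \<and> (\<forall>x\<in>\<Gamma>. \<psi> x = c x + (LINT y|M. e y x * \<psi> y))" if "continuous_on \<Gamma> c" for c
    by (rule neumann_series[of "\<lambda>x y. e y x", OF e_int' _ Ec' that]) (use half(2) in \<open>simp_all add: e_def\<close>)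
  have adj: "ip \<psi> (\<lambda>y. LINT x|M. e y x * \<mu> x) = ip (\<lambda>x. LINT y|M. e y x * \<psi> y) \<mu>"
    if c: "continuous_on \<Gamma> \<psi>" "continuous_on \<Gamma> \<mu>" for \<psi> \<mu>
  proof -
    interpret P: pair_sigma_finite M M by unfold_locales
    interpret P2: finite_measure "M \<Otimes>\<^sub>M M" by (intro finite_measure_pair_measure) unfold_locales
    have [measurable]: "\<psi> \<in> borel_measurable M" "\<mu> \<in> borel_measurable M"
      using c by (auto intro: borel_measurable_M)
    have fgm [measurable]: "f i \<in> borel_measurable M" "g i \<in> borel_measurable M" if "i < n" for i
      using cf[OF that] cg[OF that] by (auto intro: borel_measurable_M)
    have [measurable]: "(\<lambda>z. e (fst z) (snd z)) \<in> borel_measurable (M \<Otimes>\<^sub>M M)"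
      unfolding e_def
      by (intro borel_measurable_diff kern_measurable2 a borel_measurable_sum borel_measurable_times
           measurable_compose[OF measurable_fst fgm(1)] measurable_compose[OF measurable_snd fgm(2)]) auto
    obtain C0 where C0: "0 < C0" "\<And>x y. x \<in> \<Gamma> \<Longrightarrow> y \<in> \<Gamma> \<Longrightarrow> \<bar>kern a y x\<bar> \<le> C0" using kern_bounded[OF a] by blast
    obtain B1 where B1: "0 < B1" "\<And>x. x \<in> \<Gamma> \<Longrightarrow> norm (\<psi> x) \<le> B1" using bdd_meas_bound[OF bdd_meas_continuous_on[OF c(1)]] by blast
    obtain B2 where B2: "0 < B2" "\<And>x. x \<in> \<Gamma> \<Longrightarrow> norm (\<mu> x) \<le> B2" using bdd_meas_bound[OF bdd_meas_continuous_on[OF c(2)]] by blast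
    have "continuous_on (\<Gamma> \<times> \<Gamma>) (\<lambda>z. \<Sum>i<n. f i (fst z) * g i (snd z))"
      by (intro continuous_on_sum continuous_on_mult continuous_on_compose2[OF cf continuous_on_fst]
          continuous_on_compose2[OF cg continuous_on_snd] continuous_on_id) auto
    from compact_imp_bounded[OF compact_continuous_image[OF this compact_Times[OF compact_\<Gamma> compact_\<Gamma>]]]
    obtain B3 where B3: "\<And>x y. x \<in> \<Gamma> \<Longrightarrow> y \<in> \<Gamma> \<Longrightarrow> \<bar>\<Sum>i<n. f i y * g i x\<bar> \<le> B3"
      unfolding bounded_iff by force
    have int: "integrable (M \<Otimes>\<^sub>M M) (\<lambda>z. \<psi> (fst z) * e (fst z) (snd z) * \<mu> (snd z))"
    proof (rule P2.integrable_const_bound[of _ "B1 * (C0 + B3) * B2"])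
      have "norm (\<psi> y * e y x * \<mu> x) \<le> B1 * (C0 + B3) * B2" if "y \<in> \<Gamma>" "x \<in> \<Gamma>" for y x
      proof -
        have "\<bar>e y x\<bar> \<le> C0 + B3" using C0(2)[OF that(2,1)] B3[OF that(2,1)] unfolding e_def by linarith
        then show ?thesis unfolding norm_mult using B1 B2 that by (intro mult_mono) auto
      qed
      then show "AE z in M \<Otimes>\<^sub>M M. norm (\<psi> (fst z) * e (fst z) (snd z) * \<mu> (snd z)) \<le> B1 * (C0 + B3) * B2"
        by (intro AE_I2) (auto simp: space_pair_measure space_M)
    qed measurable
    have "(LINT y|M. (LINT x|M. \<psi> y * e y x * \<mu> x)) = (LINT x|M. (LINT y|M. \<psi> y * e y x * \<mu> x))"
      using P.Fubini_integral[of "\<lambda>y x. \<psi> y * e y x * \<mu> x"] int by (simp add: case_prod_beta')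
    moreover have "(LINT y|M. (LINT x|M. \<psi> y * e y x * \<mu> x)) = ip \<psi> (\<lambda>y. LINT x|M. e y x * \<mu> x)"
      unfolding ip_def by (simp only: mult.assoc integral_mult_right_zero)
    moreover have "(LINT x|M. (LINT y|M. \<psi> y * e y x * \<mu> x)) = ip (\<lambda>x. LINT y|M. e y x * \<psi> y) \<mu>"
      unfolding ip_def by (simp only: integral_mult_left_zero) (simp only: mult.commute)
    ultimately show ?thesis by simp
  qed
  \<comment> \<open>Each equation is paired with the solution of the other: the resolvents of
    \<open>e\<close> and of its transpose are adjoint to each other.\<close>
  have ip_rel: "ip c \<mu> = ip \<psi> d"
    if c: "continuous_on \<Gamma> \<psi>" "continuous_on \<Gamma> \<mu>" "continuous_on \<Gamma> c" "continuous_on \<Gamma> d"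
      and s: "\<forall>x\<in>\<Gamma>. \<psi> x = c x + (LINT y|M. e y x * \<psi> y)" "\<forall>y\<in>\<Gamma>. \<mu> y = d y + (LINT x|M. e y x * \<mu> x)" for \<psi> \<mu> c d
  proof -
    have "ip \<psi> \<mu> = (LINT x|M. c x * \<mu> x + (LINT y|M. e y x * \<psi> y) * \<mu> x)"
      unfolding ip_def by (rule Bochner_Integration.integral_cong[OF refl]) (use s(1) in \<open>auto simp: space_M distrib_right\<close>)
    also have "\<dots> = ip c \<mu> + ip (\<lambda>x. LINT y|M. e y x * \<psi> y) \<mu>"
      unfolding ip_def by (intro Bochner_Integration.integral_add ipi Ec' c)
    finally have 1: "ip \<psi> \<mu> = ip c \<mu> + ip (\<lambda>x. LINT y|M. e y x * \<psi> y) \<mu>" .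
    have "ip \<psi> \<mu> = (LINT y|M. \<psi> y * d y + \<psi> y * (LINT x|M. e y x * \<mu> x))"
      unfolding ip_def by (rule Bochner_Integration.integral_cong[OF refl]) (use s(2) in \<open>auto simp: space_M distrib_left\<close>)
    also have "\<dots> = ip \<psi> d + ip \<psi> (\<lambda>y. LINT x|M. e y x * \<mu> x)"
      unfolding ip_def by (intro Bochner_Integration.integral_add ipi Ec c)
    finally show ?thesis using 1 adj[OF c(1,2)] by linarith
  qed
  obtain \<mu>b where \<mu>b: "continuous_on \<Gamma> \<mu>b" "\<forall>y\<in>\<Gamma>. \<mu>b y = b y + (LINT x|M. e y x * \<mu>b x)" using sol[OF b] by blast
  have "\<forall>j. \<exists>\<mu>. j < n \<longrightarrow> continuous_on \<Gamma> \<mu> \<and> (\<forall>y\<in>\<Gamma>. \<mu> y = f j y + (LINT x|M. e y x * \<mu> x))" using sol cf by blast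
  then obtain \<mu>s where \<mu>s: "\<And>j. j < n \<Longrightarrow> continuous_on \<Gamma> (\<mu>s j)" "\<And>j. j < n \<Longrightarrow> \<forall>y\<in>\<Gamma>. \<mu>s j y = f j y + (LINT x|M. e y x * \<mu>s j x)" by metis
  have "\<forall>j. \<exists>\<psi>. j < n \<longrightarrow> continuous_on \<Gamma> \<psi> \<and> (\<forall>x\<in>\<Gamma>. \<psi> x = g j x + (LINT y|M. e y x * \<psi> y))" using sol' cg by blast
  then obtain \<psi>s where \<psi>s: "\<And>j. j < n \<Longrightarrow> continuous_on \<Gamma> (\<psi>s j)" "\<And>j. j < n \<Longrightarrow> \<forall>x\<in>\<Gamma>. \<psi>s j x = g j x + (LINT y|M. e y x * \<psi>s j y)" by metis
  \<comment> \<open>A solution is sought as \<open>\<mu>b\<close> plus the sum of the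
    \<open>c j * \<mu>s j\<close>, where \<open>c j\<close> has to be its own moment against
    \<open>g j\<close>; \<open>L\<close> encodes this self-consistency.\<close>
  define L where "L j c = c j - (\<Sum>l<n. ip (g j) (\<mu>s l) * c l)" for j and c :: "nat \<Rightarrow> real"
  have "\<exists>c. \<forall>j<n. L j c = ip (g j) \<mu>b"
  proof (rule lin_system_solvable)
    show "lin_form (L j)" for j
      unfolding lin_form_def L_def by (simp add: algebra_simps sum.distrib sum_distrib_left)
    fix d assume d: "\<And>c. (\<Sum>j<n. d j * L j c) = 0"
    \<comment> \<open>The adjoint solution belonging to the relation \<open>d\<close>; the leading 0
      matches the shape of \<open>ip_sum\<close>.\<close>
    define \<psi> where "\<psi> x = 0 + (\<Sum>j<n. d j * \<psi>s j x)" for x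
    have \<psi>c: "continuous_on \<Gamma> \<psi>" unfolding \<psi>_def[abs_def] by (intro continuous_intros \<psi>s) auto
    have ip\<psi>: "ip \<psi> u = (\<Sum>j<n. d j * ip (\<psi>s j) u)" if "continuous_on \<Gamma> u" for u
      using ip_sum[OF that, of "\<lambda>x. 0" \<psi>s d] \<psi>s(1) unfolding \<psi>_def[abs_def] ip_comm[of _ u] by (simp add: ip_def)
    \<comment> \<open>Evaluating the relation at unit vectors identifies \<open>d l\<close> with the
      moment of \<open>\<psi>\<close> against \<open>f l\<close>, which supplies the finite-rank
      part of the transposed kernel.\<close>
    have dl: "d l = ip \<psi> (f l)" if "l < n" for l
    proof -
      have "(\<Sum>j<n. d j * L j (\<lambda>i. if i = l then 1 else 0)) = d l - (\<Sum>j<n. d j * ip (g j) (\<mu>s l))"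
        unfolding L_def using that
        by (simp add: right_diff_distrib sum_subtractf if_distrib[of "\<lambda>x. _ * x"] sum.delta' sum.delta cong: if_cong)
      then have "d l = (\<Sum>j<n. d j * ip (g j) (\<mu>s l))" using d by simp
      also have "\<dots> = (\<Sum>j<n. d j * ip (\<psi>s j) (f l))"
        using ip_rel[OF \<psi>s(1) \<mu>s(1) cg cf \<psi>s(2) \<mu>s(2)] that by (intro sum.cong) auto
      finally show ?thesis using ip\<psi>[OF cf[OF that]] by simp
    qed
    have "(LINT x|M. \<psi> x * b x) = 0"
    proof (rule orth[OF \<psi>c])
      fix x assume x: "x \<in> \<Gamma>"
      have "\<psi> x = (\<Sum>j<n. d j * g j x) + (\<Sum>j<n. d j * (LINT y|M. e y x * \<psi>s j y))"
        unfolding \<psi>_def using \<psi>s(2) x by (simp add: distrib_left sum.distrib[symmetric])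
      also have "(\<Sum>j<n. d j * (LINT y|M. e y x * \<psi>s j y)) = (LINT y|M. (\<Sum>j<n. d j * (e y x * \<psi>s j y)))"
        unfolding integral_mult_right_zero[symmetric]
        by (intro Bochner_Integration.integral_sum[symmetric] integrable_mult_right integrable_mult_bdd_meas e_int' x bdd_meas_continuous_on \<psi>s) auto
      also have "\<dots> = (LINT y|M. e y x * \<psi> y)"
        by (intro Bochner_Integration.integral_cong refl) (simp add: \<psi>_def sum_distrib_left ac_simps)
      also have "\<dots> = (LINT y|M. kern a y x * \<psi> y) - (\<Sum>i<n. g i x * ip (f i) \<psi>)" by (rule Eeq'[OF \<psi>c x])
      also have "(\<Sum>i<n. g i x * ip (f i) \<psi>) = (\<Sum>j<n. d j * g j x)"
        using dl by (intro sum.cong) (auto simp: ip_comm[of _ \<psi>])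
      finally show "\<psi> x = (LINT y|M. kern a y x * \<psi> y)" by simp
    qed
    then have "ip \<psi> b = 0" by (simp add: ip_def)
    moreover have "ip \<psi> b = (\<Sum>j<n. d j * ip (g j) \<mu>b)"
      unfolding ip\<psi>[OF b] using ip_rel[OF \<psi>s(1) \<mu>b(1) cg b \<psi>s(2) \<mu>b(2)] by (intro sum.cong) auto
    ultimately show "(\<Sum>j<n. d j * ip (g j) \<mu>b) = 0" by simp
  qed
  then obtain c where c: "\<And>j. j < n \<Longrightarrow> L j c = ip (g j) \<mu>b" by blast
  define \<mu> where "\<mu> x = \<mu>b x + (\<Sum>j<n. c j * \<mu>s j x)" for x
  have \<mu>c: "continuous_on \<Gamma> \<mu>" unfolding \<mu>_def[abs_def] by (intro continuous_intros \<mu>s \<mu>b) auto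
  have cj: "c j = ip (g j) \<mu>" if "j < n" for j
  proof -
    have "ip (g j) \<mu> = ip (g j) \<mu>b + (\<Sum>l<n. c l * ip (g j) (\<mu>s l))"
      unfolding \<mu>_def[abs_def] by (rule ip_sum[OF cg[OF that] \<mu>b(1) \<mu>s(1)])
    then show ?thesis using c[OF that] by (simp add: L_def mult.commute)
  qed
  have "\<mu> y = Nop a \<mu> y + b y" if y: "y \<in> \<Gamma>" for y
  proof -
    have "\<mu> y = b y + (\<Sum>j<n. c j * f j y) + ((LINT x|M. e y x * \<mu>b x) + (\<Sum>j<n. c j * (LINT x|M. e y x * \<mu>s j x)))"
      unfolding \<mu>_def using \<mu>b(2) \<mu>s(2) y by (simp add: distrib_left sum.distrib)
    also have "(\<Sum>j<n. c j * (LINT x|M. e y x * \<mu>s j x)) = (LINT x|M. (\<Sum>j<n. c j * (e y x * \<mu>s j x)))"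
      unfolding integral_mult_right_zero[symmetric]
      by (intro Bochner_Integration.integral_sum[symmetric] integrable_mult_right integrable_mult_bdd_meas e_int y bdd_meas_continuous_on \<mu>s) auto
    also have "(LINT x|M. e y x * \<mu>b x) + (LINT x|M. (\<Sum>j<n. c j * (e y x * \<mu>s j x))) = (LINT x|M. e y x * \<mu>b x + (\<Sum>j<n. c j * (e y x * \<mu>s j x)))"
      by (intro Bochner_Integration.integral_add[symmetric] Bochner_Integration.integrable_sum integrable_mult_right integrable_mult_bdd_meas e_int y bdd_meas_continuous_on \<mu>s \<mu>b) auto
    also have "\<dots> = (LINT x|M. e y x * \<mu> x)"
      by (intro Bochner_Integration.integral_cong refl) (simp add: \<mu>_def distrib_left sum_distrib_left ac_simps)
    also have "\<dots> = Nop a \<mu> y - (\<Sum>i<n. f i y * ip (g i) \<mu>)" by (rule Eeq[OF \<mu>c y])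
    also have "(\<Sum>i<n. f i y * ip (g i) \<mu>) = (\<Sum>j<n. c j * f j y)"
      using cj by (intro sum.cong) auto
    finally show ?thesis by simp
  qed
  then show ?thesis using \<mu>c by blast
qed

section \<open>Real densities and points of positive measure\<close>

lemma bdd_meas_integrable:
  fixes f :: "complex \<Rightarrow> 'b::{banach, second_countable_topology}"
  shows "bdd_meas f \<Longrightarrow> integrable M f"
  unfolding bdd_meas_def using integrable_bounded by blast

lemma coeff_one: "coeff (\<lambda>_. 1)"
  unfolding coeff_def by (auto intro!: exI[of _ 0])

lemma Cbd_add:
  assumes "hoelder_on \<Gamma> \<rho>" "hoelder_on \<Gamma> \<sigma>" "y \<in> \<Gamma>"
  shows "Cbd (\<lambda>x. \<rho> x + \<sigma> x) y = Cbd \<rho> y + Cbd \<sigma> y"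
proof -
  have "(LINT x|M. (\<rho> x + \<sigma> x - (\<rho> y + \<sigma> y)) * \<tau> x / (x - y)) =
     (LINT x|M. (\<rho> x - \<rho> y) * \<tau> x / (x - y) + (\<sigma> x - \<sigma> y) * \<tau> x / (x - y))"
    by (intro Bochner_Integration.integral_cong refl) (simp add: algebra_simps add_divide_distrib diff_divide_distrib)
  also have "\<dots> = (LINT x|M. (\<rho> x - \<rho> y) * \<tau> x / (x - y)) + (LINT x|M. (\<sigma> x - \<sigma> y) * \<tau> x / (x - y))"
    by (intro Bochner_Integration.integral_add singular_integrable assms)
  finally show ?thesis unfolding Cbd_def by (simp only: add_divide_distrib)
qed

lemma Cint_diff:
  assumes "bdd_meas \<rho>" "bdd_meas \<sigma>" "z \<notin> \<Gamma>"
  shows "Cint (\<lambda>x. \<rho> x - \<sigma> x) z = Cint \<rho> z - Cint \<sigma> z"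
proof -
  have "(LINT x|M. (\<rho> x - \<sigma> x) * \<tau> x / (x - z)) = (LINT x|M. \<rho> x * \<tau> x / (x - z) - \<sigma> x * \<tau> x / (x - z))"
    by (intro Bochner_Integration.integral_cong refl) (simp add: left_diff_distrib diff_divide_distrib)
  also have "\<dots> = (LINT x|M. \<rho> x * \<tau> x / (x - z)) - (LINT x|M. \<sigma> x * \<tau> x / (x - z))"
    by (intro Bochner_Integration.integral_diff integrable_Cauchy_kernel assms)
  finally show ?thesis unfolding Cint_def by (simp only: diff_divide_distrib)
qed

text \<open>For the coefficient 1 the Neumann kernel is bounded, so the real part of the boundary
  value differs from half the density by at most a multiple of the mean of its modulus. The constant
  is the same for all \<open>\<theta>\<close>.\<close>

lemma Re_Cbd_real_bound:
  obtains C where "0 < C" "\<forall>\<theta>. hoelder_on \<Gamma> \<theta> \<longrightarrow> (\<forall>y\<in>\<Gamma>. \<bar>Re (Cbd (\<lambda>x. of_real (\<theta> x)) y) - \<theta> y / 2\<bar> \<le> C * (LINT x|M. \<bar>\<theta> x\<bar>))"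
proof -
  obtain C where C: "0 < C" "\<And>x y. x \<in> \<Gamma> \<Longrightarrow> y \<in> \<Gamma> \<Longrightarrow> \<bar>kern (\<lambda>_. 1) y x\<bar> \<le> C" using kern_bounded[OF coeff_one] by blast
  have "\<bar>Re (Cbd (\<lambda>x. of_real (\<theta> x)) y) - \<theta> y / 2\<bar> \<le> C * (LINT x|M. \<bar>\<theta> x\<bar>)" if "hoelder_on \<Gamma> \<theta>" "y \<in> \<Gamma>" for \<theta> y
  proof -
    have bm: "bdd_meas \<theta>" by (rule bdd_meas_hoelder[OF that(1)])
    then have "integrable M \<theta>" by (rule bdd_meas_integrable)
    then have i: "integrable M (\<lambda>x. C * \<bar>\<theta> x\<bar>)" by simp
    have "norm (Nop (\<lambda>_. 1) \<theta> y) \<le> (LINT x|M. C * \<bar>\<theta> x\<bar>)"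
      unfolding Nop_def
    proof (rule norm_singular_integral_le(2)[OF _ i])
      show "(\<lambda>x. kern (\<lambda>_. 1) y x * \<theta> x) \<in> borel_measurable M"
        using kern_integrable[OF coeff_one bm that(2)] by auto
      show "norm (kern (\<lambda>_. 1) y x * \<theta> x) \<le> C * \<bar>\<theta> x\<bar>" if "x \<in> \<Gamma>" for x
        unfolding norm_mult using C(2)[OF that \<open>y \<in> \<Gamma>\<close>] by (intro mult_mono) auto
    qed
    then have "\<bar>Nop (\<lambda>_. 1) \<theta> y\<bar> \<le> C * (LINT x|M. \<bar>\<theta> x\<bar>)" by simp
    moreover have "Re (Cbd (\<lambda>x. of_real (\<theta> x)) y) = (Nop (\<lambda>_. 1) \<theta> y + \<theta> y) / 2"
      using Re_Cbd[OF coeff_one that] by simp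
    ultimately show ?thesis by (simp add: add_divide_distrib)
  qed
  then show ?thesis using that[OF C(1)] by blast
qed

lemma Re_Cint_real:
  fixes \<theta> :: "complex \<Rightarrow> real"
  assumes "bdd_meas \<theta>" "z \<notin> \<Gamma>"
  shows "Re (Cint (\<lambda>x. of_real (\<theta> x)) z) = (LINT x|M. \<theta> x * Im (\<tau> x / (x - z))) / (2 * pi)"
proof -
  have bm: "bdd_meas (\<lambda>x. complex_of_real (\<theta> x))" using assms(1) unfolding bdd_meas_def by auto
  have i: "integrable M (\<lambda>x. of_real (\<theta> x) * \<tau> x / (x - z))" by (rule integrable_Cauchy_kernel[OF bm assms(2)])
  have "Re (Cint (\<lambda>x. of_real (\<theta> x)) z) = Im (LINT x|M. of_real (\<theta> x) * \<tau> x / (x - z)) / (2 * pi)"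
    unfolding Cint_def by (simp add: Re_divide cmod_power2 power2_eq_square complex_eq_iff)
  also have "Im (LINT x|M. of_real (\<theta> x) * \<tau> x / (x - z)) = (LINT x|M. Im (of_real (\<theta> x) * \<tau> x / (x - z)))"
    using integral_Im[OF i] by simp
  also have "\<dots> = (LINT x|M. \<theta> x * Im (\<tau> x / (x - z)))"
  proof (intro Bochner_Integration.integral_cong refl)
    fix x
    have "Im (of_real r * w) = r * Im w" for r w by simp
    from this[of "\<theta> x" "\<tau> x / (x - z)"] show "Im (of_real (\<theta> x) * \<tau> x / (x - z)) = \<theta> x * Im (\<tau> x / (x - z))" by (simp only: times_divide_eq_right)
  qed
  finally show ?thesis .
qed

text \<open>Otherwise every point of \<Gamma> has a ball meeting E in a null set, and finitely many
  such balls cover \<Gamma>.\<close>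

lemma support_point:
  assumes "E \<in> sets M" "measure M E > 0"
  shows "\<exists>y\<in>\<Gamma>. \<forall>r>0. measure M (E \<inter> cball y r) > 0"
proof (rule ccontr)
  assume neg: "\<not> ?thesis"
  have sub: "E \<subseteq> \<Gamma>" using sets.sets_into_space[OF assms(1)] space_M by simp
  have cm: "S \<inter> \<Gamma> \<in> sets M" if "S \<in> sets borel" for S
    using that unfolding sets_M sets_restrict_space by auto
  have "\<exists>r>0. measure M (E \<inter> cball y r) = 0" if "y \<in> \<Gamma>" for y
    using neg that measure_nonneg[of M] by (metis less_eq_real_def)
  then obtain r where r: "\<And>y. y \<in> \<Gamma> \<Longrightarrow> 0 < r y" "\<And>y. y \<in> \<Gamma> \<Longrightarrow> measure M (E \<inter> cball y (r y)) = 0" by metis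
  obtain Y where Y: "Y \<subseteq> \<Gamma>" "finite Y" "\<Gamma> \<subseteq> (\<Union>y\<in>Y. ball y (r y))"
  proof (rule compactE_image[OF compact_\<Gamma>, of \<Gamma> "\<lambda>y. ball y (r y)"])
    show "\<Gamma> \<subseteq> (\<Union>y\<in>\<Gamma>. ball y (r y))" using r(1) centre_in_ball by blast
  qed (rule open_ball)
  have m: "E \<inter> cball y (r y) \<in> sets M" for y
  proof -
    have "E \<inter> cball y (r y) = E \<inter> (cball y (r y) \<inter> \<Gamma>)" using sub by auto
    then show ?thesis using assms(1) cm[of "cball y (r y)"] by auto
  qed
  have "E \<subseteq> (\<Union>y\<in>Y. E \<inter> cball y (r y))"
  proof
    fix x assume "x \<in> E"
    then obtain y where "y \<in> Y" "x \<in> ball y (r y)" using sub Y(3) by blast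
    then show "x \<in> (\<Union>y\<in>Y. E \<inter> cball y (r y))" using \<open>x \<in> E\<close> ball_subset_cball by blast
  qed
  then have "measure M E \<le> measure M (\<Union>y\<in>Y. E \<inter> cball y (r y))"
    by (intro finite_measure_mono sets.finite_UN m Y(2))
  also have "\<dots> \<le> (\<Sum>y\<in>Y. measure M (E \<inter> cball y (r y)))"
    using m Y(2) by (intro finite_measure_subadditive_finite) auto
  also have "\<dots> = 0" using r(2) Y(1) by (intro sum.neutral) auto
  finally show False using assms(2) by simp
qed

end

section \<open>A uniqueness theorem for a transmission problem\<close>

text \<open>\<open>approach\<close> says that a Poisson-type kernel peaks: for a suitable z in
  \<open>G\<close> it exceeds any given bound on a whole neighbourhood of y.
  \<open>exp_integral_bound\<close> is Zygmund's estimate with one constant for all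
  \<open>\<theta>\<close> bounded by pi/2, whatever their Hoelder norms.\<close>

locale contour_unique = contour +
  assumes connected_G: "connected G"
    and approach: "\<And>y B. y \<in> \<Gamma> \<Longrightarrow> \<exists>r>0. \<exists>z\<in>G. \<forall>x\<in>\<Gamma>. cmod (x - y) \<le> r \<longrightarrow> B \<le> Im (\<tau> x / (x - z))"
    and exp_integral_bound: "\<exists>C. \<forall>\<theta>. hoelder_on \<Gamma> \<theta> \<longrightarrow> (\<forall>x\<in>\<Gamma>. \<bar>\<theta> x\<bar> \<le> pi / 2) \<longrightarrow>
       integrable M (\<lambda>x. exp (- Re (Cbd (\<lambda>x. \<i> * of_real (\<theta> x)) x))) \<and>
       (LINT x|M. exp (- Re (Cbd (\<lambda>x. \<i> * of_real (\<theta> x)) x))) \<le> C"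
begin

text \<open>A two constants argument: near a density point of the zero set, the harmonic function Re Q with
  boundary weight on the zero set is larger than its values on the rest of the boundary.\<close>
lemma zero_set_positive_imp_zero:
  assumes f: "holo_plus f" "hoelder_on \<Gamma> f" and pos: "measure M {x\<in>\<Gamma>. f x = 0} > 0" and "z \<in> G"
  shows "f z = 0"
proof -
  obtain T where T: "0 < T" "\<And>x. x \<in> \<Gamma> \<Longrightarrow> cmod (\<tau> x) \<le> T" using \<tau>_bound by blast
  define E where "E = {x\<in>\<Gamma>. f x = 0}"
  have cE: "closed E" unfolding E_def
    by (rule continuous_closed_preimage_constant[OF hoelder_on_imp_continuous_on[OF f(2)] closed_\<Gamma>])
  have mS: "S \<in> sets M" if "closed S" "S \<subseteq> \<Gamma>" for S
  proof -
    have "S = S \<inter> \<Gamma>" "S \<in> sets borel" using that by auto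
    then show ?thesis unfolding sets_M sets_restrict_space by (metis Int_commute imageI)
  qed
  have "E \<subseteq> \<Gamma>" by (auto simp: E_def)
  then obtain y where y: "y \<in> \<Gamma>" "\<And>r. 0 < r \<Longrightarrow> measure M (E \<inter> cball y r) > 0"
    using support_point[of E] mS[OF cE] pos unfolding E_def by metis
  obtain C where C: "0 < C" "\<forall>\<theta>. hoelder_on \<Gamma> \<theta> \<longrightarrow> (\<forall>y\<in>\<Gamma>. \<bar>Re (Cbd (\<lambda>x. of_real (\<theta> x)) y) - \<theta> y / 2\<bar> \<le> C * (LINT x|M. \<bar>\<theta> x\<bar>))"
    by (rule Re_Cbd_real_bound)
  \<comment> \<open>The threshold is chosen so that \<open>Re (Q z0)\<close> is at least (C + 1) *
    m, whereas off E' \<open>Re_Cbd_real_bound\<close> gives boundary values of at most C * m in the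
    limit.\<close>
  obtain r z0 where r: "0 < r" "z0 \<in> G" "\<forall>x\<in>\<Gamma>. cmod (x - y) \<le> r \<longrightarrow> (C + 1) * (2 * pi) \<le> Im (\<tau> x / (x - z0))"
    using approach[OF y(1), of "(C + 1) * (2 * pi)"] by blast
  define E' where "E' = E \<inter> cball y r"
  have E': "closed E'" "E' \<subseteq> \<Gamma>" unfolding E'_def using cE by (auto simp: E_def)
  have mE' [measurable]: "E' \<in> sets M" by (rule mS[OF E'])
  define m where "m = measure M E'"
  have m: "0 < m" using y(2)[OF r(1)] by (simp add: m_def E'_def)
  have E'_ne: "E' \<noteq> {}" using m by (auto simp: m_def)
  have fE': "f x = 0" if "x \<in> E'" for x using that by (simp add: E'_def E_def)
  have bmI: "bdd_meas (indicator E' :: complex \<Rightarrow> real)"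
    unfolding bdd_meas_def by (auto intro!: exI[of _ 1] simp: indicator_def)
  define Q where "Q = Cint (\<lambda>x. of_real (indicator E' x))"
  have Q_hol: "Q holomorphic_on - \<Gamma>" unfolding Q_def
    by (rule holomorphic_Cint) (use bmI in \<open>auto simp: bdd_meas_def\<close>)
  \<comment> \<open>\<open>f\<close> will turn out to vanish on this open set, and then on all of
    \<open>G\<close> by the identity theorem.\<close>
  define V where "V = {w \<in> G. C * m < Re (Q w)}"
  have "open V"
  proof -
    have "continuous_on G Q" using holomorphic_on_imp_continuous_on[OF Q_hol] G_\<Gamma>_disjoint
      by (metis continuous_on_subset disjoint_eq_subset_Compl)
    then have "continuous_on G (\<lambda>w. Re (Q w))" by (intro continuous_intros)
    then have "open (G \<inter> (\<lambda>w. Re (Q w)) -` {C * m<..})"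
      by (intro continuous_open_preimage open_G open_greaterThan)
    moreover have "V = G \<inter> (\<lambda>w. Re (Q w)) -` {C * m<..}" by (auto simp: V_def)
    ultimately show ?thesis by simp
  qed
  moreover have "z0 \<in> V"
  proof -
    have z0: "z0 \<notin> \<Gamma>" using r(2) G_\<Gamma>_disjoint by auto
    obtain r0 where r0: "0 < r0" "\<And>x. x \<in> \<Gamma> \<Longrightarrow> r0 \<le> cmod (x - z0)" using dist_pos[OF z0] by blast
    have i: "integrable M (\<lambda>x. indicator E' x * Im (\<tau> x / (x - z0)))"
    proof (rule integrable_bounded[of _ "T / r0"])
      fix x assume x: "x \<in> \<Gamma>"
      have "\<bar>Im (\<tau> x / (x - z0))\<bar> \<le> cmod (\<tau> x) / cmod (x - z0)" by (metis abs_Im_le_cmod norm_divide)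
      also have "\<dots> \<le> T / r0" using T r0 x by (intro frac_le) auto
      finally show "norm (indicator E' x * Im (\<tau> x / (x - z0))) \<le> T / r0"
        using T r0 by (auto simp: indicator_def)
    qed measurable
    have "(C + 1) * m = (LINT x|M. indicator E' x * ((C + 1) * (2 * pi))) / (2 * pi)"
      by (simp add: m_def)
    also have "\<dots> \<le> (LINT x|M. indicator E' x * Im (\<tau> x / (x - z0))) / (2 * pi)"
    proof (intro divide_right_mono integral_mono i)
      show "integrable M (\<lambda>x. indicator E' x * ((C + 1) * (2 * pi)))"
        by (intro integrable_mult_left) (use mE' in \<open>simp add: less_top[symmetric]\<close>)
      fix x assume "x \<in> space M"
      then show "indicator E' x * ((C + 1) * (2 * pi)) \<le> indicator E' x * Im (\<tau> x / (x - z0))"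
        using r(3) by (auto simp: indicator_def space_M E'_def dist_norm norm_minus_commute)
    qed auto
    also have "\<dots> = Re (Q z0)" unfolding Q_def by (rule Re_Cint_real[OF bmI z0, symmetric])
    finally show ?thesis using r(2) m by (simp add: V_def algebra_simps)
  qed
  moreover have "f w = 0" if w: "w \<in> V" for w
  proof (rule ccontr)
    assume fw: "f w \<noteq> 0"
    have wG: "w \<in> G" and wQ: "C * m < Re (Q w)" using w by (auto simp: V_def)
    have wn: "w \<notin> \<Gamma>" using wG G_\<Gamma>_disjoint by auto
    obtain s where s: "0 < s" "\<And>x. x \<in> \<Gamma> \<Longrightarrow> s \<le> cmod (x - w)" using dist_pos[OF wn] by blast
    \<comment> \<open>Lipschitz functions converging to the indicator of E': boundary values are
      available for Hoelder densities, so the passage to the indicator is made in the final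
      estimate.\<close>
    define \<phi> where "\<phi> n x = max 0 (1 - real n * infdist x E')" for n x
    have \<phi>01: "0 \<le> \<phi> n x" "\<phi> n x \<le> 1" for n x
      unfolding \<phi>_def using infdist_nonneg[of x E'] by (auto)
    have \<phi>h: "hoelder_on \<Gamma> (\<phi> n)" for n
    proof (rule hoelder_on_lipschitz[where C = "real n"])
      fix x y
      have "\<bar>infdist x E' - infdist y E'\<bar> \<le> dist x y"
        using infdist_triangle[of x E' y] infdist_triangle[of y E' x] by (simp add: dist_commute abs_le_iff)
      then have "real n * \<bar>infdist x E' - infdist y E'\<bar> \<le> real n * dist x y" by (intro mult_left_mono) auto
      then have "\<bar>real n * infdist x E' - real n * infdist y E'\<bar> \<le> real n * dist x y"
        by (simp add: abs_mult flip: right_diff_distrib)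
      then show "norm (\<phi> n x - \<phi> n y) \<le> real n * dist x y" unfolding \<phi>_def real_norm_def by linarith
    qed
    have \<phi>m [measurable]: "\<phi> n \<in> borel_measurable M" for n
      by (intro borel_measurable_M hoelder_on_imp_continuous_on \<phi>h)
    have \<phi>lim: "(\<lambda>n. \<phi> n x) \<longlonglongrightarrow> indicator E' x" for x
    proof (cases "x \<in> E'")
      case True
      then have "\<phi> n x = 1" for n by (simp add: \<phi>_def)
      then show ?thesis using True by simp
    next
      case False
      then have d: "0 < infdist x E'" using infdist_pos_not_in_closed[OF E'(1) E'_ne] by blast
      then obtain N where N: "1 / infdist x E' < real N" using reals_Archimedean2 by blast
      have "\<phi> n x = 0" if "n \<ge> N" for n
      proof -
        have "1 / infdist x E' < real n" using N that by linarith
        then have "1 < real n * infdist x E'" using d by (simp add: divide_less_eq)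
        then show ?thesis by (simp add: \<phi>_def)
      qed
      then have "\<forall>\<^sub>F n in sequentially. \<phi> n x = 0" by (auto simp: eventually_sequentially)
      then show ?thesis using False by (simp add: tendsto_eventually)
    qed
    define I where "I n = (LINT x|M. \<phi> n x)" for n
    have I: "I \<longlonglongrightarrow> m"
    proof -
      have "(\<lambda>n. LINT x|M. \<phi> n x) \<longlonglongrightarrow> (LINT x|M. indicator E' x)"
        by (rule integral_dominated_convergence[where w = "\<lambda>_. 1"]) (use \<phi>lim \<phi>01 in \<open>auto intro!: AE_I2\<close>)
      then show ?thesis by (simp add: I_def[abs_def] m_def)
    qed
    define J where "J n = Re (Cint (\<lambda>x. of_real (\<phi> n x)) w)" for n
    have J: "J \<longlonglongrightarrow> Re (Q w)"
    proof -
      have "(\<lambda>n. LINT x|M. \<phi> n x * Im (\<tau> x / (x - w))) \<longlonglongrightarrow> (LINT x|M. indicator E' x * Im (\<tau> x / (x - w)))"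
      proof (rule integral_dominated_convergence[where w = "\<lambda>_. T / s"])
        show "AE x in M. (\<lambda>n. \<phi> n x * Im (\<tau> x / (x - w))) \<longlonglongrightarrow> indicator E' x * Im (\<tau> x / (x - w))"
          using \<phi>lim by (intro AE_I2 tendsto_intros)
        show "AE x in M. norm (\<phi> n x * Im (\<tau> x / (x - w))) \<le> T / s" for n
        proof (rule AE_I2)
          fix x assume "x \<in> space M"
          then have x: "x \<in> \<Gamma>" by (simp add: space_M)
          have "\<bar>Im (\<tau> x / (x - w))\<bar> \<le> cmod (\<tau> x) / cmod (x - w)" by (metis abs_Im_le_cmod norm_divide)
          also have "\<dots> \<le> T / s" using T s x by (intro frac_le) auto
          finally have "\<bar>\<phi> n x\<bar> * \<bar>Im (\<tau> x / (x - w))\<bar> \<le> 1 * (T / s)"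
            using \<phi>01 by (intro mult_mono) auto
          then show "norm (\<phi> n x * Im (\<tau> x / (x - w))) \<le> T / s" by (simp add: abs_mult)
        qed
      qed auto
      then have "(\<lambda>n. (LINT x|M. \<phi> n x * Im (\<tau> x / (x - w))) / (2 * pi)) \<longlonglongrightarrow> (LINT x|M. indicator E' x * Im (\<tau> x / (x - w))) / (2 * pi)"
        by (intro tendsto_intros) auto
      then show ?thesis
        unfolding J_def[abs_def] Q_def Re_Cint_real[OF bdd_meas_hoelder[OF \<phi>h] wn] Re_Cint_real[OF bmI wn] .
    qed
    define K where "K = T / s * (LINT x|M. cmod (f x))"
    \<comment> \<open>The weight exp (\<kappa> * Cplus) enlarges the value at w by exp (\<kappa> * J
      n). On \<Gamma> its extra factor exp (\<kappa> * \<phi> n / 2) differs from 1 only near E' and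
      disappears in the limit, because \<open>f\<close> is 0 on E'.\<close>
    have key: "cmod (f w) * exp (\<kappa> * J n) \<le> T / s * (LINT x|M. cmod (f x) * exp (\<kappa> * (\<phi> n x / 2 + C * I n)))" if "0 < \<kappa>" for n and \<kappa> :: real
    proof -
      define h where "h z = f z * exp (of_real \<kappa> * Cplus (\<lambda>x. of_real (\<phi> n x)) z)" for z
      have \<phi>c: "hoelder_on \<Gamma> (\<lambda>x. complex_of_real (\<phi> n x))" using \<phi>h by (simp add: hoelder_on_of_real_iff)
      have hp: "holo_plus h"
      proof -
        have "((\<lambda>z. f z * exp (of_real \<kappa> * Cplus (\<lambda>x. of_real (\<phi> n x)) z)) \<longlongrightarrow> 0 * exp (of_real \<kappa> * 0)) at_infinity"
          using f(1) holo_plus_Cplus[OF \<phi>c] unfolding holo_plus_def by (intro tendsto_intros) auto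
        then show ?thesis using f(1) holo_plus_Cplus[OF \<phi>c] unfolding holo_plus_def h_def[abs_def]
          by (auto intro!: holomorphic_intros continuous_intros)
      qed
      have hh: "hoelder_on \<Gamma> h"
      proof -
        have "hoelder_on \<Gamma> (\<lambda>z. f z * exp (of_real \<kappa> * Cbd (\<lambda>x. of_real (\<phi> n x)) z))"
          by (intro hoelder_on_mult hoelder_on_exp hoelder_on_const hoelder_Cbd f compact_\<Gamma> \<phi>c)
        then show ?thesis by (subst (asm) hoelder_on_def, subst hoelder_on_def) (simp add: h_def Cplus_def)
      qed
      have "cmod (h w) = cmod (Cint h w)" using Cauchy_plus[OF hp hh wG] by simp
      also have "\<dots> \<le> T / s * (LINT x|M. cmod (h x))" by (rule norm_Cint_le[OF s T(2) bdd_meas_hoelder[OF hh]])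
      also have "\<dots> \<le> T / s * (LINT x|M. cmod (f x) * exp (\<kappa> * (\<phi> n x / 2 + C * I n)))"
      proof (intro mult_left_mono integral_mono)
        show "integrable M (\<lambda>x. cmod (h x))"
          by (intro integrable_norm bdd_meas_integrable bdd_meas_hoelder hh)
        have "continuous_on \<Gamma> (\<lambda>x. cmod (f x) * exp (\<kappa> * (\<phi> n x / 2 + C * I n)))"
          by (intro continuous_intros hoelder_on_imp_continuous_on f \<phi>h) auto
        then show "integrable M (\<lambda>x. cmod (f x) * exp (\<kappa> * (\<phi> n x / 2 + C * I n)))"
          by (intro bdd_meas_integrable bdd_meas_continuous_on)
        fix x assume "x \<in> space M"
        then have x: "x \<in> \<Gamma>" by (simp add: space_M)
        have "\<bar>Re (Cbd (\<lambda>x. of_real (\<phi> n x)) x) - \<phi> n x / 2\<bar> \<le> C * (LINT x|M. \<bar>\<phi> n x\<bar>)" using C(2) \<phi>h x by blast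
        then have "Re (Cbd (\<lambda>x. of_real (\<phi> n x)) x) \<le> \<phi> n x / 2 + C * I n"
          using \<phi>01 by (simp add: I_def abs_le_iff)
        then have "\<kappa> * Re (Cbd (\<lambda>x. of_real (\<phi> n x)) x) \<le> \<kappa> * (\<phi> n x / 2 + C * I n)" using that by (intro mult_left_mono) auto
        then show "cmod (h x) \<le> cmod (f x) * exp (\<kappa> * (\<phi> n x / 2 + C * I n))"
          using x by (simp add: h_def Cplus_def norm_mult mult_left_mono)
      qed (use T s in auto)
      finally show ?thesis using wn by (simp add: h_def Cplus_def norm_mult J_def)
    qed
    have lim: "cmod (f w) * exp (\<kappa> * (Re (Q w) - C * m)) \<le> K" if l: "0 < \<kappa>" for \<kappa> :: real
    proof -
      have "(\<lambda>n. LINT x|M. cmod (f x) * exp (\<kappa> * (\<phi> n x / 2 + C * I n))) \<longlonglongrightarrow> (LINT x|M. cmod (f x) * exp (\<kappa> * (indicator E' x / 2 + C * m)))"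
      proof -
        have [measurable]: "f \<in> borel_measurable M" by (intro borel_measurable_M hoelder_on_imp_continuous_on f)
        obtain Bf where Bf: "0 < Bf" "\<And>x. x \<in> \<Gamma> \<Longrightarrow> norm (f x) \<le> Bf" using hoelder_on_bounded[OF compact_\<Gamma> f(2)] by blast
        define B1 where "B1 = exp (\<kappa> * (1 / 2 + C * measure M \<Gamma>))"
        have In: "I n \<le> measure M \<Gamma>" for n
        proof -
          have "I n \<le> (LINT x|M. 1)" unfolding I_def using \<phi>01
            by (intro integral_mono integrable_bounded[of _ 1]) auto
          then show ?thesis by (simp add: space_M)
        qed
        show ?thesis
        proof (rule integral_dominated_convergence[where w = "\<lambda>_. Bf * B1"])
          show "AE x in M. (\<lambda>n. cmod (f x) * exp (\<kappa> * (\<phi> n x / 2 + C * I n))) \<longlonglongrightarrow> cmod (f x) * exp (\<kappa> * (indicator E' x / 2 + C * m))"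
            using \<phi>lim I by (intro AE_I2 tendsto_intros) auto
          show "AE x in M. norm (cmod (f x) * exp (\<kappa> * (\<phi> n x / 2 + C * I n))) \<le> Bf * B1" for n
          proof (rule AE_I2)
            fix x assume "x \<in> space M"
            then have x: "x \<in> \<Gamma>" by (simp add: space_M)
            have "exp (\<kappa> * (\<phi> n x / 2 + C * I n)) \<le> B1"
              unfolding B1_def using \<phi>01[of n x] In l C(1) by (auto intro!: mult_left_mono add_mono)
            then have "cmod (f x) * exp (\<kappa> * (\<phi> n x / 2 + C * I n)) \<le> Bf * B1"
              using Bf x by (intro mult_mono) auto
            then show "norm (cmod (f x) * exp (\<kappa> * (\<phi> n x / 2 + C * I n))) \<le> Bf * B1" by simp
          qed
        qed auto
      qed
      then have "(\<lambda>n. T / s * (LINT x|M. cmod (f x) * exp (\<kappa> * (\<phi> n x / 2 + C * I n)))) \<longlonglongrightarrow> T / s * (LINT x|M. cmod (f x) * exp (\<kappa> * (indicator E' x / 2 + C * m)))"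
        by (intro tendsto_intros)
      moreover have "(\<lambda>n. cmod (f w) * exp (\<kappa> * J n)) \<longlonglongrightarrow> cmod (f w) * exp (\<kappa> * Re (Q w))"
        using J by (intro tendsto_intros)
      ultimately have "cmod (f w) * exp (\<kappa> * Re (Q w)) \<le> T / s * (LINT x|M. cmod (f x) * exp (\<kappa> * (indicator E' x / 2 + C * m)))"
        using key[OF l] by (intro LIMSEQ_le) auto
      also have "(LINT x|M. cmod (f x) * exp (\<kappa> * (indicator E' x / 2 + C * m))) = (LINT x|M. cmod (f x) * exp (\<kappa> * (C * m)))"
        by (intro Bochner_Integration.integral_cong refl) (use fE' in \<open>auto simp: indicator_def\<close>)
      also have "\<dots> = (LINT x|M. cmod (f x)) * exp (\<kappa> * (C * m))" by simp
      finally have "cmod (f w) * exp (\<kappa> * Re (Q w)) \<le> K * exp (\<kappa> * (C * m))" by (simp add: K_def)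
      then have "cmod (f w) * exp (\<kappa> * Re (Q w)) / exp (\<kappa> * (C * m)) \<le> K" by (simp add: divide_le_eq)
      then show ?thesis by (simp add: right_diff_distrib exp_diff)
    qed
    define d where "d = Re (Q w) - C * m"
    have d: "0 < d" using wQ by (simp add: d_def)
    \<comment> \<open>Large enough that already the linear lower bound 1 + \<kappa> * d for the
      exponential contradicts \<open>lim\<close>.\<close>
    define \<kappa> where "\<kappa> = (\<bar>K\<bar> / cmod (f w) + 1) / d"
    have l: "0 < \<kappa>" unfolding \<kappa>_def using d fw by (intro divide_pos_pos add_nonneg_pos) auto
    have "1 + \<kappa> * d \<le> exp (\<kappa> * d)" by (rule exp_ge_add_one_self)
    then have "cmod (f w) * (1 + \<kappa> * d) \<le> K" using lim[OF l] unfolding d_def[symmetric] by (smt (verit) mult_left_mono norm_ge_zero)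
    moreover have "cmod (f w) * (1 + \<kappa> * d) = 2 * cmod (f w) + \<bar>K\<bar>" using d fw by (simp add: \<kappa>_def field_simps)
    ultimately show False using fw by (smt (verit) zero_less_norm_iff)
  qed
  ultimately show ?thesis
    using analytic_continuation_open[of V G f "\<lambda>_. 0"] open_G connected_G f(1) \<open>z \<in> G\<close>
    unfolding holo_plus_def by (auto simp: V_def)
qed

text \<open>On the boundary f = w g with w in the closed disc of radius 1/2 about 1/2, so w has a bounded
  argument and X = exp(C[log w]) factorises w up to regularisation: f / X and g / X glue to an entire
  function that vanishes at infinity.\<close>
lemma transmission_estimate:
  assumes f: "holo_plus f" "hoelder_on \<Gamma> f" and g: "holo_minus g" "hoelder_on \<Gamma> g"
    and rel: "\<And>x. x \<in> \<Gamma> \<Longrightarrow> Re (g x * cnj (f x)) = (cmod (f x))\<^sup>2"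
    and B: "\<And>x. x \<in> \<Gamma> \<Longrightarrow> cmod (g x) \<le> B" and z: "z \<in> G"
  obtains K C where "0 < K" "0 < C" "\<forall>\<epsilon>. 0 < \<epsilon> \<and> \<epsilon> < 1 \<longrightarrow>
     cmod (f z) \<le> K * sqrt \<epsilon> * exp (C * (LINT x|M. ln ((B\<^sup>2 + 1) / ((cmod (f x))\<^sup>2 + \<epsilon>))))"
proof -
  obtain T where T: "0 < T" "\<And>x. x \<in> \<Gamma> \<Longrightarrow> cmod (\<tau> x) \<le> T" using \<tau>_bound by blast
  have zn: "z \<notin> \<Gamma>" using z G_\<Gamma>_disjoint by auto
  obtain s where s: "0 < s" "\<And>x. x \<in> \<Gamma> \<Longrightarrow> s \<le> cmod (x - z)" using dist_pos[OF zn] by blast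
  obtain C1 where C1: "0 < C1" "\<forall>\<theta>. hoelder_on \<Gamma> \<theta> \<longrightarrow> (\<forall>y\<in>\<Gamma>. \<bar>Re (Cbd (\<lambda>x. of_real (\<theta> x)) y) - \<theta> y / 2\<bar> \<le> C1 * (LINT x|M. \<bar>\<theta> x\<bar>))"
    by (rule Re_Cbd_real_bound)
  obtain CZ where CZ: "\<forall>\<theta>. hoelder_on \<Gamma> \<theta> \<longrightarrow> (\<forall>x\<in>\<Gamma>. \<bar>\<theta> x\<bar> \<le> pi / 2) \<longrightarrow>
       integrable M (\<lambda>x. exp (- Re (Cbd (\<lambda>x. \<i> * of_real (\<theta> x)) x))) \<and>
       (LINT x|M. exp (- Re (Cbd (\<lambda>x. \<i> * of_real (\<theta> x)) x))) \<le> CZ"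
    using exp_integral_bound by blast
  \<comment> \<open>The first factor of \<open>K\<close> is the part of |exp (Cint l z)| caused by
    the bounded argument of w, the second the kernel bound times Zygmund's constant.
    \<open>C\<close> adds the two places where the logarithmic integral enters: exp (Cint l z) and
    \<open>Re_Cbd_real_bound\<close>.\<close>
  define K where "K = exp (T / s * (pi / 2 * measure M \<Gamma>)) * (T / s * (\<bar>CZ\<bar> + 1))"
  define C where "C = T / s + C1"
  have B0: "0 \<le> B" using B \<Gamma>_nonempty norm_ge_zero order_trans by blast
  have "cmod (f z) \<le> K * sqrt \<epsilon> * exp (C * (LINT x|M. ln ((B\<^sup>2 + 1) / ((cmod (f x))\<^sup>2 + \<epsilon>))))"
    if \<epsilon>: "0 < \<epsilon>" "\<epsilon> < 1" for \<epsilon>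
  proof -
    define u where "u x = ln ((B\<^sup>2 + 1) / ((cmod (f x))\<^sup>2 + \<epsilon>))" for x
    define U where "U = (LINT x|M. u x)"
    \<comment> \<open>The quotient f/g in the form f * cnj g / |g|^2, regularised: by
      \<open>rel\<close> its real part is (|f|^2 + \<epsilon>)/(|g|^2 + \<epsilon>) > 0, and its
      modulus is at most 1.\<close>
    define w where "w x = (f x * cnj (g x) + of_real \<epsilon>) * inverse (g x * cnj (g x) + of_real \<epsilon>)" for x
    have den: "g x * cnj (g x) + of_real \<epsilon> = of_real ((cmod (g x))\<^sup>2 + \<epsilon>)" for x
      by (simp add: complex_norm_square[symmetric])
    have wdef: "w x = (f x * cnj (g x) + of_real \<epsilon>) / of_real ((cmod (g x))\<^sup>2 + \<epsilon>)" for x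
      unfolding w_def den by (rule divide_inverse[symmetric])
    \<comment> \<open>\<open>rel\<close> gives |f|^2 \<le> |g| |f|; cancelling |f| is harmless
      because the claim is trivial where f is 0.\<close>
    have fg: "(cmod (f x))\<^sup>2 \<le> (cmod (g x))\<^sup>2" "cmod (f x) \<le> cmod (g x)" if "x \<in> \<Gamma>" for x
    proof -
      have "(cmod (f x))\<^sup>2 \<le> cmod (g x) * cmod (f x)"
        using rel[OF that] complex_Re_le_cmod[of "g x * cnj (f x)"] by (simp add: norm_mult)
      then have "cmod (f x) * cmod (f x) \<le> cmod (g x) * cmod (f x)" by (simp add: power2_eq_square)
      then show "cmod (f x) \<le> cmod (g x)" by (metis mult_right_le_imp_le norm_ge_zero zero_less_norm_iff norm_zero)
      then show "(cmod (f x))\<^sup>2 \<le> (cmod (g x))\<^sup>2" by (intro power_mono) auto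
    qed
    have Rew: "Re (w x) = ((cmod (f x))\<^sup>2 + \<epsilon>) / ((cmod (g x))\<^sup>2 + \<epsilon>)" if "x \<in> \<Gamma>" for x
    proof -
      have "Re (f x * cnj (g x)) = (cmod (f x))\<^sup>2" using rel[OF that] by (simp add: algebra_simps)
      then show ?thesis unfolding wdef by (simp only: Re_divide_of_real plus_complex.sel Re_complex_of_real)
    qed
    have gB: "(cmod (g x))\<^sup>2 + \<epsilon> \<le> B\<^sup>2 + 1" if "x \<in> \<Gamma>" for x
      using B[OF that] \<epsilon> by (intro add_mono power_mono) auto
    have Rew_lb: "((cmod (f x))\<^sup>2 + \<epsilon>) / (B\<^sup>2 + 1) \<le> Re (w x)" if "x \<in> \<Gamma>" for x
      unfolding Rew[OF that] using gB[OF that] \<epsilon> by (intro divide_left_mono) (auto intro!: mult_pos_pos add_nonneg_pos)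
    define c where "c = \<epsilon> / (B\<^sup>2 + 1)"
    have c: "0 < c" "\<And>x. x \<in> \<Gamma> \<Longrightarrow> c \<le> Re (w x)"
    proof -
      show "0 < c" using \<epsilon> by (auto simp: c_def intro!: divide_pos_pos add_nonneg_pos)
      show "c \<le> Re (w x)" if "x \<in> \<Gamma>" for x
        by (rule order_trans[OF _ Rew_lb[OF that]]) (auto simp: c_def intro!: divide_right_mono add_nonneg_nonneg)
    qed
    have w1: "cmod (w x) \<le> 1" if "x \<in> \<Gamma>" for x
    proof -
      have "cmod (f x * cnj (g x) + of_real \<epsilon>) \<le> cmod (f x) * cmod (g x) + \<epsilon>"
        using norm_triangle_ineq[of "f x * cnj (g x)" "of_real \<epsilon>"] \<epsilon> by (simp add: norm_mult)
      also have "\<dots> \<le> (cmod (g x))\<^sup>2 + \<epsilon>"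
        unfolding power2_eq_square using fg(2)[OF that] by (intro add_right_mono mult_right_mono) auto
      finally show ?thesis unfolding wdef norm_divide norm_of_real
        using \<epsilon> by (simp add: divide_le_eq add_nonneg_pos)
    qed
    have hw: "hoelder_on \<Gamma> w" unfolding w_def[abs_def]
    proof (intro hoelder_on_mult hoelder_on_add hoelder_on_const hoelder_on_cnj hoelder_on_inverse[where c = \<epsilon>] compact_\<Gamma> bounded_\<Gamma> f g)
      show "\<epsilon> \<le> cmod (g x * cnj (g x) + of_real \<epsilon>)" for x unfolding den norm_of_real using \<epsilon> by auto
    qed (use \<epsilon> in auto)
    define l where "l x = Ln (w x)" for x
    have hl: "hoelder_on \<Gamma> l" unfolding l_def[abs_def]
      by (rule hoelder_on_Ln[OF bounded_\<Gamma> hw c])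
    have wnz: "w x \<noteq> 0" if "x \<in> \<Gamma>" for x using c that by fastforce
    have expl: "exp (l x) = w x" if "x \<in> \<Gamma>" for x using wnz[OF that] by (simp add: l_def)
    have Rel: "Re (l x) = ln (cmod (w x))" if "x \<in> \<Gamma>" for x using wnz[OF that] by (simp add: l_def)
    have Iml: "\<bar>Im (l x)\<bar> \<le> pi / 2" if "x \<in> \<Gamma>" for x
    proof -
      have "0 < Re (w x)" using c(1) c(2)[OF that] by linarith
      then show ?thesis using Re_Ln_pos_lt_imp[of "w x"] by (simp add: l_def)
    qed
    have Relu: "\<bar>Re (l x)\<bar> \<le> u x" if "x \<in> \<Gamma>" for x
    proof -
      have p: "0 < (cmod (f x))\<^sup>2 + \<epsilon>" "0 < B\<^sup>2 + 1" using \<epsilon> by (auto intro!: add_nonneg_pos)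
      have "((cmod (f x))\<^sup>2 + \<epsilon>) / (B\<^sup>2 + 1) \<le> cmod (w x)"
        using Rew_lb[OF that] complex_Re_le_cmod order_trans by blast
      then have "ln (((cmod (f x))\<^sup>2 + \<epsilon>) / (B\<^sup>2 + 1)) \<le> ln (cmod (w x))"
        using p by (intro ln_mono) auto
      moreover have "ln (((cmod (f x))\<^sup>2 + \<epsilon>) / (B\<^sup>2 + 1)) = - u x"
        unfolding u_def using p by (simp add: ln_div)
      moreover have "ln (cmod (w x)) \<le> 0" using w1[OF that] wnz[OF that] by simp
      ultimately show ?thesis unfolding Rel[OF that] by linarith
    qed
    have uc: "continuous_on \<Gamma> u" unfolding u_def
      by (intro continuous_intros hoelder_on_imp_continuous_on f)
         (use \<epsilon> in \<open>auto simp: add_nonneg_eq_0_iff intro!: divide_pos_pos add_nonneg_pos\<close>)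
    have ui: "integrable M u" by (intro bdd_meas_integrable bdd_meas_continuous_on uc)
    have lm: "bdd_meas l" by (rule bdd_meas_hoelder[OF hl])
    have li: "integrable M l" using lm by (rule bdd_meas_integrable)
    have int_Rel: "(LINT x|M. \<bar>Re (l x)\<bar>) \<le> U" unfolding U_def
      using li ui Relu by (intro integral_mono) (auto simp: space_M)
    have int_l: "(LINT x|M. cmod (l x)) \<le> U + pi / 2 * measure M \<Gamma>"
    proof -
      have "(LINT x|M. cmod (l x)) \<le> (LINT x|M. u x + pi / 2)"
      proof (intro integral_mono)
        fix x assume "x \<in> space M"
        then have "x \<in> \<Gamma>" by (simp add: space_M)
        then show "cmod (l x) \<le> u x + pi / 2" using cmod_le[of "l x"] Relu[of x] Iml[of x] by linarith
      qed (use li ui in auto)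
      also have "\<dots> = U + pi / 2 * measure M \<Gamma>" using ui by (simp add: U_def space_M)
      finally show ?thesis .
    qed
    \<comment> \<open>On \<Gamma> the quotient of exp (Cplus l) by exp (Cminus l) is exp l = w, so
      these exponentials factorise w into an outer and an inner part.\<close>
    define F where "F x = f x * exp (- Cplus l x)" for x
    define K' where "K' x = g x * exp (- Cminus l x)" for x
    have F: "holo_plus F"
    proof -
      have "((\<lambda>x. f x * exp (- Cplus l x)) \<longlongrightarrow> 0 * exp (- 0)) at_infinity"
        using f(1) holo_plus_Cplus[OF hl] unfolding holo_plus_def by (intro tendsto_intros) auto
      then show ?thesis using f(1) holo_plus_Cplus[OF hl] unfolding holo_plus_def F_def[abs_def]
        by (auto intro!: holomorphic_intros continuous_intros)
    qed
    have K': "holo_minus K'"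
      using g(1) holo_minus_Cminus[OF hl] unfolding holo_minus_def K'_def[abs_def]
      by (auto intro!: holomorphic_intros continuous_intros)
    have hF: "hoelder_on \<Gamma> F"
    proof -
      have "hoelder_on \<Gamma> (\<lambda>x. f x * exp (0 - Cbd l x))"
        by (intro hoelder_on_mult hoelder_on_exp hoelder_on_diff hoelder_on_const hoelder_Cbd f compact_\<Gamma> bounded_\<Gamma> hl)
      then show ?thesis by (subst (asm) hoelder_on_def, subst hoelder_on_def) (simp add: F_def Cplus_def)
    qed
    have hK: "hoelder_on \<Gamma> K'"
    proof -
      have "hoelder_on \<Gamma> (\<lambda>x. g x * exp (l x - Cbd l x))"
        by (intro hoelder_on_mult hoelder_on_exp hoelder_on_diff hoelder_Cbd g compact_\<Gamma> bounded_\<Gamma> hl)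
      then show ?thesis by (subst (asm) hoelder_on_def, subst hoelder_on_def) (simp add: K'_def Cminus_def)
    qed
    \<comment> \<open>f = g * w holds only up to the regularisation, so F and K' differ on \<Gamma>.
      The difference is sqrt \<epsilon> times factors of which the last is controlled only in the
      mean.\<close>
    have jump: "cmod (F x - K' x) \<le> sqrt \<epsilon> * exp (C1 * U) * exp (- Re (Cbd (\<lambda>x. \<i> * of_real (Im (l x))) x))" if x: "x \<in> \<Gamma>" for x
    proof -
      have "F x - K' x = (f x - g x * exp (l x)) * exp (- Cbd l x)"
        using x by (simp add: F_def K'_def Cplus_def Cminus_def exp_diff exp_minus field_simps)
      then have 1: "cmod (F x - K' x) = cmod (f x - g x * w x) * exp (- Re (Cbd l x))"
        by (simp add: norm_mult expl[OF x])
      have "l = (\<lambda>x. of_real (Re (l x)) + \<i> * of_real (Im (l x)))" by (auto simp: complex_eq)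
      then have "Cbd l x = Cbd (\<lambda>x. of_real (Re (l x)) + \<i> * of_real (Im (l x))) x" by (rule arg_cong)
      also have "\<dots> = Cbd (\<lambda>x. of_real (Re (l x))) x + Cbd (\<lambda>x. \<i> * of_real (Im (l x))) x"
        by (intro Cbd_add hoelder_on_mult hoelder_on_const x compact_\<Gamma>)
           (auto simp: hoelder_on_of_real_iff intro!: hoelder_on_Re hoelder_on_Im hl bounded_\<Gamma>)
      finally have 2: "Re (Cbd l x) = Re (Cbd (\<lambda>x. of_real (Re (l x))) x) + Re (Cbd (\<lambda>x. \<i> * of_real (Im (l x))) x)" by simp
      have "\<bar>Re (Cbd (\<lambda>x. of_real (Re (l x))) x) - Re (l x) / 2\<bar> \<le> C1 * (LINT x|M. \<bar>Re (l x)\<bar>)"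
        using C1(2) hoelder_on_Re[OF bounded_\<Gamma> hl] x by blast
      also have "\<dots> \<le> C1 * U" using int_Rel C1(1) by (intro mult_left_mono) auto
      finally have 3: "- Re (Cbd l x) \<le> - (Re (l x) / 2) + C1 * U - Re (Cbd (\<lambda>x. \<i> * of_real (Im (l x))) x)"
        unfolding 2 by linarith
      have wp: "0 < cmod (w x)" using wnz[OF x] by simp
      have e1: "exp (Re (l x) / 2) = sqrt (cmod (w x))"
      proof -
        have "(exp (Re (l x) / 2))\<^sup>2 = cmod (w x)"
          unfolding power2_eq_square exp_add[symmetric] using Rel[OF x] wp by simp
        then show ?thesis by (metis exp_ge_zero real_sqrt_unique)
      qed
      \<comment> \<open>The factor exp (Re (l x) / 2) = sqrt |w x| is retained because it cancels
        against the half-density term of the boundary value in fact \<open>3\<close>.\<close>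
      have 4: "cmod (f x - g x * w x) \<le> sqrt \<epsilon> * exp (Re (l x) / 2)"
      proof -
        define gg where "gg = (cmod (g x))\<^sup>2"
        have gp: "0 < gg + \<epsilon>" "0 \<le> gg" using \<epsilon> by (auto simp: gg_def intro!: add_nonneg_pos)
        have gn: "of_real (gg + \<epsilon>) \<noteq> (0::complex)" using gp by (metis less_irrefl of_real_eq_0_iff)
        have ggc: "g x * cnj (g x) = of_real gg" unfolding gg_def by (rule complex_norm_square[symmetric])
        have "f x - g x * w x = (f x * of_real (gg + \<epsilon>) - g x * (f x * cnj (g x) + of_real \<epsilon>)) / of_real (gg + \<epsilon>)"
          using gn unfolding wdef gg_def[symmetric] by (simp add: diff_divide_distrib)
        also have "f x * of_real (gg + \<epsilon>) - g x * (f x * cnj (g x) + of_real \<epsilon>) = of_real \<epsilon> * (f x - g x)"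
          using ggc by (simp add: algebra_simps)
        finally have "f x - g x * w x = of_real \<epsilon> * (f x - g x) / of_real (gg + \<epsilon>)" .
        then have "cmod (f x - g x * w x) = \<epsilon> * cmod (f x - g x) / (gg + \<epsilon>)"
          using \<epsilon> gp by (simp only: norm_mult norm_divide norm_of_real) simp
        then have "(cmod (f x - g x * w x))\<^sup>2 = \<epsilon>\<^sup>2 * (cmod (f x - g x))\<^sup>2 / (gg + \<epsilon>)\<^sup>2"
          by (simp add: power_mult_distrib power_divide)
        also have "\<dots> \<le> \<epsilon>\<^sup>2 * gg / (gg + \<epsilon>)\<^sup>2"
        proof (intro divide_right_mono mult_left_mono)
          have "(cmod (f x - g x))\<^sup>2 = (cmod (f x))\<^sup>2 - 2 * Re (g x * cnj (f x)) + gg"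
            unfolding gg_def cmod_power2 by (simp add: power2_eq_square algebra_simps)
          then show "(cmod (f x - g x))\<^sup>2 \<le> gg" unfolding rel[OF x] using zero_le_power2[of "cmod (f x)"] by linarith
        qed auto
        also have "\<dots> = \<epsilon> * (\<epsilon> / (gg + \<epsilon>)) * (gg / (gg + \<epsilon>))"
          by (simp add: power2_eq_square)
        also have "\<dots> \<le> \<epsilon> * (\<epsilon> / (gg + \<epsilon>)) * 1"
          using gp \<epsilon> by (intro mult_left_mono) auto
        also have "\<dots> \<le> \<epsilon> * cmod (w x)"
        proof -
          have "\<epsilon> / (gg + \<epsilon>) \<le> Re (w x)" unfolding Rew[OF x] gg_def[symmetric] using gp by (intro divide_right_mono) auto
          then have "\<epsilon> / (gg + \<epsilon>) \<le> cmod (w x)" using complex_Re_le_cmod order_trans by blast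
          from mult_left_mono[OF this, of \<epsilon>] show ?thesis using \<epsilon> by simp
        qed
        finally have "(cmod (f x - g x * w x))\<^sup>2 \<le> \<epsilon> * cmod (w x)" .
        then have "cmod (f x - g x * w x) \<le> sqrt (\<epsilon> * cmod (w x))" by (simp add: real_le_rsqrt)
        then show ?thesis unfolding e1 by (simp add: real_sqrt_mult)
      qed
      have "cmod (F x - K' x) \<le> (sqrt \<epsilon> * exp (Re (l x) / 2)) *
          exp (- (Re (l x) / 2) + C1 * U - Re (Cbd (\<lambda>x. \<i> * of_real (Im (l x))) x))"
        unfolding 1 using 3 4 \<epsilon> by (intro mult_mono) auto
      also have "\<dots> = sqrt \<epsilon> * exp (C1 * U) * exp (- Re (Cbd (\<lambda>x. \<i> * of_real (Im (l x))) x))"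
      proof -
        have "exp a * exp (- a + b - c) = exp b * exp (- c)" for a b c :: real
          unfolding exp_add[symmetric] by simp
        then show ?thesis by (simp only: mult.assoc)
      qed
      finally show ?thesis .
    qed
    have him: "hoelder_on \<Gamma> (\<lambda>x. Im (l x))" by (rule hoelder_on_Im[OF bounded_\<Gamma> hl])
    have zyg: "integrable M (\<lambda>x. exp (- Re (Cbd (\<lambda>x. \<i> * of_real (Im (l x))) x)))"
       "(LINT x|M. exp (- Re (Cbd (\<lambda>x. \<i> * of_real (Im (l x))) x))) \<le> CZ"
      using CZ[rule_format, OF him Iml] by blast+
    \<comment> \<open>The Cauchy integral of K' vanishes in \<open>G\<close>, so \<open>F z\<close>
      depends on the jump alone.\<close>
    have "F z = Cint F z - Cint K' z" using Cauchy_plus[OF F hF z] Cauchy_minus(1)[OF K' hK z] by simp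
    also have "\<dots> = Cint (\<lambda>x. F x - K' x) z" by (intro Cint_diff[symmetric] bdd_meas_hoelder hF hK zn)
    finally have "cmod (F z) \<le> T / s * (LINT x|M. cmod (F x - K' x))"
      using norm_Cint_le[OF s T(2) bdd_meas_hoelder[OF hoelder_on_diff[OF bounded_\<Gamma> hF hK]]] by (simp only:)
    also have "\<dots> \<le> T / s * (LINT x|M. sqrt \<epsilon> * exp (C1 * U) * exp (- Re (Cbd (\<lambda>x. \<i> * of_real (Im (l x))) x)))"
    proof (intro mult_left_mono integral_mono)
      show "integrable M (\<lambda>x. cmod (F x - K' x))"
        by (intro integrable_norm bdd_meas_integrable bdd_meas_hoelder hoelder_on_diff bounded_\<Gamma> hF hK)
      show "integrable M (\<lambda>x. sqrt \<epsilon> * exp (C1 * U) * exp (- Re (Cbd (\<lambda>x. \<i> * of_real (Im (l x))) x)))"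
        using zyg(1) by (rule integrable_mult_right)
      show "0 \<le> T / s" using T s by simp
    qed (rule jump, simp add: space_M)
    also have "\<dots> = T / s * (sqrt \<epsilon> * exp (C1 * U) * (LINT x|M. exp (- Re (Cbd (\<lambda>x. \<i> * of_real (Im (l x))) x))))"
      by (simp only: integral_mult_right_zero)
    also have "\<dots> \<le> T / s * (sqrt \<epsilon> * exp (C1 * U) * (\<bar>CZ\<bar> + 1))"
      using zyg(2) \<epsilon> T s by (intro mult_left_mono) auto
    finally have Fz: "cmod (F z) \<le> T / s * (sqrt \<epsilon> * exp (C1 * U) * (\<bar>CZ\<bar> + 1))" .
    have "cmod (Cint l z) \<le> T / s * (U + pi / 2 * measure M \<Gamma>)"
    proof -
      have "cmod (Cint l z) \<le> T / s * (LINT x|M. cmod (l x))" by (rule norm_Cint_le[OF s T(2) lm])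
      also have "\<dots> \<le> T / s * (U + pi / 2 * measure M \<Gamma>)" using int_l T s by (intro mult_left_mono) auto
      finally show ?thesis .
    qed
    then have X: "cmod (exp (Cint l z)) \<le> exp (T / s * (U + pi / 2 * measure M \<Gamma>))"
      using complex_Re_le_cmod[of "Cint l z"] by simp
    have "f z = F z * exp (Cint l z)" using zn by (simp add: F_def Cplus_def exp_minus)
    then have "cmod (f z) = cmod (F z) * cmod (exp (Cint l z))" by (simp only: norm_mult)
    also have "\<dots> \<le> (T / s * (sqrt \<epsilon> * exp (C1 * U) * (\<bar>CZ\<bar> + 1))) * exp (T / s * (U + pi / 2 * measure M \<Gamma>))"
      by (intro mult_mono Fz X) (use T s \<epsilon> in auto)
    also have "\<dots> = K * sqrt \<epsilon> * exp (C * U)"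
    proof -
      have "exp (T / s * (U + pi / 2 * measure M \<Gamma>)) = exp (T / s * U) * exp (T / s * (pi / 2 * measure M \<Gamma>))"
        by (simp only: distrib_left exp_add)
      moreover have "exp (C * U) = exp (T / s * U) * exp (C1 * U)" by (simp only: C_def distrib_right exp_add)
      ultimately show ?thesis unfolding K_def by (simp only: ac_simps)
    qed
    finally show ?thesis by (simp add: U_def u_def)
  qed
  moreover have "0 < K" unfolding K_def using T s by (intro mult_pos_pos) auto
  moreover have "0 < C" unfolding C_def using T s C1 by (intro add_pos_pos) auto
  ultimately show ?thesis using that by blast
qed

text \<open>If the boundary zeros have positive measure, the two constants argument applies. If they
  form a null set, some sublevel set of |f| has very small measure; outside it the logarithm is
  bounded, on it the exponential costs at most \<epsilon>^(-1/4), and the factor sqrt \<epsilon> of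
  \<open>transmission_estimate\<close> wins as \<epsilon> tends to 0.\<close>

lemma transmission_unique:
  assumes f: "holo_plus f" "hoelder_on \<Gamma> f" and g: "holo_minus g" "hoelder_on \<Gamma> g"
    and rel: "\<And>x. x \<in> \<Gamma> \<Longrightarrow> Re (g x * cnj (f x)) = (cmod (f x))\<^sup>2" and z: "z \<in> G"
  shows "f z = 0"
proof (cases "measure M {x\<in>\<Gamma>. f x = 0} > 0")
  case True
  then show ?thesis using zero_set_positive_imp_zero f z by blast
next
  case False
  then have null: "measure M {x\<in>\<Gamma>. f x = 0} = 0" using measure_nonneg[of M] by (metis less_eq_real_def)
  obtain B where B: "0 < B" "\<And>x. x \<in> \<Gamma> \<Longrightarrow> cmod (g x) \<le> B" using hoelder_on_bounded[OF compact_\<Gamma> g(2)] by blast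
  obtain K C where KC: "0 < K" "0 < C" "\<forall>\<epsilon>. 0 < \<epsilon> \<and> \<epsilon> < 1 \<longrightarrow>
     cmod (f z) \<le> K * sqrt \<epsilon> * exp (C * (LINT x|M. ln ((B\<^sup>2 + 1) / ((cmod (f x))\<^sup>2 + \<epsilon>))))"
    by (rule transmission_estimate[OF f g rel B(2) z])
  have fB: "cmod (f x) \<le> B" if "x \<in> \<Gamma>" for x
  proof -
    have "(cmod (f x))\<^sup>2 \<le> cmod (g x) * cmod (f x)"
      using rel[OF that] complex_Re_le_cmod[of "g x * cnj (f x)"] by (simp add: norm_mult)
    then have "cmod (f x) * cmod (f x) \<le> cmod (g x) * cmod (f x)" by (simp add: power2_eq_square)
    then have "cmod (f x) \<le> cmod (g x)" by (metis mult_right_le_imp_le norm_ge_zero zero_less_norm_iff norm_zero)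
    then show ?thesis using B(2)[OF that] by linarith
  qed
  have [measurable]: "f \<in> borel_measurable M" by (intro borel_measurable_M hoelder_on_imp_continuous_on f)
  define S where "S n = {x\<in>\<Gamma>. (cmod (f x))\<^sup>2 < 1 / real (Suc n)}" for n
  have Sm [measurable]: "S n \<in> sets M" for n
  proof -
    have "{x\<in>space M. (cmod (f x))\<^sup>2 < 1 / real (Suc n)} \<in> sets M" by measurable
    then show ?thesis by (simp add: S_def space_M)
  qed
  have "(\<lambda>n. measure M (S n)) \<longlonglongrightarrow> measure M (\<Inter>n. S n)"
  proof (rule finite_Lim_measure_decseq)
    show "decseq S" unfolding decseq_def S_def
    proof (intro allI impI subsetI)
      fix m n x assume mn: "m \<le> n" and "x \<in> {x \<in> \<Gamma>. (cmod (f x))\<^sup>2 < 1 / real (Suc n)}"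
      moreover have "1 / real (Suc n) \<le> 1 / real (Suc m)" using mn by (intro divide_left_mono) auto
      ultimately show "x \<in> {x \<in> \<Gamma>. (cmod (f x))\<^sup>2 < 1 / real (Suc m)}" by auto
    qed
  qed auto
  moreover have "(\<Inter>n. S n) = {x\<in>\<Gamma>. f x = 0}"
  proof (intro set_eqI iffI)
    fix x assume x: "x \<in> (\<Inter>n. S n)"
    have "f x = 0"
    proof (rule ccontr)
      assume "f x \<noteq> 0"
      then obtain n where "inverse (real (Suc n)) < (cmod (f x))\<^sup>2" using reals_Archimedean[of "(cmod (f x))\<^sup>2"] by auto
      moreover have "x \<in> S n" using x by blast
      ultimately show False by (simp add: S_def inverse_eq_divide)
    qed
    then show "x \<in> {x\<in>\<Gamma>. f x = 0}" using x by (auto simp: S_def)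
  qed (auto simp: S_def)
  ultimately have "(\<lambda>n. measure M (S n)) \<longlonglongrightarrow> 0" using null by simp
  \<comment> \<open>Below the measure 1/(4 C) the exponential of C times the logarithmic integral
    grows at most like \<epsilon>^(-1/4).\<close>
  then have "\<forall>\<^sub>F n in sequentially. measure M (S n) < 1 / (4 * C)" using KC(2) by (intro order_tendstoD) auto
  then obtain n where n: "measure M (S n) < 1 / (4 * C)" by (auto simp: eventually_sequentially)
  define \<rho> where "\<rho> = 1 / real (Suc n)"
  define b where "b = B\<^sup>2 + 1"
  have b: "1 \<le> b" by (simp add: b_def)
  have \<rho>: "0 < \<rho>" "\<rho> \<le> 1" by (auto simp: \<rho>_def)
  define K1 where "K1 = K * exp (C * (measure M \<Gamma> * ln (b / \<rho>))) * b powr (1/4)"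
  have bound: "cmod (f z) \<le> K1 * \<epsilon> powr (1/4)" if \<epsilon>: "0 < \<epsilon>" "\<epsilon> < 1" for \<epsilon>
  proof -
    have be: "1 \<le> b / \<epsilon>" "1 \<le> b / \<rho>" using b \<epsilon> \<rho> by (auto simp: le_divide_eq)
    have "(LINT x|M. ln ((B\<^sup>2 + 1) / ((cmod (f x))\<^sup>2 + \<epsilon>))) \<le> (LINT x|M. indicator (S n) x * ln (b / \<epsilon>) + ln (b / \<rho>))"
    proof (intro integral_mono)
      have "continuous_on \<Gamma> (\<lambda>x. ln ((B\<^sup>2 + 1) / ((cmod (f x))\<^sup>2 + \<epsilon>)))"
        by (intro continuous_intros hoelder_on_imp_continuous_on f)
           (use \<epsilon> in \<open>auto simp: add_nonneg_eq_0_iff intro!: divide_pos_pos add_nonneg_pos\<close>)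
      then show "integrable M (\<lambda>x. ln ((B\<^sup>2 + 1) / ((cmod (f x))\<^sup>2 + \<epsilon>)))"
        by (intro bdd_meas_integrable bdd_meas_continuous_on)
      show "integrable M (\<lambda>x. indicator (S n) x * ln (b / \<epsilon>) + ln (b / \<rho>))"
        by (intro Bochner_Integration.integrable_add integrable_mult_left) (auto simp: less_top[symmetric])
      fix x assume "x \<in> space M"
      then have x: "x \<in> \<Gamma>" by (simp add: space_M)
      have p: "0 < (cmod (f x))\<^sup>2 + \<epsilon>" using \<epsilon> by (auto intro!: add_nonneg_pos)
      show "ln ((B\<^sup>2 + 1) / ((cmod (f x))\<^sup>2 + \<epsilon>)) \<le> indicator (S n) x * ln (b / \<epsilon>) + ln (b / \<rho>)"
      proof (cases "x \<in> S n")
        case True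
        have "ln (b / ((cmod (f x))\<^sup>2 + \<epsilon>)) \<le> ln (b / \<epsilon>)"
          using p \<epsilon> b by (intro ln_mono divide_left_mono divide_pos_pos) auto
        moreover have "0 \<le> ln (b / \<rho>)" using be by simp
        ultimately show ?thesis using True by (simp add: b_def)
      next
        case False
        then have "\<rho> \<le> (cmod (f x))\<^sup>2" using x by (simp add: S_def \<rho>_def)
        then have "ln (b / ((cmod (f x))\<^sup>2 + \<epsilon>)) \<le> ln (b / \<rho>)"
          using p \<epsilon> b \<rho> by (intro ln_mono divide_left_mono divide_pos_pos) auto
        then show ?thesis using False by (simp add: b_def)
      qed
    qed
    also have "\<dots> = measure M (S n) * ln (b / \<epsilon>) + measure M \<Gamma> * ln (b / \<rho>)"
    proof -
      have "integrable M (\<lambda>x. indicator (S n) x * ln (b / \<epsilon>))"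
        by (intro integrable_mult_left) (auto simp: less_top[symmetric])
      moreover have "(LINT x|M. indicator (S n) x * ln (b / \<epsilon>)) = measure M (S n) * ln (b / \<epsilon>)" by simp
      ultimately show ?thesis by (subst Bochner_Integration.integral_add) (auto simp: space_M)
    qed
    also have "\<dots> \<le> 1 / (4 * C) * ln (b / \<epsilon>) + measure M \<Gamma> * ln (b / \<rho>)"
      using n be by (intro add_right_mono mult_right_mono) auto
    finally have "C * (LINT x|M. ln ((B\<^sup>2 + 1) / ((cmod (f x))\<^sup>2 + \<epsilon>))) \<le> C * (1 / (4 * C) * ln (b / \<epsilon>) + measure M \<Gamma> * ln (b / \<rho>))"
      using KC(2) by (intro mult_left_mono) auto
    also have "\<dots> = 1/4 * ln (b / \<epsilon>) + C * (measure M \<Gamma> * ln (b / \<rho>))"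
      using KC(2) by (simp add: distrib_left)
    finally have ex: "exp (C * (LINT x|M. ln ((B\<^sup>2 + 1) / ((cmod (f x))\<^sup>2 + \<epsilon>)))) \<le> (b / \<epsilon>) powr (1/4) * exp (C * (measure M \<Gamma> * ln (b / \<rho>)))"
      using be b \<epsilon> by (simp add: powr_def flip: exp_add)
    have "cmod (f z) \<le> K * sqrt \<epsilon> * exp (C * (LINT x|M. ln ((B\<^sup>2 + 1) / ((cmod (f x))\<^sup>2 + \<epsilon>))))"
      using KC(3) \<epsilon> by blast
    also have "\<dots> \<le> K * sqrt \<epsilon> * ((b / \<epsilon>) powr (1/4) * exp (C * (measure M \<Gamma> * ln (b / \<rho>))))"
      using ex KC(1) \<epsilon> by (intro mult_left_mono) auto
    also have "\<dots> = K1 * (sqrt \<epsilon> * \<epsilon> powr (-1/4))"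
      using b \<epsilon> unfolding K1_def powr_divide by (simp add: powr_minus_divide)
    also have "sqrt \<epsilon> * \<epsilon> powr (-1/4) = \<epsilon> powr (1/4)"
      using \<epsilon> unfolding powr_half_sqrt[symmetric, OF less_imp_le[OF \<epsilon>(1)]] powr_add[symmetric] by simp
    finally show ?thesis .
  qed
  have "((\<lambda>\<epsilon>. K1 * \<epsilon> powr (1/4)) \<longlongrightarrow> K1 * 0 powr (1/4)) (at_right 0)"
    by (intro tendsto_intros) (auto simp: eventually_at_filter)
  moreover have "\<forall>\<^sub>F \<epsilon> in at_right 0. cmod (f z) \<le> K1 * \<epsilon> powr (1/4)"
    unfolding eventually_at_right_field using bound by (intro exI[of _ 1]) auto
  ultimately have "cmod (f z) \<le> K1 * 0 powr (1/4)"
    by (intro tendsto_lowerbound[of _ _ "at_right 0"]) auto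
  then show ?thesis by simp
qed

end

section \<open>Removable sets of finite length\<close>

text \<open>The integral over the boundary of the rectangle, counterclockwise and written in
  coordinates, so that it is visibly additive when the rectangle is cut.\<close>

definition rect_int :: "(complex \<Rightarrow> complex) \<Rightarrow> real \<Rightarrow> real \<Rightarrow> real \<Rightarrow> real \<Rightarrow> complex" where
  "rect_int F x1 x2 y1 y2 = integral {x1..x2} (\<lambda>x. F (Complex x y1)) - integral {x1..x2} (\<lambda>x. F (Complex x y2))
     + \<i> * (integral {y1..y2} (\<lambda>y. F (Complex x2 y)) - integral {y1..y2} (\<lambda>y. F (Complex x1 y)))"

definition rect :: "real \<Rightarrow> real \<Rightarrow> real \<Rightarrow> real \<Rightarrow> complex set" where
  "rect x1 x2 y1 y2 = {z. x1 \<le> Re z \<and> Re z \<le> x2 \<and> y1 \<le> Im z \<and> Im z \<le> y2}"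

lemma continuous_on_Complex [continuous_intros]:
  "continuous_on S f \<Longrightarrow> continuous_on S g \<Longrightarrow> continuous_on S (\<lambda>x. Complex (f x) (g x))"
  unfolding Complex_eq by (intro continuous_intros)

lemma continuous_lines:
  assumes "continuous_on UNIV F"
  shows "continuous_on S (\<lambda>x. F (Complex x y))" "continuous_on S (\<lambda>y. F (Complex x y))"
  by (rule continuous_on_compose2[OF assms], auto intro!: continuous_intros)+

lemma integrable_lines:
  fixes F :: "complex \<Rightarrow> complex"
  assumes "continuous_on UNIV F"
  shows "(\<lambda>x. F (Complex x y)) integrable_on {a..b}" "(\<lambda>y. F (Complex x y)) integrable_on {a..b}"
  by (auto intro!: integrable_continuous_interval continuous_lines assms)

lemma rect_int_split_x:
  assumes "continuous_on UNIV F" "x1 \<le> x2" "x2 \<le> x3"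
  shows "rect_int F x1 x3 y1 y2 = rect_int F x1 x2 y1 y2 + rect_int F x2 x3 y1 y2"
proof -
  have "integral {x1..x3} (\<lambda>x. F (Complex x y)) = integral {x1..x2} (\<lambda>x. F (Complex x y)) + integral {x2..x3} (\<lambda>x. F (Complex x y))" for y
    using Henstock_Kurzweil_Integration.integral_combine[OF assms(2,3) integrable_lines(1)[OF assms(1)]] by simp
  then show ?thesis unfolding rect_int_def by (simp add: algebra_simps)
qed

lemma rect_int_split_y:
  assumes "continuous_on UNIV F" "y1 \<le> y2" "y2 \<le> y3"
  shows "rect_int F x1 x2 y1 y3 = rect_int F x1 x2 y1 y2 + rect_int F x1 x2 y2 y3"
proof -
  have "integral {y1..y3} (\<lambda>y. F (Complex x y)) = integral {y1..y2} (\<lambda>y. F (Complex x y)) + integral {y2..y3} (\<lambda>y. F (Complex x y))" for x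
    using Henstock_Kurzweil_Integration.integral_combine[OF assms(2,3) integrable_lines(2)[OF assms(1)]] by simp
  then show ?thesis unfolding rect_int_def by (simp add: algebra_simps)
qed

lemma rect_int_grid:
  assumes "continuous_on UNIV F" "0 \<le> w" "0 \<le> h"
  shows "rect_int F x (x + real p * w) y (y + real q * h) =
     (\<Sum>i<p. \<Sum>j<q. rect_int F (x + real i * w) (x + real (Suc i) * w) (y + real j * h) (y + real (Suc j) * h))"
proof -
  have 1: "rect_int F x1 x2 y (y + real q * h) = (\<Sum>j<q. rect_int F x1 x2 (y + real j * h) (y + real (Suc j) * h))" for x1 x2
  proof (induction q)
    case (Suc q)
    have "rect_int F x1 x2 y (y + real (Suc q) * h) = rect_int F x1 x2 y (y + real q * h) + rect_int F x1 x2 (y + real q * h) (y + real (Suc q) * h)"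
      using assms(3) by (intro rect_int_split_y[OF assms(1)]) (auto simp: distrib_right)
    then show ?case using Suc by simp
  qed (simp add: rect_int_def)
  show ?thesis
  proof (induction p)
    case (Suc p)
    have "rect_int F x (x + real (Suc p) * w) y (y + real q * h) =
       rect_int F x (x + real p * w) y (y + real q * h) + rect_int F (x + real p * w) (x + real (Suc p) * w) y (y + real q * h)"
      using assms(2) by (intro rect_int_split_x[OF assms(1)]) (auto simp: distrib_right)
    then show ?case using Suc 1 by simp
  qed (simp add: rect_int_def)
qed

lemma rect_int_holomorphic:
  assumes c: "continuous_on UNIV F" and le: "x1 \<le> x2" "y1 \<le> y2"
    and hol: "F holomorphic_on S" "open S" "rect x1 x2 y1 y2 \<subseteq> S"
  shows "rect_int F x1 x2 y1 y2 = 0"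
proof -
  let ?R = "rect x1 x2 y1 y2"
  have conv: "convex ?R"
  proof -
    have "?R = {z. Re z \<ge> x1} \<inter> {z. Re z \<le> x2} \<inter> {z. Im z \<ge> y1} \<inter> {z. Im z \<le> y2}" by (auto simp: rect_def)
    then show ?thesis
      by (simp add: convex_Int convex_halfspace_Re_ge convex_halfspace_Re_le convex_halfspace_Im_ge convex_halfspace_Im_le)
  qed
  have "\<exists>P. \<forall>z\<in>?R. (P has_field_derivative F z) (at z within ?R)"
  proof (rule holomorphic_convex_primitive[OF conv finite.emptyI])
    show "continuous_on ?R F" using c continuous_on_subset by blast
    fix z assume "z \<in> interior ?R - {}"
    then have "z \<in> S" using hol(3) interior_subset by blast
    then show "F field_differentiable at z" using hol(1,2) holomorphic_on_imp_differentiable_at by blast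
  qed blast
  then obtain P where P: "\<And>z. z \<in> ?R \<Longrightarrow> (P has_field_derivative F z) (at z within ?R)" by blast
  have H: "integral {x1..x2} (\<lambda>x. F (Complex x y)) = P (Complex x2 y) - P (Complex x1 y)" if y: "y1 \<le> y" "y \<le> y2" for y
  proof (rule integral_unique, rule fundamental_theorem_of_calculus[OF le(1)])
    fix x assume x: "x \<in> {x1..x2}"
    have "((\<lambda>x. Complex x y) has_vector_derivative 1) (at x within {x1..x2})"
      unfolding Complex_eq by (auto intro!: derivative_eq_intros)
    moreover have "(P has_field_derivative F (Complex x y)) (at (Complex x y) within (\<lambda>x. Complex x y) ` {x1..x2})"
      by (rule DERIV_subset[OF P]) (use x y in \<open>auto simp: rect_def\<close>)
    ultimately have "(P \<circ> (\<lambda>x. Complex x y) has_vector_derivative 1 * F (Complex x y)) (at x within {x1..x2})"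
      by (rule field_vector_diff_chain_within)
    then show "((\<lambda>x. P (Complex x y)) has_vector_derivative F (Complex x y)) (at x within {x1..x2})"
      by (simp add: o_def)
  qed
  have V: "integral {y1..y2} (\<lambda>y. \<i> * F (Complex x y)) = P (Complex x y2) - P (Complex x y1)" if x: "x1 \<le> x" "x \<le> x2" for x
  proof (rule integral_unique, rule fundamental_theorem_of_calculus[OF le(2)])
    fix y assume y: "y \<in> {y1..y2}"
    have "((\<lambda>y. Complex x y) has_vector_derivative \<i>) (at y within {y1..y2})"
      unfolding Complex_eq by (auto intro!: derivative_eq_intros)
    moreover have "(P has_field_derivative F (Complex x y)) (at (Complex x y) within (\<lambda>y. Complex x y) ` {y1..y2})"
      by (rule DERIV_subset[OF P]) (use x y in \<open>auto simp: rect_def\<close>)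
    ultimately have "(P \<circ> (\<lambda>y. Complex x y) has_vector_derivative \<i> * F (Complex x y)) (at y within {y1..y2})"
      by (rule field_vector_diff_chain_within)
    then show "((\<lambda>y. P (Complex x y)) has_vector_derivative \<i> * F (Complex x y)) (at y within {y1..y2})"
      by (simp add: o_def)
  qed
  have "rect_int F x1 x2 y1 y2 = integral {x1..x2} (\<lambda>x. F (Complex x y1)) - integral {x1..x2} (\<lambda>x. F (Complex x y2))
     + (integral {y1..y2} (\<lambda>y. \<i> * F (Complex x2 y)) - integral {y1..y2} (\<lambda>y. \<i> * F (Complex x1 y)))"
    unfolding rect_int_def by (simp add: right_diff_distrib)
  then show ?thesis using H V le by simp
qed

text \<open>Opposite sides are compared, so the bound involves the oscillation of F instead of its
  size; this is what makes a single cell of a fine grid negligible.\<close>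

lemma rect_int_bound:
  assumes c: "continuous_on UNIV F" and le: "x1 \<le> x2" "y1 \<le> y2"
    and osc: "\<And>z w. z \<in> rect x1 x2 y1 y2 \<Longrightarrow> w \<in> rect x1 x2 y1 y2 \<Longrightarrow> cmod (F z - F w) \<le> e"
  shows "cmod (rect_int F x1 x2 y1 y2) \<le> e * ((x2 - x1) + (y2 - y1))"
proof -
  have 1: "cmod (integral {x1..x2} (\<lambda>x. F (Complex x y1)) - integral {x1..x2} (\<lambda>x. F (Complex x y2))) \<le> e * (x2 - x1)"
  proof -
    have "integral {x1..x2} (\<lambda>x. F (Complex x y1)) - integral {x1..x2} (\<lambda>x. F (Complex x y2)) = integral {x1..x2} (\<lambda>x. F (Complex x y1) - F (Complex x y2))"
      by (rule Henstock_Kurzweil_Integration.integral_diff[symmetric]) (rule integrable_lines[OF c])+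
    also have "cmod \<dots> \<le> e * (x2 - x1)"
      by (rule integral_bound[OF le(1)]) (use le osc in \<open>auto simp: rect_def intro!: continuous_intros continuous_lines c\<close>)
    finally show ?thesis .
  qed
  have 2: "cmod (integral {y1..y2} (\<lambda>y. F (Complex x2 y)) - integral {y1..y2} (\<lambda>y. F (Complex x1 y))) \<le> e * (y2 - y1)"
  proof -
    have "integral {y1..y2} (\<lambda>y. F (Complex x2 y)) - integral {y1..y2} (\<lambda>y. F (Complex x1 y)) = integral {y1..y2} (\<lambda>y. F (Complex x2 y) - F (Complex x1 y))"
      by (rule Henstock_Kurzweil_Integration.integral_diff[symmetric]) (rule integrable_lines[OF c])+
    also have "cmod \<dots> \<le> e * (y2 - y1)"
      by (rule integral_bound[OF le(2)]) (use le osc in \<open>auto simp: rect_def intro!: continuous_intros continuous_lines c\<close>)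
    finally show ?thesis .
  qed
  have "cmod (rect_int F x1 x2 y1 y2) \<le> cmod (integral {x1..x2} (\<lambda>x. F (Complex x y1)) - integral {x1..x2} (\<lambda>x. F (Complex x y2)))
     + cmod (\<i> * (integral {y1..y2} (\<lambda>y. F (Complex x2 y)) - integral {y1..y2} (\<lambda>y. F (Complex x1 y))))"
    unfolding rect_int_def by (rule norm_triangle_ineq)
  then show ?thesis using 1 2 by (simp add: norm_mult distrib_left)
qed

text \<open>Both orders of x and x' are covered, since the increments of the primitive in Morera's
  theorem may have either sign.\<close>

lemma integral_increment:
  fixes \<phi> :: "real \<Rightarrow> complex"
  assumes c: "continuous_on UNIV \<phi>" and le: "a \<le> x" "a \<le> x'" and e: "\<And>t. \<bar>t - x\<bar> \<le> \<bar>x' - x\<bar> \<Longrightarrow> cmod (\<phi> t - v) \<le> e"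
  shows "cmod (integral {a..x'} \<phi> - integral {a..x} \<phi> - of_real (x' - x) * v) \<le> e * \<bar>x' - x\<bar>"
proof -
  have i: "\<phi> integrable_on {p..q}" for p q using c by (intro integrable_continuous_interval) (rule continuous_on_subset, auto)
  have cs: "continuous_on S \<phi>" for S using c continuous_on_subset by blast
  have key: "cmod (integral {p..q} \<phi> - of_real (q - p) * v) \<le> e * (q - p)" if pq: "p \<le> q" "p = x \<or> p = x'" "q = x \<or> q = x'" for p q
  proof -
    have "integral {p..q} \<phi> - of_real (q - p) * v = integral {p..q} (\<lambda>t. \<phi> t - v)"
      using pq by (subst Henstock_Kurzweil_Integration.integral_diff[OF i]) (auto simp: scaleR_conv_of_real)
    also have "cmod \<dots> \<le> e * (q - p)"
      by (rule integral_bound[OF pq(1)]) (use pq in \<open>auto intro!: continuous_intros cs e\<close>)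
    finally show ?thesis .
  qed
  show ?thesis
  proof (cases "x \<le> x'")
    case True
    then have "integral {a..x'} \<phi> = integral {a..x} \<phi> + integral {x..x'} \<phi>"
      using Henstock_Kurzweil_Integration.integral_combine[OF le(1) True i] by simp
    then show ?thesis using key[of x x'] True by simp
  next
    case False
    then have "integral {a..x} \<phi> = integral {a..x'} \<phi> + integral {x'..x} \<phi>"
      using Henstock_Kurzweil_Integration.integral_combine[OF le(2) _ i, of x] by simp
    then have "integral {a..x'} \<phi> - integral {a..x} \<phi> - of_real (x' - x) * v = - (integral {x'..x} \<phi> - of_real (x - x') * v)"
      by (simp add: algebra_simps)
    then have "cmod (integral {a..x'} \<phi> - integral {a..x} \<phi> - of_real (x' - x) * v) = cmod (integral {x'..x} \<phi> - of_real (x - x') * v)"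
      by (simp only: norm_minus_cancel)
    then show ?thesis using key[of x' x] False by simp
  qed
qed

text \<open>Morera's theorem for rectangles: the hypothesis makes the two axis-parallel paths from a
  corner to z equivalent. One form of the primitive \<open>P\<close> gives its horizontal
  increments, the other its vertical ones.\<close>

lemma holomorphic_of_rect_int_zero:
  assumes c: "continuous_on UNIV F" and z: "\<And>x1 x2 y1 y2. x1 < x2 \<Longrightarrow> y1 < y2 \<Longrightarrow> rect_int F x1 x2 y1 y2 = 0"
  shows "F holomorphic_on UNIV"
proof -
  have "F field_differentiable at z0" for z0
  proof -
    \<comment> \<open>The offset 2 places the unit disc about z0 to the upper right of the corner,
      so that all integrals run in the positive direction.\<close>
    define a b where "a = Re z0 - 2" and "b = Im z0 - 2"
    define P where "P z = integral {a..Re z} (\<lambda>x. F (Complex x b)) + \<i> * integral {b..Im z} (\<lambda>y. F (Complex (Re z) y))" for z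
    have P2: "P z = integral {a..Re z} (\<lambda>x. F (Complex x (Im z))) + \<i> * integral {b..Im z} (\<lambda>y. F (Complex a y))"
      if "a < Re z" "b < Im z" for z
      using z[OF that] unfolding rect_int_def P_def by (simp add: algebra_simps)
    have inb: "a < Re z" "b < Im z" if "z \<in> ball z0 1" for z
    proof -
      have "cmod (z - z0) < 1" using that by (simp add: dist_norm norm_minus_commute)
      then have "\<bar>Re (z - z0)\<bar> < 1" "\<bar>Im (z - z0)\<bar> < 1" using abs_Re_le_cmod[of "z - z0"] abs_Im_le_cmod[of "z - z0"] by linarith+
      then show "a < Re z" "b < Im z" by (auto simp: a_def b_def)
    qed
    have der: "(P has_field_derivative F z) (at z)" if zb: "z \<in> ball z0 1" for z
      unfolding has_field_derivative_def has_derivative_within_alt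
    proof (intro conjI allI impI)
      show "bounded_linear ((*) (F z))" by (rule bounded_linear_mult_right)
      fix e :: real assume e: "0 < e"
      have "isCont F z" using c by (simp add: continuous_on_eq_continuous_at)
      then obtain d where d: "0 < d" "\<And>w. cmod (w - z) < d \<Longrightarrow> cmod (F w - F z) < e / 2"
        unfolding continuous_at_eps_delta dist_norm using e half_gt_zero by metis
      obtain d2 where d2: "0 < d2" "ball z d2 \<subseteq> ball z0 1" using zb open_ball openE by blast
      show "\<exists>d>0. \<forall>y\<in>UNIV. norm (y - z) < d \<longrightarrow> norm (P y - P z - F z * (y - z)) \<le> e * norm (y - z)"
      proof (intro exI[of _ "min (d/2) d2"] conjI ballI impI)
        show "0 < min (d/2) d2" using d d2 by auto
        fix w assume w: "cmod (w - z) < min (d/2) d2"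
        then have wb: "w \<in> ball z0 1" using d2 by (auto simp: dist_norm norm_minus_commute subset_iff)
        define h1 h2 where "h1 = Re w - Re z" and "h2 = Im w - Im z"
        have h: "\<bar>h1\<bar> \<le> cmod (w - z)" "\<bar>h2\<bar> \<le> cmod (w - z)"
          using abs_Re_le_cmod[of "w - z"] abs_Im_le_cmod[of "w - z"] by (auto simp: h1_def h2_def)
        have near: "cmod (F v - F z) \<le> e / 2" if "\<bar>Re v - Re z\<bar> \<le> cmod (w - z)" "\<bar>Im v - Im z\<bar> \<le> cmod (w - z)" for v
        proof -
          have "cmod (v - z) \<le> \<bar>Re (v - z)\<bar> + \<bar>Im (v - z)\<bar>" by (rule cmod_le)
          then have "cmod (v - z) < d" using that w by simp
          then show ?thesis using d(2) less_imp_le by blast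
        qed
        have I1: "cmod (integral {a..Re w} (\<lambda>x. F (Complex x (Im w))) - integral {a..Re z} (\<lambda>x. F (Complex x (Im w))) - of_real h1 * F z) \<le> e / 2 * \<bar>h1\<bar>"
          unfolding h1_def
        proof (rule integral_increment)
          show "cmod (F (Complex t (Im w)) - F z) \<le> e / 2" if "\<bar>t - Re z\<bar> \<le> \<bar>Re w - Re z\<bar>" for t
            using that h by (intro near) (auto simp: h1_def h2_def)
        qed (use inb[OF zb] inb[OF wb] continuous_lines[OF c] in auto)
        have I2: "cmod (integral {b..Im w} (\<lambda>y. F (Complex (Re z) y)) - integral {b..Im z} (\<lambda>y. F (Complex (Re z) y)) - of_real h2 * F z) \<le> e / 2 * \<bar>h2\<bar>"
          unfolding h2_def
        proof (rule integral_increment)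
          show "cmod (F (Complex (Re z) t) - F z) \<le> e / 2" if "\<bar>t - Im z\<bar> \<le> \<bar>Im w - Im z\<bar>" for t
            using that h by (intro near) (auto simp: h1_def h2_def)
        qed (use inb[OF zb] inb[OF wb] continuous_lines[OF c] in auto)
        define q where "q = Complex (Re z) (Im w)"
        have q: "Re q = Re z" "Im q = Im w" by (auto simp: q_def)
        have "P w - P q = integral {a..Re w} (\<lambda>x. F (Complex x (Im w))) - integral {a..Re z} (\<lambda>x. F (Complex x (Im w)))"
          using P2[of w] P2[of q] inb[OF zb] inb[OF wb] by (simp add: q)
        moreover have "P q - P z = \<i> * (integral {b..Im w} (\<lambda>y. F (Complex (Re z) y)) - integral {b..Im z} (\<lambda>y. F (Complex (Re z) y)))"
          by (simp add: P_def q right_diff_distrib)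
        moreover have "w - z = of_real h1 + \<i> * of_real h2" by (simp add: complex_eq_iff h1_def h2_def)
        ultimately have "P w - P z - F z * (w - z) =
           (integral {a..Re w} (\<lambda>x. F (Complex x (Im w))) - integral {a..Re z} (\<lambda>x. F (Complex x (Im w))) - of_real h1 * F z)
           + \<i> * (integral {b..Im w} (\<lambda>y. F (Complex (Re z) y)) - integral {b..Im z} (\<lambda>y. F (Complex (Re z) y)) - of_real h2 * F z)"
          by (simp add: algebra_simps)
        then have "cmod (P w - P z - F z * (w - z)) \<le> e / 2 * \<bar>h1\<bar> + e / 2 * \<bar>h2\<bar>"
        proof -
          have "cmod (X + \<i> * Y) \<le> a + b" if "cmod X \<le> a" "cmod Y \<le> b" for X Y a b
            using that norm_triangle_ineq[of X "\<i> * Y"] by (simp add: norm_mult)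
          then show ?thesis using I1 I2 \<open>P w - P z - F z * (w - z) = _\<close> by simp
        qed
        also have "\<dots> \<le> e / 2 * cmod (w - z) + e / 2 * cmod (w - z)" using h e by (intro add_mono mult_left_mono) auto
        finally show "cmod (P w - P z - F z * (w - z)) \<le> e * cmod (w - z)" by simp
      qed
    qed
    have "P holomorphic_on ball z0 1" using der by (subst holomorphic_on_open) blast+
    then have "deriv P holomorphic_on ball z0 1" by (intro holomorphic_deriv) auto
    then have "F holomorphic_on ball z0 1"
      by (rule holomorphic_transform) (use der DERIV_imp_deriv in blast)
    then show ?thesis by (rule holomorphic_on_imp_differentiable_at) auto
  qed
  then show ?thesis by (simp add: holomorphic_on_def field_differentiable_at_within)
qed

lemma card_near_interval:
  fixes I :: "nat set"
  assumes "\<And>i j. i \<in> I \<Longrightarrow> j \<in> I \<Longrightarrow> \<bar>real i - real j\<bar> \<le> real Q"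
  shows "finite I" "card I \<le> 2 * Q + 1"
proof -
  have "I \<subseteq> {} \<or> (\<exists>i0. I \<subseteq> {i0 - Q..i0 + Q})"
  proof (cases "I = {}")
    case False
    then obtain i0 where i0: "i0 \<in> I" by blast
    have "j \<in> {i0 - Q..i0 + Q}" if "j \<in> I" for j
    proof -
      have "\<bar>real i0 - real j\<bar> \<le> real Q" by (rule assms[OF i0 that])
      then have "real i0 \<le> real (j + Q)" "real j \<le> real (i0 + Q)" by auto
      then show ?thesis unfolding of_nat_le_iff by auto
    qed
    then show ?thesis by blast
  qed auto
  then obtain i0 where i0: "I \<subseteq> {i0 - Q..i0 + Q}" by blast
  then show "finite I" using finite_subset by blast
  have "card I \<le> card {i0 - Q..i0 + Q}" using i0 by (intro card_mono) auto
  then show "card I \<le> 2 * Q + 1" by auto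
qed

text \<open>Only O(n) of the cells of an n by n grid meet the curve, and each contributes o(1/n).\<close>
lemma removable_thin_set:
  assumes cl: "closed S" and cover: "\<And>n::nat. 0 < n \<Longrightarrow> \<exists>P. finite P \<and> card P \<le> N * n \<and> S \<subseteq> (\<Union>p\<in>P. cball p (C / real n))"
    and c: "continuous_on UNIV F" and hol: "F holomorphic_on (- S)"
  shows "F holomorphic_on UNIV"
proof (rule holomorphic_of_rect_int_zero[OF c])
  fix x1 x2 y1 y2 :: real assume lt: "x1 < x2" "y1 < y2"
  define w h where "w = x2 - x1" and "h = y2 - y1"
  have wh: "0 < w" "0 < h" using lt by (auto simp: w_def h_def)
  \<comment> \<open>Bounds the index difference of two grid columns, or rows, met by one disc of
    radius C/n: the diameter in units of the mesh width, plus one for the width of a cell. It does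
    not depend on n.\<close>
  define Q where "Q = nat \<lceil>2 * \<bar>C\<bar> / w + 1\<rceil> + nat \<lceil>2 * \<bar>C\<bar> / h + 1\<rceil>"
  have Q: "2 * \<bar>C\<bar> / w + 1 \<le> real Q" "2 * \<bar>C\<bar> / h + 1 \<le> real Q" unfolding Q_def by linarith+
  define K where "K = real (N * ((2 * Q + 1) * (2 * Q + 1)))"
  have "cmod (rect_int F x1 x2 y1 y2) \<le> K * (w + h) * e" if e: "0 < e" for e
  proof -
    have "compact (cbox (Complex x1 y1) (Complex x2 y2))" by simp
    then have "uniformly_continuous_on (cbox (Complex x1 y1) (Complex x2 y2)) F"
      using c by (intro compact_uniformly_continuous) (auto intro: continuous_on_subset)
    then obtain d where d: "0 < d" "\<And>u v. u \<in> rect x1 x2 y1 y2 \<Longrightarrow> v \<in> rect x1 x2 y1 y2 \<Longrightarrow> dist v u < d \<Longrightarrow> dist (F v) (F u) < e"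
      unfolding uniformly_continuous_on_def using e by (auto simp: rect_def in_cbox_complex_iff)
    obtain n0 :: nat where "(w + h) / d < real n0" using reals_Archimedean2 by blast
    define n where "n = Suc n0"
    have n: "0 < n" "(w + h) / real n < d"
    proof -
      show "0 < n" by (simp add: n_def)
      have "(w + h) / d < real n" using \<open>(w + h) / d < real n0\<close> by (simp add: n_def)
      then show "(w + h) / real n < d" using d(1) by (simp add: field_simps n_def)
    qed
    define cell where "cell i j = rect (x1 + real i * (w / real n)) (x1 + real (Suc i) * (w / real n)) (y1 + real j * (h / real n)) (y1 + real (Suc j) * (h / real n))" for i j
    define ri where "ri i j = rect_int F (x1 + real i * (w / real n)) (x1 + real (Suc i) * (w / real n)) (y1 + real j * (h / real n)) (y1 + real (Suc j) * (h / real n))" for i j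
    have eq: "rect_int F x1 x2 y1 y2 = (\<Sum>i<n. \<Sum>j<n. ri i j)"
    proof -
      have "x2 = x1 + real n * (w / real n)" "y2 = y1 + real n * (h / real n)" using n by (auto simp: w_def h_def)
      then show ?thesis unfolding ri_def using rect_int_grid[OF c, of "w / real n" "h / real n" x1 n y1 n] wh by simp
    qed
    define H where "H = {(i, j). i < n \<and> j < n \<and> cell i j \<inter> S \<noteq> {}}"
    have zero: "ri i j = 0" if "i < n" "j < n" "(i, j) \<notin> H" for i j
      unfolding ri_def using that wh cl
      by (intro rect_int_holomorphic[OF c _ _ hol]) (auto simp: H_def cell_def divide_right_mono)
    have cellsub: "cell i j \<subseteq> rect x1 x2 y1 y2" if "i < n" "j < n" for i j
    proof -
      have "real (Suc i) * (w / real n) \<le> real n * (w / real n)" "real (Suc j) * (h / real n) \<le> real n * (h / real n)"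
        using that wh by (intro mult_right_mono; simp)+
      moreover have "0 \<le> real i * (w / real n)" "0 \<le> real j * (h / real n)" using wh by auto
      ultimately show ?thesis using n unfolding cell_def rect_def by (auto simp: w_def h_def)
    qed
    have small: "cmod (ri i j) \<le> e * ((w + h) / real n)" if "i < n" "j < n" for i j
    proof -
      have "cmod (ri i j) \<le> e * ((x1 + real (Suc i) * (w / real n) - (x1 + real i * (w / real n))) + (y1 + real (Suc j) * (h / real n) - (y1 + real j * (h / real n))))"
        unfolding ri_def
      proof (rule rect_int_bound[OF c])
        fix u v assume uv: "u \<in> rect (x1 + real i * (w / real n)) (x1 + real (Suc i) * (w / real n)) (y1 + real j * (h / real n)) (y1 + real (Suc j) * (h / real n))"
          "v \<in> rect (x1 + real i * (w / real n)) (x1 + real (Suc i) * (w / real n)) (y1 + real j * (h / real n)) (y1 + real (Suc j) * (h / real n))"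
        then have "\<bar>Re (u - v)\<bar> \<le> w / real n" "\<bar>Im (u - v)\<bar> \<le> h / real n"
          unfolding rect_def by (auto simp: distrib_right abs_le_iff add_divide_distrib)
        then have "cmod (u - v) \<le> (w + h) / real n" using cmod_le[of "u - v"] by (simp add: add_divide_distrib)
        then have "dist u v < d" using n by (simp add: dist_norm)
        moreover have "u \<in> rect x1 x2 y1 y2" "v \<in> rect x1 x2 y1 y2" using uv cellsub[OF that] unfolding cell_def by blast+
        ultimately show "cmod (F u - F v) \<le> e" using d(2)[of v u] by (simp add: dist_norm)
      qed (use wh in \<open>auto simp: distrib_right add_divide_distrib\<close>)
      also have "\<dots> = e * ((w + h) / real n)" by (simp add: distrib_right add_divide_distrib)
      finally show ?thesis .
    qed
    obtain P where P: "finite P" "card P \<le> N * n" "S \<subseteq> (\<Union>p\<in>P. cball p (C / real n))" using cover[OF n(1)] by blast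
    define Ip where "Ip p = {i. \<exists>q\<in>cball p (C / real n). x1 + real i * (w / real n) \<le> Re q \<and> Re q \<le> x1 + real (Suc i) * (w / real n)}" for p
    define Jp where "Jp p = {j. \<exists>q\<in>cball p (C / real n). y1 + real j * (h / real n) \<le> Im q \<and> Im q \<le> y1 + real (Suc j) * (h / real n)}" for p
    have index: "\<bar>real i - real j\<bar> \<le> real Q"
      if ij: "b + real i * (s / real n) \<le> t" "t \<le> b + real (Suc i) * (s / real n)" "b + real j * (s / real n) \<le> t'" "t' \<le> b + real (Suc j) * (s / real n)"
        and s: "0 < s" "2 * \<bar>C\<bar> / s + 1 \<le> real Q" and t: "\<bar>t - t'\<bar> \<le> 2 * (\<bar>C\<bar> / real n)" for i j :: nat and b s t t' :: real
    proof -
      have "\<bar>real i - real j\<bar> * (s / real n) = \<bar>(real i - real j) * (s / real n)\<bar>" using s by (simp add: abs_mult)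
      also have "\<dots> \<le> 2 * (\<bar>C\<bar> / real n) + s / real n"
        using ij t by (auto simp: distrib_right left_diff_distrib abs_le_iff add_divide_distrib diff_divide_distrib)
      finally have "\<bar>real i - real j\<bar> * (s / real n) \<le> (2 * \<bar>C\<bar> / s + 1) * (s / real n)" using s by (simp add: distrib_right add_divide_distrib)
      then have "\<bar>real i - real j\<bar> \<le> 2 * \<bar>C\<bar> / s + 1" using s n by (simp add: mult_le_cancel_right divide_simps)
      then show ?thesis using s by linarith
    qed
    have near: "\<bar>Re q - Re q'\<bar> \<le> 2 * (\<bar>C\<bar> / real n)" "\<bar>Im q - Im q'\<bar> \<le> 2 * (\<bar>C\<bar> / real n)"
      if "q \<in> cball p (C / real n)" "q' \<in> cball p (C / real n)" for p q q'
    proof -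
      have "C / real n \<le> \<bar>C\<bar> / real n" by (intro divide_right_mono) auto
      then have "cmod (q - q') \<le> 2 * (\<bar>C\<bar> / real n)"
        using that dist_triangle2[of q q' p] by (simp add: dist_norm[symmetric] dist_commute)
      then show "\<bar>Re q - Re q'\<bar> \<le> 2 * (\<bar>C\<bar> / real n)" "\<bar>Im q - Im q'\<bar> \<le> 2 * (\<bar>C\<bar> / real n)"
        using abs_Re_le_cmod[of "q - q'"] abs_Im_le_cmod[of "q - q'"] by auto
    qed
    have Icard: "finite (Ip p)" "card (Ip p) \<le> 2 * Q + 1" for p
    proof -
      have *: "\<bar>real i - real j\<bar> \<le> real Q" if "i \<in> Ip p" "j \<in> Ip p" for i j
        using that index[OF _ _ _ _ wh(1) Q(1) near(1)] unfolding Ip_def by blast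
      show "finite (Ip p)" "card (Ip p) \<le> 2 * Q + 1" using card_near_interval[OF *] by blast+
    qed
    have Jcard: "finite (Jp p)" "card (Jp p) \<le> 2 * Q + 1" for p
    proof -
      have *: "\<bar>real i - real j\<bar> \<le> real Q" if "i \<in> Jp p" "j \<in> Jp p" for i j
        using that index[OF _ _ _ _ wh(2) Q(2) near(2)] unfolding Jp_def by blast
      show "finite (Jp p)" "card (Jp p) \<le> 2 * Q + 1" using card_near_interval[OF *] by blast+
    qed
    have "H \<subseteq> (\<Union>p\<in>P. Ip p \<times> Jp p)"
    proof
      fix ij assume "ij \<in> H"
      then obtain i j q where ij: "ij = (i, j)" "q \<in> cell i j" "q \<in> S" by (auto simp: H_def)
      then obtain p where "p \<in> P" "q \<in> cball p (C / real n)" using P(3) by blast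
      then show "ij \<in> (\<Union>p\<in>P. Ip p \<times> Jp p)" using ij unfolding cell_def rect_def Ip_def Jp_def by blast
    qed
    then have "card H \<le> card (\<Union>p\<in>P. Ip p \<times> Jp p)" using P(1) Icard Jcard by (intro card_mono) auto
    also have "\<dots> \<le> (\<Sum>p\<in>P. card (Ip p \<times> Jp p))" by (rule card_UN_le[OF P(1)])
    also have "\<dots> \<le> (\<Sum>p\<in>P. (2 * Q + 1) * (2 * Q + 1))"
      unfolding card_cartesian_product using Icard Jcard by (intro sum_mono mult_mono) auto
    also have "\<dots> \<le> (N * n) * ((2 * Q + 1) * (2 * Q + 1))"
      unfolding sum_constant of_nat_id by (rule mult_right_mono[OF P(2)]) simp
    finally have "real (card H) \<le> real ((N * n) * ((2 * Q + 1) * (2 * Q + 1)))" by (simp only: of_nat_le_iff)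
    then have cardH: "real (card H) \<le> K * real n" unfolding K_def by (simp only: of_nat_mult ac_simps)
    have Hsub: "H \<subseteq> {..<n} \<times> {..<n}" by (auto simp: H_def)
    have "rect_int F x1 x2 y1 y2 = (\<Sum>(i, j)\<in>{..<n} \<times> {..<n}. ri i j)" unfolding eq by (rule sum.cartesian_product)
    also have "\<dots> = (\<Sum>(i, j)\<in>H. ri i j)"
      by (rule sum.mono_neutral_right) (use Hsub zero in auto)
    also have "cmod \<dots> \<le> (\<Sum>ij\<in>H. e * ((w + h) / real n))"
      by (rule order_trans[OF norm_sum sum_mono]) (use Hsub small in auto)
    also have "\<dots> = real (card H) * (e * ((w + h) / real n))" by simp
    also have "\<dots> \<le> (K * real n) * (e * ((w + h) / real n))" using cardH e wh by (intro mult_right_mono) auto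
    also have "\<dots> = K * (w + h) * e" using n by simp
    finally show ?thesis .
  qed
  then have "cmod (rect_int F x1 x2 y1 y2) \<le> 0 + e" if "0 < e" for e
  proof -
    have Kp: "0 < K * (w + h) + 1" using wh by (auto simp: K_def intro!: add_nonneg_pos)
    have "cmod (rect_int F x1 x2 y1 y2) \<le> K * (w + h) * (e / (K * (w + h) + 1))"
      using \<open>\<And>e. 0 < e \<Longrightarrow> cmod (rect_int F x1 x2 y1 y2) \<le> K * (w + h) * e\<close>[of "e / (K * (w + h) + 1)"] Kp that by simp
    also have "\<dots> \<le> e" using Kp that by (simp add: divide_le_eq mult.commute)
    finally show ?thesis by simp
  qed
  then have "cmod (rect_int F x1 x2 y1 y2) \<le> 0" by (rule field_le_epsilon)
  then show "rect_int F x1 x2 y1 y2 = 0" by simp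
qed

section \<open>Systems of closed curves\<close>

lemma periodic_add_int:
  fixes f :: "real \<Rightarrow> 'a"
  assumes "\<And>t. f (t + p) = f t"
  shows "f (t + of_int n * p) = f t"
proof -
  interpret periodic_fun_simple f p by standard (rule assms)
  show ?thesis by (rule plus_of_int)
qed

lemma periodic_representative:
  fixes t a :: real
  obtains n :: int where "a \<le> t + of_int n * (2 * pi)" "t + of_int n * (2 * pi) < a + 2 * pi"
proof -
  define n where "n = - \<lfloor>(t - a) / (2 * pi)\<rfloor>"
  have "of_int \<lfloor>(t - a) / (2 * pi)\<rfloor> \<le> (t - a) / (2 * pi)" "(t - a) / (2 * pi) < of_int \<lfloor>(t - a) / (2 * pi)\<rfloor> + 1" by linarith+
  then have "of_int \<lfloor>(t - a) / (2 * pi)\<rfloor> * (2 * pi) \<le> t - a" "t - a < (of_int \<lfloor>(t - a) / (2 * pi)\<rfloor> + 1) * (2 * pi)"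
    using pos_le_divide_eq[of "2 * pi" "of_int \<lfloor>(t - a) / (2 * pi)\<rfloor>" "t - a"]
      pos_divide_less_eq[of "2 * pi" "t - a" "of_int \<lfloor>(t - a) / (2 * pi)\<rfloor> + 1"] pi_gt_zero by auto
  then show ?thesis by (intro that[of n]) (auto simp: n_def distrib_right)
qed

lemma periodic_derivative:
  fixes f :: "real \<Rightarrow> 'a::real_normed_vector"
  assumes "\<And>t. f (t + p) = f t" "\<And>t. (f has_vector_derivative f' t) (at t)"
  shows "f' (t + p) = f' t"
proof -
  have "((\<lambda>t. t + p) has_vector_derivative 1) (at t)" by (auto intro!: derivative_eq_intros)
  then have "(f \<circ> (\<lambda>t. t + p) has_vector_derivative 1 *\<^sub>R f' (t + p)) (at t)"
    by (rule vector_diff_chain_at) (rule assms(2))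
  moreover have "f \<circ> (\<lambda>t. t + p) = f" using assms(1) by auto
  ultimately show ?thesis using vector_derivative_unique_at[OF _ assms(2)] by fastforce
qed

lemma periodic_bounded:
  fixes f :: "real \<Rightarrow> 'a::real_normed_vector"
  assumes "continuous_on UNIV f" "\<And>t. f (t + 2 * pi) = f t"
  shows "\<exists>B. \<forall>t. norm (f t) \<le> B"
proof -
  have "compact (f ` {0..2*pi})" using assms(1) by (intro compact_continuous_image) (auto intro: continuous_on_subset)
  then obtain B where B: "\<And>t. t \<in> {0..2*pi} \<Longrightarrow> norm (f t) \<le> B" using compact_imp_bounded bounded_iff by (metis imageI)
  have "norm (f t) \<le> B" for t
  proof -
    obtain n :: int where "0 \<le> t + of_int n * (2 * pi)" "t + of_int n * (2 * pi) < 0 + 2 * pi" by (rule periodic_representative)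
    then have "norm (f (t + of_int n * (2 * pi))) \<le> B" by (intro B) auto
    then show ?thesis by (simp add: periodic_add_int[of f "2 * pi", OF assms(2)])
  qed
  then show ?thesis by blast
qed

lemma uniform_bound_lessThan:
  fixes g :: "nat \<Rightarrow> 'a \<Rightarrow> real"
  assumes "\<And>k. k < m \<Longrightarrow> \<exists>B. \<forall>t. g k t \<le> B"
  obtains B where "1 \<le> B" "\<And>k t. k < m \<Longrightarrow> g k t \<le> B"
proof -
  obtain B where B: "\<And>k t. k < m \<Longrightarrow> g k t \<le> B k" using assms by metis
  have "g k t \<le> 1 + (\<Sum>k<m. \<bar>B k\<bar>)" if "k < m" for k t
    using B[OF that, of t] member_le_sum[of k "{..<m}" "\<lambda>k. \<bar>B k\<bar>"] that by auto
  then show ?thesis using that[of "1 + (\<Sum>k<m. \<bar>B k\<bar>)"] by (simp add: sum_nonneg)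
qed

lemma lipschitz_of_derivative:
  fixes f :: "real \<Rightarrow> 'a::real_normed_vector"
  assumes "\<And>t. (f has_vector_derivative f' t) (at t)" "\<And>t. norm (f' t) \<le> B"
  shows "norm (f t - f s) \<le> B * \<bar>t - s\<bar>"
proof -
  have "norm (f t - f s) \<le> B * norm (t - s)"
  proof (rule differentiable_bound[of UNIV f "\<lambda>t h. h *\<^sub>R f' t"])
    show "(f has_derivative (\<lambda>h. h *\<^sub>R f' x)) (at x within UNIV)" for x
      using assms(1) by (simp add: has_vector_derivative_def)
    show "onorm (\<lambda>h. h *\<^sub>R f' x) \<le> B" for x
    proof (rule onorm_le)
      show "norm (h *\<^sub>R f' x) \<le> B * norm h" for h
        using mult_right_mono[OF assms(2)[of x] abs_ge_zero[of h]] by (simp add: mult.commute)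
    qed
  qed auto
  then show ?thesis by simp
qed

text \<open>The piece over [0, a] is moved by one period. This allows windows centred at a
  singularity.\<close>

lemma periodic_window_integral:
  fixes f :: "real \<Rightarrow> 'a::euclidean_space"
  assumes per: "\<And>t. f (t + 2 * pi) = f t" and int: "f integrable_on {0..2*pi}" and a: "0 \<le> a" "a \<le> 2 * pi"
  shows "(f has_integral integral {0..2*pi} f) {a..a + 2 * pi}"
proof -
  have i1: "f integrable_on {0..a}" and i2: "f integrable_on {a..2*pi}"
    using a by (auto intro: integrable_on_subinterval[OF int])
  have fs: "f \<circ> (+) (2 * pi) = f" using per by (auto simp: add.commute)
  have "(f has_integral integral {0..a} f) {0..a}" using i1 by (rule integrable_integral)
  then have "((f \<circ> (+) (2 * pi)) has_integral integral {0..a} f) (cbox 0 a)" unfolding fs by simp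
  then have "(f has_integral integral {0..a} f) (cbox (0 + 2 * pi) (a + 2 * pi))" by (simp only: has_integral_shift_cbox_iff)
  then have "(f has_integral integral {0..a} f) {2*pi..a + 2 * pi}" by simp
  then have "(f has_integral integral {a..2*pi} f + integral {0..a} f) {a..a + 2 * pi}"
    using has_integral_combine[OF a(2) _ integrable_integral[OF i2]] a by fastforce
  moreover have "integral {a..2*pi} f + integral {0..a} f = integral {0..2*pi} f"
    using Henstock_Kurzweil_Integration.integral_combine[OF a int] by (simp add: add.commute)
  ultimately show ?thesis by simp
qed

locale curves =
  fixes m :: nat and \<eta> \<eta>1 \<eta>2 :: "nat \<Rightarrow> real \<Rightarrow> complex"
  assumes m_pos: "m \<ge> 1"
    and periodic: "\<And>k t. k < m \<Longrightarrow> \<eta> k (t + 2*pi) = \<eta> k t"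
    and d1: "\<And>k t. k < m \<Longrightarrow> (\<eta> k has_vector_derivative \<eta>1 k t) (at t)"
    and d2: "\<And>k t. k < m \<Longrightarrow> (\<eta>1 k has_vector_derivative \<eta>2 k t) (at t)"
    and d2_cont: "\<And>k. k < m \<Longrightarrow> continuous_on UNIV (\<eta>2 k)"
    and d1_nz: "\<And>k t. k < m \<Longrightarrow> \<eta>1 k t \<noteq> 0"
    and simple: "\<And>k. k < m \<Longrightarrow> simple_path (bloop \<eta> k)"
    and disjoint: "\<And>j k. j < m \<Longrightarrow> k < m \<Longrightarrow> j \<noteq> k \<Longrightarrow> Gam_k \<eta> j \<inter> Gam_k \<eta> k = {}"
    and not_nested: "\<And>j k. j < m \<Longrightarrow> k < m \<Longrightarrow> j \<noteq> k \<Longrightarrow> Gam_k \<eta> j \<inter> inside (Gam_k \<eta> k) = {}"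
    and clockwise: "\<And>k z. k < m \<Longrightarrow> z \<in> inside (Gam_k \<eta> k) \<Longrightarrow> winding_number (bloop \<eta> k) z = -1"
begin

section \<open>Uniform estimates for the parametrisations\<close>

lemma periodic1: "k < m \<Longrightarrow> \<eta>1 k (t + 2*pi) = \<eta>1 k t"
  by (rule periodic_derivative[of "\<eta> k"]) (auto intro: periodic d1)

lemma periodic2: "k < m \<Longrightarrow> \<eta>2 k (t + 2*pi) = \<eta>2 k t"
  by (rule periodic_derivative[of "\<eta>1 k"]) (auto intro: periodic1 d2)

lemma cont_\<eta>: "k < m \<Longrightarrow> continuous_on S (\<eta> k)"
  using d1 by (intro continuous_at_imp_continuous_on ballI) (blast intro: has_vector_derivative_continuous)

lemma cont_\<eta>1: "k < m \<Longrightarrow> continuous_on S (\<eta>1 k)"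
  using d2 by (intro continuous_at_imp_continuous_on ballI) (blast intro: has_vector_derivative_continuous)

lemma shift_\<eta>:
  assumes "k < m"
  shows "\<eta> k (t + of_int n * (2 * pi)) = \<eta> k t" "\<eta>1 k (t + of_int n * (2 * pi)) = \<eta>1 k t"
  using periodic_add_int[of "\<eta> k" "2 * pi"] periodic_add_int[of "\<eta>1 k" "2 * pi"] periodic periodic1 assms by auto

lemma derivative_bounds:
  obtains B where "1 \<le> B" "\<And>k t. k < m \<Longrightarrow> cmod (\<eta>1 k t) \<le> B" "\<And>k t. k < m \<Longrightarrow> cmod (\<eta>2 k t) \<le> B"
    "\<And>k t. k < m \<Longrightarrow> 1 / B \<le> cmod (\<eta>1 k t)"
proof -
  define g where "g k t = cmod (\<eta>1 k t) + cmod (\<eta>2 k t) + cmod (inverse (\<eta>1 k t))" for k t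
  have "\<exists>B. \<forall>t. g k t \<le> B" if k: "k < m" for k
  proof -
    obtain B1 where "\<forall>t. cmod (\<eta>1 k t) \<le> B1" using periodic_bounded[OF cont_\<eta>1[OF k] periodic1[OF k]] by blast
    moreover obtain B2 where "\<forall>t. cmod (\<eta>2 k t) \<le> B2" using periodic_bounded[OF d2_cont[OF k] periodic2[OF k]] by blast
    moreover have "continuous_on UNIV (\<lambda>t. inverse (\<eta>1 k t))" using k d1_nz by (intro continuous_intros cont_\<eta>1) auto
    then obtain B3 where "\<forall>t. cmod (inverse (\<eta>1 k t)) \<le> B3" using periodic_bounded[of "\<lambda>t. inverse (\<eta>1 k t)"] periodic1[OF k] by auto
    ultimately show ?thesis unfolding g_def by (intro exI[of _ "B1 + B2 + B3"] allI add_mono) auto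
  qed
  then obtain B where B: "1 \<le> B" "\<And>k t. k < m \<Longrightarrow> g k t \<le> B" by (rule uniform_bound_lessThan) auto
  have "cmod (\<eta>1 k t) \<le> B" "cmod (\<eta>2 k t) \<le> B" "1 / B \<le> cmod (\<eta>1 k t)" if "k < m" for k t
  proof -
    have *: "cmod (\<eta>1 k t) \<le> B" "cmod (\<eta>2 k t) \<le> B" "cmod (inverse (\<eta>1 k t)) \<le> B"
      using B(2)[OF that, of t] norm_ge_zero[of "\<eta>1 k t"] norm_ge_zero[of "\<eta>2 k t"] norm_ge_zero[of "inverse (\<eta>1 k t)"]
      unfolding g_def by linarith+
    then show "cmod (\<eta>1 k t) \<le> B" "cmod (\<eta>2 k t) \<le> B" by auto
    have "0 < cmod (\<eta>1 k t)" using d1_nz[OF that] by simp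
    then have "inverse (cmod (\<eta>1 k t)) * cmod (\<eta>1 k t) \<le> B * cmod (\<eta>1 k t)"
      using *(3) by (intro mult_right_mono) (auto simp: norm_inverse)
    then show "1 / B \<le> cmod (\<eta>1 k t)" using \<open>0 < cmod (\<eta>1 k t)\<close> B(1) by (simp add: divide_le_eq mult.commute)
  qed
  then show ?thesis using that[OF B(1)] by blast
qed

lemma taylor_bounds:
  obtains B where "1 \<le> B" "\<And>k t. k < m \<Longrightarrow> cmod (\<eta>1 k t) \<le> B" "\<And>k t. k < m \<Longrightarrow> 1 / B \<le> cmod (\<eta>1 k t)"
    "\<And>k t s. k < m \<Longrightarrow> cmod (\<eta> k t - \<eta> k s) \<le> B * \<bar>t - s\<bar>"
    "\<And>k t s. k < m \<Longrightarrow> cmod (\<eta>1 k t - \<eta>1 k s) \<le> B * \<bar>t - s\<bar>"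
    "\<And>k t s. k < m \<Longrightarrow> cmod (\<eta> k t - \<eta> k s - of_real (t - s) * \<eta>1 k s) \<le> B * (t - s)\<^sup>2"
proof -
  obtain B where B: "1 \<le> B" "\<And>k t. k < m \<Longrightarrow> cmod (\<eta>1 k t) \<le> B" "\<And>k t. k < m \<Longrightarrow> cmod (\<eta>2 k t) \<le> B"
    "\<And>k t. k < m \<Longrightarrow> 1 / B \<le> cmod (\<eta>1 k t)" using derivative_bounds by blast
  have l1: "cmod (\<eta>1 k t - \<eta>1 k s) \<le> B * \<bar>t - s\<bar>" if "k < m" for k t s
    using d2[OF that] B(3)[OF that] by (rule lipschitz_of_derivative)
  have "cmod (\<eta> k t - \<eta> k s - of_real (t - s) * \<eta>1 k s) \<le> B * (t - s)\<^sup>2" if "k < m" for k t s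
  proof -
    have "norm (\<eta> k t - \<eta> k s - (t - s) *\<^sub>R \<eta>1 k s) \<le> norm (t - s) * (B * \<bar>t - s\<bar>)"
    proof (rule vector_differentiable_bound_linearization)
      show "(\<eta> k has_vector_derivative \<eta>1 k x) (at x within closed_segment s t)" for x
        using d1[OF that] has_vector_derivative_at_within by blast
      fix x assume "x \<in> closed_segment s t"
      then have "\<bar>x - s\<bar> \<le> \<bar>t - s\<bar>" by (auto simp: closed_segment_eq_real_ivl split: if_splits)
      then have "B * \<bar>x - s\<bar> \<le> B * \<bar>t - s\<bar>" using B(1) by (intro mult_left_mono) auto
      then show "norm (\<eta>1 k x - \<eta>1 k s) \<le> B * \<bar>t - s\<bar>" using l1[OF that, of x s] by linarith
    qed auto
    also have "norm (t - s) * (B * \<bar>t - s\<bar>) = B * (t - s)\<^sup>2" by (simp add: power2_eq_square)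
    finally show ?thesis by (simp add: scaleR_conv_of_real)
  qed
  moreover have "cmod (\<eta> k t - \<eta> k s) \<le> B * \<bar>t - s\<bar>" if "k < m" for k t s
    using d1[OF that] B(2)[OF that] by (rule lipschitz_of_derivative)
  ultimately show ?thesis using that[OF B(1)] B(2,4) l1 by blast
qed

text \<open>Both parameters are moved into the half-open period [0, 2 pi), which excludes the
  coincidence of endpoints that a simple closed path permits.\<close>

lemma \<eta>_inj_mod:
  assumes "k < m" "\<eta> k t = \<eta> k s"
  obtains n :: int where "t = s + of_int n * (2 * pi)"
proof -
  obtain a :: int where a: "0 \<le> t + of_int a * (2 * pi)" "t + of_int a * (2 * pi) < 0 + 2 * pi" by (rule periodic_representative)
  obtain b :: int where b: "0 \<le> s + of_int b * (2 * pi)" "s + of_int b * (2 * pi) < 0 + 2 * pi" by (rule periodic_representative)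
  define x y where "x = (t + of_int a * (2 * pi)) / (2 * pi)" and "y = (s + of_int b * (2 * pi)) / (2 * pi)"
  have xy: "x \<in> {0..1}" "y \<in> {0..1}" "x < 1" "y < 1" using a b by (auto simp: x_def y_def divide_le_eq)
  have "bloop \<eta> k x = bloop \<eta> k y"
    unfolding bloop_def x_def y_def using shift_\<eta>[OF assms(1)] assms(2) by simp
  then have "x = y"
    using simple[OF assms(1)] xy unfolding simple_path_def loop_free_def by (metis less_irrefl)
  then have "t + of_int a * (2 * pi) = s + of_int b * (2 * pi)" by (simp add: x_def y_def)
  then have "t = s + of_int (b - a) * (2 * pi)" by (simp add: algebra_simps)
  then show ?thesis by (rule that)
qed

lemma \<eta>_eq_imp_eq:
  assumes "k < m" "\<eta> k t = \<eta> k s" "\<bar>t - s\<bar> < 2 * pi"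
  shows "t = s"
proof -
  obtain n :: int where n: "t = s + of_int n * (2 * pi)" using \<eta>_inj_mod[OF assms(1,2)] by blast
  then have "\<bar>of_int n\<bar> * (2 * pi) < 1 * (2 * pi)" using assms(3) by (simp add: abs_mult)
  then have "\<bar>real_of_int n\<bar> < 1" by (simp only: mult_less_cancel_right) auto
  then have "n = 0" by linarith
  then show ?thesis using n by simp
qed

lemma window_representative:
  assumes "k < m"
  obtains t' where "\<bar>t' - s\<bar> \<le> pi" "\<eta> k t' = \<eta> k t" "\<eta>1 k t' = \<eta>1 k t"
proof -
  obtain n :: int where n: "s - pi \<le> t + of_int n * (2 * pi)" "t + of_int n * (2 * pi) < (s - pi) + 2 * pi" by (rule periodic_representative)
  then show ?thesis using that[of "t + of_int n * (2 * pi)"] shift_\<eta>[OF assms] by auto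
qed

lemma \<eta>_in_Gam_k: "k < m \<Longrightarrow> \<eta> k t \<in> Gam_k \<eta> k"
proof -
  assume k: "k < m"
  obtain n :: int where n: "0 \<le> t + of_int n * (2 * pi)" "t + of_int n * (2 * pi) < 0 + 2 * pi" by (rule periodic_representative)
  then have "\<eta> k (t + of_int n * (2 * pi)) \<in> Gam_k \<eta> k" unfolding Gam_k_def by auto
  then show ?thesis using shift_\<eta>[OF k] by simp
qed

lemma \<eta>_in_Gam: "k < m \<Longrightarrow> \<eta> k t \<in> Gam m \<eta>"
  using \<eta>_in_Gam_k unfolding Gam_def by blast

lemma GamE:
  assumes "x \<in> Gam m \<eta>"
  obtains k t where "k < m" "x = \<eta> k t" "t \<in> {0..2*pi}"
  using assms unfolding Gam_def Gam_k_def by auto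

lemma path_image_bloop: "path_image (bloop \<eta> k) = Gam_k \<eta> k"
proof -
  have "path_image (bloop \<eta> k) = \<eta> k ` ((\<lambda>s. 2 * pi * s) ` {0..1})"
    unfolding path_image_def bloop_def image_image ..
  also have "(\<lambda>s. 2 * pi * s) ` {0..1::real} = {0..2*pi}"
    using image_mult_atLeastAtMost[of "2 * pi" 0 1] by simp
  finally show ?thesis by (simp add: Gam_k_def)
qed

lemma compact_Gam_k: "k < m \<Longrightarrow> compact (Gam_k \<eta> k)"
  unfolding Gam_k_def by (intro compact_continuous_image cont_\<eta>) auto

lemma compact_Gam: "compact (Gam m \<eta>)"
  unfolding Gam_def by (intro compact_UN) (auto intro: compact_Gam_k)

lemma curves_separated:
  obtains d where "0 < d" "\<And>j k s t. j < m \<Longrightarrow> k < m \<Longrightarrow> j \<noteq> k \<Longrightarrow> d \<le> cmod (\<eta> j s - \<eta> k t)"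
proof -
  define g where "g jk = inverse (setdist (Gam_k \<eta> (fst jk)) (Gam_k \<eta> (snd jk)))" for jk
  define d where "d = 1 / (1 + (\<Sum>jk\<in>{..<m} \<times> {..<m}. \<bar>g jk\<bar>))"
  have S: "0 < 1 + (\<Sum>jk\<in>{..<m} \<times> {..<m}. \<bar>g jk\<bar>)" by (simp add: add_pos_nonneg sum_nonneg)
  have "d \<le> cmod (\<eta> j s - \<eta> k t)" if jk: "j < m" "k < m" "j \<noteq> k" for j k s t
  proof -
    define D where "D = setdist (Gam_k \<eta> j) (Gam_k \<eta> k)"
    have ne: "Gam_k \<eta> j \<noteq> {}" "Gam_k \<eta> k \<noteq> {}" using \<eta>_in_Gam_k jk by blast+
    have "0 < D" unfolding D_def using setdist_gt_0_compact_closed[OF compact_Gam_k[OF jk(1)] compact_imp_closed[OF compact_Gam_k[OF jk(2)]]]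
      ne disjoint[OF jk] by blast
    have "inverse D \<le> 1 + (\<Sum>jk\<in>{..<m} \<times> {..<m}. \<bar>g jk\<bar>)"
      using member_le_sum[of "(j, k)" "{..<m} \<times> {..<m}" "\<lambda>jk. \<bar>g jk\<bar>"] jk by (auto simp: g_def D_def)
    then have "d \<le> D" unfolding d_def using \<open>0 < D\<close> S by (simp add: field_simps)
    also have "D \<le> dist (\<eta> j s) (\<eta> k t)" unfolding D_def using \<eta>_in_Gam_k jk by (intro setdist_le_dist) auto
    finally show ?thesis by (simp add: dist_norm)
  qed
  then show ?thesis using that[of d] S by (simp add: d_def)
qed

text \<open>Near the diagonal the Taylor expansion gives the lower bound, away from it compactness
  and injectivity do. The restriction to |t - s| \<le> pi excludes pairs one period apart.\<close>

lemma chord_arc: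
  obtains c where "0 < c" "\<And>k t s. k < m \<Longrightarrow> \<bar>t - s\<bar> \<le> pi \<Longrightarrow> c * \<bar>t - s\<bar> \<le> cmod (\<eta> k t - \<eta> k s)"
proof -
  obtain B where B: "1 \<le> B" "\<And>k t. k < m \<Longrightarrow> 1 / B \<le> cmod (\<eta>1 k t)"
    "\<And>k t s. k < m \<Longrightarrow> cmod (\<eta> k t - \<eta> k s - of_real (t - s) * \<eta>1 k s) \<le> B * (t - s)\<^sup>2"
    using taylor_bounds by metis
  \<comment> \<open>Up to this distance the quadratic remainder consumes at most half of the linear
    term.\<close>
  define u0 where "u0 = 1 / (2 * B\<^sup>2)"
  have u0: "0 < u0" using B(1) by (simp add: u0_def)
  have near: "1 / (2 * B) * \<bar>t - s\<bar> \<le> cmod (\<eta> k t - \<eta> k s)" if k: "k < m" and ts: "\<bar>t - s\<bar> \<le> u0" for k t s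
  proof -
    have "cmod (of_real (t - s) * \<eta>1 k s) \<le> cmod (\<eta> k t - \<eta> k s) + cmod (\<eta> k t - \<eta> k s - of_real (t - s) * \<eta>1 k s)"
      using norm_triangle_ineq4[of "\<eta> k t - \<eta> k s" "\<eta> k t - \<eta> k s - of_real (t - s) * \<eta>1 k s"] by simp
    moreover have "\<bar>t - s\<bar> * (1 / B) \<le> cmod (of_real (t - s) * \<eta>1 k s)"
      unfolding norm_mult norm_of_real using B(2)[OF k] by (intro mult_left_mono) auto
    moreover have "B * (t - s)\<^sup>2 \<le> 1 / (2 * B) * \<bar>t - s\<bar>"
    proof -
      have "B * (t - s)\<^sup>2 = (B * \<bar>t - s\<bar>) * \<bar>t - s\<bar>" by (simp add: power2_eq_square)
      also have "\<dots> \<le> (B * u0) * \<bar>t - s\<bar>" using ts B(1) by (intro mult_right_mono mult_left_mono) auto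
      also have "B * u0 = 1 / (2 * B)" using B(1) by (simp add: u0_def power2_eq_square)
      finally show ?thesis .
    qed
    moreover have "\<bar>t - s\<bar> * (1 / B) = 1 / (2 * B) * \<bar>t - s\<bar> + 1 / (2 * B) * \<bar>t - s\<bar>" using B(1) by (simp add: field_simps)
    ultimately show ?thesis using B(3)[OF k, of t s] by linarith
  qed
  define K where "K = {(s, t). s \<in> {0..2*pi} \<and> u0 \<le> \<bar>t - s\<bar> \<and> \<bar>t - s\<bar> \<le> pi}"
  have "compact K"
  proof -
    have "K = ({0..2*pi} \<times> {-pi..3*pi}) \<inter> {p. u0 \<le> \<bar>snd p - fst p\<bar>} \<inter> {p. \<bar>snd p - fst p\<bar> \<le> pi}"
      unfolding K_def by (auto simp: abs_le_iff)
    moreover have "closed {p::real \<times> real. u0 \<le> \<bar>snd p - fst p\<bar>}" "closed {p::real \<times> real. \<bar>snd p - fst p\<bar> \<le> pi}"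
      by (intro closed_Collect_le continuous_intros)+
    ultimately show ?thesis by (simp add: compact_Int_closed compact_Times)
  qed
  define g where "g k p = (if p \<in> K then inverse (cmod (\<eta> k (snd p) - \<eta> k (fst p))) else 0)" for k p
  have "\<exists>B. \<forall>p. g k p \<le> B" if k: "k < m" for k
  proof -
    have nz: "\<eta> k (snd p) - \<eta> k (fst p) \<noteq> 0" if "p \<in> K" for p
      using \<eta>_eq_imp_eq[OF k, of "snd p" "fst p"] that u0 pi_gt_zero by (force simp: K_def)
    have "continuous_on K (\<lambda>p. inverse (cmod (\<eta> k (snd p) - \<eta> k (fst p))))"
      using nz by (intro continuous_intros continuous_on_compose2[OF cont_\<eta>[OF k, of UNIV]]) auto
    then have "bounded ((\<lambda>p. inverse (cmod (\<eta> k (snd p) - \<eta> k (fst p)))) ` K)"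
      using \<open>compact K\<close> compact_continuous_image compact_imp_bounded by blast
    then obtain B where "\<forall>p\<in>K. \<bar>inverse (cmod (\<eta> k (snd p) - \<eta> k (fst p)))\<bar> \<le> B" unfolding bounded_iff by auto
    then show ?thesis unfolding g_def by (intro exI[of _ "\<bar>B\<bar>"]) (auto intro: order_trans[OF abs_ge_self] order_trans)
  qed
  then obtain E where E: "1 \<le> E" "\<And>k p. k < m \<Longrightarrow> g k p \<le> E" by (rule uniform_bound_lessThan) auto
  define c where "c = min (1 / (2 * B)) (1 / (E * pi))"
  have c: "0 < c" using B(1) E(1) by (simp add: c_def)
  have "c * \<bar>t - s\<bar> \<le> cmod (\<eta> k t - \<eta> k s)" if k: "k < m" and ts: "\<bar>t - s\<bar> \<le> pi" for k t s
  proof (cases "\<bar>t - s\<bar> \<le> u0")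
    case True
    have "c * \<bar>t - s\<bar> \<le> 1 / (2 * B) * \<bar>t - s\<bar>" by (intro mult_right_mono) (auto simp: c_def)
    then show ?thesis using near[OF k True] by linarith
  next
    case False
    obtain n :: int where n: "0 \<le> s + of_int n * (2 * pi)" "s + of_int n * (2 * pi) < 0 + 2 * pi" by (rule periodic_representative)
    define p where "p = (s + of_int n * (2 * pi), t + of_int n * (2 * pi))"
    have p: "p \<in> K" using n False ts by (auto simp: K_def p_def)
    then have nz: "\<eta> k (snd p) - \<eta> k (fst p) \<noteq> 0"
      using \<eta>_eq_imp_eq[OF k, of "snd p" "fst p"] u0 pi_gt_zero by (force simp: K_def)
    have "inverse (cmod (\<eta> k (snd p) - \<eta> k (fst p))) \<le> E" using E(2)[OF k, of p] p by (simp add: g_def)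
    then have "1 / E \<le> cmod (\<eta> k (snd p) - \<eta> k (fst p))" using nz E(1) by (simp add: field_simps)
    then have "1 / E \<le> cmod (\<eta> k t - \<eta> k s)" by (simp add: p_def shift_\<eta>[OF k])
    moreover have "c * \<bar>t - s\<bar> \<le> 1 / (E * pi) * pi" using ts E(1) by (intro mult_mono) (auto simp: c_def)
    ultimately show ?thesis by simp
  qed
  then show ?thesis using that[OF c] by blast
qed

text \<open>With u = t - s the denominator is \<open>\<eta>1 k s\<close> times (u - i \<delta>) up
  to a quadratic remainder, so the kernel is that of a half-plane up to an error bounded uniformly
  in \<delta>. This serves for the boundedness of the Neumann kernel (\<delta> = 0), for its jump,
  for \<open>approach\<close>, and for the comparison with the circle.\<close>

lemma local_expansion:
  obtains C \<delta>0 where "0 < C" "0 < \<delta>0"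
    "\<forall>k s t \<delta>. k < m \<longrightarrow> \<bar>t - s\<bar> \<le> pi \<longrightarrow> \<bar>\<delta>\<bar> \<le> \<delta>0 \<longrightarrow> (t \<noteq> s \<or> \<delta> \<noteq> 0) \<longrightarrow>
       \<eta> k t - (\<eta> k s + \<i> * of_real \<delta> * \<eta>1 k s) \<noteq> 0 \<and>
       cmod (\<eta>1 k t / (\<eta> k t - (\<eta> k s + \<i> * of_real \<delta> * \<eta>1 k s)) - 1 / (of_real (t - s) - \<i> * of_real \<delta>)) \<le> C"
proof -
  obtain B where B: "1 \<le> B" "\<And>k t. k < m \<Longrightarrow> cmod (\<eta>1 k t) \<le> B" "\<And>k t. k < m \<Longrightarrow> 1 / B \<le> cmod (\<eta>1 k t)"
    "\<And>k t s. k < m \<Longrightarrow> cmod (\<eta>1 k t - \<eta>1 k s) \<le> B * \<bar>t - s\<bar>"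
    "\<And>k t s. k < m \<Longrightarrow> cmod (\<eta> k t - \<eta> k s - of_real (t - s) * \<eta>1 k s) \<le> B * (t - s)\<^sup>2"
    using taylor_bounds by metis
  obtain c where c: "0 < c" "\<And>k t s. k < m \<Longrightarrow> \<bar>t - s\<bar> \<le> pi \<Longrightarrow> c * \<bar>t - s\<bar> \<le> cmod (\<eta> k t - \<eta> k s)" using chord_arc by blast
  define u0 where "u0 = 1 / (2 * B\<^sup>2)"
  have u0: "0 < u0" using B(1) by (simp add: u0_def)
  \<comment> \<open>Small enough that for |t - s| > u0 the normal displacement takes at most half of
    the lower bound c * u0 for the chord.\<close>
  define \<delta>0 where "\<delta>0 = c * u0 / (2 * B)"
  have \<delta>0: "0 < \<delta>0" using c u0 B(1) by (simp add: \<delta>0_def)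
  define C where "C = 4 * B\<^sup>2 + 2 * B / (c * u0) + 1 / u0"
  have C0: "0 < C" using B(1) c u0 by (auto simp: C_def intro!: add_pos_pos)
  have "\<eta> k t - (\<eta> k s + \<i> * of_real \<delta> * \<eta>1 k s) \<noteq> 0 \<and>
       cmod (\<eta>1 k t / (\<eta> k t - (\<eta> k s + \<i> * of_real \<delta> * \<eta>1 k s)) - 1 / (of_real (t - s) - \<i> * of_real \<delta>)) \<le> C"
    if k: "k < m" and ts: "\<bar>t - s\<bar> \<le> pi" and d: "\<bar>\<delta>\<bar> \<le> \<delta>0" and nz: "t \<noteq> s \<or> \<delta> \<noteq> 0" for k s t \<delta>
  proof -
    define u where "u = t - s"
    define e where "e = \<eta>1 k s"
    define q where "q = of_real u - \<i> * of_real \<delta>"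
    define N where "N = \<eta> k t - (\<eta> k s + \<i> * of_real \<delta> * e)"
    define r where "r = \<eta> k t - \<eta> k s - of_real u * e"
    have Nr: "N = e * q + r" by (simp add: N_def q_def r_def algebra_simps)
    have q0: "q \<noteq> 0" using nz by (auto simp: q_def u_def complex_eq_iff)
    have uq: "\<bar>u\<bar> \<le> cmod q" using abs_Re_le_cmod[of q] by (simp add: q_def)
    have rB: "cmod r \<le> B * u\<^sup>2" using B(5)[OF k, of t s] by (simp add: r_def u_def e_def)
    have eB: "1 / B \<le> cmod e" using B(3)[OF k] by (simp add: e_def)
    have main: "N \<noteq> 0 \<and> cmod (\<eta>1 k t / N - 1 / q) \<le> C"
    proof (cases "\<bar>u\<bar> \<le> u0")
      case True
      have "B * u\<^sup>2 = (B * \<bar>u\<bar>) * \<bar>u\<bar>" by (simp add: power2_eq_square)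
      also have "\<dots> \<le> (B * u0) * cmod q" using True uq B(1) by (intro mult_mono) auto
      also have "B * u0 = 1 / (2 * B)" using B(1) by (simp add: u0_def power2_eq_square)
      finally have "cmod r \<le> 1 / (2 * B) * cmod q" using rB by linarith
      moreover have "1 / B * cmod q \<le> cmod (e * q)" unfolding norm_mult using eB by (intro mult_right_mono) auto
      moreover have "cmod (e * q) \<le> cmod N + cmod r" using norm_triangle_ineq4[of N r] by (simp add: Nr)
      moreover have "1 / B * cmod q = 1 / (2 * B) * cmod q + 1 / (2 * B) * cmod q" using B(1) by (simp add: field_simps)
      ultimately have Nl: "1 / (2 * B) * cmod q \<le> cmod N" by linarith
      then have Np: "0 < cmod N" using q0 B(1) by (smt (verit) divide_pos_pos mult_pos_pos zero_less_norm_iff)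
      have "\<eta>1 k t / N - 1 / q = ((\<eta>1 k t - e) * q - r) / (N * q)"
        using Np q0 Nr by (simp add: divide_simps) (simp add: algebra_simps)
      then have "cmod (\<eta>1 k t / N - 1 / q) = cmod ((\<eta>1 k t - e) * q - r) / (cmod N * cmod q)" by (simp add: norm_divide norm_mult)
      also have "\<dots> \<le> (2 * B * \<bar>u\<bar> * cmod q) / (1 / (2 * B) * cmod q * cmod q)"
      proof (rule frac_le)
        have "cmod ((\<eta>1 k t - e) * q - r) \<le> cmod (\<eta>1 k t - e) * cmod q + cmod r"
          using norm_triangle_ineq4[of "(\<eta>1 k t - e) * q" r] by (simp add: norm_mult)
        also have "\<dots> \<le> (B * \<bar>u\<bar>) * cmod q + B * \<bar>u\<bar> * cmod q"
        proof (rule add_mono)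
          show "cmod (\<eta>1 k t - e) * cmod q \<le> (B * \<bar>u\<bar>) * cmod q" using B(4)[OF k, of t s] by (intro mult_right_mono) (auto simp: e_def u_def)
          have "B * u\<^sup>2 = B * \<bar>u\<bar> * \<bar>u\<bar>" by (simp add: power2_eq_square)
          also have "\<dots> \<le> B * \<bar>u\<bar> * cmod q" using uq B(1) by (intro mult_left_mono) auto
          finally show "cmod r \<le> B * \<bar>u\<bar> * cmod q" using rB by linarith
        qed
        finally show "cmod ((\<eta>1 k t - e) * q - r) \<le> 2 * B * \<bar>u\<bar> * cmod q" by simp
        show "1 / (2 * B) * cmod q * cmod q \<le> cmod N * cmod q" using Nl by (intro mult_right_mono) auto
      qed (use B(1) q0 in auto)
      also have "\<dots> = 4 * B\<^sup>2 * (\<bar>u\<bar> / cmod q)" using B(1) q0 by (simp add: field_simps power2_eq_square)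
      also have "\<dots> \<le> 4 * B\<^sup>2 * 1" using uq q0 by (intro mult_left_mono) (auto simp: divide_le_eq_1)
      also have "\<dots> \<le> C" using B(1) c u0 by (auto simp: C_def)
      finally show ?thesis using Np by auto
    next
      case False
      have "c * \<bar>u\<bar> \<le> cmod (\<eta> k t - \<eta> k s)" using c(2)[OF k ts] by (simp add: u_def)
      moreover have "c * u0 \<le> c * \<bar>u\<bar>" using False c by (intro mult_left_mono) auto
      moreover have "cmod (\<i> * of_real \<delta> * e) \<le> c * u0 / 2"
      proof -
        have "cmod (\<i> * of_real \<delta> * e) = \<bar>\<delta>\<bar> * cmod e" by (simp add: norm_mult)
        also have "\<dots> \<le> \<delta>0 * B" using d B(2)[OF k] \<delta>0 by (intro mult_mono) (auto simp: e_def)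
        also have "\<dots> = c * u0 / 2" using B(1) by (simp add: \<delta>0_def)
        finally show ?thesis .
      qed
      moreover have "cmod (\<eta> k t - \<eta> k s) \<le> cmod N + cmod (\<i> * of_real \<delta> * e)"
        using norm_triangle_ineq[of N "\<i> * of_real \<delta> * e"] by (simp add: N_def)
      ultimately have Nl: "c * u0 / 2 \<le> cmod N" by linarith
      have cu: "0 < c * u0" using c u0 by simp
      then have Np: "0 < cmod N" using Nl by linarith
      have "cmod (\<eta>1 k t / N - 1 / q) \<le> cmod (\<eta>1 k t) / cmod N + 1 / cmod q"
        using norm_triangle_ineq4[of "\<eta>1 k t / N" "1 / q"] by (simp add: norm_divide)
      also have "\<dots> \<le> B / (c * u0 / 2) + 1 / u0"
        using B(1) B(2)[OF k] Nl cu u0 uq False by (intro add_mono frac_le) auto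
      also have "\<dots> \<le> C" using B(1) by (simp add: C_def mult.commute)
      finally show ?thesis using Np by auto
    qed
    then show ?thesis by (simp add: N_def q_def e_def u_def)
  qed
  then show ?thesis using that[OF C0 \<delta>0] by blast
qed

end

text \<open>The centre \<open>a\<close> may lie up to one period to either side of [0, 2 pi]; |t -
  a| is then at most 4 pi.\<close>

lemma nn_integral_powr_window:
  fixes a \<gamma> :: real
  assumes "-1 < \<gamma>" "-2 * pi \<le> a" "a \<le> 4 * pi"
  shows "(\<integral>\<^sup>+t. ennreal (\<bar>t - a\<bar> powr \<gamma>) * indicator {0..2*pi} t \<partial>lborel) \<le> ennreal (2 * ((4 * pi) powr (\<gamma> + 1) / (\<gamma> + 1)))"
proof -
  define R where "R = 4 * pi"
  define q where "q u = ennreal (u powr \<gamma>) * indicator {0..R} u" for u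
  have qm [measurable]: "q \<in> borel_measurable borel" unfolding q_def by measurable
  have Q: "(\<integral>\<^sup>+u. q u \<partial>lborel) = ennreal (R powr (\<gamma> + 1) / (\<gamma> + 1))"
    unfolding q_def by (rule nn_integral_has_integral_lebesgue'[OF _ has_integral_powr_from_0]) (use assms in \<open>auto simp: R_def\<close>)
  have Q1: "(\<integral>\<^sup>+t. q (- a + 1 * t) \<partial>lborel) = (\<integral>\<^sup>+u. q u \<partial>lborel)"
    by (subst nn_integral_real_affine[OF qm, of 1 "-a"]) auto
  have Q2: "(\<integral>\<^sup>+t. q (a + (-1) * t) \<partial>lborel) = (\<integral>\<^sup>+u. q u \<partial>lborel)"
    by (subst nn_integral_real_affine[OF qm, of "-1" a]) auto
  have "(\<integral>\<^sup>+t. ennreal (\<bar>t - a\<bar> powr \<gamma>) * indicator {0..2*pi} t \<partial>lborel) \<le> (\<integral>\<^sup>+t. q (- a + 1 * t) + q (a + (-1) * t) \<partial>lborel)"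
  proof (rule nn_integral_mono)
    fix t
    show "ennreal (\<bar>t - a\<bar> powr \<gamma>) * indicator {0..2*pi} t \<le> q (- a + 1 * t) + q (a + (-1) * t)"
    proof (cases "t \<in> {0..2*pi}")
      case True
      show ?thesis
      proof (cases "a \<le> t")
        case le: True
        then have "q (- a + 1 * t) = ennreal (\<bar>t - a\<bar> powr \<gamma>)" using True assms by (auto simp: q_def R_def)
        then show ?thesis using True by simp
      next
        case False
        then have "q (a + (-1) * t) = ennreal (\<bar>t - a\<bar> powr \<gamma>)" using True assms by (auto simp: q_def R_def)
        then show ?thesis using True by simp
      qed
    qed simp
  qed
  also have "\<dots> = (\<integral>\<^sup>+u. q u \<partial>lborel) + (\<integral>\<^sup>+u. q u \<partial>lborel)"
  proof -
    have "(\<integral>\<^sup>+t. q (- a + 1 * t) + q (a + (-1) * t) \<partial>lborel) = (\<integral>\<^sup>+t. q (- a + 1 * t) \<partial>lborel) + (\<integral>\<^sup>+t. q (a + (-1) * t) \<partial>lborel)"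
      by (rule nn_integral_add) measurable
    then show ?thesis unfolding Q1 Q2 .
  qed
  also have "\<dots> = ennreal (2 * (R powr (\<gamma> + 1) / (\<gamma> + 1)))"
    unfolding Q using assms by (subst ennreal_plus[symmetric]) (auto simp: R_def)
  finally show ?thesis by (simp add: R_def)
qed

section \<open>Tangent and measure carried by the boundary\<close>

context curves
begin

text \<open>The choice is immaterial because the curves are disjoint and each is injective modulo 2
  pi; see \<open>tang_\<eta>\<close>.\<close>

definition tang :: "complex \<Rightarrow> complex" where
  "tang x = (SOME w. \<exists>k<m. \<exists>t. x = \<eta> k t \<and> w = \<eta>1 k t)"

lemma tang_\<eta>: "k < m \<Longrightarrow> tang (\<eta> k t) = \<eta>1 k t"
proof -
  assume k: "k < m"
  have uniq: "w = \<eta>1 k t" if ex: "\<exists>j<m. \<exists>s. \<eta> k t = \<eta> j s \<and> w = \<eta>1 j s" for w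
  proof -
    from ex obtain j s where js: "j < m" "\<eta> k t = \<eta> j s" "w = \<eta>1 j s" by (elim exE conjE)
    have "j = k" using disjoint[OF js(1) k] \<eta>_in_Gam_k[OF k, of t] \<eta>_in_Gam_k[OF js(1), of s] js(2) by auto
    then have "\<eta> k t = \<eta> k s" using js(2) by simp
    then obtain n :: int where "t = s + of_int n * (2 * pi)" by (rule \<eta>_inj_mod[OF k])
    then show ?thesis using js(3) \<open>j = k\<close> shift_\<eta>(2)[OF k] by simp
  qed
  have "\<exists>w. \<exists>j<m. \<exists>s. \<eta> k t = \<eta> j s \<and> w = \<eta>1 j s" using k by blast
  then show ?thesis unfolding tang_def by (rule someI2_ex) (rule uniq)
qed

text \<open>Points on the same curve are compared in parameter space through
  \<open>chord_arc\<close>; points on different curves are a fixed distance apart, so boundedness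
  suffices there.\<close>

lemma hoelder_transfer:
  fixes \<phi> :: "complex \<Rightarrow> 'a::real_normed_vector"
  assumes "0 < \<alpha>" "\<alpha> \<le> 1" "0 \<le> L" "\<And>k t s. k < m \<Longrightarrow> \<bar>t - s\<bar> \<le> pi \<Longrightarrow> norm (\<phi> (\<eta> k t) - \<phi> (\<eta> k s)) \<le> L * \<bar>t - s\<bar> powr \<alpha>"
    and "\<And>x. x \<in> Gam m \<eta> \<Longrightarrow> norm (\<phi> x) \<le> Q"
  shows "\<exists>C. \<forall>x\<in>Gam m \<eta>. \<forall>y\<in>Gam m \<eta>. norm (\<phi> x - \<phi> y) \<le> C * cmod (x - y) powr \<alpha>"
proof -
  obtain c where c: "0 < c" "\<And>k t s. k < m \<Longrightarrow> \<bar>t - s\<bar> \<le> pi \<Longrightarrow> c * \<bar>t - s\<bar> \<le> cmod (\<eta> k t - \<eta> k s)" using chord_arc by blast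
  obtain d where d: "0 < d" "\<And>j k s t. j < m \<Longrightarrow> k < m \<Longrightarrow> j \<noteq> k \<Longrightarrow> d \<le> cmod (\<eta> j s - \<eta> k t)" using curves_separated by blast
  have Q0: "0 \<le> Q" using assms(5)[OF \<eta>_in_Gam[of 0 0]] m_pos by (smt (verit) norm_ge_zero zero_less_one_class.zero_le_one less_le_trans zero_less_one)
  define C where "C = L * (1 / c) powr \<alpha> + 2 * Q * (1 / d) powr \<alpha>"
  have "norm (\<phi> x - \<phi> y) \<le> C * cmod (x - y) powr \<alpha>" if xy: "x \<in> Gam m \<eta>" "y \<in> Gam m \<eta>" for x y
  proof -
    obtain k t where x: "k < m" "x = \<eta> k t" using GamE[OF xy(1)] by blast
    obtain j s where y: "j < m" "y = \<eta> j s" using GamE[OF xy(2)] by blast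
    show ?thesis
    proof (cases "j = k")
      case True
      obtain t' where t': "\<bar>t' - s\<bar> \<le> pi" "\<eta> k t' = \<eta> k t" using window_representative[OF x(1)] by blast
      have "\<bar>t' - s\<bar> \<le> 1 / c * cmod (x - y)"
        using c(2)[OF x(1) t'(1)] c(1) t'(2) x y True by (simp add: field_simps)
      then have "\<bar>t' - s\<bar> powr \<alpha> \<le> (1 / c * cmod (x - y)) powr \<alpha>" using assms(1) by (intro powr_mono2) auto
      also have "\<dots> = (1 / c) powr \<alpha> * cmod (x - y) powr \<alpha>" by (rule powr_mult)
      finally have "L * \<bar>t' - s\<bar> powr \<alpha> \<le> L * ((1 / c) powr \<alpha> * cmod (x - y) powr \<alpha>)" using assms(3) by (intro mult_left_mono)
      moreover have "norm (\<phi> x - \<phi> y) \<le> L * \<bar>t' - s\<bar> powr \<alpha>" using assms(4)[OF x(1) t'(1)] t'(2) x y True by simp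
      moreover have "0 \<le> 2 * Q * (1 / d) powr \<alpha> * cmod (x - y) powr \<alpha>" using Q0 by simp
      ultimately show ?thesis unfolding C_def by (simp add: distrib_right)
    next
      case False
      have "d \<le> cmod (x - y)" using d(2)[OF x(1) y(1)] False x y by blast
      then have "1 \<le> 1 / d * cmod (x - y)" using d(1) by (simp add: field_simps)
      then have "1 powr \<alpha> \<le> (1 / d * cmod (x - y)) powr \<alpha>" using assms(1) by (intro powr_mono2) auto
      also have "\<dots> = (1 / d) powr \<alpha> * cmod (x - y) powr \<alpha>" by (rule powr_mult)
      finally have "2 * Q * 1 \<le> 2 * Q * ((1 / d) powr \<alpha> * cmod (x - y) powr \<alpha>)" using Q0 by (intro mult_left_mono) auto
      moreover have "norm (\<phi> x - \<phi> y) \<le> 2 * Q" using norm_triangle_ineq4[of "\<phi> x" "\<phi> y"] assms(5)[OF xy(1)] assms(5)[OF xy(2)] by linarith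
      moreover have "0 \<le> L * (1 / c) powr \<alpha> * cmod (x - y) powr \<alpha>" using assms(3) by simp
      ultimately show ?thesis unfolding C_def by (simp add: distrib_right)
    qed
  qed
  then show ?thesis by blast
qed

lemma tang_lipschitz: "\<exists>L. \<forall>x\<in>Gam m \<eta>. \<forall>y\<in>Gam m \<eta>. cmod (tang x - tang y) \<le> L * cmod (x - y)"
proof -
  obtain B where B: "1 \<le> B" "\<And>k t. k < m \<Longrightarrow> cmod (\<eta>1 k t) \<le> B" "\<And>k t s. k < m \<Longrightarrow> cmod (\<eta>1 k t - \<eta>1 k s) \<le> B * \<bar>t - s\<bar>"
    using taylor_bounds by metis
  have "\<exists>C. \<forall>x\<in>Gam m \<eta>. \<forall>y\<in>Gam m \<eta>. cmod (tang x - tang y) \<le> C * cmod (x - y) powr 1"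
  proof (rule hoelder_transfer[where L = B and Q = B])
    show "cmod (tang x) \<le> B" if "x \<in> Gam m \<eta>" for x
      by (rule GamE[OF that]) (use B(2) tang_\<eta> in auto)
  qed (use B tang_\<eta> in auto)
  then show ?thesis by simp
qed

text \<open>The disjoint union J of the parameter intervals, realised as a product with counting
  measure.\<close>

definition pairM :: "(nat \<times> real) measure" where
  "pairM = count_space {..<m} \<Otimes>\<^sub>M restrict_space lborel {0..2*pi}"

definition curveM :: "complex measure" where
  "curveM = distr pairM (restrict_space borel (Gam m \<eta>)) (\<lambda>(k, t). \<eta> k t)"

lemma sets_curveM: "sets curveM = sets (restrict_space borel (Gam m \<eta>))"
  by (simp add: curveM_def)

lemma measurable_curve: "(\<lambda>(k, t). \<eta> k t) \<in> measurable pairM (restrict_space borel (Gam m \<eta>))"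
  unfolding pairM_def
proof (rule measurable_pair_measure_countable1)
  fix k assume "k \<in> {..<m}"
  then have k: "k < m" by simp
  have "\<eta> k \<in> measurable (restrict_space lborel {0..2*pi}) (restrict_space borel (Gam m \<eta>))"
  proof (rule measurable_restrict_space2)
    show "\<eta> k \<in> space (restrict_space lborel {0..2*pi}) \<rightarrow> Gam m \<eta>" using \<eta>_in_Gam[OF k] by auto
    have "\<eta> k \<in> borel_measurable borel" by (rule borel_measurable_continuous_onI[OF cont_\<eta>[OF k]])
    then show "\<eta> k \<in> borel_measurable (restrict_space lborel {0..2*pi})" by (intro measurable_restrict_space1) simp
  qed
  then show "(\<lambda>y. case (k, y) of (k, t) \<Rightarrow> \<eta> k t) \<in> measurable (restrict_space lborel {0..2*pi}) (restrict_space borel (Gam m \<eta>))" by simp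
qed simp

lemma finite_interval_measure: "finite_measure (restrict_space lborel {0..2*pi})"
  by (rule finite_measureI) (simp add: emeasure_restrict_space space_restrict_space)

lemma nn_integral_curveM:
  assumes F: "F \<in> borel_measurable (restrict_space borel (Gam m \<eta>))"
  shows "(\<integral>\<^sup>+x. F x \<partial>curveM) = (\<Sum>k<m. \<integral>\<^sup>+t. F (\<eta> k t) * indicator {0..2*pi} t \<partial>lborel)"
proof -
  interpret S: finite_measure "restrict_space lborel {0..2*pi}" by (rule finite_interval_measure)
  have "(\<integral>\<^sup>+x. F x \<partial>curveM) = (\<integral>\<^sup>+p. F ((\<lambda>(k, t). \<eta> k t) p) \<partial>pairM)"
    unfolding curveM_def by (rule nn_integral_distr[OF measurable_curve]) (use F in simp)
  also have "\<dots> = (\<integral>\<^sup>+k. \<integral>\<^sup>+t. F ((\<lambda>(k, t). \<eta> k t) (k, t)) \<partial>restrict_space lborel {0..2*pi} \<partial>count_space {..<m})"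
    unfolding pairM_def
    by (rule S.nn_integral_fst[symmetric]) (use measurable_compose[OF measurable_curve F] in \<open>simp add: pairM_def\<close>)
  also have "\<dots> = (\<Sum>k<m. \<integral>\<^sup>+t. F (\<eta> k t) \<partial>restrict_space lborel {0..2*pi})"
    by (simp add: nn_integral_count_space_finite)
  finally show ?thesis by (simp add: nn_integral_restrict_space)
qed

lemma finite_curveM: "finite_measure curveM"
proof (rule finite_measureI)
  have "emeasure curveM (space curveM) = (\<integral>\<^sup>+x. 1 \<partial>curveM)" by simp
  also have "\<dots> = (\<Sum>k<m. \<integral>\<^sup>+t. 1 * indicator {0..2*pi} t \<partial>lborel)" by (rule nn_integral_curveM) simp
  also have "\<dots> < \<infinity>" by (simp add: ennreal_mult_less_top of_nat_less_top)
  finally show "emeasure curveM (space curveM) \<noteq> \<infinity>" by simp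
qed

lemma integral_curveM:
  fixes F :: "complex \<Rightarrow> 'a::euclidean_space"
  assumes "integrable curveM F"
  shows "\<And>k. k < m \<Longrightarrow> (\<lambda>t. F (\<eta> k t)) integrable_on {0..2*pi}"
    and "(LINT x|curveM. F x) = (\<Sum>k<m. integral {0..2*pi} (\<lambda>t. F (\<eta> k t)))"
proof -
  interpret S: finite_measure "restrict_space lborel {0..2*pi}" by (rule finite_interval_measure)
  interpret C: finite_measure "count_space {..<m}" by (rule finite_measure_count_space) simp
  interpret P: pair_sigma_finite "count_space {..<m}" "restrict_space lborel {0..2*pi}" ..
  have Fm: "F \<in> borel_measurable (restrict_space borel (Gam m \<eta>))"
    using borel_measurable_integrable[OF assms] by (simp add: curveM_def)
  have int: "integrable pairM (\<lambda>p. F ((\<lambda>(k, t). \<eta> k t) p))"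
    using assms unfolding curveM_def by (simp add: integrable_distr_eq[OF measurable_curve Fm])
  have sec: "integrable (restrict_space lborel {0..2*pi}) (\<lambda>t. F (\<eta> k t))" if "k < m" for k
    using P.AE_integrable_fst'[of "\<lambda>p. F ((\<lambda>(k, t). \<eta> k t) p)"] int that by (simp add: AE_count_space pairM_def)
  have set: "set_integrable lborel {0..2*pi} (\<lambda>t. F (\<eta> k t))" if "k < m" for k
    using sec[OF that] unfolding set_integrable_def by (subst (asm) integrable_restrict_space) auto
  show "(\<lambda>t. F (\<eta> k t)) integrable_on {0..2*pi}" if "k < m" for k
    using set_borel_integral_eq_integral(1)[OF set[OF that]] .
  have "(LINT x|curveM. F x) = (LINT p|pairM. F ((\<lambda>(k, t). \<eta> k t) p))"
    unfolding curveM_def by (rule integral_distr[OF measurable_curve Fm])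
  also have "\<dots> = (LINT k|count_space {..<m}. (LINT t|restrict_space lborel {0..2*pi}. F ((\<lambda>(k, t). \<eta> k t) (k, t))))"
    unfolding pairM_def using int by (intro P.integral_fst'[symmetric]) (simp add: pairM_def)
  also have "\<dots> = (\<Sum>k<m. LINT t|restrict_space lborel {0..2*pi}. F (\<eta> k t))"
    by (simp add: lebesgue_integral_count_space_finite)
  also have "\<dots> = (\<Sum>k<m. integral {0..2*pi} (\<lambda>t. F (\<eta> k t)))"
  proof (rule sum.cong[OF refl])
    fix k assume "k \<in> {..<m}"
    then have k: "k < m" by simp
    have "(LINT t|restrict_space lborel {0..2*pi}. F (\<eta> k t)) = (LINT t:{0..2*pi}|lborel. F (\<eta> k t))"
      unfolding set_lebesgue_integral_def by (rule integral_restrict_space) simp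
    then show "(LINT t|restrict_space lborel {0..2*pi}. F (\<eta> k t)) = integral {0..2*pi} (\<lambda>t. F (\<eta> k t))"
      using set_borel_integral_eq_integral(2)[OF set[OF k]] by simp
  qed
  finally show "(LINT x|curveM. F x) = (\<Sum>k<m. integral {0..2*pi} (\<lambda>t. F (\<eta> k t)))" .
qed

text \<open>Centres the window of the curve carrying the singularity at its parameter s, where
  \<open>local_expansion\<close> applies; s is normalised to [pi, 3 pi] so that the window begins in
  [0, 2 pi].\<close>

lemma integral_curveM_window:
  fixes F :: "complex \<Rightarrow> 'a::euclidean_space"
  assumes "integrable curveM F" "j < m" "pi \<le> s" "s \<le> 3 * pi"
  shows "(\<lambda>t. F (\<eta> j t)) integrable_on {s - pi..s + pi}"
    "(LINT x|curveM. F x) = integral {s - pi..s + pi} (\<lambda>t. F (\<eta> j t)) + (\<Sum>k\<in>{..<m} - {j}. integral {0..2*pi} (\<lambda>t. F (\<eta> k t)))"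
proof -
  have "((\<lambda>t. F (\<eta> j t)) has_integral integral {0..2*pi} (\<lambda>t. F (\<eta> j t))) {s - pi..s - pi + 2 * pi}"
    by (rule periodic_window_integral) (use assms periodic[OF assms(2)] integral_curveM(1)[OF assms(1,2)] in auto)
  then have *: "((\<lambda>t. F (\<eta> j t)) has_integral integral {0..2*pi} (\<lambda>t. F (\<eta> j t))) {s - pi..s + pi}" by (simp add: algebra_simps)
  then show "(\<lambda>t. F (\<eta> j t)) integrable_on {s - pi..s + pi}" by blast
  show "(LINT x|curveM. F x) = integral {s - pi..s + pi} (\<lambda>t. F (\<eta> j t)) + (\<Sum>k\<in>{..<m} - {j}. integral {0..2*pi} (\<lambda>t. F (\<eta> k t)))"
    unfolding integral_curveM(2)[OF assms(1)] integral_unique[OF *] using assms(2) by (intro sum.remove) auto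
qed

text \<open>By \<open>chord_arc\<close> the singularity is bounded by a multiple of |t - a|^(\<beta>
  - 1), where a is one of s, s + 2 pi, s - 2 pi within pi of t; the sum over all three covers every
  case.\<close>

lemma growth_curveM:
  assumes "0 < \<beta>" "\<beta> \<le> 1"
  shows "\<exists>C. \<forall>y\<in>Gam m \<eta>. integrable curveM (\<lambda>x. cmod (x - y) powr (\<beta> - 1)) \<and> (LINT x|curveM. cmod (x - y) powr (\<beta> - 1)) \<le> C"
proof -
  obtain c where c: "0 < c" "\<And>k t s. k < m \<Longrightarrow> \<bar>t - s\<bar> \<le> pi \<Longrightarrow> c * \<bar>t - s\<bar> \<le> cmod (\<eta> k t - \<eta> k s)" using chord_arc by blast
  obtain d where d: "0 < d" "\<And>j k s t. j < m \<Longrightarrow> k < m \<Longrightarrow> j \<noteq> k \<Longrightarrow> d \<le> cmod (\<eta> j s - \<eta> k t)" using curves_separated by blast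
  define \<gamma> where "\<gamma> = \<beta> - 1"
  have \<gamma>: "-1 < \<gamma>" "\<gamma> \<le> 0" using assms by (auto simp: \<gamma>_def)
  define K where "K = 2 * ((4 * pi) powr (\<gamma> + 1) / (\<gamma> + 1))"
  have K: "0 \<le> K" using \<gamma> by (simp add: K_def)
  define K1 where "K1 = d powr \<gamma> * (2 * pi) + c powr \<gamma> * (K + K + K)"
  have K1: "0 \<le> K1" using K by (simp add: K1_def)
  have "integrable curveM (\<lambda>x. cmod (x - y) powr \<gamma>) \<and> (LINT x|curveM. cmod (x - y) powr \<gamma>) \<le> real m * K1" if y: "y \<in> Gam m \<eta>" for y
  proof -
    obtain j s where js: "j < m" "y = \<eta> j s" "s \<in> {0..2*pi}" by (rule GamE[OF y])
    have Fm: "(\<lambda>x. cmod (x - y) powr \<gamma>) \<in> borel_measurable (restrict_space borel (Gam m \<eta>))"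
      by (intro measurable_restrict_space1) measurable
    have part: "(\<integral>\<^sup>+t. ennreal (cmod (\<eta> k t - y) powr \<gamma>) * indicator {0..2*pi} t \<partial>lborel) \<le> ennreal K1" if k: "k < m" for k
    proof (cases "k = j")
      case False
      have "(\<integral>\<^sup>+t. ennreal (cmod (\<eta> k t - y) powr \<gamma>) * indicator {0..2*pi} t \<partial>lborel) \<le> (\<integral>\<^sup>+t. ennreal (d powr \<gamma>) * indicator {0..2*pi} t \<partial>lborel)"
      proof (intro nn_integral_mono mult_right_mono ennreal_leI)
        show "cmod (\<eta> k t - y) powr \<gamma> \<le> d powr \<gamma>" for t
          using d(2)[OF k js(1) False] d(1) \<gamma> js(2) by (intro powr_mono2') auto
      qed simp
      also have "\<dots> = ennreal (d powr \<gamma> * (2 * pi))" by (simp add: nn_integral_cmult ennreal_mult')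
      also have "\<dots> \<le> ennreal K1" using K by (intro ennreal_leI) (simp add: K1_def)
      finally show ?thesis .
    next
      case True
      define p where "p a t = ennreal (\<bar>t - a\<bar> powr \<gamma>) * indicator {0..2*pi} t" for a t
      have pm [measurable]: "p a \<in> borel_measurable lborel" for a unfolding p_def by measurable
      have "(\<integral>\<^sup>+t. ennreal (cmod (\<eta> k t - y) powr \<gamma>) * indicator {0..2*pi} t \<partial>lborel) \<le> (\<integral>\<^sup>+t. ennreal (c powr \<gamma>) * (p s t + p (s + 2 * pi) t + p (s - 2 * pi) t) \<partial>lborel)"
      proof (rule nn_integral_mono)
        fix t
        show "ennreal (cmod (\<eta> k t - y) powr \<gamma>) * indicator {0..2*pi} t \<le> ennreal (c powr \<gamma>) * (p s t + p (s + 2 * pi) t + p (s - 2 * pi) t)"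
        proof (cases "t \<in> {0..2*pi}")
          case t: True
          have *: "ennreal (cmod (\<eta> k t - y) powr \<gamma>) \<le> ennreal (c powr \<gamma>) * ennreal (\<bar>t - a\<bar> powr \<gamma>)"
            if a: "\<eta> j a = \<eta> j s" "\<bar>t - a\<bar> \<le> pi" for a
          proof (cases "t = a")
            case True
            then show ?thesis using a js \<open>k = j\<close> by simp
          next
            case False
            have "c * \<bar>t - a\<bar> \<le> cmod (\<eta> k t - y)" using c(2)[OF js(1) a(2)] a(1) js \<open>k = j\<close> by simp
            then have "cmod (\<eta> k t - y) powr \<gamma> \<le> (c * \<bar>t - a\<bar>) powr \<gamma>" using \<gamma> c(1) False by (intro powr_mono2') auto
            then show ?thesis by (simp add: powr_mult ennreal_mult'[symmetric] ennreal_leI)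
          qed
          have sh: "\<eta> j (s + 2 * pi) = \<eta> j s" "\<eta> j (s - 2 * pi) = \<eta> j s" using shift_\<eta>(1)[OF js(1), of s 1] shift_\<eta>(1)[OF js(1), of s "-1"] by auto
          consider "\<bar>t - s\<bar> \<le> pi" | "\<bar>t - (s + 2 * pi)\<bar> \<le> pi" | "\<bar>t - (s - 2 * pi)\<bar> \<le> pi" using t js(3) by fastforce
          then obtain a where a: "a = s \<or> a = s + 2 * pi \<or> a = s - 2 * pi" "\<bar>t - a\<bar> \<le> pi" by cases auto
          then have "ennreal (cmod (\<eta> k t - y) powr \<gamma>) \<le> ennreal (c powr \<gamma>) * p a t" using * sh t by (auto simp: p_def)
          also have "\<dots> \<le> ennreal (c powr \<gamma>) * (p s t + p (s + 2 * pi) t + p (s - 2 * pi) t)"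
            using a(1) by (intro mult_left_mono) (auto simp: add.assoc add_increasing add_increasing2)
          finally show ?thesis using t by simp
        qed simp
      qed
      also have "\<dots> = ennreal (c powr \<gamma>) * ((\<integral>\<^sup>+t. p s t \<partial>lborel) + (\<integral>\<^sup>+t. p (s + 2 * pi) t \<partial>lborel) + (\<integral>\<^sup>+t. p (s - 2 * pi) t \<partial>lborel))"
        by (simp add: nn_integral_cmult nn_integral_add)
      also have "\<dots> \<le> ennreal (c powr \<gamma>) * (ennreal K + ennreal K + ennreal K)"
        unfolding p_def K_def using js(3) \<gamma> by (intro mult_left_mono add_mono nn_integral_powr_window) auto
      also have "\<dots> = ennreal (c powr \<gamma> * (K + K + K))"
      proof -
        have "ennreal K + ennreal K + ennreal K = ennreal (K + K + K)"
          using K by (simp only: ennreal_plus[symmetric] add_nonneg_nonneg)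
        then show ?thesis using K by (simp only: ennreal_mult''[symmetric] add_nonneg_nonneg)
      qed
      also have "\<dots> \<le> ennreal K1" using d(1) by (intro ennreal_leI) (simp add: K1_def)
      finally show ?thesis .
    qed
    have "(\<integral>\<^sup>+x. ennreal (cmod (x - y) powr \<gamma>) \<partial>curveM) = (\<Sum>k<m. \<integral>\<^sup>+t. ennreal (cmod (\<eta> k t - y) powr \<gamma>) * indicator {0..2*pi} t \<partial>lborel)"
      by (rule nn_integral_curveM) (use Fm in measurable)
    also have "\<dots> \<le> (\<Sum>k<m. ennreal K1)" using part by (intro sum_mono) auto
    also have "\<dots> = ennreal (real m * K1)" using K1 by (simp add: ennreal_of_nat_eq_real_of_nat ennreal_mult')
    finally have b: "(\<integral>\<^sup>+x. ennreal (cmod (x - y) powr \<gamma>) \<partial>curveM) \<le> ennreal (real m * K1)" .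
    have Fm': "(\<lambda>x. cmod (x - y) powr \<gamma>) \<in> borel_measurable curveM"
      using Fm measurable_cong_sets[OF sets_curveM refl] by blast
    have "integrable curveM (\<lambda>x. cmod (x - y) powr \<gamma>)"
      by (rule integrableI_nonneg[OF Fm']) (use b le_less_trans in \<open>auto simp: less_top[symmetric] top_unique\<close>)
    moreover have "(LINT x|curveM. cmod (x - y) powr \<gamma>) \<le> real m * K1"
      using K1 b by (intro integral_real_bounded) auto
    ultimately show ?thesis by blast
  qed
  then show ?thesis unfolding \<gamma>_def by blast
qed

end

lemma Im_inverse_minus_i: "Im (1 / (of_real u - \<i> * of_real d)) = d / (u\<^sup>2 + d\<^sup>2)"
  by (simp add: Im_divide power2_eq_square)

text \<open>The Poisson kernel of the half-plane: its mass on the window tends to pi or -pi as d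
  tends to 0 from above or below, which produces the jump of the Neumann integral across
  \<Gamma>.\<close>

lemma integral_poisson_model:
  fixes d :: real
  assumes "d \<noteq> 0"
  shows "((\<lambda>t. d / ((t - s)\<^sup>2 + d\<^sup>2)) has_integral 2 * arctan (pi / d)) {s - pi..s + pi}"
proof -
  have "((\<lambda>t. d / ((t - s)\<^sup>2 + d\<^sup>2)) has_integral (arctan ((s + pi - s) / d) - arctan ((s - pi - s) / d))) {s - pi..s + pi}"
  proof (rule fundamental_theorem_of_calculus)
    fix t
    have p: "(t - s)\<^sup>2 + d\<^sup>2 \<noteq> 0" using assms by (simp add: add_nonneg_eq_0_iff)
    have "((\<lambda>t. arctan ((t - s) / d)) has_real_derivative inverse (1 + ((t - s) / d)\<^sup>2) * (1 / d)) (at t within {s - pi..s + pi})"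
      by (rule DERIV_chain2[OF DERIV_arctan]) (use assms in \<open>auto intro!: derivative_eq_intros\<close>)
    also have "inverse (1 + ((t - s) / d)\<^sup>2) * (1 / d) = d / ((t - s)\<^sup>2 + d\<^sup>2)"
    proof -
      have "1 + ((t - s) / d)\<^sup>2 = ((t - s)\<^sup>2 + d\<^sup>2) / d\<^sup>2" using assms by (simp add: power_divide add_divide_distrib)
      then show ?thesis using assms p by (simp add: power2_eq_square)
    qed
    finally show "((\<lambda>t. arctan ((t - s) / d)) has_vector_derivative d / ((t - s)\<^sup>2 + d\<^sup>2)) (at t within {s - pi..s + pi})"
      by (simp add: has_real_derivative_iff_has_vector_derivative)
  qed simp
  then show ?thesis by (simp add: arctan_minus)
qed

section \<open>Neumann kernel and winding numbers of the boundary\<close>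

context curves
begin

lemma space_curveM: "space curveM = Gam m \<eta>"
  using sets_eq_imp_space_eq[OF sets_curveM] by (simp add: space_restrict_space)

lemma measurable_curveM: "continuous_on (Gam m \<eta>) f \<Longrightarrow> f \<in> borel_measurable curveM"
  using borel_measurable_continuous_on_restrict measurable_cong_sets[OF sets_curveM refl] by blast

lemma cont_tang: "continuous_on (Gam m \<eta>) tang"
  using tang_lipschitz hoelder_on_lipschitz[of "Gam m \<eta>" tang] hoelder_on_imp_continuous_on unfolding dist_norm by blast

lemma integrable_curveM_bounded:
  fixes f :: "complex \<Rightarrow> 'b::{banach, second_countable_topology}"
  assumes "f \<in> borel_measurable curveM" "\<And>x. x \<in> Gam m \<eta> \<Longrightarrow> norm (f x) \<le> B"
  shows "integrable curveM f"
proof -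
  interpret finite_measure curveM by (rule finite_curveM)
  show ?thesis by (rule integrable_const_bound[OF _ assms(1), of B]) (use assms(2) space_curveM in auto)
qed

text \<open>For \<delta> = 0 the model kernel 1/(t - s) is real, so on a single curve the imaginary
  part consists of the bounded error alone.\<close>

lemma kappa_bound: "\<exists>C. \<forall>x\<in>Gam m \<eta>. \<forall>y\<in>Gam m \<eta>. \<bar>Im (tang x / (x - y))\<bar> \<le> C"
proof -
  obtain C \<delta>0 where C: "0 < C" "0 < \<delta>0"
    "\<forall>k s t \<delta>. k < m \<longrightarrow> \<bar>t - s\<bar> \<le> pi \<longrightarrow> \<bar>\<delta>\<bar> \<le> \<delta>0 \<longrightarrow> (t \<noteq> s \<or> \<delta> \<noteq> 0) \<longrightarrow>
       \<eta> k t - (\<eta> k s + \<i> * of_real \<delta> * \<eta>1 k s) \<noteq> 0 \<and>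
       cmod (\<eta>1 k t / (\<eta> k t - (\<eta> k s + \<i> * of_real \<delta> * \<eta>1 k s)) - 1 / (of_real (t - s) - \<i> * of_real \<delta>)) \<le> C"
    by (rule local_expansion)
  obtain d where d: "0 < d" "\<And>j k s t. j < m \<Longrightarrow> k < m \<Longrightarrow> j \<noteq> k \<Longrightarrow> d \<le> cmod (\<eta> j s - \<eta> k t)" using curves_separated by blast
  obtain B where B: "1 \<le> B" "\<And>k t. k < m \<Longrightarrow> cmod (\<eta>1 k t) \<le> B" using derivative_bounds by metis
  have "\<bar>Im (tang x / (x - y))\<bar> \<le> C + B / d" if xy: "x \<in> Gam m \<eta>" "y \<in> Gam m \<eta>" for x y
  proof -
    obtain k t where x: "k < m" "x = \<eta> k t" using GamE[OF xy(1)] by blast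
    obtain j s where y: "j < m" "y = \<eta> j s" using GamE[OF xy(2)] by blast
    show ?thesis
    proof (cases "j = k")
      case True
      obtain t' where t': "\<bar>t' - s\<bar> \<le> pi" "\<eta> k t' = \<eta> k t" "\<eta>1 k t' = \<eta>1 k t" using window_representative[OF x(1)] by blast
      have tx: "tang x / (x - y) = \<eta>1 k t' / (\<eta> k t' - \<eta> k s)" using x y True t' tang_\<eta> by simp
      show ?thesis
      proof (cases "t' = s")
        case True
        then show ?thesis unfolding tx using C(1) B(1) d(1) by simp
      next
        case False
        have "cmod (\<eta>1 k t' / (\<eta> k t' - \<eta> k s) - 1 / of_real (t' - s)) \<le> C"
          using C(3)[rule_format, OF x(1) t'(1), of 0] C(2) False by simp
        moreover have "\<bar>Im (\<eta>1 k t' / (\<eta> k t' - \<eta> k s))\<bar> = \<bar>Im (\<eta>1 k t' / (\<eta> k t' - \<eta> k s) - 1 / of_real (t' - s))\<bar>"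
          using Im_inverse_minus_i[of "t' - s" 0] by simp
        ultimately have "\<bar>Im (\<eta>1 k t' / (\<eta> k t' - \<eta> k s))\<bar> \<le> C" using abs_Im_le_cmod order_trans by metis
        then show ?thesis unfolding tx using B(1) d(1) by (simp add: add_increasing2)
      qed
    next
      case False
      have "\<bar>Im (tang x / (x - y))\<bar> \<le> cmod (tang x) / cmod (x - y)" by (metis abs_Im_le_cmod norm_divide)
      also have "\<dots> \<le> B / d" using B(2)[OF x(1)] d(2)[OF x(1) y(1)] d(1) False x y tang_\<eta> B(1) by (intro frac_le) auto
      finally show ?thesis using C(1) by linarith
    qed
  qed
  then show ?thesis by blast
qed

lemma kappa_integrable:
  assumes "y \<in> Gam m \<eta>"
  shows "integrable curveM (\<lambda>x. Im (tang x / (x - y)))"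
proof -
  obtain C where "\<forall>x\<in>Gam m \<eta>. \<forall>y\<in>Gam m \<eta>. \<bar>Im (tang x / (x - y))\<bar> \<le> C" using kappa_bound by blast
  moreover have [measurable]: "tang \<in> borel_measurable curveM" "(\<lambda>x. x) \<in> borel_measurable curveM"
    by (intro measurable_curveM cont_tang continuous_intros)+
  have "(\<lambda>x. Im (tang x / (x - y))) \<in> borel_measurable curveM" by measurable
  ultimately show ?thesis using assms by (intro integrable_curveM_bounded[of _ C]) auto
qed

lemma Cauchy_integrable:
  assumes "z \<notin> Gam m \<eta>"
  shows "integrable curveM (\<lambda>x. tang x / (x - z))" "integrable curveM (\<lambda>x. Im (tang x / (x - z)))"
proof -
  have c: "continuous_on (Gam m \<eta>) (\<lambda>x. tang x / (x - z))" using assms by (intro continuous_intros cont_tang) auto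
  then obtain B where "\<forall>x\<in>Gam m \<eta>. cmod (tang x / (x - z)) \<le> B"
    using compact_imp_bounded[OF compact_continuous_image[OF c compact_Gam]] unfolding bounded_iff by auto
  then show "integrable curveM (\<lambda>x. tang x / (x - z))"
    by (intro integrable_curveM_bounded[of _ B] measurable_curveM c) auto
  then show "integrable curveM (\<lambda>x. Im (tang x / (x - z)))" by (rule integrable_Im)
qed

lemma valid_path_bloop:
  assumes "k < m"
  shows "valid_path (bloop \<eta> k)" "\<And>x. vector_derivative (bloop \<eta> k) (at x) = of_real (2 * pi) * \<eta>1 k (2 * pi * x)"
proof -
  have D: "(bloop \<eta> k has_vector_derivative of_real (2 * pi) * \<eta>1 k (2 * pi * x)) (at x)" for x
  proof -
    have "((\<lambda>x. 2 * pi * x) has_vector_derivative 2 * pi) (at x)" by (auto intro!: derivative_eq_intros simp: has_vector_derivative_def)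
    then have "(\<eta> k \<circ> (\<lambda>x. 2 * pi * x) has_vector_derivative (2 * pi) *\<^sub>R \<eta>1 k (2 * pi * x)) (at x)"
      by (rule vector_diff_chain_at) (rule d1[OF assms])
    then show ?thesis by (simp add: o_def bloop_def scaleR_conv_of_real)
  qed
  then show "vector_derivative (bloop \<eta> k) (at x) = of_real (2 * pi) * \<eta>1 k (2 * pi * x)" for x
    by (rule vector_derivative_at)
  have "continuous_on {0..1} (\<lambda>x. of_real (2 * pi) * \<eta>1 k (2 * pi * x))"
    by (intro continuous_intros continuous_on_compose2[OF cont_\<eta>1[OF assms, of UNIV]]) auto
  then have "bloop \<eta> k C1_differentiable_on {0..1}" unfolding C1_differentiable_on_def using D
    by (intro exI[of _ "\<lambda>x. of_real (2 * pi) * \<eta>1 k (2 * pi * x)"]) simp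
  then show "valid_path (bloop \<eta> k)" unfolding valid_path_def by (rule C1_differentiable_imp_piecewise)
qed

lemma winding_integral:
  assumes "k < m" "z \<notin> Gam_k \<eta> k"
  shows "integral {0..2*pi} (\<lambda>t. \<eta>1 k t / (\<eta> k t - z)) = 2 * of_real pi * \<i> * winding_number (bloop \<eta> k) z"
proof -
  define f where "f t = \<eta>1 k t / (\<eta> k t - z)" for t
  have "continuous_on {0..2*pi} f" unfolding f_def using assms \<eta>_in_Gam_k[OF assms(1)]
    by (intro continuous_intros cont_\<eta> cont_\<eta>1) auto
  then have "f integrable_on {0..2*pi}" by (rule integrable_continuous_interval)
  then have "(f has_integral integral {0..2*pi} f) (cbox 0 (2*pi))" by (simp add: integrable_integral)
  from has_integral_affinity'[OF this, of "2 * pi" 0]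
  have "((\<lambda>x. f (2 * pi * x)) has_integral (integral {0..2*pi} f /\<^sub>R (2 * pi))) {0..1}" by simp
  then have "((\<lambda>x. of_real (2 * pi) * f (2 * pi * x)) has_integral (of_real (2 * pi) * (integral {0..2*pi} f /\<^sub>R (2 * pi)))) {0..1}"
    by (rule has_integral_mult_right)
  moreover have "of_real (2 * pi) * (integral {0..2*pi} f /\<^sub>R (2 * pi)) = integral {0..2*pi} f"
    by (simp add: scaleR_conv_of_real)
  ultimately have "((\<lambda>x. of_real (2 * pi) * f (2 * pi * x)) has_integral (integral {0..2*pi} f)) {0..1}" by simp
  then have "integral {0..1} (\<lambda>x. of_real (2 * pi) * f (2 * pi * x)) = integral {0..2*pi} f" by (rule integral_unique)
  moreover have "winding_number (bloop \<eta> k) z = 1 / (2 * pi * \<i>) * contour_integral (bloop \<eta> k) (\<lambda>w. 1 / (w - z))"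
    by (rule winding_number_valid_path) (use valid_path_bloop[OF assms(1)] assms(2) path_image_bloop in auto)
  moreover have "contour_integral (bloop \<eta> k) (\<lambda>w. 1 / (w - z)) = integral {0..1} (\<lambda>x. of_real (2 * pi) * f (2 * pi * x))"
    unfolding contour_integral_integral valid_path_bloop(2)[OF assms(1)]
    unfolding f_def bloop_def by (simp add: mult.commute)
  ultimately show ?thesis unfolding f_def[symmetric] by simp
qed

lemma Jordan_curve_k:
  assumes "k < m"
  shows "inside (Gam_k \<eta> k) \<noteq> {}" "open (inside (Gam_k \<eta> k))" "connected (inside (Gam_k \<eta> k))" "open (outside (Gam_k \<eta> k))"
    "bounded (inside (Gam_k \<eta> k))" "inside (Gam_k \<eta> k) \<inter> outside (Gam_k \<eta> k) = {}"
    "inside (Gam_k \<eta> k) \<union> outside (Gam_k \<eta> k) = - Gam_k \<eta> k" "frontier (inside (Gam_k \<eta> k)) = Gam_k \<eta> k"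
    "pathfinish (bloop \<eta> k) = pathstart (bloop \<eta> k)"
proof -
  show l: "pathfinish (bloop \<eta> k) = pathstart (bloop \<eta> k)"
    using periodic[OF assms, of 0] by (simp add: pathfinish_def pathstart_def bloop_def)
  show "inside (Gam_k \<eta> k) \<noteq> {}" "open (inside (Gam_k \<eta> k))" "connected (inside (Gam_k \<eta> k))" "open (outside (Gam_k \<eta> k))"
    "bounded (inside (Gam_k \<eta> k))" "inside (Gam_k \<eta> k) \<inter> outside (Gam_k \<eta> k) = {}"
    "inside (Gam_k \<eta> k) \<union> outside (Gam_k \<eta> k) = - Gam_k \<eta> k" "frontier (inside (Gam_k \<eta> k)) = Gam_k \<eta> k"
    using Jordan_inside_outside[OF simple[OF assms] l] unfolding path_image_bloop by blast+
qed

text \<open>The interior of curve k is connected and misses curve j by \<open>not_nested\<close>; it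
  therefore lies on one side of j.\<close>

lemma inside_subset:
  assumes "j < m" "k < m" "j \<noteq> k" "p \<in> inside (Gam_k \<eta> k)" "p \<in> inside (Gam_k \<eta> j)"
  shows "inside (Gam_k \<eta> k) \<subseteq> inside (Gam_k \<eta> j)"
proof (rule ccontr)
  assume "\<not> ?thesis"
  moreover have sub: "inside (Gam_k \<eta> k) \<subseteq> inside (Gam_k \<eta> j) \<union> outside (Gam_k \<eta> j)"
    unfolding Jordan_curve_k(7)[OF assms(1)] using not_nested[OF assms(1-3)] by blast
  ultimately have ne: "outside (Gam_k \<eta> j) \<inter> inside (Gam_k \<eta> k) \<noteq> {}" by blast
  have "inside (Gam_k \<eta> j) \<inter> inside (Gam_k \<eta> k) = {} \<or> outside (Gam_k \<eta> j) \<inter> inside (Gam_k \<eta> k) = {}"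
    by (rule connectedD[OF Jordan_curve_k(3)[OF assms(2)] Jordan_curve_k(2)[OF assms(1)] Jordan_curve_k(4)[OF assms(1)] _ sub])
       (use Jordan_curve_k(6)[OF assms(1)] in blast)
  then show False using ne assms(4,5) by blast
qed

text \<open>Overlapping interiors would contain each other, hence coincide, and so would their
  frontiers, the curves.\<close>

lemma inside_disjoint:
  assumes "j < m" "k < m" "j \<noteq> k"
  shows "inside (Gam_k \<eta> k) \<inter> inside (Gam_k \<eta> j) = {}"
proof (rule ccontr)
  assume "\<not> ?thesis"
  then obtain p where p: "p \<in> inside (Gam_k \<eta> k)" "p \<in> inside (Gam_k \<eta> j)" by blast
  have "inside (Gam_k \<eta> k) = inside (Gam_k \<eta> j)"
    using inside_subset[OF assms p] inside_subset[OF assms(2,1) assms(3)[symmetric] p(2,1)] by blast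
  then have "Gam_k \<eta> k = Gam_k \<eta> j" using Jordan_curve_k(8) assms by metis
  then show False using disjoint[OF assms] \<eta>_in_Gam_k[OF assms(1)] by blast
qed

lemma winding_sum:
  assumes "z \<notin> Gam m \<eta>"
  shows "(LINT x|curveM. tang x / (x - z)) = 2 * of_real pi * \<i> * (\<Sum>k<m. winding_number (bloop \<eta> k) z)"
proof -
  have "(LINT x|curveM. tang x / (x - z)) = (\<Sum>k<m. integral {0..2*pi} (\<lambda>t. tang (\<eta> k t) / (\<eta> k t - z)))"
    by (rule integral_curveM(2)[OF Cauchy_integrable(1)[OF assms]])
  also have "\<dots> = (\<Sum>k<m. 2 * of_real pi * \<i> * winding_number (bloop \<eta> k) z)"
  proof (rule sum.cong[OF refl])
    fix k assume "k \<in> {..<m}"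
    then have "k < m" "z \<notin> Gam_k \<eta> k" using assms by (auto simp: Gam_def)
    then show "integral {0..2*pi} (\<lambda>t. tang (\<eta> k t) / (\<eta> k t - z)) = 2 * of_real pi * \<i> * winding_number (bloop \<eta> k) z"
      using winding_integral tang_\<eta> by simp
  qed
  finally show ?thesis by (simp add: sum_distrib_left)
qed

lemma winding_outside:
  assumes "k < m" "z \<notin> Gam_k \<eta> k" "z \<notin> inside (Gam_k \<eta> k)"
  shows "winding_number (bloop \<eta> k) z = 0"
proof (rule winding_number_zero_in_outside)
  show "path (bloop \<eta> k)" using valid_path_bloop[OF assms(1)] valid_path_imp_path by blast
  show "z \<in> outside (path_image (bloop \<eta> k))" unfolding path_image_bloop using Jordan_curve_k(7)[OF assms(1)] assms by blast
qed (rule Jordan_curve_k(9)[OF assms(1)])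

lemma winding_Gdom:
  assumes "z \<in> Gdom m \<eta>"
  shows "(LINT x|curveM. tang x / (x - z)) = 0"
proof -
  have z: "z \<notin> Gam m \<eta>" "z \<notin> Gminus m \<eta>" using assms by (auto simp: Gdom_def)
  have "winding_number (bloop \<eta> k) z = 0" if "k < m" for k
    using z that by (intro winding_outside) (auto simp: Gam_def Gminus_def)
  then show ?thesis unfolding winding_sum[OF z(1)] by simp
qed

lemma Gminus_Gam_disjoint: "Gminus m \<eta> \<inter> Gam m \<eta> = {}"
proof -
  have "inside (Gam_k \<eta> k) \<inter> Gam_k \<eta> j = {}" if "k < m" "j < m" for k j
    using not_nested[of j k] that inside_no_overlap[of "Gam_k \<eta> k"] by (cases "j = k") auto
  then show ?thesis by (auto simp: Gminus_def Gam_def)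
qed

lemma winding_Gminus:
  assumes "z \<in> Gminus m \<eta>"
  shows "(LINT x|curveM. tang x / (x - z)) = - (2 * of_real pi * \<i>)"
proof -
  have z: "z \<notin> Gam m \<eta>" using assms Gminus_Gam_disjoint by blast
  obtain k where k: "k < m" "z \<in> inside (Gam_k \<eta> k)" using assms by (auto simp: Gminus_def)
  have "winding_number (bloop \<eta> j) z = 0" if "j \<in> {..<m} - {k}" for j
  proof (rule winding_outside)
    show "j < m" "z \<notin> Gam_k \<eta> j" using that z by (auto simp: Gam_def)
    show "z \<notin> inside (Gam_k \<eta> j)" using inside_disjoint[of j k] that k by auto
  qed
  then have "(\<Sum>j\<in>{..<m} - {k}. winding_number (bloop \<eta> j) z) = 0" by (intro sum.neutral) auto
  then have "(\<Sum>j<m. winding_number (bloop \<eta> j) z) = -1"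
    using sum.remove[of "{..<m}" k "\<lambda>j. winding_number (bloop \<eta> j) z"] k clockwise by simp
  then show ?thesis unfolding winding_sum[OF z] by simp
qed

lemma open_Gminus: "open (Gminus m \<eta>)"
  unfolding Gminus_def using Jordan_curve_k(2) by blast

lemma open_Gdom: "open (Gdom m \<eta>)"
proof -
  have "Gam m \<eta> \<union> Gminus m \<eta> = (\<Union>k<m. Gam_k \<eta> k \<union> inside (Gam_k \<eta> k))" by (auto simp: Gam_def Gminus_def)
  moreover have "closed (Gam_k \<eta> k \<union> inside (Gam_k \<eta> k))" if "k < m" for k
    using closed_path_image_Un_inside[of "bloop \<eta> k"] valid_path_bloop(1)[OF that] valid_path_imp_path path_image_bloop by metis
  then have "closed (\<Union>k<m. Gam_k \<eta> k \<union> inside (Gam_k \<eta> k))" by (intro closed_UN) auto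
  ultimately show ?thesis unfolding Gdom_def by (simp only: open_Compl)
qed

lemma bounded_Gminus: "bounded (Gminus m \<eta>)"
  unfolding Gminus_def by (intro bounded_UN) (auto intro: Jordan_curve_k(5))

text \<open>Approach along the normal from both sides. After the Poisson model is subtracted, the
  integrand is dominated by the constant of \<open>local_expansion\<close> and converges to the
  kernel at the boundary point; the model contributes \<sigma> * pi.\<close>

lemma kappa_limit:
  assumes j: "j < m" and s: "pi \<le> s" "s \<le> 3 * pi"
  shows "\<exists>a. (\<forall>n. 0 < a n) \<and> a \<longlonglongrightarrow> 0 \<and> (\<forall>\<sigma>. \<sigma> = 1 \<or> \<sigma> = -1 \<longrightarrow>
     (\<forall>n. \<eta> j s + \<i> * of_real (\<sigma> * a n) * \<eta>1 j s \<notin> Gam m \<eta>) \<and>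
     (\<lambda>n. LINT x|curveM. Im (tang x / (x - (\<eta> j s + \<i> * of_real (\<sigma> * a n) * \<eta>1 j s))))
        \<longlonglongrightarrow> (LINT x|curveM. Im (tang x / (x - \<eta> j s))) + \<sigma> * pi)"
proof -
  obtain C \<delta>0 where C: "0 < C" "0 < \<delta>0"
    "\<forall>k s t \<delta>. k < m \<longrightarrow> \<bar>t - s\<bar> \<le> pi \<longrightarrow> \<bar>\<delta>\<bar> \<le> \<delta>0 \<longrightarrow> (t \<noteq> s \<or> \<delta> \<noteq> 0) \<longrightarrow>
       \<eta> k t - (\<eta> k s + \<i> * of_real \<delta> * \<eta>1 k s) \<noteq> 0 \<and>
       cmod (\<eta>1 k t / (\<eta> k t - (\<eta> k s + \<i> * of_real \<delta> * \<eta>1 k s)) - 1 / (of_real (t - s) - \<i> * of_real \<delta>)) \<le> C"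
    by (rule local_expansion)
  obtain d where d: "0 < d" "\<And>j k s t. j < m \<Longrightarrow> k < m \<Longrightarrow> j \<noteq> k \<Longrightarrow> d \<le> cmod (\<eta> j s - \<eta> k t)" using curves_separated by blast
  obtain B where B: "1 \<le> B" "\<And>k t. k < m \<Longrightarrow> cmod (\<eta>1 k t) \<le> B" using derivative_bounds by metis
  \<comment> \<open>The second bound keeps the displaced points at distance at least d/2 from the
    other curves.\<close>
  define \<delta>1 where "\<delta>1 = min \<delta>0 (d / (2 * B))"
  have \<delta>1: "0 < \<delta>1" "\<delta>1 \<le> \<delta>0" "\<delta>1 * B \<le> d / 2"
  proof -
    show "0 < \<delta>1" using C(2) d(1) B(1) by (simp add: \<delta>1_def)
    have "\<delta>1 * B \<le> d / (2 * B) * B" using B(1) by (intro mult_right_mono) (auto simp: \<delta>1_def)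
    then show "\<delta>1 * B \<le> d / 2" using B(1) by simp
  qed (simp add: \<delta>1_def)
  define a where "a n = \<delta>1 / real (Suc n)" for n
  have a: "0 < a n" "a n \<le> \<delta>1" for n using \<delta>1 by (auto simp: a_def divide_le_eq)
  have a0: "a \<longlonglongrightarrow> 0"
    using tendsto_mult[OF tendsto_const[of \<delta>1] LIMSEQ_inverse_real_of_nat] by (simp add: a_def[abs_def] divide_inverse)
  have "(\<forall>n. \<eta> j s + \<i> * of_real (\<sigma> * a n) * \<eta>1 j s \<notin> Gam m \<eta>) \<and>
     (\<lambda>n. LINT x|curveM. Im (tang x / (x - (\<eta> j s + \<i> * of_real (\<sigma> * a n) * \<eta>1 j s))))
        \<longlonglongrightarrow> (LINT x|curveM. Im (tang x / (x - \<eta> j s))) + \<sigma> * pi" if \<sigma>: "\<sigma> = 1 \<or> \<sigma> = -1" for \<sigma>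
  proof -
    define z where "z n = \<eta> j s + \<i> * of_real (\<sigma> * a n) * \<eta>1 j s" for n
    have sa: "\<bar>\<sigma> * a n\<bar> = a n" "(\<sigma> * a n)\<^sup>2 = (a n)\<^sup>2" for n using \<sigma> a(1)[of n] by auto
    have dz: "cmod (z n - \<eta> j s) \<le> d / 2" for n
    proof -
      have "cmod (z n - \<eta> j s) = a n * cmod (\<eta>1 j s)" using sa by (simp add: z_def norm_mult abs_mult[symmetric])
      also have "\<dots> \<le> \<delta>1 * B" using a[of n] B(2)[OF j] by (intro mult_mono) auto
      finally show ?thesis using \<delta>1(3) by linarith
    qed
    have far: "d / 2 \<le> cmod (\<eta> k t - z n)" if "k < m" "k \<noteq> j" for k t n
    proof -
      have "d \<le> cmod (\<eta> k t - \<eta> j s)" using d(2)[OF that(1) j that(2)] .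
      also have "\<dots> \<le> cmod (\<eta> k t - z n) + cmod (z n - \<eta> j s)" using norm_triangle_ineq[of "\<eta> k t - z n" "z n - \<eta> j s"] by simp
      finally show ?thesis using dz[of n] by linarith
    qed
    have near: "\<eta> j t - z n \<noteq> 0" "cmod (\<eta>1 j t / (\<eta> j t - z n) - 1 / (of_real (t - s) - \<i> * of_real (\<sigma> * a n))) \<le> C"
      if "\<bar>t - s\<bar> \<le> pi" for t n
      using C(3)[rule_format, OF j that, of "\<sigma> * a n"] sa(1)[of n] a[of n] \<delta>1(2) \<sigma> unfolding z_def by auto
    have zn: "z n \<notin> Gam m \<eta>" for n
    proof
      assume "z n \<in> Gam m \<eta>"
      then obtain k t where kt: "k < m" "z n = \<eta> k t" using GamE by blast
      show False
      proof (cases "k = j")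
        case True
        obtain t' where "\<bar>t' - s\<bar> \<le> pi" "\<eta> j t' = \<eta> j t" using window_representative[OF j] by blast
        then show False using near(1)[of t' n] kt True by simp
      next
        case False
        then show False using far[OF kt(1) False, of t n] kt(2) d(1) by simp
      qed
    qed
    define F where "F n x = Im (tang x / (x - z n))" for n x
    define \<kappa> where "\<kappa> x = Im (tang x / (x - \<eta> j s))" for x
    have Fi: "integrable curveM (F n)" for n unfolding F_def[abs_def] by (rule Cauchy_integrable(2)[OF zn])
    have ki: "integrable curveM \<kappa>" unfolding \<kappa>_def[abs_def] by (rule kappa_integrable[OF \<eta>_in_Gam[OF j]])
    let ?W = "{s - pi..s + pi}"
    define p where "p n t = (\<sigma> * a n) / ((t - s)\<^sup>2 + (\<sigma> * a n)\<^sup>2)" for n t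
    have san: "\<sigma> * a n \<noteq> 0" for n using sa(1)[of n] a(1)[of n] by auto
    have pint: "(p n has_integral 2 * arctan (pi / (\<sigma> * a n))) ?W" for n
      unfolding p_def[abs_def] by (rule integral_poisson_model[OF san])
    have zlim: "z \<longlonglongrightarrow> \<eta> j s"
    proof -
      have "z \<longlonglongrightarrow> \<eta> j s + \<i> * of_real (\<sigma> * 0) * \<eta>1 j s" unfolding z_def[abs_def] by (intro tendsto_intros a0)
      then show ?thesis by simp
    qed
    have "(\<lambda>n. integral ?W (\<lambda>t. F n (\<eta> j t) - p n t)) \<longlonglongrightarrow> integral ?W (\<lambda>t. \<kappa> (\<eta> j t))"
    proof (rule dominated_convergence(2)[where h = "\<lambda>_. C"])
      show "(\<lambda>t. F n (\<eta> j t) - p n t) integrable_on ?W" for n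
        using integral_curveM_window(1)[OF Fi j s] pint by (intro Henstock_Kurzweil_Integration.integrable_diff) auto
      show "norm (F n (\<eta> j t) - p n t) \<le> C" if "t \<in> ?W" for n t
      proof -
        have "\<bar>t - s\<bar> \<le> pi" using that by (auto simp: abs_le_iff)
        then have "cmod (\<eta>1 j t / (\<eta> j t - z n) - 1 / (of_real (t - s) - \<i> * of_real (\<sigma> * a n))) \<le> C" by (rule near(2))
        moreover have "F n (\<eta> j t) - p n t = Im (\<eta>1 j t / (\<eta> j t - z n) - 1 / (of_real (t - s) - \<i> * of_real (\<sigma> * a n)))"
          unfolding F_def p_def tang_\<eta>[OF j] minus_complex.sel Im_inverse_minus_i ..
        ultimately show ?thesis using abs_Im_le_cmod order_trans unfolding real_norm_def by metis
      qed
      show "(\<lambda>n. F n (\<eta> j t) - p n t) \<longlonglongrightarrow> \<kappa> (\<eta> j t)" if "t \<in> ?W" for t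
      proof (cases "t = s")
        case True
        \<comment> \<open>At the singular parameter the model is exact, and \<kappa> is 0 there by
          division by zero, so convergence holds for t = s too.\<close>
        have "F n (\<eta> j s) - p n s = 0" for n
        proof -
          have "\<eta>1 j s / (\<eta> j s - z n) = 1 / (of_real (s - s) - \<i> * of_real (\<sigma> * a n))"
            using d1_nz[OF j, of s] san[of n] by (simp add: z_def field_simps)
          then show ?thesis unfolding F_def p_def tang_\<eta>[OF j] using Im_inverse_minus_i[of "s - s" "\<sigma> * a n"] by simp
        qed
        then show ?thesis using True by (simp add: \<kappa>_def)
      next
        case False
        have nz: "\<eta> j t - \<eta> j s \<noteq> 0" using \<eta>_eq_imp_eq[OF j, of t s] False that pi_gt_zero by (force simp: abs_less_iff)
        have "(\<lambda>n. Im (\<eta>1 j t / (\<eta> j t - z n))) \<longlonglongrightarrow> Im (\<eta>1 j t / (\<eta> j t - \<eta> j s))"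
          using nz by (intro tendsto_intros zlim)
        moreover have "(\<lambda>n. p n t) \<longlonglongrightarrow> (\<sigma> * 0) / ((t - s)\<^sup>2 + (\<sigma> * 0)\<^sup>2)"
          unfolding p_def using False by (intro tendsto_intros a0) auto
        ultimately show ?thesis unfolding F_def \<kappa>_def tang_\<eta>[OF j] using tendsto_diff by fastforce
      qed
    qed auto
    moreover have "(\<lambda>n. integral ?W (p n)) \<longlonglongrightarrow> \<sigma> * pi"
    proof -
      have lim: "filterlim (\<lambda>n. pi / a n) at_top sequentially"
        by (rule filterlim_tendsto_pos_mult_at_top[OF tendsto_const pi_gt_zero, of "\<lambda>n. inverse (a n)", folded divide_inverse])
           (rule filterlim_inverse_at_top[OF a0], simp add: a)
      have "(\<lambda>n. arctan (pi / a n)) \<longlonglongrightarrow> pi / 2"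
        by (rule filterlim_compose[OF tendsto_arctan_at_top lim])
      then have "(\<lambda>n. \<sigma> * (2 * arctan (pi / a n))) \<longlonglongrightarrow> \<sigma> * (2 * (pi / 2))" by (intro tendsto_intros)
      moreover have "integral ?W (p n) = \<sigma> * (2 * arctan (pi / a n))" for n
        unfolding integral_unique[OF pint] using \<sigma> by (auto simp: arctan_minus)
      ultimately show ?thesis by simp
    qed
    ultimately have "(\<lambda>n. integral ?W (\<lambda>t. F n (\<eta> j t) - p n t) + integral ?W (p n)) \<longlonglongrightarrow> integral ?W (\<lambda>t. \<kappa> (\<eta> j t)) + \<sigma> * pi"
      by (rule tendsto_add)
    moreover have "integral ?W (\<lambda>t. F n (\<eta> j t) - p n t) + integral ?W (p n) = integral ?W (\<lambda>t. F n (\<eta> j t))" for n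
      using integral_curveM_window(1)[OF Fi j s] pint by (subst Henstock_Kurzweil_Integration.integral_diff) auto
    ultimately have L1: "(\<lambda>n. integral ?W (\<lambda>t. F n (\<eta> j t))) \<longlonglongrightarrow> integral ?W (\<lambda>t. \<kappa> (\<eta> j t)) + \<sigma> * pi" by simp
    have L2: "(\<lambda>n. integral {0..2*pi} (\<lambda>t. F n (\<eta> k t))) \<longlonglongrightarrow> integral {0..2*pi} (\<lambda>t. \<kappa> (\<eta> k t))" if k: "k \<in> {..<m} - {j}" for k
    proof (rule dominated_convergence(2)[where h = "\<lambda>_. B / (d / 2)"])
      have km: "k < m" "k \<noteq> j" using k by auto
      show "(\<lambda>t. F n (\<eta> k t)) integrable_on {0..2*pi}" for n by (rule integral_curveM(1)[OF Fi km(1)])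
      show "norm (F n (\<eta> k t)) \<le> B / (d / 2)" for n t
      proof -
        have "norm (F n (\<eta> k t)) \<le> cmod (\<eta>1 k t) / cmod (\<eta> k t - z n)"
          unfolding F_def tang_\<eta>[OF km(1)] real_norm_def by (metis abs_Im_le_cmod norm_divide)
        also have "\<dots> \<le> B / (d / 2)" using B(1) B(2)[OF km(1)] far[OF km] d(1) by (intro frac_le) auto
        finally show ?thesis .
      qed
      show "(\<lambda>n. F n (\<eta> k t)) \<longlonglongrightarrow> \<kappa> (\<eta> k t)" for t
      proof -
        have "\<eta> k t - \<eta> j s \<noteq> 0" using d(2)[OF km(1) j km(2), of t s] d(1) by auto
        then show ?thesis unfolding F_def \<kappa>_def by (intro tendsto_intros zlim)
      qed
    qed auto
    have "(\<lambda>n. integral ?W (\<lambda>t. F n (\<eta> j t)) + (\<Sum>k\<in>{..<m} - {j}. integral {0..2*pi} (\<lambda>t. F n (\<eta> k t))))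
       \<longlonglongrightarrow> (integral ?W (\<lambda>t. \<kappa> (\<eta> j t)) + \<sigma> * pi) + (\<Sum>k\<in>{..<m} - {j}. integral {0..2*pi} (\<lambda>t. \<kappa> (\<eta> k t)))"
      by (intro tendsto_add L1 tendsto_sum L2)
    then have "(\<lambda>n. LINT x|curveM. F n x) \<longlonglongrightarrow> (LINT x|curveM. \<kappa> x) + \<sigma> * pi"
      unfolding integral_curveM_window(2)[OF Fi j s] integral_curveM_window(2)[OF ki j s] by (simp add: algebra_simps)
    then show ?thesis using zn unfolding F_def \<kappa>_def z_def by blast
  qed
  then show ?thesis using a(1) a0 by (intro exI[of _ a]) blast
qed

lemma Gam_representative:
  assumes "y \<in> Gam m \<eta>"
  obtains j s where "j < m" "pi \<le> s" "s \<le> 3 * pi" "y = \<eta> j s"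
proof -
  obtain j t where j: "j < m" "y = \<eta> j t" using GamE[OF assms] by blast
  obtain n :: int where n: "pi \<le> t + of_int n * (2 * pi)" "t + of_int n * (2 * pi) < pi + 2 * pi" by (rule periodic_representative)
  show ?thesis by (rule that[of j "t + of_int n * (2 * pi)"]) (use j n shift_\<eta> in auto)
qed

lemma Im_winding_values:
  assumes "z \<notin> Gam m \<eta>"
  shows "(LINT x|curveM. Im (tang x / (x - z))) = 0 \<and> z \<in> Gdom m \<eta> \<or> (LINT x|curveM. Im (tang x / (x - z))) = - 2 * pi"
proof -
  have "(LINT x|curveM. Im (tang x / (x - z))) = Im (LINT x|curveM. tang x / (x - z))"
    using integral_Im[OF Cauchy_integrable(1)[OF assms]] by simp
  moreover have "z \<in> Gdom m \<eta> \<or> z \<in> Gminus m \<eta>" using assms by (auto simp: Gdom_def)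
  ultimately show ?thesis using winding_Gdom winding_Gminus by auto
qed

text \<open>Off \<Gamma> the integral takes only the values 0 and -2 pi. Its two one-sided limits at
  y lie pi above and pi below the value sought, which leaves only -pi; on which side
  \<open>Gdom\<close> lies is not presupposed.\<close>

lemma kappa_integral_value:
  assumes "y \<in> Gam m \<eta>"
  shows "(LINT x|curveM. Im (tang x / (x - y))) = - pi"
proof -
  obtain j s where js: "j < m" "pi \<le> s" "s \<le> 3 * pi" "y = \<eta> j s" by (rule Gam_representative[OF assms])
  obtain a where a: "\<forall>\<sigma>. \<sigma> = 1 \<or> \<sigma> = -1 \<longrightarrow>
     (\<forall>n. \<eta> j s + \<i> * of_real (\<sigma> * a n) * \<eta>1 j s \<notin> Gam m \<eta>) \<and>
     (\<lambda>n. LINT x|curveM. Im (tang x / (x - (\<eta> j s + \<i> * of_real (\<sigma> * a n) * \<eta>1 j s))))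
        \<longlonglongrightarrow> (LINT x|curveM. Im (tang x / (x - \<eta> j s))) + \<sigma> * pi" using kappa_limit[OF js(1-3)] by blast
  have "(LINT x|curveM. Im (tang x / (x - y))) + \<sigma> * pi \<in> {0, - 2 * pi}" if "\<sigma> = 1 \<or> \<sigma> = -1" for \<sigma>
  proof (rule closed_sequentially)
    show "closed {0, - 2 * pi}" by simp
    show "(\<lambda>n. LINT x|curveM. Im (tang x / (x - (\<eta> j s + \<i> * of_real (\<sigma> * a n) * \<eta>1 j s)))) \<longlonglongrightarrow> (LINT x|curveM. Im (tang x / (x - y))) + \<sigma> * pi"
      using a that js(4) by blast
    show "(LINT x|curveM. Im (tang x / (x - (\<eta> j s + \<i> * of_real (\<sigma> * a n) * \<eta>1 j s)))) \<in> {0, - 2 * pi}" for n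
      using Im_winding_values a that by blast
  qed
  from this[of 1] this[of "-1"] show ?thesis using pi_gt_zero by auto
qed

lemma curve_cover:
  obtains C where "\<And>n::nat. 0 < n \<Longrightarrow> \<exists>P. finite P \<and> card P \<le> m * n \<and> Gam m \<eta> \<subseteq> (\<Union>p\<in>P. cball p (C / real n))"
proof -
  obtain B where B: "1 \<le> B" "\<And>k t s. k < m \<Longrightarrow> cmod (\<eta> k t - \<eta> k s) \<le> B * \<bar>t - s\<bar>" using taylor_bounds by metis
  have "\<exists>P. finite P \<and> card P \<le> m * n \<and> Gam m \<eta> \<subseteq> (\<Union>p\<in>P. cball p (B * (2 * pi) / real n))" if n: "0 < n" for n :: nat
  proof (intro exI conjI)
    define P where "P = (\<lambda>(k, l). \<eta> k (2 * pi * real l / real n)) ` ({..<m} \<times> {..<n})"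
    show "finite P" by (simp add: P_def)
    show "card P \<le> m * n" unfolding P_def using card_image_le[of "{..<m} \<times> {..<n}"] by simp
    show "Gam m \<eta> \<subseteq> (\<Union>p\<in>P. cball p (B * (2 * pi) / real n))"
    proof
      fix x assume "x \<in> Gam m \<eta>"
      then obtain k t where kt: "k < m" "x = \<eta> k t" using GamE by blast
      obtain i :: int where i: "0 \<le> t + of_int i * (2 * pi)" "t + of_int i * (2 * pi) < 0 + 2 * pi" by (rule periodic_representative)
      define t' where "t' = t + of_int i * (2 * pi)"
      define v where "v = t' * real n / (2 * pi)"
      have v: "0 \<le> v" "v < real n" using i n by (auto simp: v_def t'_def divide_less_eq mult.commute)
      define l where "l = nat \<lfloor>v\<rfloor>"
      have l: "real l \<le> v" "v < real l + 1" using v(1) unfolding l_def by linarith+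
      have ln: "l < n" using l v by linarith
      have t'v: "t' = 2 * pi * v / real n" using n by (simp add: v_def)
      have "\<bar>t' - 2 * pi * real l / real n\<bar> = 2 * pi / real n * \<bar>v - real l\<bar>"
        unfolding t'v by (simp add: abs_mult right_diff_distrib[symmetric] diff_divide_distrib[symmetric])
      also have "\<dots> \<le> 2 * pi / real n * 1" using l by (intro mult_left_mono) auto
      finally have "B * \<bar>t' - 2 * pi * real l / real n\<bar> \<le> B * (2 * pi / real n)" using B(1) by (intro mult_left_mono) auto
      then have "dist (\<eta> k (2 * pi * real l / real n)) x \<le> B * (2 * pi) / real n"
        using B(2)[OF kt(1), of t' "2 * pi * real l / real n"] kt(2) shift_\<eta>(1)[OF kt(1)]
        by (simp add: t'_def dist_norm norm_minus_commute)
      moreover have "\<eta> k (2 * pi * real l / real n) \<in> P" using kt(1) ln by (auto simp: P_def)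
      ultimately show "x \<in> (\<Union>p\<in>P. cball p (B * (2 * pi) / real n))" by auto
    qed
  qed
  then show ?thesis using that by blast
qed

sublocale contour curveM "Gam m \<eta>" "Gdom m \<eta>" "Gminus m \<eta>" tang
proof (intro contour.intro finite_curveM contour_axioms.intro)
  show "compact (Gam m \<eta>)" by (rule compact_Gam)
  show "Gam m \<eta> \<noteq> {}" using \<eta>_in_Gam[of 0] m_pos by auto
  show "sets curveM = sets (restrict_space borel (Gam m \<eta>))" by (rule sets_curveM)
  show "\<exists>L. \<forall>x\<in>Gam m \<eta>. \<forall>y\<in>Gam m \<eta>. cmod (tang x - tang y) \<le> L * cmod (x - y)" by (rule tang_lipschitz)
  show "tang x \<noteq> 0" if "x \<in> Gam m \<eta>" for x
    by (rule GamE[OF that]) (use tang_\<eta> d1_nz in auto)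
  show "\<exists>C. \<forall>y\<in>Gam m \<eta>. integrable curveM (\<lambda>x. cmod (x - y) powr (\<beta> - 1)) \<and> (LINT x|curveM. cmod (x - y) powr (\<beta> - 1)) \<le> C"
    if "0 < \<beta>" "\<beta> \<le> 1" for \<beta> using that by (rule growth_curveM)
  show "\<exists>C. \<forall>x\<in>Gam m \<eta>. \<forall>y\<in>Gam m \<eta>. \<bar>Im (tang x / (x - y))\<bar> \<le> C" by (rule kappa_bound)
  show "(LINT x|curveM. Im (tang x / (x - y))) = - pi" if "y \<in> Gam m \<eta>" for y using that by (rule kappa_integral_value)
  show "open (Gdom m \<eta>)" "open (Gminus m \<eta>)" "bounded (Gminus m \<eta>)" by (rule open_Gdom open_Gminus bounded_Gminus)+
  show "Gdom m \<eta> \<inter> Gminus m \<eta> = {}" by (auto simp: Gdom_def)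
  show "Gdom m \<eta> \<union> Gminus m \<eta> = - Gam m \<eta>" using Gminus_Gam_disjoint by (auto simp: Gdom_def)
  show "(LINT x|curveM. tang x / (x - z)) = 0" if "z \<in> Gdom m \<eta>" for z using that by (rule winding_Gdom)
  show "(LINT x|curveM. tang x / (x - z)) = - (2 * of_real pi * \<i>)" if "z \<in> Gminus m \<eta>" for z using that by (rule winding_Gminus)
  show "F holomorphic_on UNIV" if F: "continuous_on UNIV F" "F holomorphic_on (- Gam m \<eta>)" for F
  proof -
    obtain C where "\<And>n::nat. 0 < n \<Longrightarrow> \<exists>P. finite P \<and> card P \<le> m * n \<and> Gam m \<eta> \<subseteq> (\<Union>p\<in>P. cball p (C / real n))"
      using curve_cover by blast
    then show ?thesis using removable_thin_set[OF compact_imp_closed[OF compact_Gam] _ F] by blast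
  qed
qed

end

context contour
begin

text \<open>The pair glued in \<open>Cauchy_minus\<close>, read on the side of \<open>D\<close>; the
  sign reflects the clockwise orientation.\<close>

lemma Cauchy_minus_inside:
  assumes "holo_minus g" "hoelder_on \<Gamma> g" "z \<in> D"
  shows "Cint g z = - g z"
proof -
  have hm: "holo_minus (\<lambda>z. g z + Cminus g z)"
    using assms(1) holo_minus_Cminus[OF assms(2)] unfolding holo_minus_def by (auto intro!: holomorphic_intros continuous_intros)
  have "g z + Cminus g z = 0"
    by (rule glue(2)[OF holo_plus_Cplus[OF assms(2)] hm]) (use assms(3) in \<open>auto simp: Cplus_def Cminus_def\<close>)
  moreover have "z \<notin> \<Gamma>" using assms(3) D_\<Gamma>_disjoint by auto
  ultimately show ?thesis by (simp add: Cminus_def add_eq_0_iff)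
qed

end

section \<open>Zygmund's exponential estimate\<close>

text \<open>The unit circle is traversed clockwise, as \<open>clockwise\<close> in the locale
  \<open>curves\<close> demands.\<close>

definition circ :: "real \<Rightarrow> complex" where
  "circ t = exp (- (\<i> * of_real t))"

definition circ' :: "real \<Rightarrow> complex" where
  "circ' t = - \<i> * circ t"

lemma circ_periodic: "circ (t + 2 * pi) = circ t"
proof -
  have "exp (- (\<i> * of_real (t + 2 * pi))) = exp (- (\<i> * of_real t)) / exp (2 * of_real pi * \<i>)"
    unfolding exp_diff[symmetric] by (simp add: algebra_simps)
  then show ?thesis unfolding circ_def by simp
qed

lemma norm_circ: "cmod (circ t) = 1"
  by (simp add: circ_def)

lemma circ_nz: "circ t \<noteq> 0"
  by (simp add: circ_def)

lemma circ_deriv: "(circ has_vector_derivative circ' t) (at t)"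
  unfolding circ_def circ'_def
  by (rule has_vector_derivative_real_field[where f = "\<lambda>z. exp (- (\<i> * z))"]) (auto intro!: derivative_eq_intros)

lemma bloop_circ: "bloop (\<lambda>_. circ) k = reversepath (circlepath 0 1)"
proof
  fix s
  have "exp (2 * of_real pi * \<i> * of_real (1 - s)) = exp (2 * of_real pi * \<i>) * exp (- (\<i> * of_real (2 * pi * s)))"
    unfolding exp_add[symmetric] by (simp add: algebra_simps)
  then show "bloop (\<lambda>_. circ) k s = reversepath (circlepath 0 1) s"
    by (simp add: bloop_def circ_def reversepath_def circlepath)
qed

lemma Gam_k_circ: "Gam_k (\<lambda>_. circ) k = sphere 0 1"
proof -
  have "path_image (bloop (\<lambda>_. circ) k) = circ ` ((\<lambda>s. 2 * pi * s) ` {0..1})"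
    unfolding path_image_def bloop_def image_image ..
  also have "(\<lambda>s. 2 * pi * s) ` {0..1} = {0..2*pi}" by (simp add: image_mult_atLeastAtMost)
  finally have "Gam_k (\<lambda>_. circ) k = path_image (bloop (\<lambda>_. circ) k)" by (simp add: Gam_k_def)
  then show ?thesis unfolding bloop_circ by simp
qed

lemma inside_unit_sphere: "inside (sphere 0 1 :: complex set) = ball 0 1"
  using inside_frontier_eq_interior[of "cball 0 1 :: complex set"] by simp

text \<open>An instance of the same locale, so that the Cauchy formulas and
  \<open>local_expansion\<close> are available for the circle as well.\<close>

interpretation circle: curves "Suc 0" "\<lambda>_. circ" "\<lambda>_. circ'" "\<lambda>_ t. - circ t"
proof
  show "(circ' has_vector_derivative - circ t) (at t)" for t
    using has_vector_derivative_mult_right[OF circ_deriv, of "- \<i>" t] unfolding circ'_def[abs_def] by simp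
  show "continuous_on UNIV (\<lambda>t. - circ t)" unfolding circ_def by (intro continuous_intros)
  show "simple_path (bloop (\<lambda>_. circ) k)" for k
    unfolding bloop_circ by (intro simple_path_reversepath) (simp add: simple_path_circlepath)
  show "winding_number (bloop (\<lambda>_. circ) k) z = - 1" if "z \<in> inside (Gam_k (\<lambda>_. circ) k)" for k z
  proof -
    have z: "cmod z < 1" using that by (simp add: Gam_k_circ inside_unit_sphere)
    then have "winding_number (circlepath 0 1) z = 1" by (intro winding_number_circlepath) simp
    then show ?thesis unfolding bloop_circ using z by (subst winding_number_reversepath) auto
  qed
qed (use circ_periodic circ_deriv circ_nz in \<open>auto simp: circ'_def\<close>)

lemma Gam_circ: "Gam (Suc 0) (\<lambda>_. circ) = sphere 0 1" and Gminus_circ: "Gminus (Suc 0) (\<lambda>_. circ) = ball 0 1"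
  unfolding Gam_def Gminus_def by (auto simp: Gam_k_circ inside_unit_sphere)

lemma tang_circ: "x \<in> sphere 0 1 \<Longrightarrow> circle.tang x = - \<i> * x"
  unfolding Gam_circ[symmetric] by (erule circle.GamE) (simp add: circle.tang_\<eta> circ'_def)

text \<open>Writing w = x/(x - y), unimodularity gives w + cnj w = 1. The Neumann kernel of the
  circle is therefore constant, which makes the imaginary part of the boundary value below
  explicit.\<close>

lemma Im_tang_circ:
  assumes "x \<in> sphere 0 1" "y \<in> sphere 0 1" "x \<noteq> y"
  shows "Im (circle.tang x / (x - y)) = - (1 / 2)"
proof -
  have n: "x * cnj x = 1" "y * cnj y = 1" using assms by (auto simp: complex_norm_square[symmetric])
  define w where "w = x / (x - y)"
  have ne: "x - y \<noteq> 0" "cnj x - cnj y \<noteq> 0" using assms(3) by (auto simp flip: complex_cnj_diff)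
  have "w + cnj w = 1"
  proof -
    have "w + cnj w = (x * (cnj x - cnj y) + cnj x * (x - y)) / ((x - y) * (cnj x - cnj y))"
      using ne by (simp add: w_def field_simps)
    also have "x * (cnj x - cnj y) + cnj x * (x - y) = (x - y) * (cnj x - cnj y)"
      using n by (simp add: algebra_simps)
    finally show ?thesis using ne by simp
  qed
  then have "Re w = 1 / 2" by (simp add: complex_eq_iff)
  then show ?thesis using assms(1) by (simp add: tang_circ w_def flip: times_divide_eq_right)
qed

lemma circle_integral_const: "(LINT x|circle.curveM. (1::real)) = 2 * pi"
proof -
  have "integrable circle.curveM (\<lambda>_. 1::real)" by simp
  from circle.integral_curveM(2)[OF this] show ?thesis by simp
qed

text \<open>The holomorphic extension \<open>W\<close> of \<open>exp (- Cbd (\<i> \<theta>))\<close>, corrected by the jump, has argument \<open>\<theta> / 2\<close>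
  on the circle, so its modulus is controlled by its real part and thereby by its value at the centre.\<close>
lemma circle_exp_integral_bound:
  fixes \<theta> :: "complex \<Rightarrow> real"
  assumes \<theta>: "hoelder_on (sphere 0 1) \<theta>" "\<And>x. x \<in> sphere 0 1 \<Longrightarrow> \<bar>\<theta> x\<bar> \<le> pi / 2"
  defines "q \<equiv> \<lambda>x. Re (circle.Cbd (\<lambda>x. \<i> * of_real (\<theta> x)) x)"
  shows "(\<lambda>t. exp (- q (circ t))) integrable_on {0..2*pi}"
    "integral {0..2*pi} (\<lambda>t. exp (- q (circ t))) \<le> 2 * sqrt 2 * pi"
proof -
  define \<rho> where "\<rho> x = \<i> * of_real (\<theta> x)" for x
  have ht: "hoelder_on (Gam (Suc 0) (\<lambda>_. circ)) (\<lambda>x. complex_of_real (\<theta> x))" using \<theta>(1) by (simp add: hoelder_on_of_real_iff Gam_circ)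
  have h\<rho>: "hoelder_on (Gam (Suc 0) (\<lambda>_. circ)) \<rho>" unfolding \<rho>_def by (intro hoelder_on_mult hoelder_on_const ht circle.compact_Gam)
  define I where "I = (LINT x|circle.curveM. \<theta> x)"
  have i\<theta>: "integrable circle.curveM \<theta>"
    using circle.bdd_meas_integrable[OF circle.bdd_meas_hoelder, of \<theta>] \<theta>(1) by (simp add: Gam_circ)
  have im: "Im (circle.Cbd \<rho> y) = \<theta> y / 2 - I / (4 * pi)" if y: "y \<in> sphere 0 1" for y
  proof -
    have "Im (circle.Cbd \<rho> y) = Im (LINT x|circle.curveM. (of_real (\<theta> x) - of_real (\<theta> y)) * circle.tang x / (x - y)) / (2 * pi)"
    proof -
      have "(LINT x|circle.curveM. (\<rho> x - \<rho> y) * circle.tang x / (x - y)) =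
         \<i> * (LINT x|circle.curveM. (of_real (\<theta> x) - of_real (\<theta> y)) * circle.tang x / (x - y))"
        unfolding integral_mult_right_zero[symmetric] by (intro Bochner_Integration.integral_cong) (simp_all add: \<rho>_def right_diff_distrib)
      moreover have "Im (\<i> * w / (2 * of_real pi * \<i>)) = Im w / (2 * pi)" for w
      proof -
        have "\<i> * w / (2 * of_real pi * \<i>) = w / of_real (2 * pi)" by simp
        then show ?thesis by (simp only: Im_divide_of_real)
      qed
      ultimately show ?thesis unfolding circle.Cbd_def by (simp only:)
    qed
    also have "Im (LINT x|circle.curveM. (of_real (\<theta> x) - of_real (\<theta> y)) * circle.tang x / (x - y)) =
       (LINT x|circle.curveM. Im ((of_real (\<theta> x) - of_real (\<theta> y)) * circle.tang x / (x - y)))"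
      by (rule integral_Im[symmetric]) (use circle.singular_integrable[OF ht] y in \<open>simp add: Gam_circ\<close>)
    also have "\<dots> = (LINT x|circle.curveM. - (1 / 2) * (\<theta> x - \<theta> y))"
    proof (rule Bochner_Integration.integral_cong)
      fix x assume "x \<in> space circle.curveM"
      then have x: "x \<in> sphere 0 1" by (simp add: circle.space_curveM Gam_circ)
      show "Im ((of_real (\<theta> x) - of_real (\<theta> y)) * circle.tang x / (x - y)) = - (1 / 2) * (\<theta> x - \<theta> y)"
      proof (cases "x = y")
        case False
        have "(of_real (\<theta> x) - of_real (\<theta> y)) * circle.tang x / (x - y) = of_real (\<theta> x - \<theta> y) * (circle.tang x / (x - y))" by simp
        moreover have "Im (of_real a * w) = a * Im w" for a w by simp
        ultimately show ?thesis using Im_tang_circ[OF x y False] by (simp only:)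
      qed simp
    qed simp
    also have "\<dots> = - (1 / 2) * (I - \<theta> y * (2 * pi))"
    proof -
      have "(LINT x|circle.curveM. \<theta> x - \<theta> y * 1) = I - (LINT x|circle.curveM. \<theta> y * 1)"
        unfolding I_def by (rule Bochner_Integration.integral_diff[OF i\<theta>]) (simp add: circle.finite_measure_axioms)
      also have "(LINT x|circle.curveM. \<theta> y * 1) = \<theta> y * (2 * pi)" by (subst integral_mult_right_zero) (simp only: circle_integral_const)
      finally show ?thesis by (subst integral_mult_right_zero) simp
    qed
    finally show ?thesis by (simp add: field_simps)
  qed
  \<comment> \<open>The constant I/(4 pi) cancels the mean in \<open>im\<close>, so that on the
    circle W has argument exactly \<theta>/2.\<close>
  define W where "W z = exp (- (circle.Cminus \<rho> z + \<i> * of_real (I / (4 * pi))))" for z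
  have hmW: "circle.holo_minus W" using circle.holo_minus_Cminus[OF h\<rho>] unfolding circle.holo_minus_def W_def
    by (auto intro!: holomorphic_intros continuous_intros)
  have cW: "W x = exp (- of_real (q x)) * exp (\<i> * of_real (\<theta> x / 2))" if x: "x \<in> sphere 0 1" for x
  proof -
    have "circle.Cminus \<rho> x + \<i> * of_real (I / (4 * pi)) = of_real (q x) - \<i> * of_real (\<theta> x / 2)"
    proof -
      have "x \<in> Gam (Suc 0) (\<lambda>_. circ)" using x unfolding Gam_circ .
      then have "circle.Cminus \<rho> x = circle.Cbd \<rho> x - \<rho> x" by (simp add: circle.Cminus_def)
      moreover have "q x = Re (circle.Cbd \<rho> x)" unfolding q_def \<rho>_def ..
      moreover have "Re (\<rho> x) = 0" "Im (\<rho> x) = \<theta> x" by (simp_all add: \<rho>_def)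
      ultimately show ?thesis using im[OF x] by (simp add: complex_eq_iff)
    qed
    then show ?thesis unfolding W_def by (simp add: exp_add[symmetric])
  qed
  have hW: "hoelder_on (Gam (Suc 0) (\<lambda>_. circ)) W"
  proof -
    have "hoelder_on (Gam (Suc 0) (\<lambda>_. circ)) (\<lambda>x. exp ((- 1) * ((circle.Cbd \<rho> x - \<rho> x) + \<i> * of_real (I / (4 * pi)))))"
      by (intro hoelder_on_exp hoelder_on_mult hoelder_on_add hoelder_on_diff hoelder_on_const circle.hoelder_Cbd h\<rho> circle.compact_Gam circle.bounded_\<Gamma>)
    then show ?thesis unfolding hoelder_on_def W_def circle.Cminus_def by simp
  qed
  have iW: "integrable circle.curveM W" using hW by (intro circle.bdd_meas_integrable circle.bdd_meas_hoelder)
  have int0: "(LINT x|circle.curveM. w x * circle.tang x / (x - 0)) = - \<i> * (LINT x|circle.curveM. w x)" for w :: "complex \<Rightarrow> complex"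
  proof -
    have "(LINT x|circle.curveM. w x * circle.tang x / (x - 0)) = (LINT x|circle.curveM. - \<i> * w x)"
    proof (rule Bochner_Integration.integral_cong)
      fix x assume "x \<in> space circle.curveM"
      then have x: "x \<in> sphere 0 1" by (simp add: circle.space_curveM Gam_circ)
      then have "x \<noteq> 0" by auto
      then show "w x * circle.tang x / (x - 0) = - \<i> * w x" using tang_circ[OF x] by simp
    qed simp
    then show ?thesis by (simp only: integral_mult_right_zero)
  qed
  have "circle.Cint W 0 = - W 0" by (rule circle.Cauchy_minus_inside[OF hmW hW]) (simp add: Gminus_circ)
  then have IW: "(LINT x|circle.curveM. W x) = 2 * of_real pi * W 0"
    unfolding circle.Cint_def int0 by (simp add: field_simps)
  have "0 \<notin> Gam (Suc 0) (\<lambda>_. circ)" unfolding Gam_circ by simp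
  then have "circle.Cminus \<rho> 0 = circle.Cint \<rho> 0" by (simp add: circle.Cminus_def)
  also have "\<dots> = - \<i> * (LINT x|circle.curveM. \<rho> x) / (2 * of_real pi * \<i>)" unfolding circle.Cint_def int0 ..
  also have "(LINT x|circle.curveM. \<rho> x) = \<i> * of_real I"
    unfolding \<rho>_def I_def by (simp only: integral_mult_right_zero integral_complex_of_real)
  also have "- \<i> * (\<i> * of_real I) / (2 * of_real pi * \<i>) = - \<i> * of_real (I / (2 * pi))" by (simp add: field_simps)
  finally have "Re (circle.Cminus \<rho> 0) = 0" by simp
  then have W0: "cmod (W 0) = 1" by (simp add: W_def)
  have cont: "continuous_on (Gam (Suc 0) (\<lambda>_. circ)) (\<lambda>x. exp (- q x))"
    unfolding q_def \<rho>_def[symmetric] by (intro continuous_intros hoelder_on_imp_continuous_on circle.hoelder_Cbd h\<rho>)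
  then have iq: "integrable circle.curveM (\<lambda>x. exp (- q x))" by (intro circle.bdd_meas_integrable circle.bdd_meas_continuous_on)
  have "(LINT x|circle.curveM. exp (- q x)) \<le> (LINT x|circle.curveM. sqrt 2 * Re (W x))"
  proof (rule integral_mono[OF iq])
    show "integrable circle.curveM (\<lambda>x. sqrt 2 * Re (W x))" by (intro integrable_mult_right integrable_Re iW)
    fix x assume "x \<in> space circle.curveM"
    then have x: "x \<in> sphere 0 1" by (simp add: circle.space_curveM Gam_circ)
    \<comment> \<open>An argument of at most pi/4 makes the cosine at least 1/sqrt 2; this is the
      origin of the constant sqrt 2.\<close>
    have "\<bar>\<theta> x / 2\<bar> \<le> pi / 4" using \<theta>(2)[OF x] by simp
    then have "cos (pi / 4) \<le> cos \<bar>\<theta> x / 2\<bar>" by (intro cos_monotone_0_pi_le) auto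
    then have "sqrt 2 / 2 \<le> cos (\<theta> x / 2)" unfolding cos_45 cos_abs_real .
    from mult_left_mono[OF this, of "sqrt 2"] have c: "1 \<le> sqrt 2 * cos (\<theta> x / 2)" by simp
    have "Re (W x) = exp (- q x) * cos (\<theta> x / 2)"
      unfolding cW[OF x] exp_add[symmetric] by (simp add: Re_exp)
    then show "exp (- q x) \<le> sqrt 2 * Re (W x)" using mult_left_mono[OF c, of "exp (- q x)"] by (simp add: mult_ac)
  qed
  also have "\<dots> = sqrt 2 * Re (LINT x|circle.curveM. W x)" by (simp only: integral_mult_right_zero integral_Re[OF iW])
  also have "\<dots> \<le> sqrt 2 * cmod (LINT x|circle.curveM. W x)" by (intro mult_left_mono complex_Re_le_cmod) auto
  also have "\<dots> = 2 * sqrt 2 * pi" unfolding IW by (simp add: norm_mult W0)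
  finally have "(LINT x|circle.curveM. exp (- q x)) \<le> 2 * sqrt 2 * pi" .
  then show "integral {0..2*pi} (\<lambda>t. exp (- q (circ t))) \<le> 2 * sqrt 2 * pi"
    using circle.integral_curveM(2)[OF iq] by simp
  show "(\<lambda>t. exp (- q (circ t))) integrable_on {0..2*pi}"
    using circle.integral_curveM(1)[OF iq, of 0] by simp
qed

lemma circ_eq_imp: 
  assumes "circ t = circ s"
  obtains n :: int where "t = s + of_int n * (2 * pi)"
proof -
  obtain n :: int where "- (\<i> * of_real t) = - (\<i> * of_real s) + of_int (2 * n) * of_real pi * \<i>"
    using assms unfolding circ_def exp_eq by auto
  then have "- t = - s + 2 * of_int n * pi" by (simp add: complex_eq_iff)
  then show ?thesis by (intro that[of "- n"]) (simp add: algebra_simps)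
qed

section \<open>Transfer of the estimate to general curves; approach along the normal\<close>

context curves
begin

text \<open>In a window around the singularity both kernels are 1/(t - s) up to bounded errors, so
  the difference of the singular integrals involves only the bound pi/2 for the density. A
  dependence on its Hoelder norm would destroy the uniformity of Zygmund's estimate.\<close>

lemma Cbd_circle_comparison:
  "\<exists>K. \<forall>\<rho> \<rho>' j s. hoelder_on (Gam m \<eta>) \<rho> \<longrightarrow> (\<forall>x\<in>Gam m \<eta>. cmod (\<rho> x) \<le> pi / 2) \<longrightarrow> hoelder_on (sphere 0 1) \<rho>' \<longrightarrow>
     j < m \<longrightarrow> (\<forall>t. \<rho>' (circ t) = \<rho> (\<eta> j t)) \<longrightarrow> pi \<le> s \<longrightarrow> s \<le> 3 * pi \<longrightarrow>
     cmod (Cbd \<rho> (\<eta> j s) - circle.Cbd \<rho>' (circ s)) \<le> K"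
proof -
  obtain C \<delta>0 where C: "0 < C" "0 < \<delta>0"
    "\<forall>k s t \<delta>. k < m \<longrightarrow> \<bar>t - s\<bar> \<le> pi \<longrightarrow> \<bar>\<delta>\<bar> \<le> \<delta>0 \<longrightarrow> (t \<noteq> s \<or> \<delta> \<noteq> 0) \<longrightarrow>
       \<eta> k t - (\<eta> k s + \<i> * of_real \<delta> * \<eta>1 k s) \<noteq> 0 \<and>
       cmod (\<eta>1 k t / (\<eta> k t - (\<eta> k s + \<i> * of_real \<delta> * \<eta>1 k s)) - 1 / (of_real (t - s) - \<i> * of_real \<delta>)) \<le> C"
    by (rule local_expansion)
  obtain C' \<delta>0' where C': "0 < C'" "0 < \<delta>0'"
    "\<forall>k s t \<delta>. k < Suc 0 \<longrightarrow> \<bar>t - s\<bar> \<le> pi \<longrightarrow> \<bar>\<delta>\<bar> \<le> \<delta>0' \<longrightarrow> (t \<noteq> s \<or> \<delta> \<noteq> 0) \<longrightarrow>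
       circ t - (circ s + \<i> * of_real \<delta> * circ' s) \<noteq> 0 \<and>
       cmod (circ' t / (circ t - (circ s + \<i> * of_real \<delta> * circ' s)) - 1 / (of_real (t - s) - \<i> * of_real \<delta>)) \<le> C'"
    by (rule circle.local_expansion)
  obtain d where d: "0 < d" "\<And>j k s t. j < m \<Longrightarrow> k < m \<Longrightarrow> j \<noteq> k \<Longrightarrow> d \<le> cmod (\<eta> j s - \<eta> k t)" using curves_separated by blast
  obtain B where B: "1 \<le> B" "\<And>k t. k < m \<Longrightarrow> cmod (\<eta>1 k t) \<le> B" using derivative_bounds by metis
  \<comment> \<open>pi bounds the differences of values of \<rho>, and 2 pi is the length of a
    parameter interval; the second summand collects the other curves.\<close>
  define K where "K = (pi * (C + C') * (2 * pi) + real m * (pi * (B / d) * (2 * pi))) / (2 * pi)"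
  have "cmod (Cbd \<rho> (\<eta> j s) - circle.Cbd \<rho>' (circ s)) \<le> K"
    if h: "hoelder_on (Gam m \<eta>) \<rho>" and bd: "\<forall>x\<in>Gam m \<eta>. cmod (\<rho> x) \<le> pi / 2" and h': "hoelder_on (sphere 0 1) \<rho>'"
      and j: "j < m" and eq: "\<forall>t. \<rho>' (circ t) = \<rho> (\<eta> j t)" and s: "pi \<le> s" "s \<le> 3 * pi" for \<rho> \<rho>' j s
  proof -
    define F where "F x = (\<rho> x - \<rho> (\<eta> j s)) * tang x / (x - \<eta> j s)" for x
    define F' where "F' x = (\<rho>' x - \<rho>' (circ s)) * circle.tang x / (x - circ s)" for x
    have iF: "integrable curveM F" unfolding F_def by (rule singular_integrable[OF h \<eta>_in_Gam[OF j]])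
    have iF': "integrable circle.curveM F'" unfolding F'_def
      by (rule circle.singular_integrable) (use h' in \<open>auto simp: Gam_circ norm_circ\<close>)
    have df: "cmod (\<rho> x - \<rho> y) \<le> pi" if "x \<in> Gam m \<eta>" "y \<in> Gam m \<eta>" for x y
      using norm_triangle_ineq4[of "\<rho> x" "\<rho> y"] bd[rule_format, OF that(1)] bd[rule_format, OF that(2)] by simp
    define R where "R = (\<Sum>k\<in>{..<m} - {j}. integral {0..2*pi} (\<lambda>t. F (\<eta> k t)))"
    have W: "(\<lambda>t. F (\<eta> j t)) integrable_on {s - pi..s + pi}"
      "(LINT x|curveM. F x) = integral {s - pi..s + pi} (\<lambda>t. F (\<eta> j t)) + R"
      unfolding R_def by (rule integral_curveM_window[OF iF j s])+
    have W': "(\<lambda>t. F' (circ t)) integrable_on {s - pi..s + pi}"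
      "(LINT x|circle.curveM. F' x) = integral {s - pi..s + pi} (\<lambda>t. F' (circ t))"
      using circle.integral_curveM_window[OF iF' _ s, of 0] by (auto simp: lessThan_Suc)
    have "norm (integral {0..2*pi} (\<lambda>t. F (\<eta> k t))) \<le> pi * (B / d) * (2 * pi)" if k: "k \<in> {..<m} - {j}" for k
    proof -
      have km: "k < m" "k \<noteq> j" using k by auto
      have i: "(\<lambda>t. F (\<eta> k t)) integrable_on {0..2*pi}" by (rule integral_curveM(1)[OF iF km(1)])
      have "norm (integral (cbox 0 (2*pi)) (\<lambda>t. F (\<eta> k t))) \<le> pi * (B / d) * Sigma_Algebra.measure lborel (cbox 0 (2 * pi))"
      proof (rule integrable_bound)
        show "0 \<le> pi * (B / d)" using B(1) d(1) by simp
        show "(\<lambda>t. F (\<eta> k t)) integrable_on cbox 0 (2 * pi)" using i by simp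
        fix t
        have "norm (F (\<eta> k t)) = cmod (\<rho> (\<eta> k t) - \<rho> (\<eta> j s)) * (cmod (\<eta>1 k t) / cmod (\<eta> k t - \<eta> j s))"
          unfolding F_def using tang_\<eta>[OF km(1)] by (simp add: norm_mult norm_divide)
        also have "\<dots> \<le> pi * (B / d)"
          by (intro mult_mono frac_le df \<eta>_in_Gam km j B d(2)) (use d B km in auto)
        finally show "norm (F (\<eta> k t)) \<le> pi * (B / d)" .
      qed
      then show ?thesis by simp
    qed
    then have "norm R \<le> real (card ({..<m} - {j})) * (pi * (B / d) * (2 * pi))" unfolding R_def by (intro sum_norm_bound) auto
    also have "\<dots> \<le> real m * (pi * (B / d) * (2 * pi))"
      using B(1) d(1) card_mono[of "{..<m}" "{..<m} - {j}"] by (intro mult_right_mono) auto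
    finally have R: "norm R \<le> real m * (pi * (B / d) * (2 * pi))" .
    have "norm (integral (cbox (s - pi) (s + pi)) (\<lambda>t. F (\<eta> j t) - F' (circ t))) \<le> pi * (C + C') * Sigma_Algebra.measure lborel (cbox (s - pi) (s + pi))"
    proof (rule integrable_bound)
      show "0 \<le> pi * (C + C')" using C(1) C'(1) by simp
      show "(\<lambda>t. F (\<eta> j t) - F' (circ t)) integrable_on cbox (s - pi) (s + pi)" using W(1) W'(1) by (simp add: integrable_diff)
      fix t assume "t \<in> cbox (s - pi) (s + pi)"
      then have t: "\<bar>t - s\<bar> \<le> pi" by auto
      show "norm (F (\<eta> j t) - F' (circ t)) \<le> pi * (C + C')"
      proof (cases "t = s")
        case True
        then show ?thesis using C(1) C'(1) by (simp add: F_def F'_def)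
      next
        case False
        have 1: "cmod (\<eta>1 j t / (\<eta> j t - \<eta> j s) - 1 / of_real (t - s)) \<le> C"
          using C(3)[rule_format, of j t s 0] j t False C(2) by simp
        have 2: "cmod (circ' t / (circ t - circ s) - 1 / of_real (t - s)) \<le> C'"
          using C'(3)[rule_format, of 0 t s 0] t False C'(2) by simp
        have "F (\<eta> j t) - F' (circ t) = (\<rho> (\<eta> j t) - \<rho> (\<eta> j s)) * ((\<eta>1 j t / (\<eta> j t - \<eta> j s) - 1 / of_real (t - s)) - (circ' t / (circ t - circ s) - 1 / of_real (t - s)))"
          unfolding F_def F'_def using eq tang_\<eta>[OF j] circle.tang_\<eta>[of 0 t] by (simp add: right_diff_distrib)
        also have "cmod \<dots> \<le> pi * (C + C')" unfolding norm_mult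
          by (intro mult_mono df \<eta>_in_Gam j order_trans[OF norm_triangle_ineq4] add_mono 1 2) auto
        finally show ?thesis .
      qed
    qed
    moreover have "integral (cbox (s - pi) (s + pi)) (\<lambda>t. F (\<eta> j t) - F' (circ t)) =
        integral {s - pi..s + pi} (\<lambda>t. F (\<eta> j t)) - integral {s - pi..s + pi} (\<lambda>t. F' (circ t))"
      unfolding cbox_interval by (rule Henstock_Kurzweil_Integration.integral_diff[OF W(1) W'(1)])
    moreover have "Sigma_Algebra.measure lborel (cbox (s - pi) (s + pi)) = 2 * pi" by simp
    ultimately have I: "norm (integral {s - pi..s + pi} (\<lambda>t. F (\<eta> j t)) - integral {s - pi..s + pi} (\<lambda>t. F' (circ t))) \<le> pi * (C + C') * (2 * pi)"
      by (simp only:)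
    have "Cbd \<rho> (\<eta> j s) - circle.Cbd \<rho>' (circ s) = ((integral {s - pi..s + pi} (\<lambda>t. F (\<eta> j t)) - integral {s - pi..s + pi} (\<lambda>t. F' (circ t))) + R) / (2 * of_real pi * \<i>)"
      unfolding Cbd_def circle.Cbd_def F_def[symmetric] F'_def[symmetric] W(2) W'(2) by (simp add: diff_divide_distrib add_divide_distrib)
    also have "cmod \<dots> \<le> K" unfolding norm_divide K_def
      using order_trans[OF norm_triangle_ineq add_mono[OF I R]] by (simp add: norm_mult divide_right_mono)
    finally show ?thesis .
  qed
  then show ?thesis by blast
qed

text \<open>On each curve the density is transplanted to the circle along the common parameter; by
  the comparison the exponential grows by at most the factor exp K.\<close>

lemma exp_integral_bound_curves:
  "\<exists>C. \<forall>\<theta>. hoelder_on (Gam m \<eta>) \<theta> \<longrightarrow> (\<forall>x\<in>Gam m \<eta>. \<bar>\<theta> x\<bar> \<le> pi / 2) \<longrightarrow>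
       integrable curveM (\<lambda>x. exp (- Re (Cbd (\<lambda>x. \<i> * of_real (\<theta> x)) x))) \<and>
       (LINT x|curveM. exp (- Re (Cbd (\<lambda>x. \<i> * of_real (\<theta> x)) x))) \<le> C"
proof -
  obtain K where K: "\<forall>\<rho> \<rho>' j s. hoelder_on (Gam m \<eta>) \<rho> \<longrightarrow> (\<forall>x\<in>Gam m \<eta>. cmod (\<rho> x) \<le> pi / 2) \<longrightarrow> hoelder_on (sphere 0 1) \<rho>' \<longrightarrow>
     j < m \<longrightarrow> (\<forall>t. \<rho>' (circ t) = \<rho> (\<eta> j t)) \<longrightarrow> pi \<le> s \<longrightarrow> s \<le> 3 * pi \<longrightarrow>
     cmod (Cbd \<rho> (\<eta> j s) - circle.Cbd \<rho>' (circ s)) \<le> K" using Cbd_circle_comparison by (elim exE)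
  obtain B where B: "1 \<le> B" "\<And>k t s. k < m \<Longrightarrow> cmod (\<eta> k t - \<eta> k s) \<le> B * \<bar>t - s\<bar>" using taylor_bounds by metis
  have "integrable curveM (\<lambda>x. exp (- Re (Cbd (\<lambda>x. \<i> * of_real (\<theta> x)) x))) \<and>
       (LINT x|curveM. exp (- Re (Cbd (\<lambda>x. \<i> * of_real (\<theta> x)) x))) \<le> real m * (exp K * (2 * sqrt 2 * pi))"
    if \<theta>: "hoelder_on (Gam m \<eta>) \<theta>" "\<forall>x\<in>Gam m \<eta>. \<bar>\<theta> x\<bar> \<le> pi / 2" for \<theta>
  proof -
    define \<rho> where "\<rho> x = \<i> * of_real (\<theta> x)" for x
    have ht: "hoelder_on (Gam m \<eta>) (\<lambda>x. complex_of_real (\<theta> x))" using \<theta>(1) by (simp add: hoelder_on_of_real_iff)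
    have h\<rho>: "hoelder_on (Gam m \<eta>) \<rho>" unfolding \<rho>_def by (intro hoelder_on_mult hoelder_on_const ht compact_Gam)
    define E where "E x = exp (- Re (Cbd \<rho> x))" for x
    have iE: "integrable curveM E" unfolding E_def
      by (intro bdd_meas_integrable bdd_meas_continuous_on continuous_intros hoelder_on_imp_continuous_on hoelder_Cbd h\<rho>)
    obtain \<alpha> L where L: "0 < \<alpha>" "\<alpha> \<le> 1" "0 \<le> L" "\<forall>x\<in>Gam m \<eta>. \<forall>y\<in>Gam m \<eta>. norm (\<theta> x - \<theta> y) \<le> L * dist x y powr \<alpha>"
      using \<theta>(1) unfolding hoelder_on_def by (elim exE conjE)
    have "integral {0..2*pi} (\<lambda>t. E (\<eta> j t)) \<le> exp K * (2 * sqrt 2 * pi)" if j: "j < m" for j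
    proof -
      \<comment> \<open>The parameter is recovered as minus the argument because \<open>circ\<close>
        runs clockwise.\<close>
      define \<theta>' where "\<theta>' w = \<theta> (\<eta> j (- Arg w))" for w
      have \<theta>': "\<theta>' (circ t) = \<theta> (\<eta> j t)" for t
      proof -
        have "circ (- Arg (circ t)) = circ t"
          using Arg_eq[OF circ_nz, of t] by (simp add: circ_def[of "- _"] norm_circ)
        then obtain n :: int where "- Arg (circ t) = t + of_int n * (2 * pi)" by (rule circ_eq_imp)
        then show ?thesis unfolding \<theta>'_def using shift_\<eta>(1)[OF j] by simp
      qed
      have sph: "\<exists>t. x = circ t" if "x \<in> sphere 0 1" for x
        using that unfolding Gam_circ[symmetric] by (auto elim: circle.GamE)
      have b': "\<bar>\<theta>' x\<bar> \<le> pi / 2" if "x \<in> sphere 0 1" for x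
        using sph[OF that] \<theta>' \<theta>(2) \<eta>_in_Gam[OF j] by auto
      have "\<exists>C. \<forall>x\<in>Gam (Suc 0) (\<lambda>_. circ). \<forall>y\<in>Gam (Suc 0) (\<lambda>_. circ). norm (\<theta>' x - \<theta>' y) \<le> C * cmod (x - y) powr \<alpha>"
      proof (rule circle.hoelder_transfer[OF L(1,2)])
        show "0 \<le> L * B powr \<alpha>" using L(3) by simp
        show "norm (\<theta>' x) \<le> pi / 2" if "x \<in> Gam (Suc 0) (\<lambda>_. circ)" for x using b' that by (simp add: Gam_circ)
        fix k t s
        have "norm (\<theta>' (circ t) - \<theta>' (circ s)) \<le> L * dist (\<eta> j t) (\<eta> j s) powr \<alpha>"
          unfolding \<theta>' using L(4) \<eta>_in_Gam[OF j] by blast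
        also have "\<dots> \<le> L * (B * \<bar>t - s\<bar>) powr \<alpha>" using L B(2)[OF j, of t s] by (intro mult_left_mono powr_mono2) (auto simp: dist_norm)
        also have "\<dots> = L * B powr \<alpha> * \<bar>t - s\<bar> powr \<alpha>" using B(1) by (simp add: powr_mult)
        finally show "norm (\<theta>' (circ t) - \<theta>' (circ s)) \<le> L * B powr \<alpha> * \<bar>t - s\<bar> powr \<alpha>" .
      qed
      then obtain C' where "\<forall>x\<in>sphere 0 1. \<forall>y\<in>sphere 0 1. norm (\<theta>' x - \<theta>' y) \<le> C' * cmod (x - y) powr \<alpha>"
        unfolding Gam_circ by (elim exE)
      then have h': "hoelder_on (sphere 0 1) \<theta>'" by (intro hoelder_onI[OF L(1,2), where C = C']) (simp add: dist_norm)
      define \<rho>' where "\<rho>' x = \<i> * of_real (\<theta>' x)" for x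
      have h\<rho>': "hoelder_on (sphere 0 1) \<rho>'" unfolding \<rho>'_def
        by (intro hoelder_on_mult hoelder_on_const) (simp_all add: hoelder_on_of_real_iff h')
      have cmp: "E (\<eta> j t) \<le> exp K * exp (- Re (circle.Cbd \<rho>' (circ t)))" if t: "t \<in> {0..2*pi}" for t
      proof -
        \<comment> \<open>The comparison is stated for parameters in [pi, 3 pi]; a period is added
          where necessary.\<close>
        have "\<exists>s. pi \<le> s \<and> s \<le> 3 * pi \<and> \<eta> j s = \<eta> j t \<and> circ s = circ t"
        proof (cases "pi \<le> t")
          case True
          then show ?thesis using t by (intro exI[of _ t]) auto
        next
          case False
          then show ?thesis using t periodic[OF j, of t] circ_periodic[of t] by (intro exI[of _ "t + 2 * pi"]) auto
        qed
        then obtain s where s: "pi \<le> s" "s \<le> 3 * pi" "\<eta> j s = \<eta> j t" "circ s = circ t" by (elim exE conjE)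
        have b\<rho>: "\<forall>x\<in>Gam m \<eta>. cmod (\<rho> x) \<le> pi / 2" using \<theta>(2) by (simp add: \<rho>_def norm_mult)
        have e\<rho>: "\<forall>t. \<rho>' (circ t) = \<rho> (\<eta> j t)" by (simp add: \<rho>_def \<rho>'_def \<theta>')
        have "cmod (Cbd \<rho> (\<eta> j s) - circle.Cbd \<rho>' (circ s)) \<le> K"
          using K h\<rho> b\<rho> h\<rho>' j e\<rho> s(1,2) by blast
        then have "\<bar>Re (Cbd \<rho> (\<eta> j t)) - Re (circle.Cbd \<rho>' (circ t))\<bar> \<le> K"
          unfolding s(3,4) using abs_Re_le_cmod[of "Cbd \<rho> (\<eta> j t) - circle.Cbd \<rho>' (circ t)"] by simp
        then show ?thesis unfolding E_def exp_add[symmetric] by simp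
      qed
      have c1: "(\<lambda>t. exp (- Re (circle.Cbd \<rho>' (circ t)))) integrable_on {0..2*pi}"
        "integral {0..2*pi} (\<lambda>t. exp (- Re (circle.Cbd \<rho>' (circ t)))) \<le> 2 * sqrt 2 * pi"
        unfolding \<rho>'_def by (rule circle_exp_integral_bound[OF h' b']; assumption)+
      have "integral {0..2*pi} (\<lambda>t. E (\<eta> j t)) \<le> integral {0..2*pi} (\<lambda>t. exp K * exp (- Re (circle.Cbd \<rho>' (circ t))))"
        by (rule integral_le[OF integral_curveM(1)[OF iE j] integrable_on_mult_right[OF c1(1)] cmp])
      also have "\<dots> = exp K * integral {0..2*pi} (\<lambda>t. exp (- Re (circle.Cbd \<rho>' (circ t))))" by (rule integral_mult_right)
      also have "\<dots> \<le> exp K * (2 * sqrt 2 * pi)" by (intro mult_left_mono c1(2)) simp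
      finally show ?thesis .
    qed
    then have "(\<Sum>j<m. integral {0..2*pi} (\<lambda>t. E (\<eta> j t))) \<le> real (card {..<m}) * (exp K * (2 * sqrt 2 * pi))"
      by (intro sum_bounded_above) auto
    then have "(LINT x|curveM. E x) \<le> real m * (exp K * (2 * sqrt 2 * pi))" unfolding integral_curveM(2)[OF iE] by simp
    with iE show ?thesis unfolding E_def \<rho>_def by blast
  qed
  then show ?thesis by blast
qed

text \<open>On the side \<sigma> = 1 the winding integral tends to -pi + pi = 0, so the displaced
  points eventually lie in \<open>Gdom\<close>. There the Poisson model is at least 1/(2 \<delta>)
  for parameters within \<delta> of s and outweighs the bounded error.\<close>

lemma boundary_approach:
  assumes y: "y \<in> Gam m \<eta>"
  shows "\<exists>r>0. \<exists>z\<in>Gdom m \<eta>. \<forall>x\<in>Gam m \<eta>. cmod (x - y) \<le> r \<longrightarrow> Q \<le> Im (tang x / (x - z))"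
proof -
  obtain j s where js: "j < m" "pi \<le> s" "s \<le> 3 * pi" "y = \<eta> j s" by (rule Gam_representative[OF y])
  obtain a where a: "\<forall>n. 0 < a n" "a \<longlonglongrightarrow> 0" "\<forall>\<sigma>. \<sigma> = 1 \<or> \<sigma> = -1 \<longrightarrow>
     (\<forall>n. \<eta> j s + \<i> * of_real (\<sigma> * a n) * \<eta>1 j s \<notin> Gam m \<eta>) \<and>
     (\<lambda>n. LINT x|curveM. Im (tang x / (x - (\<eta> j s + \<i> * of_real (\<sigma> * a n) * \<eta>1 j s))))
        \<longlonglongrightarrow> (LINT x|curveM. Im (tang x / (x - \<eta> j s))) + \<sigma> * pi"
    using kappa_limit[OF js(1-3)] by (elim exE conjE)
  define z where "z n = \<eta> j s + \<i> * of_real (a n) * \<eta>1 j s" for n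
  have zn: "z n \<notin> Gam m \<eta>" for n using a(3)[rule_format, of 1] unfolding z_def by simp
  have "(\<lambda>n. LINT x|curveM. Im (tang x / (x - z n))) \<longlonglongrightarrow> - pi + 1 * pi"
    using a(3)[rule_format, of 1] kappa_integral_value[OF y] unfolding z_def js(4) by simp
  then have "(\<lambda>n. LINT x|curveM. Im (tang x / (x - z n))) \<longlonglongrightarrow> 0" by simp
  then have "\<forall>\<^sub>F n in sequentially. - 2 * pi < (LINT x|curveM. Im (tang x / (x - z n)))" by (rule order_tendstoD) simp
  then have ev: "\<forall>\<^sub>F n in sequentially. z n \<in> Gdom m \<eta>"
    by (rule eventually_mono) (use Im_winding_values[OF zn] in force)
  obtain C \<delta>0 where C: "0 < C" "0 < \<delta>0"
    "\<forall>k s t \<delta>. k < m \<longrightarrow> \<bar>t - s\<bar> \<le> pi \<longrightarrow> \<bar>\<delta>\<bar> \<le> \<delta>0 \<longrightarrow> (t \<noteq> s \<or> \<delta> \<noteq> 0) \<longrightarrow>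
       \<eta> k t - (\<eta> k s + \<i> * of_real \<delta> * \<eta>1 k s) \<noteq> 0 \<and>
       cmod (\<eta>1 k t / (\<eta> k t - (\<eta> k s + \<i> * of_real \<delta> * \<eta>1 k s)) - 1 / (of_real (t - s) - \<i> * of_real \<delta>)) \<le> C"
    by (rule local_expansion)
  obtain d where d: "0 < d" "\<And>j k s t. j < m \<Longrightarrow> k < m \<Longrightarrow> j \<noteq> k \<Longrightarrow> d \<le> cmod (\<eta> j s - \<eta> k t)" using curves_separated by blast
  obtain c where c: "0 < c" "\<And>k t s. k < m \<Longrightarrow> \<bar>t - s\<bar> \<le> pi \<Longrightarrow> c * \<bar>t - s\<bar> \<le> cmod (\<eta> k t - \<eta> k s)" using chord_arc by blast
  \<comment> \<open>At least |Q| remains after the error C of the expansion is subtracted.\<close>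
  define P where "P = \<bar>Q\<bar> + C + 1"
  have P: "0 < P" using C(1) by (simp add: P_def)
  have "\<forall>\<^sub>F n in sequentially. a n < min \<delta>0 (1 / (2 * P))" by (rule order_tendstoD[OF a(2)]) (use C(2) P in auto)
  then obtain n where n: "z n \<in> Gdom m \<eta>" "a n < min \<delta>0 (1 / (2 * P))"
    using eventually_conj[OF ev] eventually_happens by (metis (mono_tags, lifting) sequentially_bot)
  define \<delta> where "\<delta> = a n"
  have \<delta>: "0 < \<delta>" "\<delta> \<le> \<delta>0" "P \<le> 1 / (2 * \<delta>)" using a(1) n(2) P by (auto simp: \<delta>_def field_simps)
  \<comment> \<open>The first bound keeps x on the curve of y; the second forces |t' - s| \<le>
    \<delta> by \<open>chord_arc\<close>.\<close>
  define r where "r = min (d / 2) (c * \<delta>)"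
  have "Q \<le> Im (tang x / (x - z n))" if x: "x \<in> Gam m \<eta>" "cmod (x - y) \<le> r" for x
  proof -
    obtain k t where kt: "k < m" "x = \<eta> k t" using GamE[OF x(1)] by blast
    have kj: "k = j" using d(2)[OF kt(1) js(1), of t s] x(2) d(1) kt(2) js(4) by (cases "k = j") (auto simp: r_def)
    obtain t' where t': "\<bar>t' - s\<bar> \<le> pi" "\<eta> k t' = \<eta> k t" "\<eta>1 k t' = \<eta>1 k t" using window_representative[OF kt(1)] by blast
    have "c * \<bar>t' - s\<bar> \<le> c * \<delta>" using c(2)[OF js(1) t'(1)] x(2) t'(2) kt(2) kj js(4) by (simp add: r_def)
    then have u: "\<bar>t' - s\<bar> \<le> \<delta>" using c(1) by simp
    then have "(t' - s)\<^sup>2 \<le> \<delta>\<^sup>2" by (simp add: abs_le_square_iff[symmetric])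
    then have "\<delta> / (2 * \<delta>\<^sup>2) \<le> \<delta> / ((t' - s)\<^sup>2 + \<delta>\<^sup>2)" using \<delta>(1) by (intro divide_left_mono) (auto intro!: mult_pos_pos add_nonneg_pos)
    then have *: "P \<le> Im (1 / (of_real (t' - s) - \<i> * of_real \<delta>))"
      unfolding Im_inverse_minus_i using \<delta> by (simp add: power2_eq_square)
    have "tang x / (x - z n) = \<eta>1 j t' / (\<eta> j t' - (\<eta> j s + \<i> * of_real \<delta> * \<eta>1 j s))"
      using kt kj t' tang_\<eta> by (simp add: z_def \<delta>_def)
    then have "cmod (tang x / (x - z n) - 1 / (of_real (t' - s) - \<i> * of_real \<delta>)) \<le> C"
      using C(3)[rule_format, of j t' s \<delta>] js(1) t'(1) \<delta> by simp
    then have "\<bar>Im (tang x / (x - z n)) - Im (1 / (of_real (t' - s) - \<i> * of_real \<delta>))\<bar> \<le> C"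
      using abs_Im_le_cmod[of "tang x / (x - z n) - 1 / (of_real (t' - s) - \<i> * of_real \<delta>)"] by (simp only: minus_complex.simps)
    then show ?thesis using * by (simp add: P_def)
  qed
  moreover have "0 < r" using d(1) c(1) \<delta>(1) by (simp add: r_def)
  ultimately show "\<exists>r>0. \<exists>z\<in>Gdom m \<eta>. \<forall>x\<in>Gam m \<eta>. cmod (x - y) \<le> r \<longrightarrow> Q \<le> Im (tang x / (x - z))"
    using n(1) by blast
qed

lemma contour_unique_curves:
  assumes "connected (Gdom m \<eta>)"
  shows "contour_unique curveM (Gam m \<eta>) (Gdom m \<eta>) (Gminus m \<eta>) tang"
  by (intro contour_unique.intro contour_axioms contour_unique_axioms.intro assms exp_integral_bound_curves) (rule boundary_approach)

end

section \<open>Solvability of the Riemann-Hilbert problem\<close>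

context contour
begin

lemma Cminus_boundary: "x \<in> \<Gamma> \<Longrightarrow> Cminus \<rho> x = Cbd \<rho> x - \<rho> x"
  by (simp add: Cminus_def)

lemma hoelder_Cminus: "hoelder_on \<Gamma> \<rho> \<Longrightarrow> hoelder_on \<Gamma> (Cminus \<rho>)"
  using hoelder_on_diff[OF bounded_\<Gamma> hoelder_Cbd] unfolding hoelder_on_def[of _ "Cminus \<rho>"] hoelder_on_def[of _ "\<lambda>x. _ x - _ x"]
  by (simp add: Cminus_boundary)

lemma Cbd_mult_left:
  "Cbd (\<lambda>x. c * \<rho> x) y = c * Cbd \<rho> y"
proof -
  have "(LINT x|M. (c * \<rho> x - c * \<rho> y) * \<tau> x / (x - y)) = (LINT x|M. c * ((\<rho> x - \<rho> y) * \<tau> x / (x - y)))"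
    by (intro Bochner_Integration.integral_cong refl) (simp add: right_diff_distrib left_diff_distrib mult.assoc)
  then show ?thesis unfolding Cbd_def integral_mult_right_zero by (simp only: times_divide_eq_right)
qed

end

context contour_unique
begin

text \<open>\<open>approach\<close> also shows that y is a limit of points of \<open>G\<close>: a
  kernel value of at least 2|\<tau> y|/e at x = y itself forces |y - z| \<le> e/2.\<close>

lemma vanishing_boundary_values:
  assumes f: "holo_plus f" "\<And>z. z \<in> G \<Longrightarrow> f z = 0" and y: "y \<in> \<Gamma>"
  shows "f y = 0"
proof (rule ccontr)
  assume "f y \<noteq> 0"
  then have "0 < cmod (f y)" by simp
  moreover have "continuous_on (G \<union> \<Gamma>) f" using f(1) by (simp add: holo_plus_def)
  ultimately obtain e where e: "0 < e" "\<forall>z\<in>G \<union> \<Gamma>. dist z y < e \<longrightarrow> dist (f z) (f y) < cmod (f y)"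
    using y unfolding continuous_on_iff by (meson UnI2)
  define B where "B = 2 * cmod (\<tau> y) / e"
  have B: "0 < B" using e \<tau>_nz[OF y] by (simp add: B_def)
  obtain r z where rz: "0 < r" "z \<in> G" "\<forall>x\<in>\<Gamma>. cmod (x - y) \<le> r \<longrightarrow> B \<le> Im (\<tau> x / (x - z))" using approach[OF y, of B] by blast
  have "B \<le> Im (\<tau> y / (y - z))" using rz y by simp
  also have "\<dots> \<le> cmod (\<tau> y) / cmod (y - z)" using abs_Im_le_cmod[of "\<tau> y / (y - z)"] by (simp add: norm_divide)
  finally have le: "B \<le> cmod (\<tau> y) / cmod (y - z)" .
  have "y \<noteq> z" using rz(2) y G_\<Gamma>_disjoint by auto
  then have "B * cmod (y - z) \<le> cmod (\<tau> y)" using le by (simp add: pos_le_divide_eq)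
  then have "2 * cmod (\<tau> y) * cmod (y - z) \<le> cmod (\<tau> y) * e" using e(1) by (simp add: B_def field_simps)
  then have "2 * cmod (y - z) \<le> e" using \<tau>_nz[OF y] by (simp add: mult.commute mult.left_commute)
  then have "dist z y < e" using e(1) by (simp add: dist_norm norm_minus_commute)
  then show False using e(2) rz(2) f(2) by (auto simp: dist_norm)
qed

text \<open>By \<open>kern_swap\<close> the adjoint equation reads \<psi> = - Nop b \<psi> with b =
  \<tau>/a. By \<open>Re_Cbd\<close> this says that b times the boundary value from \<open>G\<close>
  is imaginary, while b * \<sigma> is real; their orthogonality is the relation demanded by
  \<open>transmission_unique\<close>.\<close>

lemma adjoint_solution:
  fixes \<psi> :: "complex \<Rightarrow> real"
  assumes a: "coeff a" and c: "continuous_on \<Gamma> \<psi>" and \<psi>: "\<And>x. x \<in> \<Gamma> \<Longrightarrow> \<psi> x = (LINT y|M. kern a y x * \<psi> y)"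
  defines "\<sigma> \<equiv> \<lambda>x. of_real (\<psi> x) / (\<tau> x / a x)"
  shows "hoelder_on \<Gamma> \<sigma>" "\<And>x. x \<in> \<Gamma> \<Longrightarrow> Cbd \<sigma> x = 0"
proof -
  define b where "b x = \<tau> x / a x" for x
  have b: "coeff b" unfolding b_def by (rule coeff_divide[OF a coeff_\<tau>])
  have N: "\<psi> x = - Nop b \<psi> x" if x: "x \<in> \<Gamma>" for x
  proof -
    have "(LINT y|M. kern a y x * \<psi> y) = (LINT y|M. - (kern b x y * \<psi> y))"
      by (intro Bochner_Integration.integral_cong refl) (use kern_swap[OF a x] in \<open>simp add: space_M b_def[abs_def]\<close>)
    then show ?thesis using \<psi>[OF x] unfolding Nop_def by simp
  qed
  have hN: "hoelder_on \<Gamma> (Nop b \<psi>)" by (intro hoelder_Nop[OF b] bdd_meas_continuous_on c)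
  \<comment> \<open>The equation itself upgrades \<psi> from continuous to Hoelder
    continuous.\<close>
  have h\<psi>: "hoelder_on \<Gamma> \<psi>"
    using hoelder_on_diff[OF bounded_\<Gamma> hoelder_on_const[of _ 0] hN] N unfolding hoelder_on_def by auto
  have sb: "\<sigma> = (\<lambda>x. of_real (\<psi> x) / b x)" by (simp add: \<sigma>_def b_def)
  show h\<sigma>: "hoelder_on \<Gamma> \<sigma>" unfolding sb by (intro hoelder_on_divide_coeff[OF b]) (simp add: hoelder_on_of_real_iff h\<psi>)
  have bnz: "b x \<noteq> 0" if "x \<in> \<Gamma>" for x using b that by (auto simp: coeff_def)
  have re: "Re (b x * Cbd \<sigma> x) = 0" if "x \<in> \<Gamma>" for x
    unfolding sb Re_Cbd[OF b h\<psi> that] using N[OF that] by simp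
  have z: "Cplus \<sigma> z = 0" if "z \<in> G" for z
  proof (rule transmission_unique[OF holo_plus_Cplus[OF h\<sigma>] _ holo_minus_Cminus[OF h\<sigma>] hoelder_Cminus[OF h\<sigma>] _ that])
    show "hoelder_on \<Gamma> (Cplus \<sigma>)" using hoelder_Cbd[OF h\<sigma>] unfolding hoelder_on_def by (simp add: Cplus_def)
    fix x assume x: "x \<in> \<Gamma>"
    define p where "p = Cbd \<sigma> x"
    have "Re (b x * \<sigma> x * cnj (b x * p)) = 0"
    proof -
      have "b x * \<sigma> x = of_real (\<psi> x)" using bnz[OF x] by (simp add: sb)
      then show ?thesis using re[OF x] by (simp add: p_def)
    qed
    moreover have "b x * \<sigma> x * cnj (b x * p) = of_real ((cmod (b x))\<^sup>2) * (\<sigma> x * cnj p)"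
      using complex_norm_square[of "b x"] by (simp add: mult_ac)
    moreover have "Re (of_real r * w) = r * Re w" for r w by simp
    ultimately have "(cmod (b x))\<^sup>2 * Re (\<sigma> x * cnj p) = 0" by (simp only:)
    then have s0: "Re (\<sigma> x * cnj p) = 0" using bnz[OF x] by simp
    have "Re ((p - \<sigma> x) * cnj p) = Re (p * cnj p) - Re (\<sigma> x * cnj p)" by (simp only: left_diff_distrib minus_complex.simps)
    also have "Re (p * cnj p) = (cmod p)\<^sup>2" unfolding complex_norm_square[symmetric] by simp
    finally show "Re (Cminus \<sigma> x * cnj (Cplus \<sigma> x)) = (cmod (Cplus \<sigma> x))\<^sup>2"
      using x s0 by (simp add: Cminus_def Cplus_def p_def)
  qed
  show "Cbd \<sigma> x = 0" if x: "x \<in> \<Gamma>" for x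
    using vanishing_boundary_values[OF holo_plus_Cplus[OF h\<sigma>] z x] x by (simp add: Cplus_def)
qed

text \<open>For \<rho> = (\<gamma> + i \<mu>)/a the real part is as prescribed. By
  \<open>Re_Cbd\<close> the condition on \<open>Cminus\<close> becomes \<beta> + (Nop a \<mu> -
  \<mu>)/2 = 0, which is the equation of the second kind with right-hand side 2 \<beta>.\<close>

lemma riemann_hilbert:
  fixes \<gamma> :: "complex \<Rightarrow> real"
  assumes a: "coeff a" and \<gamma>: "hoelder_on \<Gamma> \<gamma>"
  shows "\<exists>\<rho>. hoelder_on \<Gamma> \<rho> \<and> (\<forall>x\<in>\<Gamma>. Re (a x * \<rho> x) = \<gamma> x \<and> Im (a x * Cminus \<rho> x) = 0)"
proof -
  define \<phi> where "\<phi> x = of_real (\<gamma> x) / a x" for x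
  have h\<phi>: "hoelder_on \<Gamma> \<phi>" unfolding \<phi>_def by (intro hoelder_on_divide_coeff[OF a]) (simp add: hoelder_on_of_real_iff \<gamma>)
  define \<beta> where "\<beta> x = Im (a x * Cminus \<phi> x)" for x
  have c\<beta>: "continuous_on \<Gamma> \<beta>" unfolding \<beta>_def
    by (intro continuous_intros hoelder_on_imp_continuous_on[OF coeff_hoelder[OF a]] hoelder_on_imp_continuous_on[OF hoelder_Cminus[OF h\<phi>]])
  have anz: "a x \<noteq> 0" if "x \<in> \<Gamma>" for x using a that by (auto simp: coeff_def)
  have "\<exists>\<mu>. continuous_on \<Gamma> \<mu> \<and> (\<forall>y\<in>\<Gamma>. \<mu> y = Nop a \<mu> y + 2 * \<beta> y)"
  proof (rule fredholm_alternative[OF a])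
    show "continuous_on \<Gamma> (\<lambda>y. 2 * \<beta> y)" by (intro continuous_intros c\<beta>)
    fix \<psi> :: "complex \<Rightarrow> real"
    assume \<psi>: "continuous_on \<Gamma> \<psi>" "\<And>x. x \<in> \<Gamma> \<Longrightarrow> \<psi> x = (LINT y|M. kern a y x * \<psi> y)"
    define \<sigma> where "\<sigma> = (\<lambda>x. of_real (\<psi> x) / (\<tau> x / a x))"
    have h\<sigma>: "hoelder_on \<Gamma> \<sigma>" unfolding \<sigma>_def by (rule adjoint_solution(1)[OF a \<psi>])
    have z: "Cbd \<sigma> x = 0" if "x \<in> \<Gamma>" for x unfolding \<sigma>_def by (rule adjoint_solution(2)[OF a \<psi> that])
    \<comment> \<open>On \<Gamma> the adjoint solution gives Cminus \<sigma> = - \<sigma> and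
      \<sigma> * \<tau> = \<psi> * a. Up to sign, \<psi> * \<beta> is thus the imaginary part of P *
      \<tau> with P analytic in \<open>D\<close>.\<close>
    define P where "P x = Cminus \<sigma> x * Cminus \<phi> x" for x
    have "holo_minus P" using holo_minus_Cminus[OF h\<sigma>] holo_minus_Cminus[OF h\<phi>] unfolding holo_minus_def P_def
      by (auto intro!: holomorphic_intros continuous_intros)
    moreover have hP: "hoelder_on \<Gamma> P" unfolding P_def by (intro hoelder_on_mult compact_\<Gamma> hoelder_Cminus h\<sigma> h\<phi>)
    ultimately have P0: "(LINT x|M. P x * \<tau> x) = 0" by (rule Cauchy_minus(2))
    have iP: "integrable M (\<lambda>x. P x * \<tau> x)" by (intro bdd_meas_integrable bdd_meas_hoelder hoelder_on_mult compact_\<Gamma> hP hoelder_\<tau>)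
    have "(LINT x|M. \<psi> x * (2 * \<beta> x)) = (LINT x|M. - 2 * Im (P x * \<tau> x))"
    proof (rule Bochner_Integration.integral_cong[OF refl])
      fix x assume "x \<in> space M"
      then have x: "x \<in> \<Gamma>" by (simp add: space_M)
      have "P x * \<tau> x = - of_real (\<psi> x) * (a x * Cminus \<phi> x)"
      proof -
        have "Cminus \<sigma> x = - \<sigma> x" using z[OF x] by (simp add: Cminus_boundary[OF x])
        moreover have "\<sigma> x * \<tau> x = of_real (\<psi> x) * a x" using \<tau>_nz[OF x] anz[OF x] by (simp add: \<sigma>_def)
        ultimately show ?thesis unfolding P_def by (simp add: mult_ac)
      qed
      then have "P x * \<tau> x = of_real (- \<psi> x) * (a x * Cminus \<phi> x)" by simp
      moreover have "Im (of_real r * w) = r * Im w" for r w by simp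
      ultimately have "Im (P x * \<tau> x) = - \<psi> x * \<beta> x" unfolding \<beta>_def by (simp only:)
      then show "\<psi> x * (2 * \<beta> x) = - 2 * Im (P x * \<tau> x)" by simp
    qed
    also have "\<dots> = 0" unfolding integral_mult_right_zero integral_Im[OF iP] P0 by simp
    finally show "(LINT x|M. \<psi> x * (2 * \<beta> x)) = 0" .
  qed
  then obtain \<mu> where \<mu>: "continuous_on \<Gamma> \<mu>" "\<forall>y\<in>\<Gamma>. \<mu> y = Nop a \<mu> y + 2 * \<beta> y" by (elim exE conjE)
  have h\<beta>: "hoelder_on \<Gamma> \<beta>" unfolding \<beta>_def
    by (intro hoelder_on_Im bounded_\<Gamma> hoelder_on_mult compact_\<Gamma> coeff_hoelder[OF a] hoelder_Cminus h\<phi>)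
  have "hoelder_on \<Gamma> (\<lambda>y. Nop a \<mu> y + (\<beta> y + \<beta> y))"
    by (intro hoelder_on_add bounded_\<Gamma> hoelder_Nop[OF a] bdd_meas_continuous_on \<mu>(1) h\<beta>)
  then have h\<mu>: "hoelder_on \<Gamma> \<mu>" using \<mu>(2) unfolding hoelder_on_def by auto
  define \<omega> where "\<omega> x = of_real (\<mu> x) / a x" for x
  have h\<omega>: "hoelder_on \<Gamma> \<omega>" unfolding \<omega>_def by (intro hoelder_on_divide_coeff[OF a]) (simp add: hoelder_on_of_real_iff h\<mu>)
  have hi\<omega>: "hoelder_on \<Gamma> (\<lambda>x. \<i> * \<omega> x)" by (intro hoelder_on_mult compact_\<Gamma> hoelder_on_const h\<omega>)
  define \<rho> where "\<rho> x = \<phi> x + \<i> * \<omega> x" for x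
  have h\<rho>: "hoelder_on \<Gamma> \<rho>" unfolding \<rho>_def by (intro hoelder_on_add bounded_\<Gamma> h\<phi> hi\<omega>)
  have "Re (a x * \<rho> x) = \<gamma> x \<and> Im (a x * Cminus \<rho> x) = 0" if x: "x \<in> \<Gamma>" for x
  proof
    have ar: "a x * \<phi> x = of_real (\<gamma> x)" "a x * \<omega> x = of_real (\<mu> x)" using anz[OF x] by (simp_all add: \<phi>_def \<omega>_def)
    have "a x * \<rho> x = of_real (\<gamma> x) + \<i> * of_real (\<mu> x)" unfolding \<rho>_def distrib_left mult.left_commute[of "a x"] ar ..
    then show "Re (a x * \<rho> x) = \<gamma> x" by simp
    have "Cminus \<rho> x = Cminus \<phi> x + \<i> * (Cbd \<omega> x - \<omega> x)"
      unfolding Cminus_boundary[OF x] using Cbd_add[OF h\<phi> hi\<omega> x] Cbd_mult_left[of \<i> \<omega> x] by (simp add: \<rho>_def[abs_def] algebra_simps)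
    then have "a x * Cminus \<rho> x = a x * Cminus \<phi> x + \<i> * (a x * Cbd \<omega> x - of_real (\<mu> x))"
      unfolding ar(2)[symmetric] by (simp only: distrib_left right_diff_distrib mult.left_commute[of "a x" \<i>])
    then have "Im (a x * Cminus \<rho> x) = \<beta> x + (Re (a x * Cbd \<omega> x) - \<mu> x)" unfolding \<beta>_def by simp
    also have "Re (a x * Cbd \<omega> x) = (Nop a \<mu> x + \<mu> x) / 2" unfolding \<omega>_def[abs_def] by (rule Re_Cbd[OF a h\<mu> x])
    also have "\<mu> x = Nop a \<mu> x + 2 * \<beta> x" using \<mu>(2) x by blast
    finally show "Im (a x * Cminus \<rho> x) = 0" using \<mu>(2)[rule_format, OF x] by (simp add: field_simps)
  qed
  then show ?thesis using h\<rho> by blast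
qed

end

text \<open>An interval straddling the seam at 2 pi is split there, which doubles the
  constant.\<close>

lemma periodic_hoelder:
  fixes v :: "real \<Rightarrow> real"
  assumes per: "\<And>t. v (t + 2 * pi) = v t" and \<alpha>: "0 < \<alpha>"
    and C: "\<forall>s\<in>{0..2*pi}. \<forall>t\<in>{0..2*pi}. \<bar>v s - v t\<bar> \<le> C * \<bar>s - t\<bar> powr \<alpha>" and ts: "\<bar>t - s\<bar> \<le> pi"
  shows "\<bar>v t - v s\<bar> \<le> 2 * \<bar>C\<bar> * \<bar>t - s\<bar> powr \<alpha>"
proof -
  have C': "\<bar>v s - v t\<bar> \<le> \<bar>C\<bar> * \<bar>s - t\<bar> powr \<alpha>" if "s \<in> {0..2*pi}" "t \<in> {0..2*pi}" for s t
    using C[rule_format, OF that] by (smt (verit) mult_right_mono powr_ge_zero abs_ge_self)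
  have main: "\<bar>v t - v s\<bar> \<le> 2 * \<bar>C\<bar> * \<bar>t - s\<bar> powr \<alpha>" if st: "s \<le> t" "t \<le> s + pi" for s t
  proof -
    obtain n :: int where n: "0 \<le> s + of_int n * (2 * pi)" "s + of_int n * (2 * pi) < 0 + 2 * pi" by (rule periodic_representative)
    define s' t' where "s' = s + of_int n * (2 * pi)" and "t' = t + of_int n * (2 * pi)"
    have v: "v s' = v s" "v t' = v t" unfolding s'_def t'_def by (rule periodic_add_int, rule per)+
    have d: "t' - s' = t - s" by (simp add: s'_def t'_def)
    have s': "s' \<in> {0..2*pi}" using n by (simp add: s'_def)
    show ?thesis
    proof (cases "t' \<le> 2 * pi")
      case True
      then have "\<bar>v t' - v s'\<bar> \<le> \<bar>C\<bar> * \<bar>t' - s'\<bar> powr \<alpha>" using s' st d by (intro C') auto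
      also have "\<dots> \<le> 2 * \<bar>C\<bar> * \<bar>t' - s'\<bar> powr \<alpha>" by (intro mult_right_mono) auto
      finally show ?thesis unfolding v d .
    next
      case False
      have p: "v (t' - 2 * pi) = v t'" "v 0 = v (2 * pi)" using per[of "t' - 2 * pi"] per[of 0] by auto
      have "\<bar>v (t' - 2 * pi) - v 0\<bar> \<le> \<bar>C\<bar> * \<bar>t' - 2 * pi - 0\<bar> powr \<alpha>" using False s' st d by (intro C') auto
      also have "\<dots> \<le> \<bar>C\<bar> * \<bar>t' - s'\<bar> powr \<alpha>" using False s' \<alpha> by (intro mult_left_mono powr_mono2) auto
      finally have 1: "\<bar>v t' - v (2 * pi)\<bar> \<le> \<bar>C\<bar> * \<bar>t' - s'\<bar> powr \<alpha>" unfolding p .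
      have "\<bar>v (2 * pi) - v s'\<bar> \<le> \<bar>C\<bar> * \<bar>2 * pi - s'\<bar> powr \<alpha>" using s' by (intro C') auto
      also have "\<dots> \<le> \<bar>C\<bar> * \<bar>t' - s'\<bar> powr \<alpha>" using False s' \<alpha> by (intro mult_left_mono powr_mono2) auto
      finally have "\<bar>v (2 * pi) - v s'\<bar> \<le> \<bar>C\<bar> * \<bar>t' - s'\<bar> powr \<alpha>" .
      with 1 have "\<bar>v t' - v s'\<bar> \<le> 2 * \<bar>C\<bar> * \<bar>t' - s'\<bar> powr \<alpha>" by linarith
      then show ?thesis unfolding v d .
    qed
  qed
  show ?thesis
  proof (cases "s \<le> t")
    case True
    then show ?thesis using ts by (intro main) auto
  next
    case False
    then show ?thesis using ts main[of t s] by (simp add: abs_minus_commute)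
  qed
qed

section \<open>From functions on the parameter intervals to functions on the boundary\<close>

context curves
begin

text \<open>Parameters with the same image belong to the same curve and differ by whole periods, so
  a periodic family is constant on the fibres.\<close>

lemma periodic_family_factors:
  assumes v: "\<forall>k<m. \<forall>t. v k (t + 2 * pi) = v k t"
  obtains g where "\<forall>k<m. \<forall>t. g (\<eta> k t) = v k t"
proof -
  define g where "g x = (SOME w. \<exists>k<m. \<exists>t. x = \<eta> k t \<and> w = v k t)" for x
  have "g (\<eta> k t) = v k t" if k: "k < m" for k t
  proof -
    have uniq: "w = v k t" if ex: "\<exists>j<m. \<exists>s. \<eta> k t = \<eta> j s \<and> w = v j s" for w
    proof -
      from ex obtain j s where js: "j < m" "\<eta> k t = \<eta> j s" "w = v j s" by (elim exE conjE)
      have "j = k" using disjoint[OF js(1) k] \<eta>_in_Gam_k[OF k, of t] \<eta>_in_Gam_k[OF js(1), of s] js(2) by auto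
      then have "\<eta> k t = \<eta> k s" using js(2) by simp
      then obtain n :: int where "t = s + of_int n * (2 * pi)" by (rule \<eta>_inj_mod[OF k])
      moreover have "v k (s + of_int n * (2 * pi)) = v k s" by (rule periodic_add_int) (use v k in simp)
      ultimately show ?thesis using js(3) \<open>j = k\<close> by simp
    qed
    have "\<exists>w. \<exists>j<m. \<exists>s. \<eta> k t = \<eta> j s \<and> w = v j s" using k by blast
    then show ?thesis unfolding g_def by (rule someI2_ex) (rule uniq)
  qed
  then show ?thesis using that by blast
qed

lemma spaceH_hoelder:
  assumes "\<gamma> \<in> spaceH m"
  obtains g where "hoelder_on (Gam m \<eta>) g" "\<forall>k<m. \<forall>t. g (\<eta> k t) = \<gamma> k t"
proof -
  have per: "\<forall>k<m. \<forall>t. \<gamma> k (t + 2 * pi) = \<gamma> k t" using assms by (simp add: spaceH_def)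
  obtain g where g: "\<forall>k<m. \<forall>t. g (\<eta> k t) = \<gamma> k t" by (rule periodic_family_factors[OF per])
  have "\<exists>p. \<forall>k<m. 0 < snd (p k) \<and> snd (p k) \<le> 1 \<and>
     (\<forall>s\<in>{0..2*pi}. \<forall>t\<in>{0..2*pi}. \<bar>\<gamma> k s - \<gamma> k t\<bar> \<le> fst (p k) * \<bar>s - t\<bar> powr snd (p k))"
  proof (rule choice, rule allI)
    fix k show "\<exists>p. k < m \<longrightarrow> 0 < snd p \<and> snd p \<le> 1 \<and>
       (\<forall>s\<in>{0..2*pi}. \<forall>t\<in>{0..2*pi}. \<bar>\<gamma> k s - \<gamma> k t\<bar> \<le> fst p * \<bar>s - t\<bar> powr snd p)"
      using assms unfolding spaceH_def by (cases "k < m") auto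
  qed
  then obtain p where p: "\<forall>k<m. 0 < snd (p k) \<and> snd (p k) \<le> 1 \<and>
     (\<forall>s\<in>{0..2*pi}. \<forall>t\<in>{0..2*pi}. \<bar>\<gamma> k s - \<gamma> k t\<bar> \<le> fst (p k) * \<bar>s - t\<bar> powr snd (p k))" by (elim exE)
  \<comment> \<open>A common exponent for all curves; \<open>m_pos\<close> makes the minimum range
    over a nonempty set.\<close>
  define \<alpha> where "\<alpha> = Min ((\<lambda>k. snd (p k)) ` {..<m})"
  have ne: "{..<m} \<noteq> {}" using m_pos by (auto simp: lessThan_empty_iff)
  have \<alpha>k: "\<alpha> \<le> snd (p k)" if "k < m" for k unfolding \<alpha>_def using that by (intro Min_le) auto
  have \<alpha>: "0 < \<alpha>" unfolding \<alpha>_def using ne p by (subst Min_gr_iff) auto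
  have \<alpha>1: "\<alpha> \<le> 1" using \<alpha>k[of 0] p m_pos by fastforce
  \<comment> \<open>The factor 4 exceeds pi and hence bounds |t - s| when the exponent is lowered by
    \<open>powr_exponent_le\<close>.\<close>
  define L where "L = (\<Sum>k<m. 2 * \<bar>fst (p k)\<bar>) * 4"
  have tr: "norm (g (\<eta> k t) - g (\<eta> k s)) \<le> L * \<bar>t - s\<bar> powr \<alpha>" if k: "k < m" and ts: "\<bar>t - s\<bar> \<le> pi" for k t s
  proof -
    have pk: "0 < snd (p k)" "snd (p k) \<le> 1"
      "\<forall>s\<in>{0..2*pi}. \<forall>t\<in>{0..2*pi}. \<bar>\<gamma> k s - \<gamma> k t\<bar> \<le> fst (p k) * \<bar>s - t\<bar> powr snd (p k)" using p k by blast+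
    have "norm (g (\<eta> k t) - g (\<eta> k s)) = \<bar>\<gamma> k t - \<gamma> k s\<bar>" using g k by simp
    also have "\<dots> \<le> 2 * \<bar>fst (p k)\<bar> * \<bar>t - s\<bar> powr snd (p k)"
      by (rule periodic_hoelder[OF _ pk(1,3) ts]) (use per k in blast)
    also have "\<dots> \<le> 2 * \<bar>fst (p k)\<bar> * (4 * \<bar>t - s\<bar> powr \<alpha>)"
      using pi_less_4 ts \<alpha>k[OF k] \<alpha> pk by (intro mult_left_mono powr_exponent_le) auto
    also have "\<dots> \<le> (\<Sum>k<m. 2 * \<bar>fst (p k)\<bar>) * (4 * \<bar>t - s\<bar> powr \<alpha>)"
      using k by (intro mult_right_mono member_le_sum) auto
    finally show ?thesis by (simp add: L_def mult.assoc)
  qed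
  have L0: "0 \<le> L" by (simp add: L_def sum_nonneg)
  have bd: "norm (g x) \<le> (\<Sum>k<m. \<bar>\<gamma> k 0\<bar> + \<bar>fst (p k)\<bar> * (2 * pi) powr snd (p k))" if x: "x \<in> Gam m \<eta>" for x
  proof -
    obtain k t where kt: "k < m" "x = \<eta> k t" "t \<in> {0..2*pi}" by (rule GamE[OF x])
    have "\<bar>\<gamma> k t - \<gamma> k 0\<bar> \<le> fst (p k) * \<bar>t - 0\<bar> powr snd (p k)"
      by (rule p[rule_format, THEN conjunct2, THEN conjunct2, rule_format]) (use kt in auto)
    also have "\<dots> \<le> \<bar>fst (p k)\<bar> * (2 * pi) powr snd (p k)"
      using p kt by (intro mult_mono powr_mono2) (auto intro: less_imp_le)
    finally have "norm (g x) \<le> \<bar>\<gamma> k 0\<bar> + \<bar>fst (p k)\<bar> * (2 * pi) powr snd (p k)" using g kt by simp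
    also have "\<dots> \<le> (\<Sum>k<m. \<bar>\<gamma> k 0\<bar> + \<bar>fst (p k)\<bar> * (2 * pi) powr snd (p k))"
      using kt by (intro member_le_sum) auto
    finally show ?thesis .
  qed
  have "\<exists>C. \<forall>x\<in>Gam m \<eta>. \<forall>y\<in>Gam m \<eta>. norm (g x - g y) \<le> C * cmod (x - y) powr \<alpha>"
    by (rule hoelder_transfer[OF \<alpha> \<alpha>1 L0 tr bd])
  then obtain C where "\<forall>x\<in>Gam m \<eta>. \<forall>y\<in>Gam m \<eta>. norm (g x - g y) \<le> C * cmod (x - y) powr \<alpha>" by (elim exE)
  then have "hoelder_on (Gam m \<eta>) g" by (intro hoelder_onI[OF \<alpha> \<alpha>1, where C = C]) (simp add: dist_norm)
  then show ?thesis using that g by blast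
qed

lemma hoelder_spaceH:
  assumes "hoelder_on (Gam m \<eta>) g"
  shows "(\<lambda>k t. g (\<eta> k t)) \<in> spaceH m"
proof -
  obtain \<alpha> C where C: "0 < \<alpha>" "\<alpha> \<le> 1" "0 \<le> C" "\<forall>x\<in>Gam m \<eta>. \<forall>y\<in>Gam m \<eta>. norm (g x - g y) \<le> C * dist x y powr \<alpha>"
    using assms unfolding hoelder_on_def by (elim exE conjE)
  obtain B where B: "1 \<le> B" "\<And>k t s. k < m \<Longrightarrow> cmod (\<eta> k t - \<eta> k s) \<le> B * \<bar>t - s\<bar>" using taylor_bounds by metis
  have "\<bar>g (\<eta> k s) - g (\<eta> k t)\<bar> \<le> (C * B powr \<alpha>) * \<bar>s - t\<bar> powr \<alpha>" if k: "k < m" for k s t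
  proof -
    have "\<bar>g (\<eta> k s) - g (\<eta> k t)\<bar> \<le> C * dist (\<eta> k s) (\<eta> k t) powr \<alpha>" using C(4) \<eta>_in_Gam[OF k] by simp
    also have "\<dots> \<le> C * (B * \<bar>s - t\<bar>) powr \<alpha>" using C(1,3) B(2)[OF k, of s t] by (intro mult_left_mono powr_mono2) (auto simp: dist_norm)
    also have "\<dots> = (C * B powr \<alpha>) * \<bar>s - t\<bar> powr \<alpha>" using B(1) by (simp add: powr_mult)
    finally show ?thesis .
  qed
  then have "\<exists>C \<alpha>. 0 < \<alpha> \<and> \<alpha> \<le> 1 \<and> (\<forall>s\<in>{0..2*pi}. \<forall>t\<in>{0..2*pi}. \<bar>g (\<eta> k s) - g (\<eta> k t)\<bar> \<le> C * \<bar>s - t\<bar> powr \<alpha>)"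
    if "k < m" for k using C(1,2) that by blast
  then show ?thesis unfolding spaceH_def using periodic by simp
qed

lemma coeff_C1:
  assumes nz: "\<And>z. z \<in> Gam m \<eta> \<Longrightarrow> A z \<noteq> 0" and C1: "\<And>k. k < m \<Longrightarrow> (\<lambda>t. A (\<eta> k t)) C1_differentiable_on UNIV"
  shows "coeff A"
proof -
  \<comment> \<open>Size and difference quotient are bounded together, as one family of functions of
    pairs, so that a single L serves all curves in \<open>hoelder_transfer\<close>.\<close>
  have "\<exists>B. \<forall>q. norm (A (\<eta> k (fst q))) + (if fst q = snd q then 0 else norm (A (\<eta> k (fst q)) - A (\<eta> k (snd q))) / \<bar>fst q - snd q\<bar>) \<le> B"
    if k: "k < m" for k
  proof -
    obtain D where D: "\<forall>t. ((\<lambda>t. A (\<eta> k t)) has_vector_derivative D t) (at t)" "continuous_on UNIV D"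
      using C1[OF k] unfolding C1_differentiable_on_def by auto
    have per: "A (\<eta> k (t + 2 * pi)) = A (\<eta> k t)" for t using periodic[OF k] by simp
    have perD: "D (t + 2 * pi) = D t" for t by (rule periodic_derivative[of "\<lambda>t. A (\<eta> k t)"]) (use per D in auto)
    obtain B where B: "\<forall>t. norm (D t) \<le> B" using periodic_bounded[OF D(2) perD] by blast
    have "continuous_on UNIV (\<lambda>t. A (\<eta> k t))"
      using D(1) by (intro continuous_at_imp_continuous_on ballI) (blast intro: has_vector_derivative_continuous)
    then have "\<exists>B'. \<forall>t. norm (A (\<eta> k t)) \<le> B'" using per by (rule periodic_bounded)
    then obtain B' where B': "\<forall>t. norm (A (\<eta> k t)) \<le> B'" by (elim exE)
    have l: "norm (A (\<eta> k t) - A (\<eta> k s)) \<le> B * \<bar>t - s\<bar>" for t s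
      by (rule lipschitz_of_derivative[of "\<lambda>t. A (\<eta> k t)" D]) (use D(1) B in auto)
    have B0: "0 \<le> B" using order_trans[OF norm_ge_zero] B by blast
    have "(if t = s then 0 else norm (A (\<eta> k t) - A (\<eta> k s)) / \<bar>t - s\<bar>) \<le> B" for t s
      using l[of t s] B0 by (auto simp: divide_le_eq)
    then show ?thesis using B' by (intro exI[of _ "B' + B"] allI add_mono) auto
  qed
  then obtain L where L: "1 \<le> L" "\<And>k q. k < m \<Longrightarrow>
      norm (A (\<eta> k (fst q))) + (if fst q = snd q then 0 else norm (A (\<eta> k (fst q)) - A (\<eta> k (snd q))) / \<bar>fst q - snd q\<bar>) \<le> L"
    by (rule uniform_bound_lessThan) auto
  have "\<exists>C. \<forall>x\<in>Gam m \<eta>. \<forall>y\<in>Gam m \<eta>. norm (A x - A y) \<le> C * cmod (x - y) powr 1"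
  proof (rule hoelder_transfer[where L = L and Q = L])
    show "norm (A (\<eta> k t) - A (\<eta> k s)) \<le> L * \<bar>t - s\<bar> powr 1" if k: "k < m" for k t s
    proof (cases "t = s")
      case False
      have "norm (A (\<eta> k t)) + norm (A (\<eta> k t) - A (\<eta> k s)) / \<bar>t - s\<bar> \<le> L"
        using L(2)[OF k, of "(t, s)"] False by simp
      then have "norm (A (\<eta> k t) - A (\<eta> k s)) / \<bar>t - s\<bar> \<le> L" using norm_ge_zero[of "A (\<eta> k t)"] by linarith
      then show ?thesis using False by (simp add: divide_le_eq)
    qed simp
    show "norm (A x) \<le> L" if x: "x \<in> Gam m \<eta>" for x
    proof -
      obtain k t where kt: "k < m" "x = \<eta> k t" "t \<in> {0..2*pi}" by (rule GamE[OF x])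
      show ?thesis using L(2)[OF kt(1), of "(t, t)"] kt(2) by simp
    qed
  qed (use L in auto)
  then show ?thesis unfolding coeff_def using nz by auto
qed

end

theorem theorem4p11:
  fixes m :: nat
    and \<eta> \<eta>1 \<eta>2 :: "nat \<Rightarrow> real \<Rightarrow> complex"
    and A :: "complex \<Rightarrow> complex"
    and \<gamma> :: "nat \<Rightarrow> real \<Rightarrow> real"
  assumes m_pos: "m \<ge> 1"
    and periodic: "\<And>k t. k < m \<Longrightarrow> \<eta> k (t + 2*pi) = \<eta> k t"
    and d1: "\<And>k t. k < m \<Longrightarrow> (\<eta> k has_vector_derivative \<eta>1 k t) (at t)"
    and d2: "\<And>k t. k < m \<Longrightarrow> (\<eta>1 k has_vector_derivative \<eta>2 k t) (at t)"
    and d2_cont: "\<And>k. k < m \<Longrightarrow> continuous_on UNIV (\<eta>2 k)"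
    and d1_nz: "\<And>k t. k < m \<Longrightarrow> \<eta>1 k t \<noteq> 0"
    and simple: "\<And>k. k < m \<Longrightarrow> simple_path (bloop \<eta> k)"
    and disjoint: "\<And>j k. j < m \<Longrightarrow> k < m \<Longrightarrow> j \<noteq> k \<Longrightarrow> Gam_k \<eta> j \<inter> Gam_k \<eta> k = {}"
    and not_nested: "\<And>j k. j < m \<Longrightarrow> k < m \<Longrightarrow> j \<noteq> k \<Longrightarrow> Gam_k \<eta> j \<inter> inside (Gam_k \<eta> k) = {}"
    and clockwise: "\<And>k z. k < m \<Longrightarrow> z \<in> inside (Gam_k \<eta> k) \<Longrightarrow> winding_number (bloop \<eta> k) z = -1"
    and G_conn: "connected (Gdom m \<eta>)"
    and zero_in_G: "0 \<in> Gdom m \<eta>"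
    and A_nz: "\<And>z. z \<in> Gam m \<eta> \<Longrightarrow> A z \<noteq> 0"
    and A_C1: "\<And>k. k < m \<Longrightarrow> (\<lambda>t. A (\<eta> k t)) C1_differentiable_on UNIV"
    and \<gamma>_H: "\<gamma> \<in> spaceH m"
  shows "\<exists>h \<in> Sminus m \<eta> A. \<exists>f :: complex \<Rightarrow> complex.
           f holomorphic_on Gdom m \<eta> \<and>
           (f \<longlongrightarrow> 0) at_infinity \<and>
           continuous_on (Gdom m \<eta> \<union> Gam m \<eta>) f \<and>
           (\<forall>k<m. \<forall>t. Re (A (\<eta> k t) * f (\<eta> k t)) = \<gamma> k t + h k t)"
proof -
  interpret curves m \<eta> \<eta>1 \<eta>2
    by unfold_locales (fact m_pos periodic d1 d2 d2_cont d1_nz simple disjoint not_nested clockwise)+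
  interpret U: contour_unique curveM "Gam m \<eta>" "Gdom m \<eta>" "Gminus m \<eta>" tang
    by (rule contour_unique_curves[OF G_conn])
  have cA: "coeff A" by (rule coeff_C1[OF A_nz A_C1])
  obtain g where g: "hoelder_on (Gam m \<eta>) g" "\<forall>k<m. \<forall>t. g (\<eta> k t) = \<gamma> k t" by (rule spaceH_hoelder[OF \<gamma>_H])
  obtain \<rho> where \<rho>: "hoelder_on (Gam m \<eta>) \<rho>" "\<forall>x\<in>Gam m \<eta>. Re (A x * \<rho> x) = g x \<and> Im (A x * Cminus \<rho> x) = 0"
    using U.riemann_hilbert[OF cA g(1)] by (elim exE conjE)
  \<comment> \<open>\<open>A\<close> times \<open>Cminus \<rho>\<close> is real on \<Gamma> by the
    choice of \<rho>, so the real part is the whole product and h lies in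
    \<open>Sminus\<close>.\<close>
  define h where "h k t = Re (A (\<eta> k t) * Cminus \<rho> (\<eta> k t))" for k t
  have hm: "Cminus \<rho> holomorphic_on Gminus m \<eta>" "continuous_on (Gminus m \<eta> \<union> Gam m \<eta>) (Cminus \<rho>)"
    using holo_minus_Cminus[OF \<rho>(1)] by (auto simp: holo_minus_def)
  have hp: "Cplus \<rho> holomorphic_on Gdom m \<eta>" "continuous_on (Gdom m \<eta> \<union> Gam m \<eta>) (Cplus \<rho>)" "(Cplus \<rho> \<longlongrightarrow> 0) at_infinity"
    using holo_plus_Cplus[OF \<rho>(1)] by (auto simp: holo_plus_def)
  have "hoelder_on (Gam m \<eta>) (\<lambda>x. Re (A x * Cminus \<rho> x))"
    by (intro hoelder_on_Re bounded_\<Gamma> hoelder_on_mult compact_\<Gamma> coeff_hoelder[OF cA] hoelder_Cminus \<rho>(1))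
  then have hH: "h \<in> spaceH m" unfolding h_def by (rule hoelder_spaceH)
  have "(Cminus \<rho> \<longlongrightarrow> Cminus \<rho> z) (at z within Gminus m \<eta>)" if "z \<in> Gam m \<eta>" for z
    using hm(2) that unfolding continuous_on_def by (meson UnI2 Un_upper1 tendsto_within_subset)
  moreover have "complex_of_real (h k t) = A (\<eta> k t) * Cminus \<rho> (\<eta> k t)" if "k < m" for k t
    using \<rho>(2) \<eta>_in_Gam[OF that] by (simp add: h_def complex_eq_iff)
  ultimately have hS: "h \<in> Sminus m \<eta> A" unfolding Sminus_def using hH hm(1) by blast
  have "Re (A (\<eta> k t) * Cplus \<rho> (\<eta> k t)) = \<gamma> k t + h k t" if k: "k < m" for k t
  proof -
    have x: "\<eta> k t \<in> Gam m \<eta>" by (rule \<eta>_in_Gam[OF k])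
    have "Cplus \<rho> (\<eta> k t) = \<rho> (\<eta> k t) + Cminus \<rho> (\<eta> k t)" using x by (simp add: Cplus_def Cminus_def)
    then have "Re (A (\<eta> k t) * Cplus \<rho> (\<eta> k t)) = Re (A (\<eta> k t) * \<rho> (\<eta> k t)) + h k t" unfolding h_def by (simp only: distrib_left plus_complex.simps)
    then show ?thesis using \<rho>(2) x g(2) k by simp
  qed
  then show ?thesis using hS hp by blast
qed

end
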